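(* Let $N\ge2$, $0<\alpha<1$, let $\Gamma\subset\mathbb{R}^N$ be a surface of class $C^{2,\alpha}$ which is the boundary of a bounded domain $\Omega\subset\mathbb{R}^N$, and let $u\in C^{2,\alpha}(\overline\Omega)$ be the solution of $\Delta u=N$ in $\Omega$, $u=0$ on $\Gamma$. If $\Gamma$ is strictly mean-convex (i.e. $H>0$ on $\Gamma$), then $$\frac1{N-1}\int_\Omega\Big\{|\nabla^2u|^2-\frac{(\Delta u)^2}{N}\Big\}dx+\int_\Gamma\frac{(1-H\,u_\nu)^2}{H}\,dS_x=\int_\Gamma\frac{dS_x}{H}-N|\Omega|.$$ In particular the Heintze–Karcher inequality $\int_\Gamma\frac{dS_x}{H}\ge N|\Omega|$ holds, with equality if and only if $\Omega$ is a ball. Moreover, if $H$ is constant on $\Gamma$, then $\Gamma$ is a sphere.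
   Context: $|\Omega|$ is the volume of $\Omega$, $\nu$ the outward unit normal, $u_\nu$ the outward normal derivative of $u$, $|\nabla^2u|^2$ the sum of squares of the entries of the Hessian. $H$ is the mean curvature of $\Gamma$ normalized as the average of the principal curvatures with respect to $\nu$, i.e. $H=\frac1{N-1}\mathrm{div}\,\nu$, so a sphere of radius $\rho$ has $H=1/\rho$. *)

theory Defs
  imports "HOL-Analysis.Analysis"
begin

definition pd :: "(real^'n \<Rightarrow> real) \<Rightarrow> 'n \<Rightarrow> real^'n \<Rightarrow> real" where
  "pd f i x = frechet_derivative f (at x) (axis i 1)"

definition grad :: "(real^'n \<Rightarrow> real) \<Rightarrow> real^'n \<Rightarrow> real^'n" where
  "grad f x = (\<chi> i. pd f i x)"

definition hess :: "(real^'n \<Rightarrow> real) \<Rightarrow> real^'n \<Rightarrow> real^'n^'n" where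
  "hess f x = (\<chi> i j. pd (\<lambda>y. pd f j y) i x)"

definition laplacian :: "(real^'n \<Rightarrow> real) \<Rightarrow> real^'n \<Rightarrow> real" where
  "laplacian f x = (\<Sum>i\<in>UNIV. hess f x $ i $ i)"

definition divergence :: "(real^'n \<Rightarrow> real^'n) \<Rightarrow> real^'n \<Rightarrow> real" where
  "divergence V x = (\<Sum>i\<in>UNIV. frechet_derivative V (at x) (axis i 1) $ i)"

definition C2_on :: "(real^'n) set \<Rightarrow> (real^'n \<Rightarrow> real) \<Rightarrow> bool" where
  "C2_on U f \<longleftrightarrow>
     (\<forall>x\<in>U. f differentiable (at x) \<and> (\<forall>j. (\<lambda>y. pd f j y) differentiable (at x)))
     \<and> continuous_on U (hess f)"

definition C2alpha_on :: "real \<Rightarrow> (real^'n) set \<Rightarrow> (real^'n \<Rightarrow> real) \<Rightarrow> bool" where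
  "C2alpha_on \<alpha> U f \<longleftrightarrow> C2_on U f \<and>
     (\<forall>K. compact K \<and> K \<subseteq> U \<longrightarrow>
        (\<exists>C. \<forall>x\<in>K. \<forall>y\<in>K. norm (hess f x - hess f y) \<le> C * dist x y powr \<alpha>))"

text \<open>u \<in> C^{2,alpha}(closure Omega): C^2 in Omega, continuous on the closure,
  gradient extends continuously to the closure, Hessian globally alpha-Hoelder on Omega
  (hence bounded and continuously extendable to the closure).\<close>
definition C2alpha_closure :: "real \<Rightarrow> (real^'n) set \<Rightarrow> (real^'n \<Rightarrow> real) \<Rightarrow> bool" where
  "C2alpha_closure \<alpha> \<Omega> u \<longleftrightarrow> C2_on \<Omega> u \<and>
     continuous_on (closure \<Omega>) u \<and>
     uniformly_continuous_on \<Omega> (grad u) \<and>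
     (\<exists>C. \<forall>x\<in>\<Omega>. \<forall>y\<in>\<Omega>. norm (hess u x - hess u y) \<le> C * dist x y powr \<alpha>)"

definition bgrad :: "(real^'n) set \<Rightarrow> (real^'n \<Rightarrow> real) \<Rightarrow> real^'n \<Rightarrow> real^'n" where
  "bgrad \<Omega> u x = Lim (at x within \<Omega>) (grad u)"

definition local_defn :: "(real^'n) set \<Rightarrow> real^'n \<Rightarrow> (real^'n) set \<Rightarrow> (real^'n \<Rightarrow> real) \<Rightarrow> bool" where
  "local_defn \<Omega> p U \<phi> \<longleftrightarrow> open U \<and> p \<in> U \<and> C2_on U \<phi> \<and>
     (\<forall>x\<in>U. grad \<phi> x \<noteq> 0) \<and> \<Omega> \<inter> U = {x\<in>U. \<phi> x < 0}"

definition C2alpha_boundary :: "real \<Rightarrow> (real^'n) set \<Rightarrow> bool" where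
  "C2alpha_boundary \<alpha> \<Omega> \<longleftrightarrow>
     (\<forall>p\<in>frontier \<Omega>. \<exists>U \<phi>. local_defn \<Omega> p U \<phi> \<and> C2alpha_on \<alpha> U \<phi>)"

text \<open>Outward unit normal nu = grad phi / |grad phi| (independent of the choice of phi).\<close>
definition outer_normal :: "(real^'n) set \<Rightarrow> real^'n \<Rightarrow> real^'n" where
  "outer_normal \<Omega> x = (SOME \<nu>. \<exists>U \<phi>. local_defn \<Omega> x U \<phi> \<and>
       \<nu> = inverse (norm (grad \<phi> x)) *\<^sub>R grad \<phi> x)"

text \<open>Mean curvature H = div(nu)/(N-1), nu extended as grad phi/|grad phi|
  (independent of phi); a sphere of radius rho has H = 1/rho.\<close>
definition mean_curv :: "(real^'n) set \<Rightarrow> real^'n \<Rightarrow> real" where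
  "mean_curv \<Omega> x = (SOME h. \<exists>U \<phi>. local_defn \<Omega> x U \<phi> \<and>
       h = divergence (\<lambda>y. inverse (norm (grad \<phi> y)) *\<^sub>R grad \<phi> y) x
             / (real CARD('n) - 1))"

definition hausdorff_delta :: "real \<Rightarrow> real \<Rightarrow> 'a::metric_space set \<Rightarrow> ennreal" where
  "hausdorff_delta d \<delta> A =
     (INF C \<in> {C :: nat \<Rightarrow> 'a set. A \<subseteq> (\<Union>i. C i) \<and>
                 (\<forall>i. bounded (C i) \<and> diameter (C i) \<le> \<delta>)}.
        \<Sum>i. ennreal (unit_ball_vol d * (diameter (C i) / 2) powr d))"

definition hausdorff_measure :: "real \<Rightarrow> 'a::metric_space set \<Rightarrow> ennreal" where
  "hausdorff_measure d A = (SUP \<delta> \<in> {0<..}. hausdorff_delta d \<delta> A)"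

definition surface_measure :: "(real^'n) set \<Rightarrow> (real^'n) measure" where
  "surface_measure \<Gamma> =
     measure_of \<Gamma> (sets (restrict_space borel \<Gamma>)) (hausdorff_measure (real CARD('n) - 1))"

end

theory Submission
  imports Defs
begin

text \<open>
  Reilly's identity for u reads (N-1) int_Gamma H (u_nu)^2 = int_Omega ((Delta u)^2 - |Hess u|^2), and the
  divergence theorem gives int_Gamma u_nu = N |Omega|; expanding (1 - H u_nu)^2 / H then yields the
  integral identity. Its left-hand side is nonnegative because |Hess u|^2 - N = |Hess u - I|^2 when
  Delta u = N, and equality forces Hess u = I, so that u is (|x - c|^2 - r^2) / 2 and Omega is a ball.
  For constant H, Minkowski's formula int_Gamma H (x . nu) = |Gamma| gives the equality case.

  The boundary integrals are against Hausdorff measure: the isodiametric inequality (from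
  Brunn--Minkowski) identifies it with Lebesgue measure in top dimension, and near a boundary point a
  (1 + O(eta^2))-bi-Lipschitz graph parametrization compares int_Omega D_d f with
  int_Gamma f (nu . d) up to an error O(eta^2), for every d within eta of the normal. Both sides being
  linear in d, differences of such d reach all directions with an error of order eta, so the
  divergence theorem follows from a partition of unity, and no area formula is needed. Third
  derivatives of u never occur: Reilly's identity is the integral identity for
  div (f (g_b a - g_a b)), which follows for C^1 functions f, g from difference quotients.
\<close>

section \<open>Hausdorff measure\<close>

text \<open>Three features of the definitions shape the proof. \<open>outer_normal\<close> and
  \<open>mean_curv\<close> choose a local defining function by \<open>SOME\<close>, so independence
  of the choice has to be shown: two unit vectors that satisfy the cone condition at the same
  boundary point coincide, and two unit fields that agree on the boundary have the same tangential
  derivatives there, hence the same divergence. \<open>surface_measure\<close> is built from an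
  outer measure normalised by the volume of a ball: Borel sets must be shown measurable before
  anything can be integrated, and covers by sets other than balls must be shown to be no cheaper.
  The solution u is known on the closed domain only. It is not extended across the boundary; near
  each boundary point its argument is shifted inwards, which gives a C^1 function on a full
  neighbourhood, and the shift tends to 0 at the end. The boundary term of Reilly's identity comes
  from grad u = u_nu nu on the boundary: this is the vanishing of the 2x2 minors of (grad u, nu),
  and their tangential derivatives give Delta u - u_nu_nu = (N - 1) H u_nu without differentiating
  u_nu.\<close>

lemma hausdorff_delta_mono: "A \<subseteq> B \<Longrightarrow> hausdorff_delta d \<delta> A \<le> hausdorff_delta d \<delta> B"
  unfolding hausdorff_delta_def by (rule INF_superset_mono) auto

lemma hausdorff_delta_antimono: "\<delta> \<le> \<delta>' \<Longrightarrow> hausdorff_delta d \<delta>' A \<le> hausdorff_delta d \<delta> A"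
  unfolding hausdorff_delta_def by (rule INF_superset_mono) (auto intro: order_trans)

lemma hausdorff_delta_le:
  fixes C :: "nat \<Rightarrow> 'a::metric_space set"
  assumes "A \<subseteq> (\<Union>i. C i)" "\<And>i. bounded (C i)" "\<And>i. diameter (C i) \<le> \<delta>"
  shows "hausdorff_delta d \<delta> A \<le> (\<Sum>i. ennreal (unit_ball_vol d * (diameter (C i) / 2) powr d))"
  unfolding hausdorff_delta_def using assms by (intro INF_lower) auto

lemma hausdorff_delta_empty [simp]: "0 \<le> \<delta> \<Longrightarrow> hausdorff_delta d \<delta> {} = 0"
  using hausdorff_delta_le[of "{}" "\<lambda>_. {}" \<delta> d] by simp

lemma hausdorff_delta_lessE:
  fixes A :: "'a::metric_space set"
  assumes "hausdorff_delta d \<delta> A < b"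
  obtains C :: "nat \<Rightarrow> 'a set" where "A \<subseteq> (\<Union>i. C i)" "\<And>i. bounded (C i)" "\<And>i. diameter (C i) \<le> \<delta>"
    "(\<Sum>i. ennreal (unit_ball_vol d * (diameter (C i) / 2) powr d)) < b"
  using assms unfolding hausdorff_delta_def INF_less_iff by auto

text \<open>Near-optimal covers of the sets \<open>A i\<close>, the i-th within e / 2^(i+1), are
  merged into one sequence by the pairing function on the natural numbers.\<close>

lemma hausdorff_delta_UN:
  fixes A :: "nat \<Rightarrow> 'a::metric_space set"
  shows "hausdorff_delta d \<delta> (\<Union>i. A i) \<le> (\<Sum>i. hausdorff_delta d \<delta> (A i))"
proof (rule ennreal_le_epsilon)
  let ?w = "\<lambda>S::'a set. ennreal (unit_ball_vol d * (diameter S / 2) powr d)"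
  fix e :: real assume e: "0 < e" and fin: "(\<Sum>i. hausdorff_delta d \<delta> (A i)) < top"
  have fini: "hausdorff_delta d \<delta> (A i) < top" for i
    using fin ennreal_suminf_lessD by blast
  have "\<exists>C. A i \<subseteq> (\<Union>j. C j) \<and> (\<forall>j. bounded (C j)) \<and> (\<forall>j. diameter (C j) \<le> \<delta>) \<and>
    (\<Sum>j. ?w (C j)) < hausdorff_delta d \<delta> (A i) + ennreal (e * (1/2)^Suc i)" for i
  proof -
    have "hausdorff_delta d \<delta> (A i) < hausdorff_delta d \<delta> (A i) + ennreal (e * (1/2)^Suc i)"
      using fini[of i] e by (cases "hausdorff_delta d \<delta> (A i)") (auto simp flip: ennreal_plus simp: ennreal_less_iff)
    then show ?thesis by (elim hausdorff_delta_lessE) blast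
  qed
  then obtain C where C: "\<And>i. A i \<subseteq> (\<Union>j. C i j)" "\<And>i j. bounded (C i j)" "\<And>i j. diameter (C i j) \<le> \<delta>"
    "\<And>i. (\<Sum>j. ?w (C i j)) < hausdorff_delta d \<delta> (A i) + ennreal (e * (1/2)^Suc i)" by metis
  define D where "D n = (case prod_decode n of (i,j) \<Rightarrow> C i j)" for n
  have cov: "(\<Union>i. A i) \<subseteq> (\<Union>n. D n)"
  proof
    fix x assume "x \<in> (\<Union>i. A i)"
    then obtain i j where "x \<in> C i j" using C(1) by blast
    then have "x \<in> D (prod_encode (i,j))" by (simp add: D_def)
    then show "x \<in> (\<Union>n. D n)" by blast
  qed
  have "hausdorff_delta d \<delta> (\<Union>i. A i) \<le> (\<Sum>n. ?w (D n))"
    by (rule hausdorff_delta_le[OF cov]) (auto simp: D_def C split: prod.split)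
  also have "\<dots> = (\<Sum>i. \<Sum>j. ?w (C i j))"
    using suminf_ennreal_2dimen[of "\<lambda>i. \<Sum>j. ?w (C i j)" "\<lambda>(i,j). ?w (C i j)"]
    by (simp add: D_def o_def case_prod_unfold)
  also have "\<dots> \<le> (\<Sum>i. hausdorff_delta d \<delta> (A i) + ennreal (e * (1/2)^Suc i))"
    by (intro suminf_le less_imp_le C(4)) auto
  also have "\<dots> = (\<Sum>i. hausdorff_delta d \<delta> (A i)) + (\<Sum>i. ennreal (e * (1/2)^Suc i))"
    by (rule suminf_add[symmetric]) auto
  also have "(\<Sum>i. ennreal (e * (1/2)^Suc i)) = ennreal e"
    using e sums_mult[OF power_half_series, of e] by (intro suminf_ennreal_eq) auto
  finally show "hausdorff_delta d \<delta> (\<Union>i. A i) \<le> (\<Sum>i. hausdorff_delta d \<delta> (A i)) + ennreal e" .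
qed

lemma hausdorff_delta_le_measure: "0 < \<delta> \<Longrightarrow> hausdorff_delta d \<delta> A \<le> hausdorff_measure d A"
  unfolding hausdorff_measure_def by (rule SUP_upper) auto

text \<open>The content grows as the scale shrinks, so countably many scales suffice; an increasing
  sequence makes the supremum additive.\<close>

lemma hausdorff_measure_seq:
  "hausdorff_measure d A = (SUP n. hausdorff_delta d (1 / real (Suc n)) A)"
proof (rule antisym)
  show "hausdorff_measure d A \<le> (SUP n. hausdorff_delta d (1 / real (Suc n)) A)"
    unfolding hausdorff_measure_def
  proof (rule SUP_least)
    fix \<delta> :: real assume "\<delta> \<in> {0<..}"
    then obtain n where "1 / real (Suc n) < \<delta>"
      by (metis greaterThan_iff nat_approx_posE)
    then have "hausdorff_delta d \<delta> A \<le> hausdorff_delta d (1 / real (Suc n)) A"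
      by (intro hausdorff_delta_antimono) auto
    then show "hausdorff_delta d \<delta> A \<le> (SUP n. hausdorff_delta d (1 / real (Suc n)) A)"
      by (meson SUP_upper2 UNIV_I)
  qed
  show "(SUP n. hausdorff_delta d (1 / real (Suc n)) A) \<le> hausdorff_measure d A"
    by (intro SUP_least hausdorff_delta_le_measure) auto
qed

lemma incseq_hausdorff_delta: "incseq (\<lambda>n. hausdorff_delta d (1 / real (Suc n)) A)"
  by (intro incseq_SucI hausdorff_delta_antimono) (auto simp: field_simps)

lemma hausdorff_measure_mono: "A \<subseteq> B \<Longrightarrow> hausdorff_measure d A \<le> hausdorff_measure d B"
  unfolding hausdorff_measure_def by (intro SUP_mono') (auto intro: hausdorff_delta_mono)

lemma hausdorff_measure_empty [simp]: "hausdorff_measure d {} = 0"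
  by (simp add: hausdorff_measure_seq)

lemma hausdorff_measure_UN:
  "hausdorff_measure d (\<Union>i. A (i::nat)) \<le> (\<Sum>i. hausdorff_measure d (A i))"
  unfolding hausdorff_measure_def[of d "\<Union>i. A i"]
proof (rule SUP_least)
  fix \<delta> :: real assume "\<delta> \<in> {0<..}"
  then have "(\<Sum>i. hausdorff_delta d \<delta> (A i)) \<le> (\<Sum>i. hausdorff_measure d (A i))"
    by (intro suminf_le hausdorff_delta_le_measure) auto
  then show "hausdorff_delta d \<delta> (\<Union>i. A i) \<le> (\<Sum>i. hausdorff_measure d (A i))"
    using hausdorff_delta_UN order_trans by blast
qed

lemma outer_measure_space_hausdorff: "outer_measure_space (Pow \<Omega>) (hausdorff_measure d)"
  unfolding outer_measure_space_def positive_def increasing_def countably_subadditive_def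
  by (auto intro: hausdorff_measure_mono hausdorff_measure_UN)

section \<open>Caratheodory's criterion: Borel sets are measurable for Hausdorff measure\<close>

lemma hausdorff_measure_Un: "hausdorff_measure d (A \<union> B) \<le> hausdorff_measure d A + hausdorff_measure d B"
proof -
  let ?f = "\<lambda>i::nat. if i = 0 then A else if i = 1 then B else {}"
  have "A \<union> B = (\<Union>i. ?f i)" by (auto split: if_splits)
  then have "hausdorff_measure d (A \<union> B) \<le> (\<Sum>i. hausdorff_measure d (?f i))"
    using hausdorff_measure_UN[of d ?f] by argo
  also have "\<dots> = (\<Sum>i<2. hausdorff_measure d (?f i))"
    by (rule suminf_finite) auto
  finally show ?thesis by (simp add: numeral_2_eq_2)
qed

text \<open>A covering set of diameter less than \<eta> meets at most one of A and B, so every fine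
  cover of the union splits into a cover of A and a cover of B.\<close>

lemma hausdorff_measure_Un_separated:
  fixes A B :: "'a::metric_space set"
  assumes "0 < \<eta>" "\<And>x y. x \<in> A \<Longrightarrow> y \<in> B \<Longrightarrow> \<eta> \<le> dist x y"
  shows "hausdorff_measure d (A \<union> B) = hausdorff_measure d A + hausdorff_measure d B"
proof (rule antisym[OF hausdorff_measure_Un])
  let ?w = "\<lambda>S::'a set. ennreal (unit_ball_vol d * (diameter S / 2) powr d)"
  have *: "hausdorff_delta d \<delta> A + hausdorff_delta d \<delta> B \<le> hausdorff_delta d \<delta> (A \<union> B)"
    if "0 < \<delta>" "\<delta> < \<eta>" for \<delta>
    unfolding hausdorff_delta_def[of d \<delta> "A \<union> B"]
  proof (rule INF_greatest, clarsimp)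
    fix C :: "nat \<Rightarrow> 'a set"
    assume C: "A \<subseteq> (\<Union>i. C i)" "B \<subseteq> (\<Union>i. C i)" "\<forall>i. bounded (C i) \<and> diameter (C i) \<le> \<delta>"
    \<comment> \<open>Sets that miss S are replaced by the empty set, which has weight 0, so that
      the thinned cover is still a sequence.\<close>
    define D where "D S i = (if C i \<inter> S = {} then {} else C i)" for S i
    have D: "hausdorff_delta d \<delta> S \<le> (\<Sum>i. ?w (D S i))" if "S \<subseteq> (\<Union>i. C i)" for S
    proof (rule hausdorff_delta_le)
      show "S \<subseteq> (\<Union>i. D S i)" using that by (force simp: D_def)
    qed (use C \<open>0<\<delta>\<close> in \<open>auto simp: D_def\<close>)
    have disj: "D A i = {} \<or> D B i = {}" for i
    proof (rule ccontr)
      assume "\<not> ?thesis"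
      then obtain x y where "x \<in> C i" "x \<in> A" "y \<in> C i" "y \<in> B" by (auto simp: D_def split: if_splits)
      then show False using C(3) diameter_bounded_bound[of "C i" x y] assms(2)[of x y] that
        by (smt (verit))
    qed
    have "hausdorff_delta d \<delta> A + hausdorff_delta d \<delta> B \<le> (\<Sum>i. ?w (D A i)) + (\<Sum>i. ?w (D B i))"
      using D C by (intro add_mono) auto
    also have "\<dots> = (\<Sum>i. ?w (D A i) + ?w (D B i))" by (rule suminf_add) auto
    also have "\<dots> \<le> (\<Sum>i. ?w (C i))"
    proof (intro suminf_le)
      show "?w (D A i) + ?w (D B i) \<le> ?w (C i)" for i
      proof -
        have D01: "D S i = {} \<or> D S i = C i" for S by (simp add: D_def)
        then show ?thesis using disj[of i] D01[of A] D01[of B]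
          by (elim disjE) simp_all
      qed
    qed auto
    finally show "hausdorff_delta d \<delta> A + hausdorff_delta d \<delta> B \<le> (\<Sum>i. ?w (C i))" .
  qed
  have "hausdorff_measure d A + hausdorff_measure d B
      = (SUP n. hausdorff_delta d (1 / real (Suc n)) A + hausdorff_delta d (1 / real (Suc n)) B)"
    unfolding hausdorff_measure_seq by (intro ennreal_SUP_add[symmetric] incseq_hausdorff_delta)
  also have "\<dots> \<le> hausdorff_measure d (A \<union> B)"
  proof (rule SUP_least)
    fix n
    obtain m where m: "1 / real (Suc m) < \<eta>" using assms(1) nat_approx_posE by blast
    let ?k = "max m n"
    have k: "1 / real (Suc ?k) < \<eta>" "1 / real (Suc ?k) \<le> 1 / real (Suc n)"
      using m by (auto intro!: divide_left_mono order.strict_trans1[OF _ m])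
    have "hausdorff_delta d (1 / real (Suc n)) A + hausdorff_delta d (1 / real (Suc n)) B
       \<le> hausdorff_delta d (1 / real (Suc ?k)) A + hausdorff_delta d (1 / real (Suc ?k)) B"
      using k by (intro add_mono hausdorff_delta_antimono) auto
    also have "\<dots> \<le> hausdorff_delta d (1 / real (Suc ?k)) (A \<union> B)" by (rule *) (use k in auto)
    also have "\<dots> \<le> hausdorff_measure d (A \<union> B)" by (rule hausdorff_delta_le_measure) auto
    finally show "hausdorff_delta d (1 / real (Suc n)) A + hausdorff_delta d (1 / real (Suc n)) B
       \<le> hausdorff_measure d (A \<union> B)" .
  qed
  finally show "hausdorff_measure d A + hausdorff_measure d B \<le> hausdorff_measure d (A \<union> B)" .
qed

lemma ennreal_suminf_tail:
  fixes f :: "nat \<Rightarrow> ennreal"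
  assumes "(\<Sum>i. f i) < top" "0 < e"
  obtains n where "(\<Sum>i. f (i + n)) < ennreal e"
proof -
  have fin: "f i < top" for i using assms(1) ennreal_suminf_lessD by blast
  define g where "g i = enn2real (f i)" for i
  have fg: "f i = ennreal (g i)" for i using fin[of i] by (simp add: g_def)
  have g0: "g i \<ge> 0" for i by (simp add: g_def)
  have sg: "summable g"
    using assms(1) by (intro summable_suminf_not_top) (auto simp: g0 fg[symmetric])
  obtain n where n: "norm (\<Sum>i. g (i + n)) < e"
    using suminf_exist_split[OF assms(2) sg] by blast
  have "(\<Sum>i. f (i + n)) = ennreal (\<Sum>i. g (i + n))"
    unfolding fg by (intro suminf_ennreal2) (auto simp: g0 sg summable_iff_shift)
  also have "\<dots> < ennreal e" using n assms(2) by (auto simp: ennreal_less_iff suminf_nonneg g0 sg summable_iff_shift)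
  finally show ?thesis by (rule that)
qed

text \<open>The argument for metric outer measures. The sets \<open>A n\<close> at distance at least
  1/(n+1) from F exhaust E - F and are separated from F. The shells \<open>R n\<close> between them
  have finite total measure, because shells of equal parity are separated from one another; hence
  the tail of shells, which is all of E - F outside \<open>A n\<close>, has small measure.\<close>

lemma hausdorff_measure_split_closed:
  fixes E F :: "'a::metric_space set"
  assumes F: "closed F"
  shows "hausdorff_measure d (E \<inter> F) + hausdorff_measure d (E - F) \<le> hausdorff_measure d E"
proof (cases "F = {} \<or> hausdorff_measure d E = top")
  case True
  then show ?thesis by (auto simp: add.commute)
next
  case False
  then have ne: "F \<noteq> {}" and fin: "hausdorff_measure d E < top" by (auto simp: top.not_eq_extremum)
  let ?H = "hausdorff_measure d :: 'a set \<Rightarrow> ennreal"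
  define A where "A n = {x \<in> E. 1 / real (Suc n) \<le> infdist x F}" for n
  define R where "R n = A (Suc n) - A n" for n
  have Rsub: "R n \<subseteq> E" for n by (auto simp: R_def A_def)
  have dist_ge: "infdist x F - infdist y F \<le> dist x y" for x y
    using infdist_triangle[of x F y] by (simp add: dist_commute)
  have monoA: "A m \<subseteq> A n" if "m \<le> n" for m n
  proof
    fix x assume "x \<in> A m"
    moreover have "1 / real (Suc n) \<le> 1 / real (Suc m)" using that by (auto intro!: divide_left_mono)
    ultimately show "x \<in> A n" by (auto simp: A_def)
  qed
  have sep: "?H (U \<union> R n) = ?H U + ?H (R n)" if "U \<subseteq> A k" "k < n" for U n k
  proof (rule hausdorff_measure_Un_separated)
    have "1 / real (Suc n) < 1 / real n" using that by (intro divide_strict_left_mono) auto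
    then show "0 < 1 / real n - 1 / real (Suc n)" by simp
    fix x y assume "x \<in> U" "y \<in> R n"
    then have "1 / real (Suc k) \<le> infdist x F" "infdist y F \<le> 1 / real (Suc n)" using that by (auto simp: R_def A_def)
    moreover have "1 / real n \<le> 1 / real (Suc k)" using that by (auto intro!: divide_left_mono)
    ultimately show "1 / real n - 1 / real (Suc n) \<le> dist x y" using dist_ge[of x y] by linarith
  qed
  \<comment> \<open>Taking every second shell leaves a gap: the earlier shells lie in
    \<open>A (2*n-1+c)\<close>, which is at positive distance from \<open>R (2*n+c)\<close>, and the
    measures add up exactly.\<close>
  have fsum: "(\<Sum>k<n. ?H (R (2*k+c))) = ?H (\<Union>k<n. R (2*k+c))" for n c
  proof (induction n)
    case (Suc n)
    show ?case
    proof (cases "n = 0")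
      case True then show ?thesis by (simp add: lessThan_Suc)
    next
      case False
      have "(\<Union>k<n. R (2*k+c)) \<subseteq> A (2 * n - 1 + c)"
      proof (rule UN_least)
        fix k assume "k \<in> {..<n}"
        then have "A (Suc (2*k+c)) \<subseteq> A (2*n-1+c)" by (intro monoA) auto
        then show "R (2*k+c) \<subseteq> A (2*n-1+c)" by (auto simp: R_def)
      qed
      then have "?H ((\<Union>k<n. R (2*k+c)) \<union> R (2*n+c)) = ?H (\<Union>k<n. R (2*k+c)) + ?H (R (2*n+c))"
        using False by (intro sep[where k="2*n-1+c"]) auto
      then show ?thesis using Suc by (simp add: lessThan_Suc Un_commute)
    qed
  qed simp
  have half: "(\<Sum>k. ?H (R (2*k+c))) \<le> ?H E" for c
  proof (rule suminf_le_const)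
    show "(\<Sum>k<n. ?H (R (2*k+c))) \<le> ?H E" for n
      unfolding fsum using Rsub by (intro hausdorff_measure_mono) auto
  qed auto
  have "(\<Sum>k. ?H (R k)) \<le> ?H E + ?H E"
  proof (rule suminf_le_const)
    fix n
    have "(\<Sum>k<n. ?H (R k)) \<le> (\<Sum>k<2*n. ?H (R k))" by (intro sum_mono2) auto
    also have "\<dots> = (\<Sum>k<n. ?H (R (2*k+0))) + (\<Sum>k<n. ?H (R (2*k+1)))"
      by (induction n) (auto simp: algebra_simps)
    also have "\<dots> \<le> ?H E + ?H E"
      using sum_le_suminf[of "\<lambda>k. ?H (R (2*k+0))" "{..<n}"] sum_le_suminf[of "\<lambda>k. ?H (R (2*k+1))" "{..<n}"]
        half[of 0] half[of 1] by (intro add_mono) (auto intro: order_trans)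
    finally show "(\<Sum>k<n. ?H (R k)) \<le> ?H E + ?H E" .
  qed auto
  also have "\<dots> < top" using fin by auto
  finally have sfin: "(\<Sum>k. ?H (R k)) < top" .
  have EF: "E - F \<subseteq> A n \<union> (\<Union>k. R (k + n))" for n
  proof
    fix x assume x: "x \<in> E - F"
    then have "0 < infdist x F" using F ne by (simp add: infdist_pos_not_in_closed)
    then obtain m where "1 / real (Suc m) < infdist x F" using nat_approx_posE by blast
    then have ex: "x \<in> A m" using x by (auto simp: A_def)
    define m0 where "m0 = (LEAST m. x \<in> A m)"
    have m0: "x \<in> A m0" "\<And>k. k < m0 \<Longrightarrow> x \<notin> A k"
      unfolding m0_def using ex by (auto intro: LeastI dest: not_less_Least)
    show "x \<in> A n \<union> (\<Union>k. R (k + n))"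
    proof (cases "m0 \<le> n")
      case True then show ?thesis using m0 monoA by blast
    next
      case False
      then have "x \<in> R (m0 - 1)" using m0 by (auto simp: R_def)
      moreover have "m0 - 1 = (m0 - 1 - n) + n" using False by simp
      ultimately show ?thesis by (metis UNIV_I UN_I UnI2)
    qed
  qed
  show ?thesis
  proof (rule ennreal_le_epsilon)
    fix e :: real assume "0 < e"
    then obtain n where n: "(\<Sum>k. ?H (R (k + n))) < ennreal e" using ennreal_suminf_tail[OF sfin] by blast
    have "?H (E - F) \<le> ?H (A n) + ?H (\<Union>k. R (k + n))"
      using hausdorff_measure_mono[OF EF] hausdorff_measure_Un order_trans by blast
    also have "\<dots> \<le> ?H (A n) + ennreal e"
      using hausdorff_measure_UN[of d "\<lambda>k. R (k + n)"] n by (intro add_left_mono) (auto intro: order_trans less_imp_le)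
    finally have "?H (E \<inter> F) + ?H (E - F) \<le> ?H (E \<inter> F) + ?H (A n) + ennreal e"
      by (simp add: add.assoc add_left_mono)
    also have "?H (E \<inter> F) + ?H (A n) = ?H ((E \<inter> F) \<union> A n)"
    proof (rule hausdorff_measure_Un_separated[symmetric])
      show "0 < 1 / real (Suc n)" by simp
      fix x y assume "x \<in> E \<inter> F" "y \<in> A n"
      then show "1 / real (Suc n) \<le> dist x y"
        using infdist_le[of x F y] by (auto simp: A_def dist_commute)
    qed
    also have "\<dots> \<le> ?H E" by (intro hausdorff_measure_mono) (auto simp: A_def)
    finally show "?H (E \<inter> F) + ?H (E - F) \<le> ?H E + ennreal e" by (simp add: add_right_mono)
  qed
qed

text \<open>\<open>measure_of\<close> yields the zero measure unless the set function is countably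
  additive. Closed sets generate the Borel sets, so it suffices that they lie in the lambda
  system.\<close>

lemma measure_space_hausdorff:
  fixes \<Gamma> :: "'a::metric_space set"
  shows "measure_space \<Gamma> (sets (restrict_space borel \<Gamma>)) (hausdorff_measure d)"
proof -
  let ?L = "lambda_system \<Gamma> (Pow \<Gamma>) (hausdorff_measure d)"
  interpret sigma_algebra \<Gamma> "Pow \<Gamma>" by (rule sigma_algebra_Pow)
  have ms: "measure_space \<Gamma> ?L (hausdorff_measure d)"
    by (rule caratheodory_lemma[OF outer_measure_space_hausdorff])
  then interpret L: sigma_algebra \<Gamma> ?L by (simp add: measure_space_def)
  have closed: "\<Gamma> \<inter> S \<in> ?L" if "closed S" for S
  proof -
    note cl = hausdorff_measure_split_closed[OF that]
    have "hausdorff_measure d (\<Gamma> \<inter> S \<inter> x) + hausdorff_measure d ((\<Gamma> - \<Gamma> \<inter> S) \<inter> x) = hausdorff_measure d x"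
      if x: "x \<subseteq> \<Gamma>" for x
    proof -
      have "\<Gamma> \<inter> S \<inter> x = x \<inter> S" "(\<Gamma> - \<Gamma> \<inter> S) \<inter> x = x - S" using x by auto
      moreover have "(x \<inter> S) \<union> (x - S) = x" by auto
      ultimately show ?thesis using cl[of d x]
         hausdorff_measure_Un[of d "x \<inter> S" "x - S"] by (metis antisym)
    qed
    then show "\<Gamma> \<inter> S \<in> ?L" unfolding lambda_system_def by auto
  qed
  have "\<Gamma> \<inter> B \<in> ?L" if "B \<in> sigma_sets UNIV (Collect closed)" for B
    using that
  proof induction
    case (Basic a) then show ?case by (simp add: closed)
  next
    case Empty then show ?case by auto
  next
    case (Compl a)
    then have "\<Gamma> - \<Gamma> \<inter> a \<in> ?L" by (intro L.compl_sets)
    moreover have "\<Gamma> - \<Gamma> \<inter> a = \<Gamma> \<inter> (UNIV - a)" by auto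
    ultimately show ?case by simp
  next
    case (Union a)
    then have "(\<Union>i. \<Gamma> \<inter> a i) \<in> ?L" by (intro L.countable_nat_UN) auto
    then show ?case by simp
  qed
  then have "sets (restrict_space borel \<Gamma>) \<subseteq> ?L"
    unfolding sets_restrict_space borel_eq_closed by (auto simp: sets_measure_of_conv)
  moreover have "sigma_algebra \<Gamma> (sets (restrict_space borel \<Gamma>))"
    using sets.sigma_algebra_axioms[of "restrict_space borel \<Gamma>"] by (simp add: space_restrict_space)
  ultimately show ?thesis using ms measure_down by blast
qed

section \<open>The surface measure, and Hausdorff measure under Lipschitz maps\<close>

lemma sets_surface_measure [simp, measurable_cong]: "sets (surface_measure \<Gamma>) = sets (restrict_space borel \<Gamma>)"
  using sets.sigma_algebra_axioms[of "restrict_space borel \<Gamma>"] sigma_algebra.sets_measure_of_eq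
  by (fastforce simp: surface_measure_def space_restrict_space)

lemma space_surface_measure [simp]: "space (surface_measure \<Gamma>) = \<Gamma>"
  using sets_surface_measure[of \<Gamma>, THEN sets_eq_imp_space_eq] by (simp add: space_restrict_space)

lemma emeasure_surface_measure:
  fixes \<Gamma> :: "(real^'n) set"
  assumes "A \<in> sets (restrict_space borel \<Gamma>)"
  shows "emeasure (surface_measure \<Gamma>) A = hausdorff_measure (real CARD('n) - 1) A"
proof (rule emeasure_measure_of[OF surface_measure_def])
  show "sets (restrict_space borel \<Gamma>) \<subseteq> Pow \<Gamma>"
    using sets.space_closed[of "restrict_space borel \<Gamma>"] by (simp add: space_restrict_space)
  show "positive (sets (surface_measure \<Gamma>)) (hausdorff_measure (real CARD('n) - 1))"
    "countably_additive (sets (surface_measure \<Gamma>)) (hausdorff_measure (real CARD('n) - 1))"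
    using measure_space_hausdorff[of \<Gamma> "real CARD('n) - 1"] by (auto simp: measure_space_def)
  show "A \<in> sets (surface_measure \<Gamma>)" using assms by simp
qed

text \<open>A cover of A at scale \<delta> / L, intersected with A where f is Lipschitz, is mapped
  to a cover of the image at scale \<delta>.\<close>

lemma hausdorff_measure_Lipschitz_image:
  fixes f :: "'a::metric_space \<Rightarrow> 'b::metric_space"
  assumes L: "0 < L" and d: "0 \<le> d" and lip: "\<And>x y. x \<in> A \<Longrightarrow> y \<in> A \<Longrightarrow> dist (f x) (f y) \<le> L * dist x y"
  shows "hausdorff_measure d (f ` A) \<le> ennreal (L powr d) * hausdorff_measure d A"
  unfolding hausdorff_measure_def[of d "f ` A"]
proof (rule SUP_least)
  fix \<delta> :: real assume \<delta>: "\<delta> \<in> {0<..}"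
  let ?w = "\<lambda>S. ennreal (unit_ball_vol d * (diameter S / 2) powr d)"
  \<comment> \<open>The factor is put on the left so that the right-hand side is a bare infimum over
    covers, against which the bound can be checked cover by cover.\<close>
  have "ennreal (L powr - d) * hausdorff_delta d \<delta> (f ` A) \<le> hausdorff_delta d (\<delta> / L) A"
    unfolding hausdorff_delta_def[of d "\<delta> / L"]
  proof (rule INF_greatest, clarsimp)
    fix C :: "nat \<Rightarrow> 'a set"
    assume C: "A \<subseteq> (\<Union>i. C i)" "\<forall>i. bounded (C i) \<and> diameter (C i) \<le> \<delta> / L"
    have dist: "dist x y \<le> L * diameter (C i)" if xy: "x \<in> f ` (C i \<inter> A)" "y \<in> f ` (C i \<inter> A)" for x y i
    proof -
      obtain u v where uv: "u \<in> C i \<inter> A" "v \<in> C i \<inter> A" "x = f u" "y = f v" using xy by blast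
      then have "dist u v \<le> diameter (C i)" using C by (intro diameter_bounded_bound) auto
      then show ?thesis using lip[of u v] uv L by (smt (verit) Int_iff mult_left_mono)
    qed
    have diam: "diameter (f ` (C i \<inter> A)) \<le> L * diameter (C i)" for i
    proof (cases "f ` (C i \<inter> A) = {}")
      case True then show ?thesis using L C by (simp add: diameter_ge_0)
    next
      case False
      define m where "m = L * diameter (C i)"
      have "(SUP (x,y)\<in>f ` (C i \<inter> A) \<times> f ` (C i \<inter> A). dist x y) \<le> m"
      proof (rule cSUP_least)
        show "f ` (C i \<inter> A) \<times> f ` (C i \<inter> A) \<noteq> {}" using False by blast
        fix z assume "z \<in> f ` (C i \<inter> A) \<times> f ` (C i \<inter> A)"
        then show "(case z of (x,y) \<Rightarrow> dist x y) \<le> m"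
          using dist[of "fst z" i "snd z"] unfolding m_def by (simp only: case_prod_unfold mem_Times_iff)
      qed
      then show ?thesis using False by (simp add: diameter_def m_def)
    qed
    have bdd: "bounded (f ` (C i \<inter> A))" for i
      unfolding bounded_two_points using dist by blast
    have "hausdorff_delta d \<delta> (f ` A) \<le> (\<Sum>i. ?w (f ` (C i \<inter> A)))"
    proof (rule hausdorff_delta_le)
      show "f ` A \<subseteq> (\<Union>i. f ` (C i \<inter> A))" using C by blast
      show "diameter (f ` (C i \<inter> A)) \<le> \<delta>" for i
        using diam[of i] C(2)[rule_format, of i] L by (simp add: field_simps)
    qed (rule bdd)
    also have "\<dots> \<le> (\<Sum>i. ennreal (L powr d) * ?w (C i))"
    proof (intro suminf_le)
      fix i
      have "(diameter (f ` (C i \<inter> A)) / 2) powr d \<le> (L * diameter (C i) / 2) powr d"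
        using diam[of i] bdd d by (intro powr_mono2) (auto simp: diameter_ge_0)
      also have "\<dots> = L powr d * (diameter (C i) / 2) powr d"
        using L C by (simp add: powr_mult diameter_ge_0 flip: times_divide_eq_right)
      finally have "unit_ball_vol d * (diameter (f ` (C i \<inter> A)) / 2) powr d
          \<le> L powr d * (unit_ball_vol d * (diameter (C i) / 2) powr d)"
        using d by (simp add: mult_left_mono mult.left_commute)
      then show "?w (f ` (C i \<inter> A)) \<le> ennreal (L powr d) * ?w (C i)"
        using d by (simp flip: ennreal_mult)
    qed auto
    finally have "ennreal (L powr - d) * hausdorff_delta d \<delta> (f ` A) \<le> ennreal (L powr - d) * (ennreal (L powr d) * (\<Sum>i. ?w (C i)))"
      by (simp add: mult_left_mono)
    also have "\<dots> = (\<Sum>i. ?w (C i))"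
      using L by (simp flip: ennreal_mult powr_add mult.assoc)
    finally show "ennreal (L powr - d) * hausdorff_delta d \<delta> (f ` A) \<le> (\<Sum>i. ?w (C i))" .
  qed
  then have "ennreal (L powr d) * (ennreal (L powr - d) * hausdorff_delta d \<delta> (f ` A))
     \<le> ennreal (L powr d) * hausdorff_delta d (\<delta> / L) A" by (rule mult_left_mono) simp
  then have "hausdorff_delta d \<delta> (f ` A) \<le> ennreal (L powr d) * hausdorff_delta d (\<delta> / L) A"
    using L by (simp flip: ennreal_mult powr_add mult.assoc)
  also have "\<dots> \<le> ennreal (L powr d) * hausdorff_measure d A"
    using \<delta> L by (intro mult_left_mono hausdorff_delta_le_measure) auto
  finally show "hausdorff_delta d \<delta> (f ` A) \<le> ennreal (L powr d) * hausdorff_measure d A" .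
qed

section \<open>The Brunn--Minkowski inequality for finite unions of boxes\<close>

text \<open>The Minkowski sum scaled by 1/2. For it Brunn--Minkowski takes the form |A| |B| <= |(A +
  B)/2|^2, in which the dimension does not occur.\<close>

definition midsum :: "'a::real_vector set \<Rightarrow> 'a set \<Rightarrow> 'a set" where
  "midsum A B = {(1/2) *\<^sub>R (x + y) | x y. x \<in> A \<and> y \<in> B}"

lemma midsum_mono: "A \<subseteq> A' \<Longrightarrow> B \<subseteq> B' \<Longrightarrow> midsum A B \<subseteq> midsum A' B'"
  by (auto simp: midsum_def)

lemma midsum_commute: "midsum A B = midsum B A"
proof -
  have "midsum A B \<subseteq> midsum B A" for A B :: "'a set"
    by (auto simp: midsum_def) (metis add.commute)
  then show ?thesis by blast
qed

lemma open_midsum: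
  fixes A B :: "'a::euclidean_space set"
  assumes "open A"
  shows "open (midsum A B)"
proof -
  have "midsum A B = (\<Union>y\<in>B. (\<lambda>x. (1/2) *\<^sub>R (x + y)) ` A)"
    unfolding midsum_def by blast
  also have "\<dots> = (\<Union>y\<in>B. (\<lambda>x. (1/2) *\<^sub>R y + (1/2) *\<^sub>R x) ` A)"
    by (simp add: scaleR_right_distrib add.commute)
  finally have "midsum A B = (\<Union>y\<in>B. (\<lambda>x. (1/2) *\<^sub>R y + (1/2) *\<^sub>R x) ` A)" .
  moreover have "open ((\<lambda>x. (1/2) *\<^sub>R y + (1/2) *\<^sub>R x) ` A)" for y
    using assms by (intro open_affinity) auto
  ultimately show ?thesis by auto
qed

lemma bounded_midsum:
  fixes A B :: "'a::euclidean_space set"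
  assumes "bounded A" "bounded B"
  shows "bounded (midsum A B)"
proof -
  have "midsum A B \<subseteq> (\<lambda>x. (1/2) *\<^sub>R x) ` {x + y | x y. x \<in> A \<and> y \<in> B}"
    by (auto simp: midsum_def)
  moreover have "bounded ((\<lambda>x. (1/2::real) *\<^sub>R x) ` {x + y | x y. x \<in> A \<and> y \<in> B})"
    using bounded_plus[OF assms] by (intro bounded_scaling) (simp add: image_def conj_commute Bex_def)
  ultimately show ?thesis by (rule bounded_subset[rotated])
qed

text \<open>In each coordinate, a point at relative position \<open>t i\<close> in the averaged
  interval is the average of the points at the same relative position in the two given
  intervals.\<close>

lemma midsum_boxes:
  fixes a b c d :: "'a::euclidean_space"
  assumes "box a b \<noteq> {}" "box c d \<noteq> {}"
  shows "box ((1/2) *\<^sub>R (a + c)) ((1/2) *\<^sub>R (b + d)) \<subseteq> midsum (box a b) (box c d)"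
proof
  fix z assume z: "z \<in> box ((1/2) *\<^sub>R (a + c)) ((1/2) *\<^sub>R (b + d))"
  have ab: "a \<bullet> i < b \<bullet> i" "c \<bullet> i < d \<bullet> i" if "i \<in> Basis" for i
    using assms that by (auto simp: box_ne_empty)
  define t where "t i = (2 * (z \<bullet> i) - (a + c) \<bullet> i) / ((b + d) \<bullet> i - (a + c) \<bullet> i)" for i
  have t: "0 < t i" "t i < 1" if "i \<in> Basis" for i
    using z that ab[OF that] by (auto simp: t_def mem_box inner_simps field_simps)
  define x where "x = (\<Sum>i\<in>Basis. (a \<bullet> i + t i * (b \<bullet> i - a \<bullet> i)) *\<^sub>R i)"
  define y where "y = (\<Sum>i\<in>Basis. (c \<bullet> i + t i * (d \<bullet> i - c \<bullet> i)) *\<^sub>R i)"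
  have "x \<in> box a b" "y \<in> box c d"
  proof -
    have *: "p < p + s * (q - p) \<and> p + s * (q - p) < q" if "p < q" "0 < s" "s < 1" for p q s :: real
    proof -
      have "s * (q - p) < 1 * (q - p)" using that by (intro mult_strict_right_mono) auto
      then have "s * (q - p) < q - p" by simp
      moreover have "0 < s * (q - p)" using that by simp
      ultimately show ?thesis by linarith
    qed
    show "x \<in> box a b" "y \<in> box c d"
      unfolding mem_box x_def y_def using * t ab by auto
  qed
  moreover have "z = (1/2) *\<^sub>R (x + y)"
  proof (rule euclidean_eqI)
    fix i :: 'a assume i: "i \<in> Basis"
    have "t i * ((b + d) \<bullet> i - (a + c) \<bullet> i) = 2 * (z \<bullet> i) - (a + c) \<bullet> i"
      using ab[OF i] by (simp add: t_def inner_simps)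
    then show "z \<bullet> i = (1/2) *\<^sub>R (x + y) \<bullet> i" using i
      by (simp only: x_def y_def inner_scaleR_left inner_add_left inner_sum_left_Basis) (simp add: algebra_simps)
  qed
  ultimately show "z \<in> midsum (box a b) (box c d)" by (auto simp: midsum_def)
qed

text \<open>The inequality of arithmetic and geometric means in each coordinate: s t <= ((s +
  t)/2)^2 for side lengths s and t.\<close>

lemma midsum_boxes_measure:
  fixes a b c d :: "'a::euclidean_space"
  assumes ne: "box a b \<noteq> {}" "box c d \<noteq> {}"
  shows "measure lebesgue (box a b) * measure lebesgue (box c d) \<le> (measure lebesgue (midsum (box a b) (box c d)))\<^sup>2"
proof -
  have ab: "a \<bullet> i < b \<bullet> i" "c \<bullet> i < d \<bullet> i" if "i \<in> Basis" for i
    using ne that by (auto simp: box_ne_empty)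
  have "measure lebesgue (box a b) * measure lebesgue (box c d) = (\<Prod>i\<in>Basis. ((b - a) \<bullet> i) * ((d - c) \<bullet> i))"
    using ab by (subst (1 2) measure_completion) (auto simp: less_imp_le prod.distrib)
  also have "\<dots> \<le> (\<Prod>i\<in>Basis. (((1/2) *\<^sub>R (b + d) - (1/2) *\<^sub>R (a + c)) \<bullet> i)\<^sup>2)"
  proof (rule prod_mono, safe)
    fix i :: 'a assume i: "i \<in> Basis"
    show "0 \<le> (b - a) \<bullet> i * ((d - c) \<bullet> i)" using ab[OF i] by (simp add: inner_simps)
    have "0 \<le> ((b - a) \<bullet> i - (d - c) \<bullet> i)\<^sup>2" by simp
    then show "(b - a) \<bullet> i * ((d - c) \<bullet> i) \<le> (((1/2) *\<^sub>R (b + d) - (1/2) *\<^sub>R (a + c)) \<bullet> i)\<^sup>2"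
      by (simp add: inner_simps power2_eq_square algebra_simps)
  qed
  also have "\<dots> = (measure lebesgue (box ((1/2) *\<^sub>R (a + c)) ((1/2) *\<^sub>R (b + d))))\<^sup>2"
    using ab by (subst measure_completion) (auto simp: less_imp_le prod_power_distrib inner_simps add_mono)
  also have "\<dots> \<le> (measure lebesgue (midsum (box a b) (box c d)))\<^sup>2"
    by (intro power_mono measure_mono_fmeasurable midsum_boxes ne lmeasurable_open bounded_midsum open_midsum)
       (auto simp: bounded_box)
  finally show ?thesis .
qed

text \<open>Averages of the two lower parts lie below the hyperplane at height (a + b)/2 and
  averages of the two upper parts above it, so the two contributions are disjoint and their volumes
  add. In the application t is the common fraction of volume below the two cuts.\<close>

lemma midsum_halfspace_split:
  fixes A B :: "'a::euclidean_space set"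
  assumes "open A" "bounded A" "open B" "bounded B" and u: "0 \<le> u" and t: "0 \<le> t" "t \<le> 1"
    and m1: "t * u \<le> measure lebesgue (midsum (A \<inter> {x. x \<bullet> i < a}) (B \<inter> {x. x \<bullet> i < b}))"
    and m2: "(1 - t) * u \<le> measure lebesgue (midsum (A \<inter> {x. a < x \<bullet> i}) (B \<inter> {x. b < x \<bullet> i}))"
  shows "u \<le> measure lebesgue (midsum A B)"
proof -
  let ?M1 = "midsum (A \<inter> {x. x \<bullet> i < a}) (B \<inter> {x. x \<bullet> i < b})"
  let ?M2 = "midsum (A \<inter> {x. a < x \<bullet> i}) (B \<inter> {x. b < x \<bullet> i})"
  have op: "open {x::'a. x \<bullet> i < c}" "open {x::'a. c < x \<bullet> i}" for c
    by (intro open_Collect_less continuous_intros)+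
  have meas: "?M1 \<in> lmeasurable" "?M2 \<in> lmeasurable" "midsum A B \<in> lmeasurable"
    using assms op by (auto intro!: lmeasurable_open open_midsum bounded_midsum bounded_Int)
  have disj: "?M1 \<inter> ?M2 = {}"
  proof -
    have "z \<bullet> i < (a + b) / 2" if "z \<in> ?M1" for z
      using that by (auto simp: midsum_def inner_simps)
    moreover have "(a + b) / 2 < z \<bullet> i" if "z \<in> ?M2" for z
      using that by (auto simp: midsum_def inner_simps)
    ultimately show ?thesis by (meson disjoint_iff less_asym)
  qed
  have "u = t * u + (1 - t) * u" by (simp add: algebra_simps)
  also have "\<dots> \<le> measure lebesgue ?M1 + measure lebesgue ?M2" using m1 m2 by (rule add_mono)
  also have "\<dots> = measure lebesgue (?M1 \<union> ?M2)"
    using meas disj by (subst measure_Un3) auto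
  also have "\<dots> \<le> measure lebesgue (midsum A B)"
    by (intro measure_mono_fmeasurable Un_least midsum_mono) (use meas in auto)
  finally show ?thesis .
qed

lemma measure_halfspace_split:
  fixes A :: "'a::euclidean_space set"
  assumes "open A" "bounded A" "i \<noteq> 0"
  shows "measure lebesgue A = measure lebesgue (A \<inter> {x. x \<bullet> i < c}) + measure lebesgue (A \<inter> {x. c < x \<bullet> i})"
proof -
  have op: "open {x::'a. x \<bullet> i < c}" "open {x::'a. c < x \<bullet> i}" for c
    by (intro open_Collect_less continuous_intros)+
  have neg: "negligible (A \<inter> {x. x \<bullet> i = c})"
    by (rule negligible_subset[OF negligible_hyperplane[of i c]]) (auto simp: inner_commute assms(3))
  have m: "A \<inter> {x. x \<bullet> i < c} \<in> lmeasurable" "A \<inter> {x. c < x \<bullet> i} \<in> lmeasurable"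
    using assms op by (auto intro!: lmeasurable_open)
  have "measure lebesgue A = measure lebesgue ((A \<inter> {x. x \<bullet> i < c}) \<union> (A \<inter> {x. c < x \<bullet> i}))"
  proof (rule measure_negligible_symdiff)
    show "(A \<inter> {x. x \<bullet> i < c}) \<union> (A \<inter> {x. c < x \<bullet> i}) \<in> lmeasurable" using m by (rule fmeasurable.Un)
    show "negligible (sym_diff ((A \<inter> {x. x \<bullet> i < c}) \<union> (A \<inter> {x. c < x \<bullet> i})) A)"
      by (rule negligible_subset[OF neg]) force
  qed
  also have "\<dots> = measure lebesgue (A \<inter> {x. x \<bullet> i < c}) + measure lebesgue (A \<inter> {x. c < x \<bullet> i})"
  proof -
    have e: "(A \<inter> {x. x \<bullet> i < c}) \<inter> (A \<inter> {x. c < x \<bullet> i}) = {}" by auto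
    show ?thesis using measure_Un3[OF m] unfolding e by simp
  qed
  finally show ?thesis .
qed

text \<open>Intermediate value theorem: the volume below height c depends continuously on c because
  hyperplanes are null sets.\<close>

lemma halfspace_cut_ex:
  fixes B :: "'a::euclidean_space set"
  assumes B: "open B" "bounded B" and i: "i \<noteq> 0" and t: "0 \<le> t" "t \<le> 1"
  obtains c where "measure lebesgue (B \<inter> {x. x \<bullet> i < c}) = t * measure lebesgue B"
proof -
  let ?h = "\<lambda>c. measure lebesgue (B \<inter> {x. x \<bullet> i < c})"
  have op: "open {x::'a. x \<bullet> i < c}" "open {x::'a. c < x \<bullet> i}" for c
    by (intro open_Collect_less continuous_intros)+
  have m: "B \<inter> {x. x \<bullet> i < c} \<in> lmeasurable" for c
    using B op by (auto intro!: lmeasurable_open)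
  have B': "B \<in> lmeasurable" using B by (rule lmeasurable_open[rotated])
  have heq: "?h c = (LINT x|lebesgue. indicat_real (B \<inter> {x. x \<bullet> i < c}) x)" for c
    using m[of c] by (simp add: )
  have cont: "continuous_on UNIV ?h"
    unfolding continuous_on_sequentially
  proof (safe, unfold o_def)
    fix c :: "nat \<Rightarrow> real" and c0 assume c: "c \<longlonglongrightarrow> c0"
    show "(\<lambda>n. ?h (c n)) \<longlonglongrightarrow> ?h c0"
      unfolding heq
    proof (rule integral_dominated_convergence)
      show "integrable lebesgue (indicat_real B)" using B' by (simp add: lmeasurable_iff_integrable)
      have "{x. i \<bullet> x = c0} \<in> null_sets lebesgue"
        using negligible_hyperplane[of i c0] i by (simp add: negligible_iff_null_sets)
      then have "AE x in lebesgue. i \<bullet> x \<noteq> c0" by (auto intro: AE_I')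
      then show "AE x in lebesgue. (\<lambda>n. indicat_real (B \<inter> {x. x \<bullet> i < c n}) x) \<longlonglongrightarrow> indicat_real (B \<inter> {x. x \<bullet> i < c0}) x"
      proof (eventually_elim)
        fix x assume "i \<bullet> x \<noteq> c0"
        then consider "x \<bullet> i < c0" | "c0 < x \<bullet> i" by (force simp: inner_commute)
        then have "\<forall>\<^sub>F n in sequentially. indicat_real (B \<inter> {x. x \<bullet> i < c n}) x = indicat_real (B \<inter> {x. x \<bullet> i < c0}) x"
        proof cases
          case 1 then have "\<forall>\<^sub>F n in sequentially. x \<bullet> i < c n" using c by (auto dest: order_tendstoD)
          then show ?thesis by eventually_elim (use 1 in \<open>auto simp: indicator_def\<close>)
        next
          case 2 then have "\<forall>\<^sub>F n in sequentially. c n < x \<bullet> i" using c by (auto dest: order_tendstoD)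
          then show ?thesis by eventually_elim (use 2 in \<open>auto simp: indicator_def\<close>)
        qed
        then show "(\<lambda>n. indicat_real (B \<inter> {x. x \<bullet> i < c n}) x) \<longlonglongrightarrow> indicat_real (B \<inter> {x. x \<bullet> i < c0}) x"
          by (rule tendsto_eventually)
      qed
    qed (use m in \<open>auto simp: indicator_def\<close>)
  qed
  obtain R where R: "\<And>x. x \<in> B \<Longrightarrow> norm x \<le> R" using B(2) by (auto simp: bounded_iff)
  define M where "M = \<bar>R\<bar> * norm i + 1"
  have bd: "\<bar>x \<bullet> i\<bar> < M" if "x \<in> B" for x
  proof -
    have "\<bar>x \<bullet> i\<bar> \<le> norm x * norm i" by (rule Cauchy_Schwarz_ineq2)
    also have "\<dots> \<le> \<bar>R\<bar> * norm i" using R[OF that] by (intro mult_right_mono) auto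
    finally show ?thesis by (simp add: M_def)
  qed
  have e1: "B \<inter> {x. x \<bullet> i < - M} = {}" "B \<inter> {x. x \<bullet> i < M} = B" using bd by fastforce+
  have M0: "0 \<le> M" by (simp add: M_def)
  have "\<exists>c\<ge>-M. c \<le> M \<and> ?h c = t * measure lebesgue B"
    by (rule IVT'[of ?h "-M" _ M])
      (use t M0 in \<open>auto simp: e1 mult_left_le_one_le intro: continuous_on_subset[OF cont]\<close>)
  then show ?thesis using that by blast
qed

lemma box_halfspace_Int:
  fixes a b :: "'a::euclidean_space"
  assumes i: "i \<in> Basis"
  shows "\<exists>b'. box a b \<inter> {x. x \<bullet> i < c} = box a b'" "\<exists>a'. box a b \<inter> {x. c < x \<bullet> i} = box a' b"
proof -
  have "box a b \<inter> {x. x \<bullet> i < c} = box a (\<Sum>j\<in>Basis. (if j = i then min (b \<bullet> i) c else b \<bullet> j) *\<^sub>R j)"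
    using i by (auto simp: mem_box split: if_splits)
  then show "\<exists>b'. box a b \<inter> {x. x \<bullet> i < c} = box a b'" by blast
  have "box a b \<inter> {x. c < x \<bullet> i} = box (\<Sum>j\<in>Basis. (if j = i then max (a \<bullet> i) c else a \<bullet> j) *\<^sub>R j) b"
    using i by (auto simp: mem_box split: if_splits)
  then show "\<exists>a'. box a b \<inter> {x. c < x \<bullet> i} = box a' b" by blast
qed

text \<open>Neither the family nor any of its members is empty, so the union has positive volume and
  fractions of volume can be formed.\<close>

definition boxfam :: "'a::euclidean_space set set \<Rightarrow> bool" where
  "boxfam \<A> \<longleftrightarrow> finite \<A> \<and> \<A> \<noteq> {} \<and> disjoint \<A> \<and> (\<forall>X\<in>\<A>. X \<noteq> {} \<and> (\<exists>a b. X = box a b))"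

lemma boxfam_open_bounded: assumes "boxfam \<A>" shows "open (\<Union>\<A>)" "bounded (\<Union>\<A>)"
proof -
  have "open X \<and> bounded X" if "X \<in> \<A>" for X
    using assms that unfolding boxfam_def by (metis open_box bounded_box)
  moreover have "finite \<A>" using assms by (simp add: boxfam_def)
  ultimately show "open (\<Union>\<A>)" "bounded (\<Union>\<A>)" by (blast intro: bounded_Union open_Union)+
qed

lemma boxfam_measure_pos: assumes "boxfam \<A>" shows "0 < measure lebesgue (\<Union>\<A>)"
proof -
  obtain X where X: "X \<in> \<A>" using assms unfolding boxfam_def by blast
  then obtain a b where ab: "box a b \<in> \<A>" "box a b \<noteq> {}" using assms unfolding boxfam_def by metis
  have "0 < measure lebesgue (box a b)"
    using ab(2) by (subst measure_completion) (auto simp: box_ne_empty less_imp_le inner_diff_left intro!: prod_pos)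
  also have "\<dots> \<le> measure lebesgue (\<Union>\<A>)"
  proof (rule measure_mono_fmeasurable)
    show "box a b \<subseteq> \<Union>\<A>" using ab by blast
    show "\<Union>\<A> \<in> lmeasurable" using boxfam_open_bounded[OF assms] by (intro lmeasurable_open)
  qed simp
  finally show ?thesis .
qed

text \<open>The counts drive the induction: a cut by a half-space never increases the number of
  boxes, and lowers it as soon as one box is missed.\<close>

lemma boxfam_cut:
  assumes fam: "boxfam \<A>" and H: "\<And>a b. \<exists>a' b'. box a b \<inter> H = box a' b'" and ne: "\<Union>\<A> \<inter> H \<noteq> {}"
  shows "boxfam ((\<lambda>X. X \<inter> H) ` \<A> - {{}})" "\<Union>((\<lambda>X. X \<inter> H) ` \<A> - {{}}) = \<Union>\<A> \<inter> H"
    "card ((\<lambda>X. X \<inter> H) ` \<A> - {{}}) \<le> card \<A>"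
    "Y \<in> \<A> \<Longrightarrow> Y \<inter> H = {} \<Longrightarrow> card ((\<lambda>X. X \<inter> H) ` \<A> - {{}}) < card \<A>"
proof -
  let ?B = "(\<lambda>X. X \<inter> H) ` \<A> - {{}}"
  have fin: "finite \<A>" using fam by (simp add: boxfam_def)
  have d: "disjoint \<A>" using fam by (simp add: boxfam_def)
  have "disjoint ?B"
  proof (rule disjointI)
    fix P Q assume "P \<in> ?B" "Q \<in> ?B" "P \<noteq> Q"
    then obtain X Y where "X \<in> \<A>" "Y \<in> \<A>" "P = X \<inter> H" "Q = Y \<inter> H" "X \<noteq> Y" by blast
    then show "P \<inter> Q = {}" using d by (auto dest: disjointD)
  qed
  moreover show "\<Union>?B = \<Union>\<A> \<inter> H" by auto
  moreover have "\<exists>a b. X = box a b" if "X \<in> ?B" for X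
    using that fam H unfolding boxfam_def by (metis DiffD1 imageE)
  moreover have "?B \<noteq> {}" using ne by blast
  moreover have "finite ?B" using fin by blast
  ultimately show "boxfam ?B" unfolding boxfam_def by blast
  show "card ?B \<le> card \<A>"
    by (meson card_Diff1_le card_image_le fin order_trans card_mono Diff_subset finite_imageI)
  assume Y: "Y \<in> \<A>" "Y \<inter> H = {}"
  then have "?B \<subseteq> (\<lambda>X. X \<inter> H) ` (\<A> - {Y})" by auto
  then have "card ?B \<le> card (\<A> - {Y})" using fin by (meson card_image_le card_mono finite_Diff finite_imageI order_trans)
  also have "\<dots> < card \<A>" using Y fin by (meson card_Diff1_less)
  finally show "card ?B < card \<A>" .
qed

text \<open>The Hadwiger--Ohmann step. Two disjoint boxes of \<A> are separated by a coordinate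
  hyperplane, so each side of it meets fewer boxes of \<A>. \<B> is cut by a parallel hyperplane in
  the same ratio of volumes, the induction hypothesis applies on both sides, and the two bounds are
  t u and (1 - t) u with u the geometric mean of the volumes.\<close>

lemma Brunn_Minkowski_boxfam_aux:
  fixes \<A> \<B> :: "'a::euclidean_space set set"
  assumes A: "boxfam \<A>" and B: "boxfam \<B>" and card: "2 \<le> card \<A>"
    and IH: "\<And>\<A>' \<B>' :: 'a set set. boxfam \<A>' \<Longrightarrow> boxfam \<B>' \<Longrightarrow> card \<A>' + card \<B>' < card \<A> + card \<B> \<Longrightarrow>
       measure lebesgue (\<Union>\<A>') * measure lebesgue (\<Union>\<B>') \<le> (measure lebesgue (midsum (\<Union>\<A>') (\<Union>\<B>')))\<^sup>2"
  shows "measure lebesgue (\<Union>\<A>) * measure lebesgue (\<Union>\<B>) \<le> (measure lebesgue (midsum (\<Union>\<A>) (\<Union>\<B>)))\<^sup>2"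
proof -
  let ?m = "measure lebesgue :: 'a set \<Rightarrow> real"
  note Aob = boxfam_open_bounded[OF A] and Bob = boxfam_open_bounded[OF B]
  note Apos = boxfam_measure_pos[OF A] and Bpos = boxfam_measure_pos[OF B]
  obtain X Y where XY: "X \<in> \<A>" "Y \<in> \<A>" "X \<noteq> Y"
  proof -
    have "finite \<A>" using A by (simp add: boxfam_def)
    then show thesis using card card_le_Suc0_iff_eq[of \<A>] that by fastforce
  qed
  obtain a b c d where ab: "X = box a b" "Y = box c d" and ne: "X \<noteq> {}" "Y \<noteq> {}"
    using A XY unfolding boxfam_def by metis
  have disj: "box a b \<inter> box c d = {}" using A XY ab unfolding boxfam_def by (auto dest: disjointD)
  obtain i where i: "i \<in> Basis" and sep0: "b \<bullet> i \<le> c \<bullet> i \<or> d \<bullet> i \<le> a \<bullet> i"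
    using disj ne unfolding ab disjoint_interval box_eq_empty by (metis not_le)
  obtain P Q e where PQ: "P \<in> \<A>" "Q \<in> \<A>" "P \<noteq> {}" "Q \<noteq> {}" "P \<subseteq> {x. x \<bullet> i < e}" "Q \<subseteq> {x. e < x \<bullet> i}"
  proof (cases "b \<bullet> i \<le> c \<bullet> i")
    case True
    have "X \<subseteq> {x. x \<bullet> i < b \<bullet> i}" "Y \<subseteq> {x. b \<bullet> i < x \<bullet> i}" using i True unfolding ab by (force simp: mem_box)+
    then show ?thesis by (intro that[of X Y "b \<bullet> i"] XY ne)
  next
    case False
    with sep0 have "d \<bullet> i \<le> a \<bullet> i" by simp
    then have "Y \<subseteq> {x. x \<bullet> i < d \<bullet> i}" "X \<subseteq> {x. d \<bullet> i < x \<bullet> i}" using i unfolding ab by (force simp: mem_box)+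
    then show ?thesis by (intro that[of Y X "d \<bullet> i"] XY ne)
  qed
  let ?L = "\<lambda>c. {x::'a. x \<bullet> i < c}" and ?G = "\<lambda>c. {x::'a. c < x \<bullet> i}"
  have HL: "\<exists>a' b'. box a b \<inter> ?L c = box a' b'" and HG: "\<exists>a' b'. box a b \<inter> ?G c = box a' b'" for a b c
    using box_halfspace_Int[OF i] by blast+
  define t where "t = ?m (\<Union>\<A> \<inter> ?L e) / ?m (\<Union>\<A>)"
  have i0: "i \<noteq> 0" using i by auto
  have neL: "\<Union>\<A> \<inter> ?L e \<noteq> {}" and neG: "\<Union>\<A> \<inter> ?G e \<noteq> {}" using PQ by blast+
  note cL = boxfam_cut[where H = "?L e", OF A HL neL] and cG = boxfam_cut[where H = "?G e", OF A HG neG]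
  have posL: "0 < ?m (\<Union>\<A> \<inter> ?L e)" using boxfam_measure_pos[OF cL(1)] unfolding cL(2) .
  have posG: "0 < ?m (\<Union>\<A> \<inter> ?G e)" using boxfam_measure_pos[OF cG(1)] unfolding cG(2) .
  have spl: "?m (\<Union>\<A>) = ?m (\<Union>\<A> \<inter> ?L e) + ?m (\<Union>\<A> \<inter> ?G e)" by (rule measure_halfspace_split[OF Aob i0])
  have t: "0 < t" "t < 1" using posL posG Apos spl by (auto simp: t_def)
  have tL: "?m (\<Union>\<A> \<inter> ?L e) = t * ?m (\<Union>\<A>)" using Apos by (simp add: t_def)
  have tG: "?m (\<Union>\<A> \<inter> ?G e) = (1 - t) * ?m (\<Union>\<A>)" using spl tL by (simp add: algebra_simps)
  obtain f where f: "?m (\<Union>\<B> \<inter> ?L f) = t * ?m (\<Union>\<B>)"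
    using halfspace_cut_ex[OF Bob i0, of t] t by auto
  have f': "?m (\<Union>\<B> \<inter> ?G f) = (1 - t) * ?m (\<Union>\<B>)"
    using measure_halfspace_split[OF Bob i0, of f] f by (simp add: algebra_simps)
  have neL': "\<Union>\<B> \<inter> ?L f \<noteq> {}" using f t Bpos by force
  have neG': "\<Union>\<B> \<inter> ?G f \<noteq> {}" using f' t Bpos by force
  note dL = boxfam_cut[where H = "?L f", OF B HL neL'] and dG = boxfam_cut[where H = "?G f", OF B HG neG']
  define u where "u = sqrt (?m (\<Union>\<A>) * ?m (\<Union>\<B>))"
  have u2: "u\<^sup>2 = ?m (\<Union>\<A>) * ?m (\<Union>\<B>)" and u0: "0 \<le> u" using Apos Bpos by (auto simp: u_def)
  have "Q \<inter> ?L e = {}" "P \<inter> ?G e = {}" using PQ by force+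
  then have lessL: "card ((\<lambda>X. X \<inter> ?L e) ` \<A> - {{}}) < card \<A>" and lessG: "card ((\<lambda>X. X \<inter> ?G e) ` \<A> - {{}}) < card \<A>"
    using cL(4)[of Q] cG(4)[of P] PQ by auto
  have "(t * u)\<^sup>2 \<le> (?m (midsum (\<Union>\<A> \<inter> ?L e) (\<Union>\<B> \<inter> ?L f)))\<^sup>2"
    using IH[OF cL(1), OF dL(1)] lessL dL(3) unfolding cL(2) dL(2) tL f power_mult_distrib u2
    by (simp add: power2_eq_square mult_ac)
  then have m1: "t * u \<le> ?m (midsum (\<Union>\<A> \<inter> ?L e) (\<Union>\<B> \<inter> ?L f))" by (rule power2_le_imp_le) simp
  have "((1 - t) * u)\<^sup>2 \<le> (?m (midsum (\<Union>\<A> \<inter> ?G e) (\<Union>\<B> \<inter> ?G f)))\<^sup>2"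
    using IH[OF cG(1), OF dG(1)] lessG dG(3) unfolding cG(2) dG(2) tG f' power_mult_distrib u2
    by (simp add: power2_eq_square mult_ac)
  then have m2: "(1 - t) * u \<le> ?m (midsum (\<Union>\<A> \<inter> ?G e) (\<Union>\<B> \<inter> ?G f))" by (rule power2_le_imp_le) simp
  have "u \<le> ?m (midsum (\<Union>\<A>) (\<Union>\<B>))"
    using midsum_halfspace_split[OF Aob Bob u0 _ _ m1 m2] t by auto
  then have "u\<^sup>2 \<le> (?m (midsum (\<Union>\<A>) (\<Union>\<B>)))\<^sup>2" using u0 by (intro power_mono)
  then show ?thesis by (simp add: u2)
qed

lemma Brunn_Minkowski_boxfam:
  fixes \<A> \<B> :: "'a::euclidean_space set set"
  assumes "boxfam \<A>" "boxfam \<B>"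
  shows "measure lebesgue (\<Union>\<A>) * measure lebesgue (\<Union>\<B>) \<le> (measure lebesgue (midsum (\<Union>\<A>) (\<Union>\<B>)))\<^sup>2"
  using assms
proof (induction "card \<A> + card \<B>" arbitrary: \<A> \<B> rule: less_induct)
  case less
  have fin: "finite \<A>" "\<A> \<noteq> {}" "finite \<B>" "\<B> \<noteq> {}" using less.prems by (auto simp: boxfam_def)
  consider "2 \<le> card \<A>" | "2 \<le> card \<B>" | "card \<A> = 1" "card \<B> = 1"
    using fin by (metis One_nat_def Suc_1 card_gt_0_iff le_eq_less_or_eq not_less_eq_eq Suc_leI)
  then show ?case
  proof cases
    case 1
    show ?thesis by (rule Brunn_Minkowski_boxfam_aux[OF less.prems 1 less.hyps])
  next
    case 2
    have "measure lebesgue (\<Union>\<B>) * measure lebesgue (\<Union>\<A>) \<le> (measure lebesgue (midsum (\<Union>\<B>) (\<Union>\<A>)))\<^sup>2"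
      by (rule Brunn_Minkowski_boxfam_aux[OF less.prems(2,1) 2 less.hyps]) (simp_all add: add.commute)
    then show ?thesis by (simp add: midsum_commute mult.commute)
  next
    case 3
    then obtain X Y where XY: "\<A> = {X}" "\<B> = {Y}" by (metis card_1_singletonE)
    then obtain a b c d where "X = box a b" "Y = box c d" "X \<noteq> {}" "Y \<noteq> {}"
      using less.prems unfolding boxfam_def by auto
    then show ?thesis using XY midsum_boxes_measure[of a b c d] by simp
  qed
qed

section \<open>The isodiametric inequality and top-dimensional Hausdorff measure\<close>

text \<open>Encloses a compact set in a finite union of boxes within a prescribed neighbourhood, the
  kind of set for which Brunn--Minkowski has been proved.\<close>

lemma elementary_approx_compact:
  fixes K V :: "'a::euclidean_space set"
  assumes "compact K" "open V" "K \<subseteq> V"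
  obtains p where "p division_of (\<Union>p)" "K \<subseteq> \<Union>p" "\<Union>p \<subseteq> V"
proof -
  have "\<exists>a b. x \<in> box a b \<and> cbox a b \<subseteq> V" if "x \<in> K" for x
    using open_contains_cbox[OF assms(2), of x] that assms(3) by (metis subsetD)
  then obtain a b where ab: "\<And>x. x \<in> K \<Longrightarrow> x \<in> box (a x) (b x) \<and> cbox (a x) (b x) \<subseteq> V" by metis
  obtain F where F: "F \<subseteq> K" "finite F" "K \<subseteq> (\<Union>x\<in>F. box (a x) (b x))"
  proof (rule compactE_image[OF assms(1), of K "\<lambda>x. box (a x) (b x)"])
    show "K \<subseteq> (\<Union>x\<in>K. box (a x) (b x))" using ab by blast
  qed auto
  obtain p where p: "p division_of \<Union>((\<lambda>x. cbox (a x) (b x)) ` F)"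
    using elementary_unions_intervals[of "(\<lambda>x. cbox (a x) (b x)) ` F"] F(2) by auto
  then have U: "\<Union>p = (\<Union>x\<in>F. cbox (a x) (b x))" by (simp add: division_of_def)
  show ?thesis
  proof (rule that)
    show "p division_of \<Union>p" using p U by simp
    show "K \<subseteq> \<Union>p" unfolding U using F(3) box_subset_cbox by fastforce
    show "\<Union>p \<subseteq> V" unfolding U using F(1) ab by blast
  qed
qed

text \<open>The intervals of a division may share faces. Passing to interiors makes them disjoint
  and removes only a null set.\<close>

lemma division_interiors:
  fixes p :: "'a::euclidean_space set set"
  assumes p: "p division_of (\<Union>p)"
  defines "\<A> \<equiv> interior ` p - {{}}"
  shows "\<A> = {} \<or> boxfam \<A>" "\<Union>\<A> \<subseteq> \<Union>p" "measure lebesgue (\<Union>\<A>) = measure lebesgue (\<Union>p)"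
proof -
  note pD = division_ofD[OF p]
  have "disjoint \<A>"
  proof (rule disjointI)
    fix P Q assume "P \<in> \<A>" "Q \<in> \<A>" "P \<noteq> Q"
    then obtain X Y where "X \<in> p" "Y \<in> p" "P = interior X" "Q = interior Y" "X \<noteq> Y" by (auto simp: \<A>_def)
    then show "P \<inter> Q = {}" using pD(5) by simp
  qed
  moreover have "\<exists>a b. X = box a b" if "X \<in> \<A>" for X
    using that pD(4) unfolding \<A>_def by (metis DiffD1 imageE interior_cbox)
  ultimately show "\<A> = {} \<or> boxfam \<A>" using pD(1) by (auto simp: boxfam_def \<A>_def)
  show sub: "\<Union>\<A> \<subseteq> \<Union>p" using interior_subset by (fastforce simp: \<A>_def)
  have neg: "negligible (\<Union>X\<in>p. X - interior X)"
  proof (rule negligible_Union[OF finite_imageI[OF pD(1)]], safe)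
    fix X assume "X \<in> p"
    then obtain a b where "X = cbox a b" using pD(4) by blast
    then show "negligible (X - interior X)" by (simp add: negligible_frontier_interval)
  qed
  have "\<Union>p - \<Union>\<A> \<subseteq> (\<Union>X\<in>p. X - interior X)" by (auto simp: \<A>_def)
  moreover have "\<Union>\<A> - \<Union>p = {}" using sub by auto
  ultimately have "negligible ((\<Union>p - \<Union>\<A>) \<union> (\<Union>\<A> - \<Union>p))"
    using negligible_subset[OF neg] by simp
  moreover have "\<Union>p \<in> lmeasurable"
    using pD(1,4) by (intro lmeasurable_compact compact_Union) (auto, metis compact_cbox)
  ultimately show "measure lebesgue (\<Union>\<A>) = measure lebesgue (\<Union>p)"
    by (intro measure_negligible_symdiff)
qed

lemma boxfam_uminus:
  fixes \<A> :: "'a::euclidean_space set set"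
  assumes "boxfam \<A>" shows "boxfam ((`) uminus ` \<A>)"
proof -
  have "\<exists>c d. uminus ` box a b = box c d" for a b :: 'a
  proof -
    have "uminus ` box a b = box (-b) (-a)"
    proof (safe)
      fix x assume "x \<in> box (-b) (-a)"
      then have "- x \<in> box a b" by (auto simp: mem_box minus_less_iff less_minus_iff)
      then show "x \<in> uminus ` box a b" by (metis add.inverse_inverse image_eqI)
    qed (auto simp: mem_box)
    then show ?thesis by blast
  qed
  moreover have "disjoint ((`) uminus ` \<A>)"
  proof (rule disjointI)
    fix P Q assume "P \<in> (`) uminus ` \<A>" "Q \<in> (`) uminus ` \<A>" "P \<noteq> Q"
    then obtain X Y where "X \<in> \<A>" "Y \<in> \<A>" "P = uminus ` X" "Q = uminus ` Y" "X \<noteq> Y" by blast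
    moreover have "disjoint \<A>" using assms by (simp add: boxfam_def)
    ultimately have "X \<inter> Y = {}" by (simp add: disjointD)
    moreover have "P \<inter> Q = uminus ` (X \<inter> Y)" using \<open>P = _\<close> \<open>Q = _\<close> by (auto simp: image_iff)
    ultimately show "P \<inter> Q = {}" by simp
  qed
  moreover have "X \<noteq> {} \<and> (\<exists>a b. X = box a b)" if "X \<in> \<A>" for X using that assms by (simp add: boxfam_def)
  moreover have "finite \<A>" "\<A> \<noteq> {}" using assms by (auto simp: boxfam_def)
  moreover have "Y \<noteq> {} \<and> (\<exists>a b. Y = box a b)" if "Y \<in> (`) uminus ` \<A>" for Y
  proof -
    from that obtain X where X: "X \<in> \<A>" "Y = uminus ` X" by blast
    then show ?thesis using calculation(1) calculation(3)[OF X(1)] by (metis image_is_empty)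
  qed
  ultimately show ?thesis unfolding boxfam_def by simp
qed

text \<open>Brunn--Minkowski for a set A and its reflection gives |A| <= |(A - A)/2|, and every (x -
  y)/2 lies in the ball whose radius is half the diameter. Enclosing K in boxes enlarges this radius
  by at most e, which tends to 0 at the end.\<close>

lemma isodiametric_compact:
  fixes K :: "'a::euclidean_space set"
  assumes K: "compact K"
  shows "measure lebesgue K \<le> unit_ball_vol DIM('a) * (diameter K / 2) ^ DIM('a)"
proof (cases "K = {}")
  case False
  have *: "measure lebesgue K \<le> unit_ball_vol DIM('a) * (diameter K / 2 + e) ^ DIM('a)" if e: "0 < e" for e
  proof -
    have d0: "0 \<le> diameter K" by (rule diameter_ge_0) (use K compact_imp_bounded in blast)
    define V where "V = {x. infdist x K < e}"
    have "open V" unfolding V_def by (intro open_Collect_less continuous_intros)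
    moreover have "K \<subseteq> V" using e by (auto simp: V_def)
    ultimately obtain p where p: "p division_of (\<Union>p)" "K \<subseteq> \<Union>p" "\<Union>p \<subseteq> V"
      using elementary_approx_compact[OF K] by blast
    define \<A> where "\<A> = interior ` p - {{}}"
    note A = division_interiors[OF p(1), folded \<A>_def]
    have "measure lebesgue K \<le> measure lebesgue (\<Union>p)"
      using p division_ofD[OF p(1)] K
      by (intro measure_mono_fmeasurable lmeasurable_compact compact_Union) (auto simp: compact_cbox borel_compact)
    also have "\<dots> = measure lebesgue (\<Union>\<A>)" using A(3) by simp
    also have "\<dots> \<le> unit_ball_vol DIM('a) * (diameter K / 2 + e) ^ DIM('a)"
    proof (cases "\<A> = {}")
      case True then show ?thesis using e d0 by simp
    next
      case False
      then have bf: "boxfam \<A>" using A by blast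
      have U: "\<Union>((`) uminus ` \<A>) = uminus ` (\<Union>\<A>)" by auto
      have "measure lebesgue (uminus ` (\<Union>\<A>)) = measure lebesgue (\<Union>\<A>)"
        using measure_lebesgue_affine[of "-1" 0 "\<Union>\<A>"] by simp
      then have "(measure lebesgue (\<Union>\<A>))\<^sup>2 \<le> (measure lebesgue (midsum (\<Union>\<A>) (uminus ` (\<Union>\<A>))))\<^sup>2"
        using Brunn_Minkowski_boxfam[OF bf boxfam_uminus[OF bf]] by (simp add: U power2_eq_square)
      then have "measure lebesgue (\<Union>\<A>) \<le> measure lebesgue (midsum (\<Union>\<A>) (uminus ` (\<Union>\<A>)))"
        by (rule power2_le_imp_le) simp
      also have "midsum (\<Union>\<A>) (uminus ` (\<Union>\<A>)) \<subseteq> cball 0 (diameter K / 2 + e)"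
      proof
        fix z assume "z \<in> midsum (\<Union>\<A>) (uminus ` (\<Union>\<A>))"
        then obtain x y where xy: "x \<in> V" "y \<in> V" "z = (1/2) *\<^sub>R (x - y)"
        proof -
          obtain x y where "x \<in> \<Union>\<A>" "y \<in> uminus ` (\<Union>\<A>)" "z = (1/2) *\<^sub>R (x + y)"
            using \<open>z \<in> _\<close> unfolding midsum_def by blast
          moreover from this obtain y' where "y' \<in> \<Union>\<A>" "y = - y'" by blast
          ultimately show thesis using that[of x y'] A(2) p(3) by auto
        qed
        obtain k where k: "k \<in> K" "infdist x K = dist x k"
          using infdist_attains_inf[OF compact_imp_closed[OF K] \<open>K \<noteq> {}\<close>] by metis
        obtain l where l: "l \<in> K" "infdist y K = dist y l"
          using infdist_attains_inf[OF compact_imp_closed[OF K] \<open>K \<noteq> {}\<close>] by metis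
        have "dist x y \<le> dist x k + dist k l + dist y l" by metric
        also have "\<dots> \<le> e + diameter K + e"
          using k l xy diameter_bounded_bound[OF compact_imp_bounded[OF K] k(1) l(1)] by (intro add_mono) (auto simp: V_def)
        finally show "z \<in> cball 0 (diameter K / 2 + e)" using xy by (simp add: dist_norm)
      qed
      then have "measure lebesgue (midsum (\<Union>\<A>) (uminus ` (\<Union>\<A>))) \<le> measure lebesgue (cball 0 (diameter K / 2 + e) :: 'a set)"
        using boxfam_open_bounded[OF bf] by (intro measure_mono_fmeasurable) (auto simp: open_midsum)
      also have "\<dots> = unit_ball_vol DIM('a) * (diameter K / 2 + e) ^ DIM('a)"
        using e d0 by (subst content_cball[symmetric]) auto
      finally show ?thesis .
    qed
    finally show ?thesis .
  qed
  have "((\<lambda>e. unit_ball_vol DIM('a) * (diameter K / 2 + e) ^ DIM('a)) \<longlongrightarrow> unit_ball_vol DIM('a) * (diameter K / 2 + 0) ^ DIM('a)) (at_right 0)"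
    by (intro tendsto_intros)
  moreover have "\<forall>\<^sub>F e in at_right 0. measure lebesgue K \<le> unit_ball_vol DIM('a) * (diameter K / 2 + e) ^ DIM('a)"
    using * by (auto simp: eventually_at_right_less intro: eventually_mono[OF eventually_at_right_less])
  ultimately show ?thesis
    using tendsto_lowerbound[of _ _ "at_right (0::real)"] by fastforce
qed simp

section \<open>Hausdorff measure equals Lebesgue measure in top dimension\<close>

lemma powr_DIM: "0 \<le> x \<Longrightarrow> x powr real DIM('a::euclidean_space) = x ^ DIM('a)"
  by (cases "x = 0") (auto simp: powr_realpow)

lemma isodiametric:
  fixes C :: "'a::euclidean_space set"
  assumes C: "bounded C"
  shows "emeasure lborel (closure C) \<le> ennreal (unit_ball_vol DIM('a) * (diameter C / 2) powr DIM('a))"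
proof -
  have c: "compact (closure C)" using C by (simp add: compact_closure)
  then have "emeasure lborel (closure C) = ennreal (measure lborel (closure C))"
    using emeasure_compact_finite[OF c] by (intro emeasure_eq_ennreal_measure) auto
  also have "\<dots> \<le> ennreal (unit_ball_vol DIM('a) * (diameter C / 2) powr DIM('a))"
    using isodiametric_compact[OF c] C by (simp add: powr_DIM diameter_ge_0 diameter_closure ennreal_leI)
  finally show ?thesis .
qed

text \<open>By the isodiametric inequality each covering set weighs at least the volume of its
  closure, so at scale 1 already no cover undercuts the volume.\<close>

lemma lborel_le_hausdorff:
  fixes A :: "'a::euclidean_space set"
  assumes A: "A \<in> sets borel"
  shows "emeasure lborel A \<le> hausdorff_measure DIM('a) A"
proof -
  have "emeasure lborel A \<le> hausdorff_delta DIM('a) 1 A"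
    unfolding hausdorff_delta_def
  proof (rule INF_greatest, clarsimp)
    fix C :: "nat \<Rightarrow> 'a set" assume C: "A \<subseteq> (\<Union>i. C i)" "\<forall>i. bounded (C i) \<and> diameter (C i) \<le> 1"
    have "emeasure lborel A \<le> emeasure lborel (\<Union>i. closure (C i))"
    proof (rule emeasure_mono)
      show "A \<subseteq> (\<Union>i. closure (C i))" using C(1) closure_subset by blast
    qed auto
    also have "\<dots> \<le> (\<Sum>i. emeasure lborel (closure (C i)))"
      by (intro emeasure_subadditive_countably) auto
    also have "\<dots> \<le> (\<Sum>i. ennreal (unit_ball_vol DIM('a) * (diameter (C i) / 2) powr DIM('a)))"
      using C by (intro suminf_le isodiametric) auto
    finally show "emeasure lborel A \<le> (\<Sum>i. ennreal (unit_ball_vol DIM('a) * (diameter (C i) / 2) powr DIM('a)))" .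
  qed
  also have "\<dots> \<le> hausdorff_measure DIM('a) A" by (rule hausdorff_delta_le_measure) simp
  finally show ?thesis .
qed

text \<open>A ball of radius s r weighs s^n times the volume of the ball of radius r, and the latter
  balls are disjoint inside V. Used with s = 5 for the covering lemma that enlarges the balls, and
  with s = 1 for the covering theorem that leaves a null set over.\<close>

lemma hausdorff_delta_le_countable_cballs:
  fixes c :: "'i \<Rightarrow> 'a::euclidean_space"
  assumes I: "countable I" and cov: "A \<subseteq> (\<Union>i\<in>I. cball (c i) (s * r i))" and s: "1 \<le> s"
    and r: "\<And>i. i \<in> I \<Longrightarrow> 0 < r i \<and> 2 * s * r i \<le> \<delta>"
    and disj: "\<And>i j. i \<in> I \<Longrightarrow> j \<in> I \<Longrightarrow> i \<noteq> j \<Longrightarrow> ball (c i) (r i) \<inter> ball (c j) (r j) = {}"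
    and sub: "\<And>i. i \<in> I \<Longrightarrow> ball (c i) (r i) \<subseteq> V" and V: "open V" and "0 < \<delta>"
  shows "hausdorff_delta DIM('a) \<delta> A \<le> ennreal (s ^ DIM('a)) * emeasure lborel V"
proof -
  let ?w = "\<lambda>S::'a set. ennreal (unit_ball_vol DIM('a) * (diameter S / 2) powr DIM('a))"
  obtain h and N :: "nat set" where h: "bij_betw h N I"
    using I by (meson bij_betw_inv_into countableE inj_on_imp_bij_betw)
  define D where "D n = (if n \<in> N then cball (c (h n)) (s * r (h n)) else {})" for n
  define E where "E n = (if n \<in> N then ball (c (h n)) (r (h n)) else {})" for n
  have hI: "n \<in> N \<Longrightarrow> h n \<in> I" for n using h by (auto simp: bij_betw_def)
  have diam: "diameter (cball x t) \<le> 2 * t" if "0 \<le> t" for x :: 'a and t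
    using that by (simp add: diameter_cball)
  have "hausdorff_delta DIM('a) \<delta> A \<le> (\<Sum>n. ?w (D n))"
  proof (rule hausdorff_delta_le)
    show "A \<subseteq> (\<Union>n. D n)"
    proof
      fix x assume "x \<in> A"
      then obtain i where "i \<in> I" "x \<in> cball (c i) (s * r i)" using cov by blast
      moreover obtain n where "n \<in> N" "h n = i" using h \<open>i \<in> I\<close> by (auto simp: bij_betw_def)
      ultimately have "x \<in> D n" by (simp add: D_def)
      then show "x \<in> (\<Union>n. D n)" by blast
    qed
    show "diameter (D n) \<le> \<delta>" for n
      using diam[of "s * r (h n)" "c (h n)"] r[OF hI, of n] s \<open>0 < \<delta>\<close> by (auto simp: D_def intro: order_trans)
  qed (auto simp: D_def)
  also have "\<dots> \<le> (\<Sum>n. ennreal (s ^ DIM('a)) * emeasure lborel (E n))"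
  proof (intro suminf_le)
    fix n
    show "?w (D n) \<le> ennreal (s ^ DIM('a)) * emeasure lborel (E n)"
    proof (cases "n \<in> N")
      case True
      then have rp: "0 < r (h n)" using r[OF hI] by auto
      have "(diameter (D n) / 2) powr DIM('a) \<le> (s * r (h n)) ^ DIM('a)"
        using diam[of "s * r (h n)" "c (h n)"] True rp s
        by (simp add: D_def powr_DIM diameter_ge_0 power_mono)
      then have "unit_ball_vol DIM('a) * (diameter (D n) / 2) powr DIM('a) \<le> s ^ DIM('a) * (unit_ball_vol DIM('a) * r (h n) ^ DIM('a))"
        by (simp add: power_mult_distrib mult.left_commute mult_left_mono)
      then show ?thesis using True rp s
        by (simp add: E_def emeasure_ball ennreal_mult[symmetric])
    qed (simp add: D_def)
  qed auto
  also have "\<dots> = ennreal (s ^ DIM('a)) * (\<Sum>n. emeasure lborel (E n))" by simp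
  also have "(\<Sum>n. emeasure lborel (E n)) = emeasure lborel (\<Union>n. E n)"
  proof (rule suminf_emeasure)
    have "E m \<inter> E n = {}" if "m \<noteq> n" for m n
    proof (cases "m \<in> N \<and> n \<in> N")
      case True
      then have "h m \<noteq> h n" using h that by (auto simp: bij_betw_def inj_on_def)
      then show ?thesis using True disj[OF hI hI] by (simp add: E_def)
    qed (auto simp: E_def)
    then show "disjoint_family E" by (simp add: disjoint_family_on_def)
  qed (auto simp: E_def)
  also have "\<dots> \<le> emeasure lborel V"
    using sub hI V by (intro emeasure_mono) (auto simp: E_def split: if_splits)
  finally show ?thesis by (simp add: mult_left_mono)
qed

text \<open>A null set lies in an open set of small volume, and the five-fold covering lemma of
  Vitali costs only the factor 5^n.\<close>

lemma hausdorff_delta_negligible: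
  fixes A :: "'a::euclidean_space set"
  assumes A: "negligible A" and \<delta>: "0 < \<delta>"
  shows "hausdorff_delta DIM('a) \<delta> A = 0"
proof -
  have "hausdorff_delta DIM('a) \<delta> A \<le> 0 + ennreal e" if e: "0 < e" for e
  proof -
    have A0: "A \<in> null_sets lebesgue" using A by (simp add: negligible_iff_null_sets)
    then have "A \<in> sets lebesgue" by auto
    then obtain V where V: "open V" "A \<subseteq> V" "emeasure lebesgue (V - A) < ennreal (e / 5 ^ DIM('a))"
      by (rule sets_lebesgue_outer_open[of A "e / 5 ^ DIM('a)"]) (use e in auto)
    have "emeasure lborel V = emeasure lebesgue V" using V(1) by simp
    also have "\<dots> = emeasure lebesgue (V - A)"
      using V(1) A0 by (intro emeasure_Diff_null_set[symmetric]) auto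
    finally have VL: "emeasure lborel V < ennreal (e / 5 ^ DIM('a))" using V(3) by simp
    \<comment> \<open>Radii up to \<delta> / 10 keep the diameter of the balls enlarged five times
      within \<delta>.\<close>
    define K where "K = {(x, r). x \<in> A \<and> 0 < r \<and> r \<le> \<delta> / 10 \<and> ball x r \<subseteq> V}"
    have cov: "A \<subseteq> (\<Union>i\<in>K. cball (fst i) (snd i))"
    proof
      fix x assume x: "x \<in> A"
      then obtain r where r: "0 < r" "ball x r \<subseteq> V" using V open_contains_ball by blast
      then have "(x, min r (\<delta>/10)) \<in> K" using x \<delta> by (auto simp: K_def)
      moreover have "x \<in> cball x (min r (\<delta>/10))" using r \<delta> by simp
      ultimately show "x \<in> (\<Union>i\<in>K. cball (fst i) (snd i))" by (metis UN_I fst_conv snd_conv)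
    qed
    have rad: "0 < snd i \<and> snd i \<le> \<delta> / 10" if "i \<in> K" for i using that by (auto simp: K_def)
    obtain C where C: "countable C" "C \<subseteq> K"
       "pairwise (\<lambda>i j. disjnt (cball (fst i) (snd i)) (cball (fst j) (snd j))) C"
       "A \<subseteq> (\<Union>i\<in>C. cball (fst i) (5 * snd i))"
      by (rule Vitali_covering_lemma_cballs[OF cov rad])
    have "hausdorff_delta DIM('a) \<delta> A \<le> ennreal (5 ^ DIM('a)) * emeasure lborel V"
    proof (rule hausdorff_delta_le_countable_cballs[OF C(1,4)])
      show "ball (fst i) (snd i) \<inter> ball (fst j) (snd j) = {}" if "i \<in> C" "j \<in> C" "i \<noteq> j" for i j
      proof -
        have "cball (fst i) (snd i) \<inter> cball (fst j) (snd j) = {}"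
          using C(3) that by (simp add: pairwise_def disjnt_def)
        then show ?thesis using ball_subset_cball by blast
      qed
      show "ball (fst i) (snd i) \<subseteq> V" if "i \<in> C" for i using subsetD[OF C(2) that] by (simp add: K_def case_prod_unfold)
    qed (use C(2) V(1) \<delta> in \<open>auto simp: K_def\<close>)
    also have "ennreal (5 ^ DIM('a)) * emeasure lborel V \<le> ennreal (5 ^ DIM('a)) * ennreal (e / 5 ^ DIM('a))"
      using VL by (intro mult_left_mono) auto
    also have "\<dots> = ennreal e" using e by (simp flip: ennreal_mult)
    finally show ?thesis by simp
  qed
  then have "hausdorff_delta DIM('a) \<delta> A \<le> 0" by (rule ennreal_le_epsilon)
  then show ?thesis by simp
qed

lemma hausdorff_delta_Un: "0 \<le> \<delta> \<Longrightarrow> hausdorff_delta d \<delta> (A \<union> B) \<le> hausdorff_delta d \<delta> A + hausdorff_delta d \<delta> B"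
proof -
  assume \<delta>: "0 \<le> \<delta>"
  let ?f = "\<lambda>i::nat. if i = 0 then A else if i = 1 then B else {}"
  have "A \<union> B = (\<Union>i. ?f i)" by (auto split: if_splits)
  then have "hausdorff_delta d \<delta> (A \<union> B) \<le> (\<Sum>i. hausdorff_delta d \<delta> (?f i))"
    using hausdorff_delta_UN[of d \<delta> ?f] by argo
  also have "\<dots> = (\<Sum>i<2. hausdorff_delta d \<delta> (?f i))"
    by (rule suminf_finite) (use \<delta> in auto)
  finally show ?thesis by (simp add: numeral_2_eq_2)
qed

text \<open>Vitali's theorem fills V up to a null set with disjoint small balls, and a ball weighs
  exactly its volume.\<close>

lemma hausdorff_delta_le_lborel_open:
  fixes V :: "'a::euclidean_space set"
  assumes V: "open V" and \<delta>: "0 < \<delta>"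
  shows "hausdorff_delta DIM('a) \<delta> V \<le> emeasure lborel V"
proof -
  define K where "K = {(x, r). x \<in> V \<and> 0 < r \<and> r \<le> \<delta> / 2 \<and> ball x r \<subseteq> V}"
  have cov: "\<exists>i. i \<in> K \<and> x \<in> ball (fst i) (snd i) \<and> snd i < d" if xd: "x \<in> V" "0 < d" for x d
  proof -
    obtain r where r: "0 < r" "ball x r \<subseteq> V" using V xd open_contains_ball by blast
    define t where "t = min r (min (\<delta>/2) (d/2))"
    have "(x, t) \<in> K" "x \<in> ball x t" "t < d" using r \<delta> xd by (auto simp: K_def t_def)
    then show ?thesis by (metis fst_conv snd_conv)
  qed
  obtain C where C: "countable C" "C \<subseteq> K"
     "pairwise (\<lambda>i j. disjnt (ball (fst i) (snd i)) (ball (fst j) (snd j))) C"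
     "negligible (V - (\<Union>i\<in>C. ball (fst i) (snd i)))"
    by (rule Vitali_covering_theorem_balls[OF cov])
  let ?U = "\<Union>i\<in>C. ball (fst i) (snd i)"
  have "hausdorff_delta DIM('a) \<delta> V \<le> hausdorff_delta DIM('a) \<delta> (?U \<union> (V - ?U))"
    by (rule hausdorff_delta_mono) auto
  also have "\<dots> \<le> hausdorff_delta DIM('a) \<delta> ?U + hausdorff_delta DIM('a) \<delta> (V - ?U)"
    using \<delta> by (intro hausdorff_delta_Un) auto
  also have "hausdorff_delta DIM('a) \<delta> (V - ?U) = 0" by (rule hausdorff_delta_negligible[OF C(4) \<delta>])
  also have "hausdorff_delta DIM('a) \<delta> ?U \<le> ennreal (1 ^ DIM('a)) * emeasure lborel V"
  proof (rule hausdorff_delta_le_countable_cballs[OF C(1)])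
    show "?U \<subseteq> (\<Union>i\<in>C. cball (fst i) (1 * snd i))" using ball_subset_cball by auto
    show "ball (fst i) (snd i) \<inter> ball (fst j) (snd j) = {}" if "i \<in> C" "j \<in> C" "i \<noteq> j" for i j
      using C(3) that by (simp add: pairwise_def disjnt_def)
    show "ball (fst i) (snd i) \<subseteq> V" if "i \<in> C" for i using subsetD[OF C(2) that] by (simp add: K_def case_prod_unfold)
  qed (use C(2) V \<delta> in \<open>auto simp: K_def\<close>)
  finally show ?thesis by simp
qed

theorem hausdorff_measure_eq_lborel:
  fixes A :: "'a::euclidean_space set"
  assumes A: "A \<in> sets borel"
  shows "hausdorff_measure DIM('a) A = emeasure lborel A"
proof (rule antisym[OF _ lborel_le_hausdorff[OF A]])
  show "hausdorff_measure DIM('a) A \<le> emeasure lborel A"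
  proof (rule ennreal_le_epsilon)
    fix e :: real assume e: "0 < e"
    have AL: "A \<in> sets lebesgue" using A by simp
    obtain V where V: "open V" "A \<subseteq> V" "emeasure lebesgue (V - A) < ennreal e"
      by (rule sets_lebesgue_outer_open[OF AL e])
    have "emeasure lborel V = emeasure lborel A + emeasure lborel (V - A)"
      using V A emeasure_Un[of A lborel "V - A"] by (subst plus_emeasure) (auto simp: Un_absorb1)
    also have "\<dots> \<le> emeasure lborel A + ennreal e" using V A by (intro add_left_mono) auto
    finally have VA: "emeasure lborel V \<le> emeasure lborel A + ennreal e" .
    show "hausdorff_measure DIM('a) A \<le> emeasure lborel A + ennreal e"
      unfolding hausdorff_measure_def
    proof (rule SUP_least)
      fix \<delta> :: real assume "\<delta> \<in> {0<..}"
      then have "hausdorff_delta DIM('a) \<delta> V \<le> emeasure lborel V" using V by (intro hausdorff_delta_le_lborel_open) auto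
      then show "hausdorff_delta DIM('a) \<delta> A \<le> emeasure lborel A + ennreal e"
        using hausdorff_delta_mono[OF V(2)] VA by (meson order_trans)
    qed
  qed
qed

section \<open>Isometries, continuously differentiable functions and partitions of unity\<close>

text \<open>An index type with one element fewer, since the dimension of \<open>real^'n\<close> is a type.\<close>

typedef 'a minus_one = "{x::'a. x \<noteq> undefined \<or> (\<forall>y::'a. y = undefined)}"
  by blast

instance minus_one :: (finite) finite
proof
  have "finite (Rep_minus_one ` (UNIV :: 'a minus_one set))" by simp
  then show "finite (UNIV :: 'a minus_one set)"
    by (rule finite_imageD) (auto intro!: inj_onI simp: Rep_minus_one_inject)
qed

lemma CARD_minus_one:
  assumes "CARD('a::finite) \<ge> 2"
  shows "CARD('a minus_one) = CARD('a) - 1"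
proof -
  have "\<not> (\<forall>y::'a. y = undefined)"
  proof
    assume "\<forall>y::'a. y = undefined"
    then have "(UNIV :: 'a set) = {undefined}" by auto
    then have "CARD('a) = 1" by (metis card_1_singleton_iff One_nat_def)
    with assms show False by simp
  qed
  then have "{x::'a. x \<noteq> undefined \<or> (\<forall>y::'a. y = undefined)} = UNIV - {undefined}" by auto
  then show ?thesis
    using type_definition.card[OF type_definition_minus_one, where 'a='a] by (simp add: card_Diff_singleton)
qed

text \<open>J and its inverse are 1-Lipschitz, so they preserve Hausdorff measure, which is Lebesgue
  measure on both sides. Domain and range may be different spaces, as needed for graph coordinates
  on \<open>real^'n\<close>.\<close>

lemma lborel_distr_isometry:
  fixes J :: "'a::euclidean_space \<Rightarrow> 'b::euclidean_space"
  assumes dim: "DIM('a) = DIM('b)" and surj: "surj J" and dist: "\<And>x y. dist (J x) (J y) = dist x y"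
  shows "distr lborel borel J = lborel"
proof (rule measure_eqI)
  fix A assume "A \<in> sets (distr lborel borel J)"
  then have A: "A \<in> sets borel" by simp
  have inj: "inj J" using dist by (metis dist_eq_0_iff injI)
  have cont: "continuous_on UNIV J"
    unfolding continuous_on_iff using dist by auto
  then have m: "J \<in> borel_measurable borel" by (rule borel_measurable_continuous_onI)
  have "J -` A \<in> sets borel" using measurable_sets[OF m A] by simp
  note H = hausdorff_measure_eq_lborel[OF A] hausdorff_measure_eq_lborel[OF this]
  have im: "J ` (J -` A) = A" using surj by (simp add: surj_image_vimage_eq)
  have im': "inv J ` A = J -` A" using inj surj by (metis bij_def bij_vimage_eq_inv_image)
  have "hausdorff_measure DIM('a) (J ` (J -` A)) \<le> ennreal (1 powr DIM('a)) * hausdorff_measure DIM('a) (J -` A)"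
    by (rule hausdorff_measure_Lipschitz_image) (auto simp: dist)
  moreover have "dist (inv J x) (inv J y) = dist x y" for x y
    using surj dist by (metis surj_f_inv_f)
  then have "hausdorff_measure DIM('a) (inv J ` A) \<le> ennreal (1 powr DIM('a)) * hausdorff_measure DIM('a) A"
    by (intro hausdorff_measure_Lipschitz_image) auto
  ultimately have "emeasure lborel (J -` A) = emeasure lborel A"
    using H unfolding im im' dim by (simp add: antisym)
  then show "emeasure (distr lborel borel J) A = emeasure lborel A"
    using A m by (simp add: emeasure_distr)
qed simp

text \<open>Provides coordinates with last axis d: an arbitrary isometry sends (0,1) to some unit
  vector, and an orthogonal transformation moves that vector to d.\<close>

lemma isometry_with_axis:
  fixes d :: "real^'n"
  assumes "CARD('n) \<ge> 2" and d: "norm d = 1"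
  obtains J :: "(real^('n minus_one)) \<times> real \<Rightarrow> real^'n"
    where "linear J" "surj J" "\<And>z. norm (J z) = norm z" "J (0,1) = d"
proof -
  have "DIM((real^('n minus_one)) \<times> real) = DIM(real^'n)"
    using assms(1) by (simp add: CARD_minus_one)
  then have dims: "dim (UNIV :: ((real^('n minus_one)) \<times> real) set) = dim (UNIV :: (real^'n) set)"
    by (simp only: dim_UNIV)
  obtain f :: "(real^('n minus_one)) \<times> real \<Rightarrow> real^'n" and g where fg: "linear f" "f ` UNIV = UNIV" "\<And>x. norm (f x) = norm x"
    using isometries_subspaces[OF subspace_UNIV subspace_UNIV dims] by (metis UNIV_I)
  have "norm (f (0,1)) = norm d" using fg(3)[of "(0,1)"] d by simp
  then obtain h where h: "orthogonal_transformation h" "h (f (0,1)) = d"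
    using orthogonal_transformation_exists by blast
  show ?thesis
  proof (rule that[of "h \<circ> f"])
    show "linear (h \<circ> f)" using fg(1) h(1) by (simp add: linear_compose orthogonal_transformation_linear)
    show "surj (h \<circ> f)" using fg(2) orthogonal_transformation_surj[OF h(1)] by (rule comp_surj)
    show "norm ((h \<circ> f) z) = norm z" for z using fg(3) h(1) by (simp add: orthogonal_transformation_norm)
    show "(h \<circ> f) (0,1) = d" using h(2) by simp
  qed
qed

lemma isometry_inner:
  fixes J :: "'a::real_inner \<Rightarrow> 'b::real_inner"
  assumes "linear J" "\<And>z. norm (J z) = norm z"
  shows "J x \<bullet> J y = x \<bullet> y"
proof -
  have "(norm (J (x + y)))\<^sup>2 = (norm (x + y))\<^sup>2" using assms(2) by simp
  then have "(norm (J x))\<^sup>2 + 2 * (J x \<bullet> J y) + (norm (J y))\<^sup>2 = (norm x)\<^sup>2 + 2 * (x \<bullet> y) + (norm y)\<^sup>2"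
    by (simp add: linear_add[OF assms(1)] power2_norm_eq_inner inner_add_left inner_add_right inner_commute)
  then show ?thesis by (simp add: assms(2))
qed

text \<open>The gradient is an explicit argument, so that statements about gradients become
  pointwise equations; outside S the values of F are free.\<close>

definition C1on :: "'a::euclidean_space set \<Rightarrow> ('a \<Rightarrow> real) \<Rightarrow> ('a \<Rightarrow> 'a) \<Rightarrow> bool" where
  "C1on S f F \<longleftrightarrow> (\<forall>x\<in>S. (f has_derivative (\<lambda>h. F x \<bullet> h)) (at x)) \<and> continuous_on S F"

lemma C1onD: "C1on S f F \<Longrightarrow> x \<in> S \<Longrightarrow> (f has_derivative (\<lambda>h. F x \<bullet> h)) (at x)"
  and C1on_continuous_grad: "C1on S f F \<Longrightarrow> continuous_on S F"
  by (auto simp: C1on_def)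

lemma C1on_continuous: "C1on S f F \<Longrightarrow> continuous_on S f"
  by (meson C1onD continuous_at_imp_continuous_on has_derivative_continuous)

lemma C1on_subset: "C1on S f F \<Longrightarrow> T \<subseteq> S \<Longrightarrow> C1on T f F"
  unfolding C1on_def using continuous_on_subset by blast

lemma C1on_const: "C1on S (\<lambda>_. c) (\<lambda>_. 0)"
  by (auto simp: C1on_def)

lemma C1on_inner_left: "C1on S (\<lambda>x. a \<bullet> x) (\<lambda>_. a)"
  by (auto simp: C1on_def intro!: derivative_eq_intros)

lemma C1on_add: "C1on S f F \<Longrightarrow> C1on S g G \<Longrightarrow> C1on S (\<lambda>x. f x + g x) (\<lambda>x. F x + G x)"
  by (auto simp: C1on_def inner_add_left intro!: has_derivative_add continuous_intros)

lemma C1on_diff: "C1on S f F \<Longrightarrow> C1on S g G \<Longrightarrow> C1on S (\<lambda>x. f x - g x) (\<lambda>x. F x - G x)"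
  by (auto simp: C1on_def inner_diff_left intro!: has_derivative_diff continuous_intros)

lemma C1on_mult:
  assumes f: "C1on S f F" and g: "C1on S g G"
  shows "C1on S (\<lambda>x. f x * g x) (\<lambda>x. f x *\<^sub>R G x + g x *\<^sub>R F x)"
  unfolding C1on_def
proof (intro conjI ballI)
  fix x assume "x \<in> S"
  then show "((\<lambda>x. f x * g x) has_derivative (\<lambda>h. (f x *\<^sub>R G x + g x *\<^sub>R F x) \<bullet> h)) (at x)"
    using has_derivative_mult[OF C1onD[OF f] C1onD[OF g]] by (simp add: inner_add_left mult.commute)
qed (intro continuous_intros C1on_continuous[OF f] C1on_continuous[OF g] C1on_continuous_grad[OF f] C1on_continuous_grad[OF g])

lemma C1on_cmult: "C1on S f F \<Longrightarrow> C1on S (\<lambda>x. c * f x) (\<lambda>x. c *\<^sub>R F x)"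
  using C1on_mult[OF C1on_const] by fastforce

lemma C1on_sum:
  assumes "finite I" "\<And>i. i \<in> I \<Longrightarrow> C1on S (f i) (F i)"
  shows "C1on S (\<lambda>x. \<Sum>i\<in>I. f i x) (\<lambda>x. \<Sum>i\<in>I. F i x)"
  using assms
proof (induction I rule: finite_induct)
  case (insert i I)
  then show ?case using C1on_add[of S "f i" "F i"] by simp
qed (simp add: C1on_const)

lemma C1on_compose:
  assumes f: "C1on S f F" and \<phi>: "\<And>x. x \<in> S \<Longrightarrow> DERIV \<phi> (f x) :> \<phi>' (f x)" and c: "continuous_on S (\<lambda>x. \<phi>' (f x))"
  shows "C1on S (\<lambda>x. \<phi> (f x)) (\<lambda>x. \<phi>' (f x) *\<^sub>R F x)"
  unfolding C1on_def
proof (intro conjI ballI)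
  fix x assume x: "x \<in> S"
  have "(\<phi> has_derivative (\<lambda>h. \<phi>' (f x) * h)) (at (f x))"
    using \<phi>[OF x] by (simp add: has_field_derivative_def)
  from has_derivative_compose[OF C1onD[OF f x] this]
  show "((\<lambda>x. \<phi> (f x)) has_derivative (\<lambda>h. (\<phi>' (f x) *\<^sub>R F x) \<bullet> h)) (at x)" by simp
qed (intro continuous_intros c C1on_continuous_grad[OF f])

lemma C1on_translate:
  assumes f: "C1on S f F" shows "C1on ((\<lambda>x. x - v) -` S) (\<lambda>x. f (x - v)) (\<lambda>x. F (x - v))"
  unfolding C1on_def
proof (intro conjI ballI)
  fix x assume x: "x \<in> (\<lambda>x. x - v) -` S"
  have "((\<lambda>x. x - v) has_derivative (\<lambda>h. h)) (at x)" by (auto intro!: derivative_eq_intros)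
  from has_derivative_compose[OF this C1onD[OF f]] x
  show "((\<lambda>x. f (x - v)) has_derivative (\<bullet>) (F (x - v))) (at x)" by simp
next
  show "continuous_on ((\<lambda>x. x - v) -` S) (\<lambda>x. F (x - v))"
    by (rule continuous_on_compose2[OF C1on_continuous_grad[OF f]]) (auto intro!: continuous_intros)
qed

lemma C1on_transform:
  assumes "C1on S f F" "open S" "\<And>x. x \<in> S \<Longrightarrow> f x = g x" "\<And>x. x \<in> S \<Longrightarrow> F x = G x"
  shows "C1on S g G"
  unfolding C1on_def
proof (intro conjI ballI)
  fix x assume x: "x \<in> S"
  show "(g has_derivative (\<bullet>) (G x)) (at x)"
    using has_derivative_transform_within_open[OF C1onD[OF assms(1) x] assms(2) x assms(3)] assms(4)[OF x] by simp
next
  show "continuous_on S G"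
    using C1on_continuous_grad[OF assms(1)] assms(4) continuous_on_cong by metis
qed

lemma C1on_Un: "open S \<Longrightarrow> open T \<Longrightarrow> C1on S f F \<Longrightarrow> C1on T f F \<Longrightarrow> C1on (S \<union> T) f F"
  by (auto simp: C1on_def intro: continuous_on_open_Un)

lemma C1on_grad_unique:
  assumes "C1on S f F" "C1on T g G" "open U" "x \<in> U" "U \<subseteq> S" "U \<subseteq> T" "\<And>y. y \<in> U \<Longrightarrow> f y = g y"
  shows "F x = G x"
proof -
  have "(f has_derivative (\<lambda>h. F x \<bullet> h)) (at x)" using assms by (auto dest: C1onD)
  moreover have "(f has_derivative (\<lambda>h. G x \<bullet> h)) (at x)"
    by (rule has_derivative_transform_within_open[OF C1onD[OF assms(2)] assms(3,4)]) (use assms in auto)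
  ultimately have "(\<lambda>h. F x \<bullet> h) = (\<lambda>h. G x \<bullet> h)" by (rule has_derivative_unique)
  then show ?thesis by (metis vector_eq_rdot inner_commute)
qed

lemma C1on_grad_zero:
  assumes "C1on UNIV f F" "closed K" "\<And>x. x \<notin> K \<Longrightarrow> f x = 0" "x \<notin> K"
  shows "F x = 0"
  using C1on_grad_unique[OF assms(1) C1on_const[of UNIV 0], of "- K" x] assms by auto

text \<open>U and the complement of K are open and cover the space; on the overlap \<theta> and its
  gradient vanish, so the two descriptions agree.\<close>

lemma C1on_extend_zero:
  assumes f: "C1on U f F" "open U" and \<theta>: "C1on UNIV \<theta> T" "closed K" "K \<subseteq> U" "\<And>x. x \<notin> K \<Longrightarrow> \<theta> x = 0"
  shows "C1on UNIV (\<lambda>x. if x \<in> U then \<theta> x * f x else 0) (\<lambda>x. if x \<in> U then \<theta> x *\<^sub>R F x + f x *\<^sub>R T x else 0)"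
proof -
  let ?g = "\<lambda>x. if x \<in> U then \<theta> x * f x else 0" and ?G = "\<lambda>x. if x \<in> U then \<theta> x *\<^sub>R F x + f x *\<^sub>R T x else 0"
  have "C1on U (\<lambda>x. \<theta> x * f x) (\<lambda>x. \<theta> x *\<^sub>R F x + f x *\<^sub>R T x)"
    by (rule C1on_mult[OF C1on_subset[OF \<theta>(1)] f(1)]) simp
  then have 1: "C1on U ?g ?G" by (rule C1on_transform) (use f in auto)
  have "C1on (-K) (\<lambda>_. 0) (\<lambda>_. 0)" by (rule C1on_const)
  then have 2: "C1on (-K) ?g ?G"
    by (rule C1on_transform) (use \<theta> C1on_grad_zero[OF \<theta>(1,2,4)] in auto)
  have "U \<union> -K = UNIV" using \<theta>(3) by auto
  then show ?thesis using C1on_Un[OF f(2) _ 1 2] \<theta>(2) by (auto simp: open_closed)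
qed

text \<open>Squaring makes the positive part continuously differentiable. Bumps and the modified
  divisor in the partition of unity are built from this profile.\<close>

lemma DERIV_pos_part_square: "DERIV (\<lambda>t::real. (max 0 t)\<^sup>2) t :> 2 * max 0 t"
proof -
  consider "t < 0" | "t = 0" | "0 < t" by linarith
  then show ?thesis
  proof cases
    case 1
    have "DERIV (\<lambda>t::real. 0) t :> 0" by simp
    then have "DERIV (\<lambda>t::real. (max 0 t)\<^sup>2) t :> 0"
      by (rule DERIV_cong_ev[THEN iffD1, rotated -1])
         (use 1 in \<open>auto intro!: eventually_mono[OF eventually_nhds_in_open[of "{..<0}"]]\<close>)
    then show ?thesis using 1 by simp
  next
    case 2
    have "((\<lambda>h::real. (max 0 h)\<^sup>2 / h) \<longlongrightarrow> 0) (at 0)"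
    proof (rule Lim_null_comparison)
      show "\<forall>\<^sub>F h in at 0. norm ((max 0 h)\<^sup>2 / h) \<le> \<bar>h\<bar>"
        by (intro always_eventually allI) (auto simp: max_def power2_eq_square)
      show "((\<lambda>h::real. \<bar>h\<bar>) \<longlongrightarrow> 0) (at 0)" by (auto intro!: tendsto_eq_intros)
    qed
    then show ?thesis using 2 by (simp add: DERIV_def)
  next
    case 3
    have "DERIV (\<lambda>t::real. t\<^sup>2) t :> 2 * t" by (auto intro!: derivative_eq_intros)
    then have "DERIV (\<lambda>t::real. (max 0 t)\<^sup>2) t :> 2 * t"
      by (rule DERIV_cong_ev[THEN iffD1, rotated -1])
         (use 3 in \<open>auto intro!: eventually_mono[OF eventually_nhds_in_open[of "{0<..}"]]\<close>)
    then show ?thesis using 3 by simp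
  qed
qed

lemma C1_bump:
  fixes p :: "'a::euclidean_space"
  assumes r: "0 < r"
  obtains \<beta> B where "C1on UNIV \<beta> B" "\<And>x. 0 \<le> \<beta> x" "\<And>x. 0 < \<beta> x \<longleftrightarrow> dist x p < r"
proof -
  let ?q = "\<lambda>x. r\<^sup>2 - (x - p) \<bullet> (x - p)"
  have "C1on UNIV ?q (\<lambda>x. (-2) *\<^sub>R (x - p))"
    by (auto simp: C1on_def inner_commute intro!: derivative_eq_intros continuous_intros)
  then have c: "C1on UNIV (\<lambda>x. (max 0 (?q x))\<^sup>2) (\<lambda>x. (2 * max 0 (?q x)) *\<^sub>R ((-2) *\<^sub>R (x - p)))"
    by (rule C1on_compose[where \<phi> = "\<lambda>t. (max 0 t)\<^sup>2" and \<phi>' = "\<lambda>t. 2 * max 0 t"])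
      (intro DERIV_pos_part_square continuous_intros)+
  have "0 < (max 0 (?q x))\<^sup>2 \<longleftrightarrow> dist x p < r" for x
  proof -
    have "?q x = r\<^sup>2 - (dist x p)\<^sup>2" by (simp add: dist_norm power2_norm_eq_inner)
    moreover have "(dist x p)\<^sup>2 < r\<^sup>2 \<longleftrightarrow> dist x p < r"
      using power_strict_mono[of "dist x p" r 2] power_mono[of r "dist x p" 2] r
      by (cases "dist x p < r") (simp_all add: not_less)
    ultimately have "0 < ?q x \<longleftrightarrow> dist x p < r" by simp
    moreover have "0 < (max 0 t)\<^sup>2 \<longleftrightarrow> 0 < t" for t :: real by (auto simp: max_def)
    ultimately show ?thesis by simp
  qed
  then show ?thesis using c by (intro that[OF c]) simp_all
qed

lemma C1_partition_of_unity:
  fixes K :: "'a::euclidean_space set"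
  assumes K: "compact K" and rad: "\<And>p. p \<in> K \<Longrightarrow> 0 < rad p"
  obtains P \<eta> X V where "finite P" "P \<subseteq> K" "\<And>p. p \<in> P \<Longrightarrow> C1on UNIV (\<eta> p) (X p)"
    "\<And>p x. p \<in> P \<Longrightarrow> 0 \<le> \<eta> p x" "\<And>p x. p \<in> P \<Longrightarrow> rad p \<le> dist x p \<Longrightarrow> \<eta> p x = 0"
    "open V" "K \<subseteq> V" "\<And>x. x \<in> V \<Longrightarrow> (\<Sum>p\<in>P. \<eta> p x) = 1"
proof -
  have "\<exists>\<beta> B. C1on UNIV \<beta> B \<and> (\<forall>x. 0 \<le> \<beta> x) \<and> (\<forall>x. 0 < \<beta> x \<longleftrightarrow> dist x p < rad p)" if p: "p \<in> K" for p
    by (rule C1_bump[OF rad[OF p], of p]) blast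
  then obtain \<beta> B where b: "\<And>p. p \<in> K \<Longrightarrow> C1on UNIV (\<beta> p) (B p)" "\<And>p x. p \<in> K \<Longrightarrow> 0 \<le> \<beta> p x"
    "\<And>p x. p \<in> K \<Longrightarrow> 0 < \<beta> p x \<longleftrightarrow> dist x p < rad p" by metis
  have cov: "K \<subseteq> (\<Union>p\<in>K. ball p (rad p))" using rad by force
  obtain P where P: "P \<subseteq> K" "finite P" "K \<subseteq> (\<Union>p\<in>P. ball p (rad p))"
    by (rule compactE_image[OF K _ cov]) auto
  define S where "S x = (\<Sum>p\<in>P. \<beta> p x)" for x
  define S' where "S' x = (\<Sum>p\<in>P. B p x)" for x
  have CS: "C1on UNIV S S'" unfolding S_def S'_def using P b(1) by (intro C1on_sum) auto
  have S0: "0 \<le> S x" for x unfolding S_def using P b(2) by (intro sum_nonneg) auto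
  have Spos: "0 < S x" if xK: "x \<in> K" for x
  proof -
    obtain p where p: "p \<in> P" "x \<in> ball p (rad p)" using P(3) xK by blast
    then have p: "p \<in> P" "dist x p < rad p" by (auto simp: dist_commute)
    then have "0 < \<beta> p x" using b(3) P(1) by auto
    then show ?thesis unfolding S_def using P b(2) p by (intro sum_pos2[of _ p]) auto
  qed
  have "\<exists>s>0. \<forall>x\<in>K. s < S x"
  proof (cases "K = {}")
    case False
    then obtain x where x: "x \<in> K" "\<And>y. y \<in> K \<Longrightarrow> S x \<le> S y"
      using continuous_attains_inf[OF K, of S] continuous_on_subset[OF C1on_continuous[OF CS]] by blast
    have "0 < S x / 2 \<and> (\<forall>y\<in>K. S x / 2 < S y)" using x Spos by (force intro: less_le_trans[of _ "S x"])
    then show ?thesis by blast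
  qed (auto intro: exI[of _ 1])
  then obtain s where s: "0 < s" "\<And>x. x \<in> K \<Longrightarrow> s < S x" by blast
  \<comment> \<open>\<psi> is positive on the nonnegative reals and is the identity beyond s. Hence
    1/\<psi>(S) is C^1 everywhere, also where all bumps vanish, and it equals 1/S near K.\<close>
  define \<psi> where "\<psi> t = t + (max 0 (s - t))\<^sup>2" for t
  define \<psi>' where "\<psi>' t = 1 - 2 * max 0 (s - t)" for t
  have d\<psi>: "DERIV \<psi> t :> \<psi>' t" for t
  proof -
    have "DERIV (\<lambda>t. (max 0 (s - t))\<^sup>2) t :> (2 * max 0 (s - t)) * (-1)"
      by (rule DERIV_chain2[OF DERIV_pos_part_square]) (auto intro!: derivative_eq_intros)
    from DERIV_add[OF DERIV_ident this] show ?thesis unfolding \<psi>_def \<psi>'_def by simp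
  qed
  have \<psi>pos: "0 < \<psi> t" if "0 \<le> t" for t
    using that s(1) by (cases "t < s") (auto simp: \<psi>_def add_nonneg_pos)
  have cS: "continuous_on UNIV S" by (rule C1on_continuous[OF CS])
  have CR: "C1on UNIV (\<lambda>x. inverse (\<psi> (S x))) (\<lambda>x. (- (inverse (\<psi> (S x)) * \<psi>' (S x) * inverse (\<psi> (S x)))) *\<^sub>R S' x)"
  proof (rule C1on_compose[OF CS, where \<phi> = "\<lambda>t. inverse (\<psi> t)" and \<phi>' = "\<lambda>t. - (inverse (\<psi> t) * \<psi>' t * inverse (\<psi> t))"])
    fix x :: 'a
    have ne: "\<psi> (S x) \<noteq> 0" using \<psi>pos[OF S0] by (metis less_irrefl)
    show "DERIV (\<lambda>t. inverse (\<psi> t)) (S x) :> - (inverse (\<psi> (S x)) * \<psi>' (S x) * inverse (\<psi> (S x)))"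
      by (rule DERIV_inverse'[OF d\<psi> ne])
  next
    have ne: "\<psi> (S x) \<noteq> 0" for x using \<psi>pos[OF S0] by (metis less_irrefl)
    have "continuous_on UNIV (\<lambda>x. \<psi> (S x))" "continuous_on UNIV (\<lambda>x. \<psi>' (S x))"
      unfolding \<psi>_def \<psi>'_def by (intro continuous_intros cS)+
    then show "continuous_on UNIV (\<lambda>x. - (inverse (\<psi> (S x)) * \<psi>' (S x) * inverse (\<psi> (S x))))"
      using ne by (intro continuous_intros) auto
  qed
  define R where "R x = inverse (\<psi> (S x))" for x
  define R' where "R' x = (- (inverse (\<psi> (S x)) * \<psi>' (S x) * inverse (\<psi> (S x)))) *\<^sub>R S' x" for x
  show ?thesis
  proof (rule that[of P "\<lambda>p x. \<beta> p x * R x" "\<lambda>p x. \<beta> p x *\<^sub>R R' x + R x *\<^sub>R B p x" "{x. s < S x}"])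
    show "finite P" "P \<subseteq> K" by fact+
    show "C1on UNIV (\<lambda>x. \<beta> p x * R x) (\<lambda>x. \<beta> p x *\<^sub>R R' x + R x *\<^sub>R B p x)" if "p \<in> P" for p
      using C1on_mult[OF b(1) CR] that P by (auto simp: R_def R'_def)
    show "0 \<le> \<beta> p x * R x" if "p \<in> P" for p x
      using b(2) that P \<psi>pos[OF S0, of x] by (auto simp: R_def less_imp_le)
    show "\<beta> p x * R x = 0" if "p \<in> P" "rad p \<le> dist x p" for p x
    proof -
      have "p \<in> K" using that P by blast
      then have "\<not> 0 < \<beta> p x" "0 \<le> \<beta> p x" using b(2)[of p x] b(3)[of p x] that by auto
      then show ?thesis by simp
    qed
    show "open {x. s < S x}" by (intro open_Collect_less continuous_intros cS)
    show "K \<subseteq> {x. s < S x}" using s by auto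
    fix x assume "x \<in> {x. s < S x}"
    then have "\<psi> (S x) = S x" "S x \<noteq> 0" using s(1) by (auto simp: \<psi>_def)
    then have "S x * R x = 1" by (simp add: R_def)
    then show "(\<Sum>p\<in>P. \<beta> p x * R x) = 1" by (simp add: S_def sum_distrib_right)
  qed
qed

text \<open>The sum of a partition of unity whose supports lie in U is a cutoff.\<close>

lemma C1_cutoff:
  fixes K :: "'a::euclidean_space set"
  assumes K: "compact K" and U: "open U" "K \<subseteq> U"
  obtains \<theta> T L V where "C1on UNIV \<theta> T" "compact L" "L \<subseteq> U" "\<And>x. x \<notin> L \<Longrightarrow> \<theta> x = 0"
    "open V" "K \<subseteq> V" "\<And>x. x \<in> V \<Longrightarrow> \<theta> x = 1"
proof -
  have "\<forall>p\<in>K. \<exists>r>0. cball p r \<subseteq> U" using U open_contains_cball by blast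
  then obtain rad where rad: "\<And>p. p \<in> K \<Longrightarrow> 0 < rad p" "\<And>p. p \<in> K \<Longrightarrow> cball p (rad p) \<subseteq> U" by metis
  obtain P \<eta> X V where P: "finite P" "P \<subseteq> K" "\<And>p. p \<in> P \<Longrightarrow> C1on UNIV (\<eta> p) (X p)"
    "\<And>p x. p \<in> P \<Longrightarrow> 0 \<le> \<eta> p x" "\<And>p x. p \<in> P \<Longrightarrow> rad p \<le> dist x p \<Longrightarrow> \<eta> p x = 0"
    "open V" "K \<subseteq> V" "\<And>x. x \<in> V \<Longrightarrow> (\<Sum>p\<in>P. \<eta> p x) = 1"
    by (rule C1_partition_of_unity[OF K rad(1)]) auto
  show ?thesis
  proof (rule that[of "\<lambda>x. \<Sum>p\<in>P. \<eta> p x" "\<lambda>x. \<Sum>p\<in>P. X p x" "\<Union>p\<in>P. cball p (rad p)" V])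
    show "C1on UNIV (\<lambda>x. \<Sum>p\<in>P. \<eta> p x) (\<lambda>x. \<Sum>p\<in>P. X p x)" by (intro C1on_sum P)
    show "compact (\<Union>p\<in>P. cball p (rad p))" using P(1) by (intro compact_UN) auto
    show "(\<Union>p\<in>P. cball p (rad p)) \<subseteq> U" using rad P(2) by blast
    show "(\<Sum>p\<in>P. \<eta> p x) = 0" if "x \<notin> (\<Union>p\<in>P. cball p (rad p))" for x
      using that P(5) by (intro sum.neutral) (auto simp: dist_commute not_le less_imp_le)
  qed (use P in auto)
qed

lemma nn_integral_mono_measure:
  assumes s: "sets M = sets N" and le: "\<And>A. A \<in> sets M \<Longrightarrow> emeasure M A \<le> emeasure N A"
  shows "(\<integral>\<^sup>+x. f x \<partial>M) \<le> (\<integral>\<^sup>+x. f x \<partial>N)"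
  unfolding nn_integral_def
proof (rule SUP_mono, clarsimp)
  fix g :: "'a \<Rightarrow> ennreal" assume g: "simple_function M g" "g \<le> f"
  have "simple_function N g"
    using g(1) by (simp add: simple_function_def s sets_eq_imp_space_eq[OF s])
  moreover have "integral\<^sup>S M g \<le> integral\<^sup>S N g"
    unfolding simple_integral_def sets_eq_imp_space_eq[OF s]
    using g(1) le s by (intro sum_mono mult_left_mono le) (auto simp: simple_function_def sets_eq_imp_space_eq[OF s])
  ultimately show "\<exists>h. simple_function N h \<and> h \<le> f \<and> integral\<^sup>S M g \<le> integral\<^sup>S N h" using g by blast
qed

section \<open>Graphs: divergence theorem and surface measure\<close>

lemma C1on_grad_integrable:
  fixes F :: "'a::euclidean_space \<Rightarrow> 'a"
  assumes "continuous_on UNIV F" "compact K" "\<And>x. x \<notin> K \<Longrightarrow> F x = 0"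
  shows "integrable lborel (\<lambda>x. F x \<bullet> d)"
proof -
  have "integrable lborel (\<lambda>x. indicator K x *\<^sub>R (F x \<bullet> d))"
    by (intro borel_integrable_compact assms continuous_intros continuous_on_subset[OF assms(1)]) auto
  also have "(\<lambda>x. indicator K x *\<^sub>R (F x \<bullet> d)) = (\<lambda>x. F x \<bullet> d)"
  proof
    show "indicator K x *\<^sub>R (F x \<bullet> d) = F x \<bullet> d" for x
      by (cases "x \<in> K") (simp_all add: assms(3))
  qed
  finally show ?thesis .
qed

text \<open>In coordinates with last axis \<open>J (0,1)\<close> the set is the region below the
  graph of g. Fubini and the fundamental theorem of calculus on vertical lines give the values of f
  on the graph, since f vanishes at the lower ends. The right-hand side carries no area density;
  \<open>graph_surface_estimate\<close> accounts for it.\<close>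

lemma graph_divergence:
  fixes J :: "'m::euclidean_space \<times> real \<Rightarrow> 'a::euclidean_space"
  assumes J: "linear J" "surj J" "\<And>z. norm (J z) = norm z" and dim: "DIM('m \<times> real) = DIM('a)"
    and \<Omega>: "open \<Omega>" and B: "bounded B"
    and g: "\<And>y. y \<in> B \<Longrightarrow> a < g y \<and> g y < b"
    and graph: "\<And>y t. y \<in> B \<Longrightarrow> a < t \<Longrightarrow> t < b \<Longrightarrow> J (y, t) \<in> \<Omega> \<longleftrightarrow> t < g y"
    and f: "C1on UNIV f F" and K: "closed K" "K \<subseteq> J ` (B \<times> {a<..<b})" "\<And>x. x \<notin> K \<Longrightarrow> f x = 0"
  shows "(LINT x|lborel. indicator \<Omega> x * (F x \<bullet> J (0,1))) = (LINT y|lborel. indicator B y * f (J (y, g y)))"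
proof -
  define d where "d = J (0,1)"
  have F0: "F x = 0" if "x \<notin> K" for x
    by (rule C1on_grad_zero[OF f K(1) _ that]) (rule K(3))
  have distJ: "dist (J x) (J y) = dist x y" for x y
    using J by (simp add: dist_norm flip: linear_diff)
  then have injJ: "inj J" by (metis dist_eq_0_iff injI)
  have "bounded (B \<times> {a<..<b})" using B by (intro bounded_Times) auto
  then have "bounded (J ` (B \<times> {a<..<b}))"
    by (rule bounded_linear_image) (use J(1) linear_conv_bounded_linear in blast)
  then have cK: "compact K" using K bounded_subset by (auto simp: compact_eq_bounded_closed)
  have contF: "continuous_on UNIV F" using f by (rule C1on_continuous_grad)
  have mJ: "J \<in> borel_measurable borel"
    using J(1) by (intro borel_measurable_continuous_onI linear_continuous_on) (simp add: linear_conv_bounded_linear)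
  define h where "h x = indicat_real \<Omega> x * (F x \<bullet> d)" for x
  have hint: "integrable lborel h"
    unfolding h_def
    using integrable_mult_indicator[of \<Omega> lborel, OF _ C1on_grad_integrable[OF contF cK F0, of d]] \<Omega> by simp
  note dJ = lborel_distr_isometry[OF dim J(2) distJ]
  have mh: "h \<in> borel_measurable borel" using borel_measurable_integrable[OF hint] by simp
  have e1: "(LINT x|lborel. h x) = (LINT z|lborel. h (J z))"
    unfolding dJ[symmetric] using mh mJ by (subst integral_distr) auto
  have hJint: "integrable lborel (\<lambda>z. h (J z))"
    using hint mh mJ unfolding dJ[symmetric] by (subst (asm) integrable_distr_eq) auto
  have "(LINT z|lborel. h (J z)) = (LINT y|lborel. LINT t|lborel. h (J (y, t)))"
    using lborel_pair.integral_fst'[of "\<lambda>z. h (J z)"] hJint by (simp add: lborel_prod)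
  also have "(\<lambda>y. LINT t|lborel. h (J (y, t))) = (\<lambda>y. indicator B y * f (J (y, g y)))"
  proof
    fix y
    show "(LINT t|lborel. h (J (y, t))) = indicator B y * f (J (y, g y))"
    proof (cases "y \<in> B")
      case False
      then have "J (y, t) \<notin> K" for t using K(2) injJ by (auto simp: inj_image_mem_iff dest!: subsetD[OF K(2)] injD)
      then show ?thesis using False F0 by (simp add: h_def)
    next
      case True
      have out: "J (y, t) \<notin> K" if "t \<le> a \<or> b \<le> t" for t
        using that injJ by (auto dest!: subsetD[OF K(2)] injD)
      have J1: "J (y, t) = J (y, 0) + t *\<^sub>R d" for t
        using linear_add[OF J(1), of "(y,0)" "t *\<^sub>R (0,1)"] linear_scale[OF J(1), of t "(0,1)"] by (simp add: d_def)
      have J1f: "(\<lambda>t. J (y, t)) = (\<lambda>t. J (y, 0) + t *\<^sub>R d)" by (rule ext) (rule J1)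
      have der: "DERIV (\<lambda>t. f (J (y, t))) t :> F (J (y, t)) \<bullet> d" for t
      proof -
        have "((\<lambda>t. J (y, t)) has_derivative (\<lambda>s. s *\<^sub>R d)) (at t)"
          by (subst J1f) (auto intro!: derivative_eq_intros)
        from has_derivative_compose[OF this C1onD[OF f UNIV_I]]
        show ?thesis by (simp add: has_field_derivative_def mult_commute_abs)
      qed
      have cJ: "continuous_on UNIV (\<lambda>t. J (y, t))" by (subst J1f) (intro continuous_intros)
      have cont: "isCont (\<lambda>t. F (J (y, t)) \<bullet> d) t" for t
        using continuous_on_compose2[OF contF cJ] by (auto intro!: continuous_intros simp: continuous_on_eq_continuous_at)
      have "(LINT t|lborel. h (J (y, t))) = (LINT t|lborel. (F (J (y, t)) \<bullet> d) * indicator {a .. g y} t)"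
      proof (rule integral_cong_AE)
        show "(\<lambda>t. h (J (y, t))) \<in> borel_measurable lborel"
          using measurable_compose[OF borel_measurable_continuous_onI[OF cJ] mh] by simp
        show "(\<lambda>t. (F (J (y, t)) \<bullet> d) * indicator {a .. g y} t) \<in> borel_measurable lborel"
          using cont by (intro borel_measurable_times borel_measurable_indicator) (auto intro!: borel_measurable_continuous_onI simp: continuous_on_eq_continuous_at)
        \<comment> \<open>The closed interval of the fundamental theorem contains t = g y, a
          boundary point outside \<Omega>; a single point is null.\<close>
        have "AE t in lborel. t \<noteq> g y" by (rule AE_lborel_singleton)
        then show "AE t in lborel. h (J (y, t)) = (F (J (y, t)) \<bullet> d) * indicator {a .. g y} t"
        proof eventually_elim
          fix t assume "t \<noteq> g y"
          show "h (J (y, t)) = (F (J (y, t)) \<bullet> d) * indicator {a .. g y} t"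
          proof (cases "a < t \<and> t < b")
            case True
            then show ?thesis using graph[OF \<open>y \<in> B\<close>, of t] \<open>t \<noteq> g y\<close> by (auto simp: h_def indicator_def)
          next
            case False
            then have "t \<le> a \<or> b \<le> t" by auto
            from F0[OF out[OF this]] show ?thesis by (simp add: h_def)
          qed
        qed
      qed
      also have "\<dots> = f (J (y, g y)) - f (J (y, a))"
        using g[OF True] by (intro integral_FTC_Icc_real[of a "g y" "\<lambda>t. f (J (y, t))"]) (auto intro: der cont)
      also have "f (J (y, a)) = 0" using K(3) out by simp
      finally show ?thesis using True by simp
    qed
  qed
  finally show ?thesis using e1 by (simp add: h_def d_def)
qed

text \<open>The inverse of G is 1-Lipschitz and G is L-Lipschitz, so Lebesgue measure transported by
  G and Hausdorff measure on the graph differ by a factor between 1 and L^m. The comparison of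
  measures passes to integrals by \<open>nn_integral_mono_measure\<close>.\<close>

lemma graph_surface_compare:
  fixes G :: "real^'m \<Rightarrow> real^'n"
  assumes card: "CARD('n) = CARD('m) + 1" and B: "open B" and \<Gamma>: "closed \<Gamma>" and W: "open W"
    and G: "G ` B = \<Gamma> \<inter> W" and L: "0 < L"
    and lo: "\<And>y y'. y \<in> B \<Longrightarrow> y' \<in> B \<Longrightarrow> dist y y' \<le> dist (G y) (G y')"
    and hi: "\<And>y y'. y \<in> B \<Longrightarrow> y' \<in> B \<Longrightarrow> dist (G y) (G y') \<le> L * dist y y'"
    and h: "h \<in> borel_measurable (restrict_space borel \<Gamma>)" "\<And>x. x \<in> \<Gamma> - W \<Longrightarrow> h x = 0"
  shows "(\<integral>\<^sup>+y. h (G y) * indicator B y \<partial>lborel) \<le> (\<integral>\<^sup>+x. h x \<partial>surface_measure \<Gamma>)"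
    "(\<integral>\<^sup>+x. h x \<partial>surface_measure \<Gamma>) \<le> ennreal (L ^ CARD('m)) * (\<integral>\<^sup>+y. h (G y) * indicator B y \<partial>lborel)"
proof -
  let ?S = "surface_measure \<Gamma>" and ?R = "restrict_space borel \<Gamma>"
  have contG: "continuous_on B G"
    unfolding continuous_on_iff
  proof (intro ballI allI impI)
    fix x e assume "x \<in> B" "(0::real) < e"
    then show "\<exists>d>0. \<forall>x'\<in>B. dist x' x < d \<longrightarrow> dist (G x') (G x) < e"
      using hi L by (intro exI[of _ "e / L"]) (auto simp: field_simps intro: le_less_trans[OF hi])
  qed
  have sub: "G ` B \<subseteq> \<Gamma>" using G by auto
  have mG: "G \<in> measurable (restrict_space lborel B) ?R"
    using borel_measurable_continuous_on_restrict[OF contG] sub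
    by (intro measurable_restrict_space2) (auto simp: space_restrict_space cong: measurable_cong_sets sets_restrict_space_cong)
  define M1 where "M1 = distr (restrict_space lborel B) ?R G"
  define M2 where "M2 = density ?S (indicator (\<Gamma> \<inter> W))"
  have GW: "\<Gamma> \<inter> W \<in> sets ?R" using W by (auto simp: sets_restrict_space)
  have injG: "inj_on G B" using lo by (fastforce intro: inj_onI)
  have e1: "emeasure M1 A = hausdorff_measure (real CARD('m)) (G -` A \<inter> B)" if "A \<in> sets ?R" for A
  proof -
    have s: "G -` A \<inter> B \<in> sets (restrict_space lborel B)"
      using measurable_sets[OF mG that] by (simp add: space_restrict_space)
    then have s': "G -` A \<inter> B \<in> sets borel" using B by (simp add: sets_restrict_space_iff)
    have "emeasure M1 A = emeasure lborel (G -` A \<inter> B)"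
      unfolding M1_def using that B s mG by (simp add: emeasure_distr space_restrict_space emeasure_restrict_space)
    then show ?thesis using hausdorff_measure_eq_lborel[OF s'] by simp
  qed
  have e2: "emeasure M2 A = hausdorff_measure (real CARD('m)) (A \<inter> W)" if "A \<in> sets ?R" for A
  proof -
    have A: "A \<subseteq> \<Gamma>" using sets.sets_into_space[OF that] by (simp add: space_restrict_space)
    have "emeasure M2 A = emeasure ?S ((\<Gamma> \<inter> W) \<inter> A)"
      unfolding M2_def using that GW by (simp add: emeasure_density flip: indicator_inter_arith) 
    also have "\<dots> = hausdorff_measure (real CARD('m)) ((\<Gamma> \<inter> W) \<inter> A)"
      using that GW card by (simp add: emeasure_surface_measure sets.Int)
    also have "(\<Gamma> \<inter> W) \<inter> A = A \<inter> W" using A by auto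
    finally show ?thesis .
  qed
  have im: "G ` (G -` A \<inter> B) = A \<inter> W" if "A \<subseteq> \<Gamma>" for A
  proof -
    have "G ` (G -` A \<inter> B) = A \<inter> G ` B" by auto
    then show ?thesis using G that by auto
  qed
  have sM1: "sets M1 = sets ?R" and sM2: "sets M2 = sets ?R" by (auto simp: M1_def M2_def)
  have le1: "emeasure M1 A \<le> emeasure M2 A" if "A \<in> sets M1" for A
  proof -
    have A: "A \<in> sets ?R" "A \<subseteq> \<Gamma>" using that sM1 sets.sets_into_space[of A ?R] by (auto simp: space_restrict_space)
    have "hausdorff_measure (real CARD('m)) (inv_into B G ` (A \<inter> W)) \<le> ennreal (1 powr real CARD('m)) * hausdorff_measure (real CARD('m)) (A \<inter> W)"
    proof (rule hausdorff_measure_Lipschitz_image)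
      fix x y assume "x \<in> A \<inter> W" "y \<in> A \<inter> W"
      then have "x \<in> G ` B" "y \<in> G ` B" using G A by auto
      then show "dist (inv_into B G x) (inv_into B G y) \<le> 1 * dist x y"
        using lo[of "inv_into B G x" "inv_into B G y"] by (simp add: inv_into_into f_inv_into_f)
    qed auto
    also have "inv_into B G ` (A \<inter> W) = G -` A \<inter> B"
      unfolding im[OF A(2), symmetric] using injG by (subst inv_into_image_cancel) auto
    finally show ?thesis using e1[OF A(1)] e2[OF A(1)] by simp
  qed
  have le2: "emeasure M2 A \<le> emeasure (scale_measure (ennreal (L ^ CARD('m))) M1) A" if "A \<in> sets M2" for A
  proof -
    have A: "A \<in> sets ?R" "A \<subseteq> \<Gamma>" using that sM2 sets.sets_into_space[of A ?R] by (auto simp: space_restrict_space)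
    have "hausdorff_measure (real CARD('m)) (G ` (G -` A \<inter> B)) \<le> ennreal (L powr real CARD('m)) * hausdorff_measure (real CARD('m)) (G -` A \<inter> B)"
      using L hi by (intro hausdorff_measure_Lipschitz_image) auto
    then show ?thesis unfolding im[OF A(2)] using e1[OF A(1)] e2[OF A(1)] L by (simp add: powr_realpow)
  qed
  have h1: "(\<integral>\<^sup>+x. h x \<partial>M1) = (\<integral>\<^sup>+y. h (G y) * indicator B y \<partial>lborel)"
    unfolding M1_def using mG h B by (simp add: nn_integral_distr nn_integral_restrict_space)
  have h2: "(\<integral>\<^sup>+x. h x \<partial>M2) = (\<integral>\<^sup>+x. h x \<partial>?S)"
  proof -
    have "(\<integral>\<^sup>+x. h x \<partial>M2) = (\<integral>\<^sup>+x. indicator (\<Gamma> \<inter> W) x * h x \<partial>?S)"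
      unfolding M2_def using h GW by (intro nn_integral_density) (auto cong: measurable_cong_sets)
    also have "\<dots> = (\<integral>\<^sup>+x. h x \<partial>?S)"
      using h(2) by (intro nn_integral_cong) (auto simp: indicator_def)
    finally show ?thesis .
  qed
  show "(\<integral>\<^sup>+y. h (G y) * indicator B y \<partial>lborel) \<le> (\<integral>\<^sup>+x. h x \<partial>?S)"
    using nn_integral_mono_measure[of M1 M2 h] le1 sM1 sM2 h1 h2 by simp
  have "(\<integral>\<^sup>+x. h x \<partial>M2) \<le> (\<integral>\<^sup>+x. h x \<partial>scale_measure (ennreal (L ^ CARD('m))) M1)"
    using le2 sM1 sM2 by (intro nn_integral_mono_measure) auto
  also have "\<dots> = ennreal (L ^ CARD('m)) * (\<integral>\<^sup>+x. h x \<partial>M1)"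
    using h(1) by (intro nn_integral_scale_measure) (simp add: M1_def)
  finally show "(\<integral>\<^sup>+x. h x \<partial>?S) \<le> ennreal (L ^ CARD('m)) * (\<integral>\<^sup>+y. h (G y) * indicator B y \<partial>lborel)"
    by (simp add: h1 h2)
qed

text \<open>The comparison holds for nonnegative functions, so it is applied to the positive and the
  negative part of f; the two errors add up to a multiple of the integral of |f|.\<close>

lemma graph_surface_estimate:
  fixes G :: "real^'m \<Rightarrow> real^'n"
  assumes card: "CARD('n) = CARD('m) + 1" and B: "open B" and \<Gamma>: "closed \<Gamma>" and W: "open W"
    and G: "G ` B = \<Gamma> \<inter> W" and L: "0 < L"
    and lo: "\<And>y y'. y \<in> B \<Longrightarrow> y' \<in> B \<Longrightarrow> dist y y' \<le> dist (G y) (G y')"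
    and hi: "\<And>y y'. y \<in> B \<Longrightarrow> y' \<in> B \<Longrightarrow> dist (G y) (G y') \<le> L * dist y y'"
    and f: "integrable (surface_measure \<Gamma>) f" "\<And>x. x \<in> \<Gamma> - W \<Longrightarrow> f x = 0"
  shows "\<bar>(LINT y|lborel. indicator B y * f (G y)) - (LINT x|surface_measure \<Gamma>. f x)\<bar>
     \<le> (L ^ CARD('m) - 1) * (LINT x|surface_measure \<Gamma>. \<bar>f x\<bar>)"
proof -
  let ?S = "surface_measure \<Gamma>"
  have contG: "continuous_on B G"
    unfolding continuous_on_iff
  proof (intro ballI allI impI)
    fix x e assume "x \<in> B" "(0::real) < e"
    then show "\<exists>d>0. \<forall>x'\<in>B. dist x' x < d \<longrightarrow> dist (G x') (G x) < e"
      using hi L by (intro exI[of _ "e / L"]) (auto simp: field_simps intro: le_less_trans[OF hi])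
  qed
  have sub: "G ` B \<subseteq> \<Gamma>" using G by auto
  have mG: "G \<in> measurable (restrict_space lborel B) (restrict_space borel \<Gamma>)"
    using borel_measurable_continuous_on_restrict[OF contG] sub
    by (intro measurable_restrict_space2) (auto simp: space_restrict_space cong: measurable_cong_sets sets_restrict_space_cong)
  have main: "integrable lborel (\<lambda>y. indicator B y * u (G y)) \<and> (LINT y|lborel. indicator B y * u (G y)) \<le> (LINT x|?S. u x)
     \<and> (LINT x|?S. u x) \<le> L ^ CARD('m) * (LINT y|lborel. indicator B y * u (G y))"
    if u: "integrable ?S u" "\<And>x. 0 \<le> u x" "\<And>x. x \<in> \<Gamma> - W \<Longrightarrow> u x = 0" for u :: "real^'n \<Rightarrow> real"
  proof -
    have mu: "u \<in> borel_measurable (restrict_space borel \<Gamma>)"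
      using borel_measurable_integrable[OF u(1)] by (simp cong: measurable_cong_sets)
    have "(\<lambda>x. ennreal (u x)) \<in> borel_measurable (restrict_space borel \<Gamma>)" using mu by simp
    note cmp = graph_surface_compare[OF card B \<Gamma> W G L lo hi this]
    have e: "ennreal (u (G y)) * indicator B y = ennreal (indicator B y * u (G y))" for y
      by (simp add: indicator_def)
    have nS: "(\<integral>\<^sup>+x. u x \<partial>?S) = ennreal (LINT x|?S. u x)"
      using u by (intro nn_integral_eq_integral) auto
    have "(\<lambda>y. u (G y)) \<in> borel_measurable (restrict_space lborel B)"
      using measurable_compose[OF mG mu] by simp
    then have m: "(\<lambda>y. indicator B y * u (G y)) \<in> borel_measurable lborel"
      using B by (subst (asm) borel_measurable_restrict_space_iff) auto
    have lt: "(\<integral>\<^sup>+y. ennreal (indicator B y * u (G y)) \<partial>lborel) \<le> ennreal (LINT x|?S. u x)"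
      using cmp(1) u(3) unfolding e nS by simp
    then have i: "integrable lborel (\<lambda>y. indicator B y * u (G y))"
      using m u(2) by (intro integrableI_nonneg) (auto simp: le_less_trans)
    have nB: "(\<integral>\<^sup>+y. ennreal (indicator B y * u (G y)) \<partial>lborel) = ennreal (LINT y|lborel. indicator B y * u (G y))"
      using i u(2) by (intro nn_integral_eq_integral) auto
    have I0: "0 \<le> (LINT y|lborel. indicator B y * u (G y))" "0 \<le> (LINT x|?S. u x)" using u(2) by (auto intro!: integral_nonneg_AE)
    have "ennreal (LINT x|?S. u x) \<le> ennreal (L ^ CARD('m)) * ennreal (LINT y|lborel. indicator B y * u (G y))"
      using cmp(2) u(3) unfolding e nS nB by simp
    then have "(LINT x|?S. u x) \<le> L ^ CARD('m) * (LINT y|lborel. indicator B y * u (G y))"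
      using L I0 by (simp add: ennreal_mult[symmetric])
    then show ?thesis using i lt I0 unfolding nB by simp
  qed
  define p where "p x = max 0 (f x)" for x
  define q where "q x = max 0 (- f x)" for x
  have fpq: "f x = p x - q x" "\<bar>f x\<bar> = p x + q x" for x by (auto simp: p_def q_def)
  have ip: "integrable ?S p" and iq: "integrable ?S q"
    using f(1) integrable_max[OF integrable_zero[of ?S] f(1)] integrable_max[OF integrable_zero[of ?S] integrable_minus[OF f(1)]]
    unfolding p_def q_def by simp_all
  have P: "integrable lborel (\<lambda>y. indicator B y * p (G y)) \<and> (LINT y|lborel. indicator B y * p (G y)) \<le> (LINT x|?S. p x)
     \<and> (LINT x|?S. p x) \<le> L ^ CARD('m) * (LINT y|lborel. indicator B y * p (G y))"
    by (rule main[OF ip]) (auto simp: p_def f(2))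
  have Q: "integrable lborel (\<lambda>y. indicator B y * q (G y)) \<and> (LINT y|lborel. indicator B y * q (G y)) \<le> (LINT x|?S. q x)
     \<and> (LINT x|?S. q x) \<le> L ^ CARD('m) * (LINT y|lborel. indicator B y * q (G y))"
    by (rule main[OF iq]) (auto simp: q_def f(2))
  define P1 P2 Q1 Q2 where "P1 = (LINT y|lborel. indicator B y * p (G y))" "P2 = (LINT x|?S. p x)"
    "Q1 = (LINT y|lborel. indicator B y * q (G y))" "Q2 = (LINT x|?S. q x)"
  note defs = this
  have e1: "(LINT y|lborel. indicator B y * f (G y)) = P1 - Q1"
    unfolding defs fpq(1) using P Q by (simp add: right_diff_distrib)
  have e2: "(LINT x|?S. f x) = P2 - Q2" unfolding defs fpq(1) using ip iq by simp
  have e3: "(LINT x|?S. \<bar>f x\<bar>) = P2 + Q2" unfolding defs fpq(2) using ip iq by simp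
  have nn: "0 \<le> P1" "0 \<le> Q1" unfolding defs by (auto intro!: integral_nonneg_AE simp: p_def q_def)
  \<comment> \<open>For t1 > 0 the assumptions force l >= 1; for t1 = 0 the factor l may be smaller,
    but then t2 = 0.\<close>
  have *: "0 \<le> t2 - t1 \<and> t2 - t1 \<le> (l - 1) * t2" if "t1 \<le> t2" "t2 \<le> l * t1" "0 \<le> t1" for t1 t2 l :: real
  proof (cases "t1 = 0")
    case False
    have "1 * t1 \<le> l * t1" using that by linarith
    then have "1 \<le> l" using False that by (simp add: mult_le_cancel_right)
    then have "(l - 1) * t1 \<le> (l - 1) * t2" using that by (intro mult_left_mono) auto
    then show ?thesis using that by (simp add: algebra_simps)
  qed (use that in auto)
  have "0 \<le> P2 - P1 \<and> P2 - P1 \<le> (L ^ CARD('m) - 1) * P2" "0 \<le> Q2 - Q1 \<and> Q2 - Q1 \<le> (L ^ CARD('m) - 1) * Q2"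
    using *[of P1 P2 "L ^ CARD('m)"] *[of Q1 Q2 "L ^ CARD('m)"] P Q nn unfolding defs[symmetric] by blast+
  then show ?thesis unfolding e1 e2 e3 by (simp add: distrib_left abs_le_iff)
qed

section \<open>Domains with a continuous outer normal\<close>

text \<open>The condition \<open>cone\<close> says that \<open>- n p\<close> points strictly into the domain, uniformly near \<open>p\<close>:
  locally, the domain lies below the graph of a function with arbitrarily small Lipschitz constant over the
  tangent plane. It is all that the divergence theorem uses of the boundary.\<close>

locale C1_domain =
  fixes \<Omega> :: "(real^'n) set" and n :: "real^'n \<Rightarrow> real^'n"
  assumes CARD2: "CARD('n) \<ge> 2" and open_\<Omega>: "open \<Omega>" and bounded_\<Omega>: "bounded \<Omega>"
    and cont_n: "continuous_on (frontier \<Omega>) n" and norm_n: "\<And>x. x \<in> frontier \<Omega> \<Longrightarrow> norm (n x) = 1"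
    and cone: "\<And>p \<eta>. p \<in> frontier \<Omega> \<Longrightarrow> 0 < \<eta> \<Longrightarrow>
      \<exists>\<rho>>0. \<forall>x\<in>ball p \<rho>. \<forall>y\<in>ball p \<rho>. x \<in> closure \<Omega> \<longrightarrow> n p \<bullet> (y - x) < - \<eta> * norm (y - x) \<longrightarrow> y \<in> \<Omega>"
begin

abbreviation \<Gamma> where "\<Gamma> \<equiv> frontier \<Omega>"
abbreviation S where "S \<equiv> surface_measure (frontier \<Omega>)"

lemma frontier_iff: "x \<in> \<Gamma> \<longleftrightarrow> x \<in> closure \<Omega> \<and> x \<notin> \<Omega>"
  using open_\<Omega> by (simp add: frontier_def interior_open)

lemma compact_\<Gamma>: "compact \<Gamma>" and compact_closure_\<Omega>: "compact (closure \<Omega>)"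
  using bounded_\<Omega> by (auto simp: compact_frontier_bounded)

text \<open>Tilting the axis by \<eta>/2 changes the slope by at most \<eta>/2, so the cone of slope
  \<eta> about d lies in the cone of slope \<eta>/2 about \<open>n p\<close>.\<close>

lemma cone_dir:
  assumes p: "p \<in> \<Gamma>" and \<eta>: "0 < \<eta>" and d: "norm (d - n p) \<le> \<eta> / 2"
  obtains \<rho> where "0 < \<rho>" "\<And>x y. x \<in> ball p \<rho> \<Longrightarrow> y \<in> ball p \<rho> \<Longrightarrow> x \<in> closure \<Omega> \<Longrightarrow> d \<bullet> (y - x) < - \<eta> * norm (y - x) \<Longrightarrow> y \<in> \<Omega>"
proof -
  obtain \<rho> where \<rho>: "0 < \<rho>" "\<forall>x\<in>ball p \<rho>. \<forall>y\<in>ball p \<rho>. x \<in> closure \<Omega> \<longrightarrow> n p \<bullet> (y - x) < - (\<eta>/2) * norm (y - x) \<longrightarrow> y \<in> \<Omega>"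
    using cone[OF p, of "\<eta>/2"] \<eta> by auto
  show ?thesis
  proof (rule that[OF \<rho>(1)])
    fix x y assume xy: "x \<in> ball p \<rho>" "y \<in> ball p \<rho>" "x \<in> closure \<Omega>" "d \<bullet> (y - x) < - \<eta> * norm (y - x)"
    have "\<bar>(d - n p) \<bullet> (y - x)\<bar> \<le> norm (d - n p) * norm (y - x)" by (rule Cauchy_Schwarz_ineq2)
    also have "\<dots> \<le> \<eta> / 2 * norm (y - x)" using d by (intro mult_right_mono) auto
    finally have "- (\<eta> / 2 * norm (y - x)) \<le> d \<bullet> (y - x) - n p \<bullet> (y - x)"
      unfolding inner_diff_left[of d "n p", symmetric] by linarith
    moreover have "\<eta> / 2 * norm (y - x) = \<eta> * norm (y - x) - \<eta> / 2 * norm (y - x)" by simp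
    ultimately have "n p \<bullet> (y - x) < - (\<eta>/2) * norm (y - x)" using xy(4) by linarith
    then show "y \<in> \<Omega>" using \<rho>(2) xy by blast
  qed
qed

text \<open>In a small cylinder about p with axis d, the cone condition based at p puts the bottom
  into \<Omega> and keeps the top off its closure. The height g is the last parameter at which a
  vertical line meets the closure. If two boundary points had a height difference larger than \<eta>
  times their distance, the cone condition would put one of them into \<Omega>.\<close>

lemma local_graph:
  assumes p: "p \<in> \<Gamma>" and d: "norm d = 1" "norm (d - n p) \<le> \<eta> / 2" and \<eta>: "0 < \<eta>" "\<eta> \<le> 1/2"
  obtains J :: "(real^('n minus_one)) \<times> real \<Rightarrow> real^'n" and B a g b
  where "linear J" "surj J" "\<And>z. norm (J z) = norm z" "J (0,1) = d" "open B" "bounded B"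
    "\<And>y. y \<in> B \<Longrightarrow> a < g y \<and> g y < b"
    "\<And>y t. y \<in> B \<Longrightarrow> a < t \<Longrightarrow> t < b \<Longrightarrow> J (y, t) \<in> \<Omega> \<longleftrightarrow> t < g y"
    "open (J ` (B \<times> {a<..<b}))" "p \<in> J ` (B \<times> {a<..<b})"
    "(\<lambda>y. J (y, g y)) ` B = \<Gamma> \<inter> J ` (B \<times> {a<..<b})"
    "\<And>y y'. y \<in> B \<Longrightarrow> y' \<in> B \<Longrightarrow> dist y y' \<le> dist (J (y, g y)) (J (y', g y'))"
    "\<And>y y'. y \<in> B \<Longrightarrow> y' \<in> B \<Longrightarrow> dist (J (y, g y)) (J (y', g y')) \<le> 1 / sqrt (1 - \<eta>\<^sup>2) * dist y y'"
proof -
  obtain J :: "(real^('n minus_one)) \<times> real \<Rightarrow> real^'n"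
    where J: "linear J" "surj J" "\<And>z. norm (J z) = norm z" "J (0,1) = d"
    using isometry_with_axis[OF CARD2 d(1)] by blast
  obtain \<rho> where \<rho>: "0 < \<rho>" "\<And>x y. x \<in> ball p \<rho> \<Longrightarrow> y \<in> ball p \<rho> \<Longrightarrow> x \<in> closure \<Omega> \<Longrightarrow> d \<bullet> (y - x) < - \<eta> * norm (y - x) \<Longrightarrow> y \<in> \<Omega>"
    using cone_dir[OF p \<eta>(1) d(2)] by blast
  obtain y0 t0 where p0: "p = J (y0, t0)" using J(2) by (metis surjE surj_pair)
  define h where "h = \<rho> / 4"
  define B where "B = ball y0 h"
  define a b where "a = t0 - h" "b = t0 + h"
  note ab = this
  have h0: "0 < h" using \<rho> by (simp add: h_def)
  have Jdiff: "J (y, t) - J (y', t') = J (y - y', t - t')" for y t y' t'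
    using linear_diff[OF J(1), of "(y,t)" "(y',t')"] by simp
  have nJ: "norm (J (y, t)) = sqrt ((norm y)\<^sup>2 + t\<^sup>2)" for y t using J(3) by (simp add: norm_Pair)
  have dJ: "d \<bullet> J (y, t) = t" for y t
    using isometry_inner[OF J(1,3), of "(0,1)" "(y,t)"] J(4) by simp
  have nJle: "norm (J (y, t)) \<le> norm y + \<bar>t\<bar>" for y t
    unfolding nJ using sqrt_sum_squares_le_sum_abs[of "norm y" t] by simp
  have inb: "J (y, t) \<in> ball p \<rho>" if "y \<in> B" "a \<le> t" "t \<le> b" for y t
  proof -
    have "norm (J (y, t) - p) \<le> norm (y - y0) + \<bar>t - t0\<bar>" unfolding p0 Jdiff by (rule nJle)
    also have "\<dots> < h + 2 * h" using that h0 by (intro add_less_le_mono) (auto simp: B_def ab dist_norm norm_minus_commute)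
    also have "\<dots> \<le> \<rho>" using \<rho> by (simp add: h_def)
    finally show ?thesis by (simp add: dist_norm norm_minus_commute)
  qed
  have pb: "p \<in> ball p \<rho>" using \<rho> by simp
  have pc: "p \<in> closure \<Omega>" "p \<notin> \<Omega>" using p by (auto simp: frontier_iff)
  \<comment> \<open>A displacement from p to the bottom or top has height h and length below 2 h, so
    slopes \<eta> <= 1/2 are admissible.\<close>
  have lowh: "- h < - \<eta> * norm (J (y - y0, s))" if "y \<in> B" "\<bar>s\<bar> = h" for y s
  proof -
    have "norm (J (y - y0, s)) \<le> norm (y - y0) + h" using nJle[of "y - y0" s] that by simp
    also have "\<dots> < 2 * h" using that by (auto simp: B_def dist_norm norm_minus_commute)
    finally have "\<eta> * norm (J (y - y0, s)) < \<eta> * (2 * h)" using \<eta> by (intro mult_strict_left_mono)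
    also have "\<dots> \<le> 1/2 * (2 * h)" using \<eta> h0 by (intro mult_right_mono) auto
    finally show ?thesis by simp
  qed
  have c1: "J (y, a) \<in> \<Omega>" if "y \<in> B" for y
  proof (rule \<rho>(2)[OF pb inb pc(1)])
    show "d \<bullet> (J (y, a) - p) < - \<eta> * norm (J (y, a) - p)"
      unfolding p0 Jdiff dJ using lowh[OF that, of "a - t0"] h0 by (simp add: ab)
  qed (use that h0 in \<open>auto simp: ab\<close>)
  have c2: "J (y, b) \<notin> closure \<Omega>" if "y \<in> B" for y
  proof
    assume cl: "J (y, b) \<in> closure \<Omega>"
    have "p \<in> \<Omega>"
    proof (rule \<rho>(2)[OF inb pb cl])
      have "J (y0 - y, - h) = - J (y - y0, h)" using linear_neg[OF J(1), of "(y - y0, h)"] by simp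
      moreover have "p - J (y, b) = J (y0 - y, - h)" unfolding p0 Jdiff by (simp add: ab)
      ultimately have e: "p - J (y, b) = - J (y - y0, h)" by simp
      show "d \<bullet> (p - J (y, b)) < - \<eta> * norm (p - J (y, b))"
        unfolding e using lowh[OF that, of h] h0 by (simp add: dJ)
    qed (use that h0 in \<open>auto simp: ab\<close>)
    then show False using pc by simp
  qed
  have c3: "J (y, t') \<in> \<Omega>" if "y \<in> B" "J (y, t) \<in> closure \<Omega>" "a \<le> t'" "t' < t" "t \<le> b" for y t t'
  proof (rule \<rho>(2)[OF inb inb that(2)])
    have "norm (J (0, t' - t)) = t - t'" using that by (simp add: nJ)
    moreover have "\<eta> * (t - t') < 1 * (t - t')" using that \<eta> by (intro mult_strict_right_mono) auto
    ultimately show "d \<bullet> (J (y, t') - J (y, t)) < - \<eta> * norm (J (y, t') - J (y, t))"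
      unfolding Jdiff dJ by simp
  qed (use that in auto)
  have contJ: "continuous_on UNIV (\<lambda>t. J (y, t))" for y
    by (rule continuous_on_compose2[OF linear_continuous_on[of J]]) (use J(1) in \<open>auto simp: linear_conv_bounded_linear intro!: continuous_intros\<close>)
  have slide: "\<exists>e>0. \<forall>t'. \<bar>t' - t\<bar> < e \<longrightarrow> J (y, t') \<in> \<Omega>" if "J (y, t) \<in> \<Omega>" for y t
  proof -
    have "open ((\<lambda>t. J (y, t)) -` \<Omega>)" using contJ open_\<Omega> by (simp add: continuous_on_open_vimage)
    then show ?thesis using that unfolding open_dist dist_real_def by auto
  qed
  define T where "T y = {t\<in>{a..b}. J (y, t) \<in> closure \<Omega>}" for y
  define g where "g y = Sup (T y)" for y
  have closedT: "closed (T y)" for y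
  proof -
    have "closed ((\<lambda>t. J (y, t)) -` closure \<Omega>)" using contJ by (simp add: continuous_on_closed_vimage)
    moreover have "T y = {a..b} \<inter> (\<lambda>t. J (y, t)) -` closure \<Omega>" by (auto simp: T_def)
    ultimately show ?thesis by (simp add: closed_Int)
  qed
  have bdd: "bdd_above (T y)" for y by (auto simp: T_def bdd_above_def)
  have gT: "g y \<in> T y" if "y \<in> B" for y
  proof -
    have "a \<in> T y" using c1[OF that] h0 closure_subset by (auto simp: T_def ab)
    then show ?thesis unfolding g_def using closed_contains_Sup[OF _ bdd closedT] by blast
  qed
  have gup: "t \<le> g y" if "t \<in> T y" for t y unfolding g_def by (rule cSup_upper[OF that bdd])
  have gcl: "J (y, g y) \<in> closure \<Omega>" "a \<le> g y" "g y \<le> b" if "y \<in> B" for y using gT[OF that] by (auto simp: T_def)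
  have gb: "g y < b" if "y \<in> B" for y using gcl[OF that] c2[OF that] by (metis less_eq_real_def)
  have gnot: "J (y, g y) \<notin> \<Omega>" if y: "y \<in> B" for y
  proof
    assume "J (y, g y) \<in> \<Omega>"
    then obtain e where e: "0 < e" "\<And>t'. \<bar>t' - g y\<bar> < e \<Longrightarrow> J (y, t') \<in> \<Omega>" using slide by blast
    define t where "t = min b (g y + e / 2)"
    have t: "a \<le> t" "t \<le> b" "\<bar>t - g y\<bar> < e" using e(1) gb[OF y] gcl[OF y] by (auto simp: t_def min_def)
    then have "t \<in> T y" using subsetD[OF closure_subset e(2)[OF t(3)]] by (simp add: T_def)
    from gup[OF this] show False using e gb[OF y] by (auto simp: t_def min_def split: if_splits)
  qed
  have ga: "a < g y" if "y \<in> B" for y using gcl[OF that] gnot[OF that] c1[OF that] by (metis less_eq_real_def)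
  have graph: "J (y, t) \<in> \<Omega> \<longleftrightarrow> t < g y" if "y \<in> B" "a < t" "t < b" for y t
  proof
    assume "t < g y" then show "J (y, t) \<in> \<Omega>" using c3[OF that(1) gcl(1)[OF that(1)]] that gcl[OF that(1)] by simp
  next
    assume i: "J (y, t) \<in> \<Omega>"
    then have "t \<in> T y" using that closure_subset by (auto simp: T_def)
    then show "t < g y" using gup[of t y] gnot[OF that(1)] i by (metis less_eq_real_def)
  qed
  let ?W = "J ` (B \<times> {a<..<b})"
  have G\<Gamma>: "J (y, g y) \<in> \<Gamma>" if "y \<in> B" for y using gcl[OF that] gnot[OF that] by (simp add: frontier_iff)
  have img: "(\<lambda>y. J (y, g y)) ` B = \<Gamma> \<inter> ?W"
  proof
    show "(\<lambda>y. J (y, g y)) ` B \<subseteq> \<Gamma> \<inter> ?W"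
    proof (rule image_subsetI)
      fix y assume y: "y \<in> B"
      then have "(y, g y) \<in> B \<times> {a<..<b}" using ga gb by simp
      then show "J (y, g y) \<in> \<Gamma> \<inter> ?W" using G\<Gamma>[OF y] by blast
    qed
    show "\<Gamma> \<inter> ?W \<subseteq> (\<lambda>y. J (y, g y)) ` B"
    proof
      fix x assume "x \<in> \<Gamma> \<inter> ?W"
      then obtain y t where yt: "x = J (y, t)" "y \<in> B" "a < t" "t < b" "x \<in> closure \<Omega>" "x \<notin> \<Omega>"
        by (auto simp: frontier_iff)
      then have "t \<le> g y" "\<not> t < g y" using graph[of y t] gup[of t y] by (auto simp: T_def)
      then have "t = g y" by linarith
      then show "x \<in> (\<lambda>y. J (y, g y)) ` B" using yt by simp
    qed
  qed
  have distJ: "dist (J (y, t)) (J (y', t')) = sqrt ((dist y y')\<^sup>2 + (t - t')\<^sup>2)" for y t y' t'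
    by (simp add: dist_norm Jdiff nJ)
  have half: "g y' - g y \<ge> - \<eta> * dist (J (y', g y')) (J (y, g y))" if "y \<in> B" "y' \<in> B" for y y'
  proof (rule ccontr)
    assume "\<not> ?thesis"
    then have "d \<bullet> (J (y', g y') - J (y, g y)) < - \<eta> * norm (J (y', g y') - J (y, g y))"
      by (simp add: Jdiff dJ dist_norm)
    then have "J (y', g y') \<in> \<Omega>"
      using \<rho>(2)[OF inb inb gcl(1)[OF that(1)]] that gcl by blast
    then show False using gnot[OF that(2)] by simp
  qed
  show ?thesis
  proof (rule that[OF J, of B a g b])
    show "open ?W" by (intro open_surjective_linear_image J open_Times) (auto simp: B_def)
    show "p \<in> ?W" unfolding p0 using h0 by (intro imageI) (auto simp: B_def ab)
    show "dist y y' \<le> dist (J (y, g y)) (J (y', g y'))" if "y \<in> B" "y' \<in> B" for y y'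
      unfolding distJ by (simp add: real_le_rsqrt)
    show "dist (J (y, g y)) (J (y', g y')) \<le> 1 / sqrt (1 - \<eta>\<^sup>2) * dist y y'" if "y \<in> B" "y' \<in> B" for y y'
    proof -
      define D where "D = dist (J (y, g y)) (J (y', g y'))"
      \<comment> \<open>The height difference is bounded by \<eta> times the distance D of the graph
        points, not of the base points; with Pythagoras this gives the constant 1 / sqrt (1 -
        \<eta>^2).\<close>
      have "\<bar>g y - g y'\<bar> \<le> \<eta> * D" using half[OF that] half[OF that(2,1)] by (auto simp: D_def dist_commute abs_le_iff)
      then have "(g y - g y')\<^sup>2 \<le> (\<eta> * D)\<^sup>2" by (metis abs_ge_zero power2_abs power_mono)
      moreover have "D\<^sup>2 = (dist y y')\<^sup>2 + (g y - g y')\<^sup>2" unfolding D_def distJ by simp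
      ultimately have "(1 - \<eta>\<^sup>2) * D\<^sup>2 \<le> (dist y y')\<^sup>2" by (simp add: algebra_simps power_mult_distrib)
      then have "sqrt ((1 - \<eta>\<^sup>2) * D\<^sup>2) \<le> dist y y'" by (simp add: real_le_lsqrt)
      then have "sqrt (1 - \<eta>\<^sup>2) * D \<le> dist y y'" by (simp add: real_sqrt_mult D_def)
      moreover have "\<eta>\<^sup>2 < 1" using \<eta> by (simp add: power_less_one_iff)
      ultimately show ?thesis by (simp add: D_def field_simps)
    qed
  qed (use ga gb graph img in \<open>auto simp: B_def\<close>)
qed

section \<open>The local error estimate and the finiteness of the area\<close>

lemma CARD_m: "CARD('n) = CARD('n minus_one) + 1"
  using CARD_minus_one[where 'a='n] CARD2 by simp

text \<open>The volume integral equals the integral over the base, and the base integral differs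
  from the surface integral by the bi-Lipschitz factor. Integrability of f is assumed at this point,
  because the finiteness of the surface measure is itself deduced from the first conclusion.\<close>

lemma local_estimate:
  assumes p: "p \<in> \<Gamma>" and d: "norm d = 1" "norm (d - n p) \<le> \<eta> / 2" and \<eta>: "0 < \<eta>" "\<eta> \<le> 1/2"
  shows "\<exists>r>0. hausdorff_measure (real CARD('n) - 1) (\<Gamma> \<inter> ball p r) < top \<and>
    (\<forall>f F. C1on UNIV f F \<longrightarrow> (\<forall>x. x \<notin> cball p r \<longrightarrow> f x = 0) \<longrightarrow> integrable S f \<longrightarrow>
      \<bar>(LINT x|lborel. indicator \<Omega> x * (F x \<bullet> d)) - (LINT x|S. f x)\<bar>
      \<le> ((1 / sqrt (1 - \<eta>\<^sup>2)) ^ (CARD('n) - 1) - 1) * (LINT x|S. \<bar>f x\<bar>))"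
proof -
  obtain J :: "(real^('n minus_one)) \<times> real \<Rightarrow> real^'n" and B a g b where
    J: "linear J" "surj J" "\<And>z. norm (J z) = norm z" "J (0,1) = d" and B: "open B" "bounded B"
    and g: "\<And>y. y \<in> B \<Longrightarrow> a < g y \<and> g y < b"
    and graph: "\<And>y t. y \<in> B \<Longrightarrow> a < t \<Longrightarrow> t < b \<Longrightarrow> J (y, t) \<in> \<Omega> \<longleftrightarrow> t < g y"
    and W: "open (J ` (B \<times> {a<..<b}))" "p \<in> J ` (B \<times> {a<..<b})"
    and G: "(\<lambda>y. J (y, g y)) ` B = \<Gamma> \<inter> J ` (B \<times> {a<..<b})"
    and lo: "\<And>y y'. y \<in> B \<Longrightarrow> y' \<in> B \<Longrightarrow> dist y y' \<le> dist (J (y, g y)) (J (y', g y'))"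
    and hi: "\<And>y y'. y \<in> B \<Longrightarrow> y' \<in> B \<Longrightarrow> dist (J (y, g y)) (J (y', g y')) \<le> 1 / sqrt (1 - \<eta>\<^sup>2) * dist y y'"
    by (rule local_graph[OF p d \<eta>]) (rule that, assumption+)
  obtain r where r: "0 < r" "cball p r \<subseteq> J ` (B \<times> {a<..<b})" using W open_contains_cball by blast
  have "\<eta>\<^sup>2 < 1" using \<eta> by (simp add: power_less_one_iff)
  then have L: "0 < 1 / sqrt (1 - \<eta>\<^sup>2)" by simp
  have dim: "DIM((real^('n minus_one)) \<times> real) = DIM(real^'n)" using CARD_m by simp
  have "hausdorff_measure (real CARD('n) - 1) (\<Gamma> \<inter> ball p r) \<le> hausdorff_measure (real CARD('n) - 1) ((\<lambda>y. J (y, g y)) ` B)"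
    unfolding G using r by (intro hausdorff_measure_mono) auto
  also have "\<dots> \<le> ennreal ((1 / sqrt (1 - \<eta>\<^sup>2)) powr (real CARD('n) - 1)) * hausdorff_measure (real CARD('n) - 1) B"
    using CARD2 hi L by (intro hausdorff_measure_Lipschitz_image) auto
  also have "hausdorff_measure (real CARD('n) - 1) B = emeasure lborel B"
    using hausdorff_measure_eq_lborel[of B] B CARD_m by simp
  also have "ennreal ((1 / sqrt (1 - \<eta>\<^sup>2)) powr (real CARD('n) - 1)) * emeasure lborel B < top"
    using emeasure_bounded_finite[OF B(2)] by (simp add: ennreal_mult_less_top)
  finally have fin: "hausdorff_measure (real CARD('n) - 1) (\<Gamma> \<inter> ball p r) < top" .
  have est: "\<bar>(LINT x|lborel. indicator \<Omega> x * (F x \<bullet> d)) - (LINT x|S. f x)\<bar>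
      \<le> ((1 / sqrt (1 - \<eta>\<^sup>2)) ^ (CARD('n) - 1) - 1) * (LINT x|S. \<bar>f x\<bar>)"
    if f: "C1on UNIV f F" "\<forall>x. x \<notin> cball p r \<longrightarrow> f x = 0" "integrable S f" for f F
  proof -
    have "(LINT x|lborel. indicator \<Omega> x * (F x \<bullet> d)) = (LINT y|lborel. indicator B y * f (J (y, g y)))"
      using graph_divergence[OF J(1-3) dim open_\<Omega> B(2) g graph f(1) closed_cball r(2)] f(2) unfolding J(4) by blast
    moreover have "\<bar>(LINT y|lborel. indicator B y * f (J (y, g y))) - (LINT x|S. f x)\<bar>
       \<le> ((1 / sqrt (1 - \<eta>\<^sup>2)) ^ CARD('n minus_one) - 1) * (LINT x|S. \<bar>f x\<bar>)"
      by (rule graph_surface_estimate[OF CARD_m B(1) _ W(1) G L lo hi f(3)]) (use f(2) r(2) in blast)+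
    ultimately show ?thesis using CARD_m by simp
  qed
  show ?thesis using r(1) fin est by blast
qed

lemma finite_surface: "emeasure S \<Gamma> < top"
proof -
  have "\<exists>r>0. hausdorff_measure (real CARD('n) - 1) (\<Gamma> \<inter> ball p r) < top" if "p \<in> \<Gamma>" for p
    using local_estimate[OF that norm_n[OF that], of "1/2"] by auto
  then obtain r where r: "\<And>p. p \<in> \<Gamma> \<Longrightarrow> 0 < r p \<and> hausdorff_measure (real CARD('n) - 1) (\<Gamma> \<inter> ball p (r p)) < top" by metis
  have cov: "\<Gamma> \<subseteq> (\<Union>p\<in>\<Gamma>. ball p (r p))" using r by force
  obtain P where P: "P \<subseteq> \<Gamma>" "finite P" "\<Gamma> \<subseteq> (\<Union>p\<in>P. ball p (r p))"
    by (rule compactE_image[OF compact_\<Gamma> _ cov]) auto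
  have m: "\<Gamma> \<inter> ball p (r p) \<in> sets S" for p by (auto simp: sets_restrict_space)
  have "emeasure S \<Gamma> \<le> emeasure S (\<Union>p\<in>P. \<Gamma> \<inter> ball p (r p))"
    using P(3) by (intro emeasure_mono sets.finite_UN[OF P(2)] m) blast
  also have "\<dots> \<le> (\<Sum>p\<in>P. emeasure S (\<Gamma> \<inter> ball p (r p)))"
    using P m by (intro emeasure_subadditive_finite) auto
  also have "\<dots> = (\<Sum>p\<in>P. hausdorff_measure (real CARD('n) - 1) (\<Gamma> \<inter> ball p (r p)))"
    using m by (intro sum.cong refl emeasure_surface_measure) auto
  also have "\<dots> < top" using P r by (auto simp: ennreal_sum_less_top)
  finally show ?thesis .
qed

sublocale S: finite_measure S
  using finite_surface by (intro finite_measureI) auto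

lemma integrable_surface:
  fixes f :: "real^'n \<Rightarrow> real"
  assumes f: "continuous_on \<Gamma> f" shows "integrable S f"
proof -
  obtain C where C: "\<And>x. x \<in> \<Gamma> \<Longrightarrow> norm (f x) \<le> C"
    using compact_continuous_image[OF f compact_\<Gamma>, THEN compact_imp_bounded] by (auto simp: bounded_iff)
  have "f \<in> borel_measurable S"
    using borel_measurable_continuous_on_restrict[OF f] by (simp cong: measurable_cong_sets)
  then show ?thesis using C by (intro S.integrable_const_bound[of _ C]) auto
qed

end

section \<open>The divergence theorem\<close>

text \<open>On [0,1] a convex function lies below its chord, here of slope 2^m - 1; the induction is
  on this sharper bound.\<close>

lemma one_plus_power_le:
  fixes x :: real
  assumes "0 \<le> x" "x \<le> 1" shows "(1 + x) ^ m \<le> 1 + 2 ^ m * x"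
proof -
  have "(1 + x) ^ m \<le> 1 + (2 ^ m - 1) * x"
  proof (induction m)
    case (Suc m)
    have "(1 + x) ^ Suc m \<le> (1 + x) * (1 + (2 ^ m - 1) * x)"
      using Suc assms by simp
    also have "\<dots> = 1 + 2 ^ m * x + (2 ^ m - 1) * (x * x)" by (simp add: algebra_simps)
    also have "\<dots> \<le> 1 + 2 ^ m * x + (2 ^ m - 1) * (1 * x)"
      using assms by (intro add_left_mono mult_left_mono mult_right_mono) auto
    finally show ?case by (simp add: algebra_simps)
  qed simp
  also have "\<dots> \<le> 1 + 2 ^ m * x" using assms by (simp add: algebra_simps)
  finally show ?thesis .
qed

text \<open>The error is quadratic in \<eta>. A linear one would be lost in
  \<open>local_defect\<close>, where a difference of directions of size \<eta>/4 is divided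
  out.\<close>

lemma lipschitz_power_le:
  fixes \<eta> :: real
  assumes "0 < \<eta>" "\<eta> \<le> 1/2"
  shows "(1 / sqrt (1 - \<eta>\<^sup>2)) ^ m - 1 \<le> 2 ^ Suc m * \<eta>\<^sup>2"
proof -
  have "\<eta>\<^sup>2 \<le> (1/2)\<^sup>2" using assms by (intro power_mono) auto
  then have e: "\<eta>\<^sup>2 \<le> 1/4" "0 < \<eta>\<^sup>2" using assms by (auto simp: power2_eq_square)
  have s: "0 < sqrt (1 - \<eta>\<^sup>2)" "sqrt (1 - \<eta>\<^sup>2) \<le> 1" using e by auto
  have "1 - \<eta>\<^sup>2 = sqrt (1 - \<eta>\<^sup>2) * sqrt (1 - \<eta>\<^sup>2)" using e by simp
  also have "\<dots> \<le> sqrt (1 - \<eta>\<^sup>2) * 1" using s by (intro mult_left_mono) auto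
  finally have "1 / sqrt (1 - \<eta>\<^sup>2) \<le> 1 / (1 - \<eta>\<^sup>2)" using e by (intro divide_left_mono) auto
  also have "\<dots> \<le> 1 + 2 * \<eta>\<^sup>2"
  proof -
    have "\<eta>\<^sup>2 * \<eta>\<^sup>2 \<le> \<eta>\<^sup>2 * (1/4)" using e by (intro mult_left_mono) auto
    moreover have "0 \<le> \<eta>\<^sup>2 * \<eta>\<^sup>2" by simp
    moreover have "(1 + 2 * \<eta>\<^sup>2) * (1 - \<eta>\<^sup>2) = 1 + \<eta>\<^sup>2 - 2 * (\<eta>\<^sup>2 * \<eta>\<^sup>2)" by (simp add: algebra_simps)
    ultimately have "1 \<le> (1 + 2 * \<eta>\<^sup>2) * (1 - \<eta>\<^sup>2)" by linarith
    then show ?thesis using e by (simp add: divide_le_eq)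
  qed
  finally have "(1 / sqrt (1 - \<eta>\<^sup>2)) ^ m \<le> (1 + 2 * \<eta>\<^sup>2) ^ m" using s by (intro power_mono) auto
  also have "\<dots> \<le> 1 + 2 ^ m * (2 * \<eta>\<^sup>2)" using e by (intro one_plus_power_le) auto
  finally show ?thesis by simp
qed

text \<open>The case of a half-space x . w < M containing the support: f vanishes on its
  boundary.\<close>

lemma integral_C1_compact_support:
  fixes f :: "real^'n \<Rightarrow> real"
  assumes "CARD('n) \<ge> 2" and f: "C1on UNIV f F" and K: "compact K" "\<And>x. x \<notin> K \<Longrightarrow> f x = 0" and w: "norm w = 1"
  shows "(LINT x|lborel. F x \<bullet> w) = 0"
proof -
  obtain J :: "(real^('n minus_one)) \<times> real \<Rightarrow> real^'n"
    where J: "linear J" "surj J" "\<And>z. norm (J z) = norm z" "J (0,1) = w"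
    using isometry_with_axis[OF assms(1) w] by blast
  obtain M where M: "0 < M" "\<And>x. x \<in> K \<Longrightarrow> norm x < M"
    using compact_imp_bounded[OF K(1)] unfolding bounded_pos_less by blast
  have wJ: "J (y, t) \<bullet> w = t" for y t
    using isometry_inner[OF J(1,3), of "(y,t)" "(0,1)"] J(4) by simp
  have F0: "F x = 0" if "x \<notin> K" for x
    by (rule C1on_grad_zero[OF f compact_imp_closed[OF K(1)] _ that]) (rule K(2))
  have dim: "DIM((real^('n minus_one)) \<times> real) = DIM(real^'n)" using CARD_minus_one[where 'a='n] assms(1) by simp
  have Ksub: "K \<subseteq> J ` (ball 0 M \<times> {-M<..<M+1})"
  proof
    fix x assume x: "x \<in> K"
    obtain y t where yt: "x = J (y, t)" using J(2) by (metis surjE surj_pair)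
    have "norm (y, t) < M" using M(2)[OF x] J(3) yt by simp
    then have "norm y < M" "norm t < M" using norm_fst_le[of y t] norm_snd_le[of t y] by (auto intro: le_less_trans)
    then show "x \<in> J ` (ball 0 M \<times> {-M<..<M+1})" using yt by (intro image_eqI[of _ _ "(y,t)"]) (auto simp: abs_less_iff)
  qed
  have "(LINT x|lborel. F x \<bullet> w) = (LINT x|lborel. indicator {x. x \<bullet> w < M} x * (F x \<bullet> w))"
  proof (intro Bochner_Integration.integral_cong refl)
    fix x
    have "x \<bullet> w < M" if "x \<in> K" using M(2)[OF that] Cauchy_Schwarz_ineq2[of x w] w by auto
    then show "F x \<bullet> w = indicator {x. x \<bullet> w < M} x * (F x \<bullet> w)" using F0 by (cases "x \<in> K") auto
  qed
  also have "\<dots> = (LINT y|lborel. indicator (ball 0 M) y * f (J (y, M)))"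
    unfolding J(4)[symmetric]
  proof (rule graph_divergence[OF J(1-3) dim _ bounded_ball, where g = "\<lambda>_. M" and a = "-M" and b = "M+1", OF _ _ _ f compact_imp_closed[OF K(1)] Ksub])
    show "open {x. x \<bullet> J (0, 1) < M}" by (intro open_Collect_less continuous_intros)
  qed (use M wJ K(2) in \<open>auto simp: J(4)\<close>)
  also have "\<dots> = 0"
  proof -
    have "J (y, M) \<notin> K" for y
      using M(2)[of "J (y, M)"] J(3)[of "(y,M)"] norm_snd_le[of M y] by auto
    then show ?thesis using K(2) by simp
  qed
  finally show ?thesis .
qed

section \<open>From local errors to the divergence theorem\<close>

context C1_domain
begin

lemma integrable_volume:
  fixes h :: "real^'n \<Rightarrow> real"
  assumes "continuous_on (closure \<Omega>) h"
  shows "integrable lborel (\<lambda>x. indicator \<Omega> x * h x)"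
proof -
  have "integrable lborel (\<lambda>x. indicator (closure \<Omega>) x *\<^sub>R h x)"
    by (rule borel_integrable_compact[OF compact_closure_\<Omega> assms])
  then have "integrable lborel (\<lambda>x. indicator \<Omega> x *\<^sub>R (indicator (closure \<Omega>) x *\<^sub>R h x))"
    by (rule integrable_mult_indicator[rotated]) (use open_\<Omega> in simp)
  also have "(\<lambda>x. indicator \<Omega> x *\<^sub>R (indicator (closure \<Omega>) x *\<^sub>R h x)) = (\<lambda>x. indicator \<Omega> x * h x)"
  proof
    show "indicator \<Omega> x *\<^sub>R (indicator (closure \<Omega>) x *\<^sub>R h x) = indicator \<Omega> x * h x" for x
      using closure_subset[of \<Omega>] by (cases "x \<in> \<Omega>") auto
  qed
  finally show ?thesis .
qed

text \<open>The error of the divergence theorem. It is linear in w, which carries information from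
  directions near the normal to all directions.\<close>

definition defect :: "(real^'n \<Rightarrow> real) \<Rightarrow> (real^'n \<Rightarrow> real^'n) \<Rightarrow> real^'n \<Rightarrow> real" where
  "defect f F w = (LINT x|lborel. indicator \<Omega> x * (F x \<bullet> w)) - (LINT x|S. f x * (n x \<bullet> w))"

lemma C1_integrable:
  assumes f: "C1on UNIV f F"
  shows "integrable lborel (\<lambda>x. indicator \<Omega> x * (F x \<bullet> w))" "integrable S (\<lambda>x. f x * (n x \<bullet> w))" "integrable S f"
  using continuous_on_subset[OF C1on_continuous_grad[OF f]] continuous_on_subset[OF C1on_continuous[OF f]] cont_n
  by (auto intro!: integrable_volume integrable_surface continuous_intros)

lemma defect_add_scale:
  assumes f: "C1on UNIV f F"
  shows "defect f F (v + c *\<^sub>R w) = defect f F v + c * defect f F w"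
proof -
  note i = C1_integrable[OF f]
  have "(LINT x|lborel. indicator \<Omega> x * (F x \<bullet> (v + c *\<^sub>R w)))
    = (LINT x|lborel. indicator \<Omega> x * (F x \<bullet> v) + c * (indicator \<Omega> x * (F x \<bullet> w)))"
    by (intro Bochner_Integration.integral_cong refl) (simp add: inner_add_right algebra_simps)
  also have "\<dots> = (LINT x|lborel. indicator \<Omega> x * (F x \<bullet> v)) + c * (LINT x|lborel. indicator \<Omega> x * (F x \<bullet> w))"
    using i by simp
  finally have 1: "(LINT x|lborel. indicator \<Omega> x * (F x \<bullet> (v + c *\<^sub>R w))) = \<dots>" .
  have "(LINT x|S. f x * (n x \<bullet> (v + c *\<^sub>R w))) = (LINT x|S. f x * (n x \<bullet> v) + c * (f x * (n x \<bullet> w)))"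
    by (intro Bochner_Integration.integral_cong refl) (simp add: inner_add_right algebra_simps)
  also have "\<dots> = (LINT x|S. f x * (n x \<bullet> v)) + c * (LINT x|S. f x * (n x \<bullet> w))"
    using i by simp
  finally show ?thesis using 1 by (simp add: defect_def algebra_simps)
qed

lemma defect_scale: "C1on UNIV f F \<Longrightarrow> defect f F (c *\<^sub>R w) = c * defect f F w"
  using defect_add_scale[of f F 0 c w] by (simp add: defect_def)

text \<open>\<open>local_estimate\<close> compares with the integral of f alone. Inserting the
  factor n . d costs 1 - n . d = |n - d|^2 / 2, also of order \<eta>^2 because both vectors are
  unit. The term 2^N in the constant comes from the graph, the 1 from this replacement.\<close>

lemma local_dir_defect:
  assumes p: "p \<in> \<Gamma>" and d: "norm d = 1" "norm (d - n p) \<le> \<eta> / 2" and \<eta>: "0 < \<eta>" "\<eta> \<le> 1/2"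
  shows "\<exists>r>0. \<forall>f F. C1on UNIV f F \<longrightarrow> (\<forall>x. x \<notin> cball p r \<longrightarrow> f x = 0) \<longrightarrow>
      \<bar>defect f F d\<bar> \<le> (2 ^ CARD('n) + 1) * \<eta>\<^sup>2 * (LINT x|S. \<bar>f x\<bar>)"
proof -
  obtain r1 where r1: "0 < r1" and est: "\<And>f F. C1on UNIV f F \<Longrightarrow> (\<forall>x. x \<notin> cball p r1 \<longrightarrow> f x = 0) \<Longrightarrow> integrable S f \<Longrightarrow>
      \<bar>(LINT x|lborel. indicator \<Omega> x * (F x \<bullet> d)) - (LINT x|S. f x)\<bar>
      \<le> ((1 / sqrt (1 - \<eta>\<^sup>2)) ^ (CARD('n) - 1) - 1) * (LINT x|S. \<bar>f x\<bar>)"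
    using local_estimate[OF p d \<eta>] by blast
  obtain r2 where r2: "0 < r2" "\<And>x. x \<in> \<Gamma> \<Longrightarrow> dist x p < r2 \<Longrightarrow> dist (n x) (n p) < \<eta> / 2"
    using cont_n p \<eta>(1) unfolding continuous_on_iff by (meson half_gt_zero)
  define r where "r = min r1 (r2 / 2)"
  have r: "0 < r" "r \<le> r1" "r < r2" using r1 r2 by (auto simp: r_def)
  have "\<bar>defect f F d\<bar> \<le> (2 ^ CARD('n) + 1) * \<eta>\<^sup>2 * (LINT x|S. \<bar>f x\<bar>)"
    if f: "C1on UNIV f F" and supp: "\<forall>x. x \<notin> cball p r \<longrightarrow> f x = 0" for f F
  proof -
    note i = C1_integrable[OF f]
    have M0: "0 \<le> (LINT x|S. \<bar>f x\<bar>)" by (intro integral_nonneg_AE) auto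
    have "\<bar>(LINT x|lborel. indicator \<Omega> x * (F x \<bullet> d)) - (LINT x|S. f x)\<bar>
      \<le> ((1 / sqrt (1 - \<eta>\<^sup>2)) ^ (CARD('n) - 1) - 1) * (LINT x|S. \<bar>f x\<bar>)"
      using est[OF f] supp r i(3) by auto
    also have "\<dots> \<le> (2 ^ CARD('n) * \<eta>\<^sup>2) * (LINT x|S. \<bar>f x\<bar>)"
      using lipschitz_power_le[OF \<eta>, of "CARD('n) - 1"] M0 by (intro mult_right_mono) auto
    finally have 1: "\<bar>(LINT x|lborel. indicator \<Omega> x * (F x \<bullet> d)) - (LINT x|S. f x)\<bar> \<le> (2 ^ CARD('n) * \<eta>\<^sup>2) * (LINT x|S. \<bar>f x\<bar>)" .
    have pt: "\<bar>f x - f x * (n x \<bullet> d)\<bar> \<le> \<eta>\<^sup>2 * \<bar>f x\<bar>" if x: "x \<in> \<Gamma>" for x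
    proof (cases "x \<in> cball p r")
      case True
      have "norm (n x - d) \<le> norm (n x - n p) + norm (d - n p)"
        using norm_triangle_ineq[of "n x - n p" "n p - d"] by (simp add: norm_minus_commute)
      also have "\<dots> \<le> \<eta>"
      proof -
        have "dist x p < r2" using True r by (simp add: dist_commute)
        then have "norm (n x - n p) < \<eta> / 2" using r2(2)[OF x] by (simp add: dist_norm)
        then show ?thesis using d(2) by linarith
      qed
      finally have "(norm (n x - d))\<^sup>2 \<le> \<eta>\<^sup>2" by (intro power_mono) auto
      moreover have "(norm (n x - d))\<^sup>2 = 2 - 2 * (n x \<bullet> d)"
        using norm_n[OF x] d(1) unfolding norm_eq_1 power2_norm_eq_inner by (simp add: inner_diff_left inner_diff_right inner_commute)
      moreover have "n x \<bullet> d \<le> 1" using Cauchy_Schwarz_ineq2[of "n x" d] norm_n[OF x] d(1) by auto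
      ultimately have "\<bar>1 - n x \<bullet> d\<bar> \<le> \<eta>\<^sup>2" using zero_le_power2[of \<eta>] by linarith
      then have "\<bar>f x\<bar> * \<bar>1 - n x \<bullet> d\<bar> \<le> \<bar>f x\<bar> * \<eta>\<^sup>2" by (intro mult_left_mono) auto
      then show ?thesis by (simp add: abs_mult[symmetric] algebra_simps)
    qed (use supp in simp)
    have "\<bar>(LINT x|S. f x) - (LINT x|S. f x * (n x \<bullet> d))\<bar> = \<bar>LINT x|S. f x - f x * (n x \<bullet> d)\<bar>"
      using i by simp
    also have "\<dots> \<le> (LINT x|S. \<bar>f x - f x * (n x \<bullet> d)\<bar>)" by (rule integral_abs_bound)
    also have "\<dots> \<le> (LINT x|S. \<eta>\<^sup>2 * \<bar>f x\<bar>)"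
      using i pt by (intro integral_mono) auto
    finally have 2: "\<bar>(LINT x|S. f x) - (LINT x|S. f x * (n x \<bullet> d))\<bar> \<le> \<eta>\<^sup>2 * (LINT x|S. \<bar>f x\<bar>)" by simp
    show ?thesis using 1 2 unfolding defect_def by (simp add: distrib_right)
  qed
  then show ?thesis using r(1) by blast
qed

text \<open>\<open>n p\<close> and the normalised vector n p + (\<eta>/4) w are both directions with
  error of order \<eta>^2. By linearity the error in direction w is bounded by their errors divided
  by \<eta>/4, which is of order \<eta>.\<close>

lemma local_defect:
  assumes p: "p \<in> \<Gamma>" and w: "norm w = 1" and \<zeta>: "0 < \<zeta>"
  shows "\<exists>r>0. \<forall>f F. C1on UNIV f F \<longrightarrow> (\<forall>x. x \<notin> cball p r \<longrightarrow> f x = 0) \<longrightarrow> \<bar>defect f F w\<bar> \<le> \<zeta> * (LINT x|S. \<bar>f x\<bar>)"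
proof -
  define C :: real where "C = 2 ^ CARD('n) + 1"
  have C: "0 < C" by (auto simp: C_def intro: add_pos_pos)
  \<comment> \<open>With |v| <= 2 the two errors sum to at most 3 C \<eta>^2 times the integral of
    |f|; division by \<eta>/4 gives 12 C \<eta>.\<close>
  define \<eta> where "\<eta> = min (1/2) (\<zeta> / (12 * C))"
  have \<eta>: "0 < \<eta>" "\<eta> \<le> 1/2" and \<eta>C: "12 * C * \<eta> \<le> \<zeta>"
    using C \<zeta> by (auto simp: \<eta>_def min_def field_simps)
  \<comment> \<open>The step \<eta>/4 leaves room for the normalisation, which moves v by at most
    another \<eta>/4, so d stays within \<eta>/2 of \<open>n p\<close>.\<close>
  define v where "v = n p + (\<eta>/4) *\<^sub>R w"
  define d where "d = (1 / norm v) *\<^sub>R v"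
  have vn: "norm (v - n p) = \<eta> / 4" using w \<eta> by (simp add: v_def)
  have "\<bar>norm v - norm (n p)\<bar> \<le> norm (v - n p)" by (rule norm_triangle_ineq3)
  then have nv: "\<bar>norm v - 1\<bar> \<le> \<eta> / 4" using vn norm_n[OF p] by simp
  then have v0: "0 < norm v" "norm v \<le> 2" using \<eta> by linarith+
  have d1: "norm d = 1" using v0 by (simp add: d_def)
  have vd: "v = norm v *\<^sub>R d" using v0 by (simp add: d_def)
  have "d - norm v *\<^sub>R d = (1 - norm v) *\<^sub>R d" by (simp add: scaleR_left_diff_distrib)
  then have "d - v = (1 - norm v) *\<^sub>R d" unfolding vd[symmetric] .
  then have "norm (d - v) \<le> \<eta> / 4" using nv d1 by (simp add: abs_minus_commute)
  moreover have "norm (d - n p) \<le> norm (d - v) + norm (v - n p)"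
    using norm_triangle_ineq[of "d - v" "v - n p"] by simp
  ultimately have d2: "norm (d - n p) \<le> \<eta> / 2" using vn by simp
  obtain r0 where r0: "0 < r0" "\<And>f F. C1on UNIV f F \<Longrightarrow> (\<forall>x. x \<notin> cball p r0 \<longrightarrow> f x = 0) \<Longrightarrow>
      \<bar>defect f F (n p)\<bar> \<le> C * \<eta>\<^sup>2 * (LINT x|S. \<bar>f x\<bar>)"
    using local_dir_defect[OF p norm_n[OF p] _ \<eta>] \<eta> unfolding C_def by auto
  obtain r1 where r1: "0 < r1" "\<And>f F. C1on UNIV f F \<Longrightarrow> (\<forall>x. x \<notin> cball p r1 \<longrightarrow> f x = 0) \<Longrightarrow>
      \<bar>defect f F d\<bar> \<le> C * \<eta>\<^sup>2 * (LINT x|S. \<bar>f x\<bar>)"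
    using local_dir_defect[OF p d1 d2 \<eta>] unfolding C_def by blast
  have "\<bar>defect f F w\<bar> \<le> \<zeta> * (LINT x|S. \<bar>f x\<bar>)"
    if f: "C1on UNIV f F" and supp: "\<forall>x. x \<notin> cball p (min r0 r1) \<longrightarrow> f x = 0" for f F
  proof -
    define M where "M = (LINT x|S. \<bar>f x\<bar>)"
    have M0: "0 \<le> M" unfolding M_def by (intro integral_nonneg_AE) auto
    have e0: "\<bar>defect f F (n p)\<bar> \<le> C * \<eta>\<^sup>2 * M" using r0(2)[OF f] supp by (auto simp: M_def)
    have e1: "\<bar>defect f F d\<bar> \<le> C * \<eta>\<^sup>2 * M" using r1(2)[OF f] supp by (auto simp: M_def)
    have "defect f F v = norm v * defect f F d" by (subst vd) (rule defect_scale[OF f])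
    moreover have "defect f F v = defect f F (n p) + \<eta>/4 * defect f F w"
      unfolding v_def by (rule defect_add_scale[OF f])
    ultimately have "\<eta>/4 * defect f F w = norm v * defect f F d - defect f F (n p)" by simp
    then have "\<bar>\<eta>/4 * defect f F w\<bar> \<le> norm v * \<bar>defect f F d\<bar> + \<bar>defect f F (n p)\<bar>"
      using v0 by (metis abs_mult abs_norm_cancel abs_triangle_ineq4)
    also have "\<dots> \<le> 2 * (C * \<eta>\<^sup>2 * M) + C * \<eta>\<^sup>2 * M" using v0 e0 e1 by (intro add_mono mult_mono) auto
    finally have "\<eta> * \<bar>defect f F w\<bar> \<le> \<eta> * (12 * C * \<eta> * M)" using \<eta> by (simp add: abs_mult power2_eq_square mult_ac)
    then have "\<bar>defect f F w\<bar> \<le> 12 * C * \<eta> * M" using \<eta>(1) by (rule mult_left_le_imp_le)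
    also have "\<dots> \<le> \<zeta> * M" using \<eta>C M0 by (rule mult_right_mono)
    finally show ?thesis by (simp add: M_def)
  qed
  then show ?thesis using r0(1) r1(1) by (intro exI[of _ "min r0 r1"]) auto
qed

lemma interior_defect:
  assumes p: "p \<in> \<Omega>" and w: "norm w = 1"
  shows "\<exists>r>0. \<forall>f F. C1on UNIV f F \<longrightarrow> (\<forall>x. x \<notin> cball p r \<longrightarrow> f x = 0) \<longrightarrow> defect f F w = 0"
proof -
  obtain r where r: "0 < r" "cball p r \<subseteq> \<Omega>" using open_\<Omega> p open_contains_cball by blast
  have "defect f F w = 0" if f: "C1on UNIV f F" and supp: "\<forall>x. x \<notin> cball p r \<longrightarrow> f x = 0" for f F
  proof -
    have F0: "F x = 0" if "x \<notin> cball p r" for x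
      by (rule C1on_grad_zero[OF f closed_cball _ that]) (use supp in blast)
    have "(LINT x|lborel. indicator \<Omega> x * (F x \<bullet> w)) = (LINT x|lborel. F x \<bullet> w)"
    proof (intro Bochner_Integration.integral_cong refl)
      show "indicator \<Omega> x * (F x \<bullet> w) = F x \<bullet> w" for x
        using F0[of x] r by (cases "x \<in> cball p r") (auto simp: subset_iff)
    qed
    also have "\<dots> = 0" using integral_C1_compact_support[OF CARD2 f compact_cball _ w] supp by blast
    moreover have "(LINT x|S. f x * (n x \<bullet> w)) = (LINT x|S. 0)"
    proof (intro Bochner_Integration.integral_cong refl)
      fix x assume "x \<in> space S"
      then have "x \<notin> cball p r" using r by (auto simp: frontier_iff)
      then show "f x * (n x \<bullet> w) = 0" using supp by simp
    qed
    ultimately show ?thesis by (simp add: defect_def)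
  qed
  then show ?thesis using r by blast
qed

text \<open>The radii, and so the number of pieces of the partition, depend on \<zeta>. This is
  harmless because each error is measured by the integral of the absolute value of its own piece,
  and these add up to the integral of |f| on the boundary, however many pieces there are.\<close>

lemma divergence_unit:
  assumes f: "C1on UNIV f F" and w: "norm w = 1"
  shows "defect f F w = 0"
proof -
  have bound: "\<bar>defect f F w\<bar> \<le> \<zeta> * (LINT x|S. \<bar>f x\<bar>)" if \<zeta>: "0 < \<zeta>" for \<zeta>
  proof -
    have "\<exists>r>0. \<forall>f F. C1on UNIV f F \<longrightarrow> (\<forall>x. x \<notin> cball p r \<longrightarrow> f x = 0) \<longrightarrow> \<bar>defect f F w\<bar> \<le> \<zeta> * (LINT x|S. \<bar>f x\<bar>)"
      if p: "p \<in> closure \<Omega>" for p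
    proof (cases "p \<in> \<Omega>")
      case True
      have "0 \<le> \<zeta> * (LINT x|S. \<bar>f x\<bar>)" for f :: "real^'n \<Rightarrow> real"
        using \<zeta> by (intro mult_nonneg_nonneg integral_nonneg_AE) auto
      then show ?thesis using interior_defect[OF True w] by (metis abs_zero)
    next
      case False
      then show ?thesis using p local_defect[OF _ w \<zeta>] by (simp add: frontier_iff)
    qed
    then obtain rad where rad: "\<And>p. p \<in> closure \<Omega> \<Longrightarrow> 0 < rad p"
      "\<And>p f F. p \<in> closure \<Omega> \<Longrightarrow> C1on UNIV f F \<Longrightarrow> (\<forall>x. x \<notin> cball p (rad p) \<longrightarrow> f x = 0) \<Longrightarrow> \<bar>defect f F w\<bar> \<le> \<zeta> * (LINT x|S. \<bar>f x\<bar>)"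
      by metis
    obtain P \<eta> E V where P: "finite P" "P \<subseteq> closure \<Omega>" "\<And>p. p \<in> P \<Longrightarrow> C1on UNIV (\<eta> p) (E p)"
      "\<And>p x. p \<in> P \<Longrightarrow> 0 \<le> \<eta> p x" "\<And>p x. p \<in> P \<Longrightarrow> rad p \<le> dist x p \<Longrightarrow> \<eta> p x = 0"
      "open V" "closure \<Omega> \<subseteq> V" "\<And>x. x \<in> V \<Longrightarrow> (\<Sum>p\<in>P. \<eta> p x) = 1"
      by (rule C1_partition_of_unity[OF compact_closure_\<Omega> rad(1)]) auto
    define g where "g p x = \<eta> p x * f x" for p x
    define G where "G p x = \<eta> p x *\<^sub>R F x + f x *\<^sub>R E p x" for p x
    have g: "C1on UNIV (g p) (G p)" if "p \<in> P" for p
      unfolding g_def G_def by (rule C1on_mult[OF P(3)[OF that] f])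
    have gs: "C1on UNIV (\<lambda>x. \<Sum>p\<in>P. g p x) (\<lambda>x. \<Sum>p\<in>P. G p x)" by (intro C1on_sum P(1) g)
    have fsum: "f x = (\<Sum>p\<in>P. g p x)" if "x \<in> V" for x
      using P(8)[OF that] by (simp add: g_def flip: sum_distrib_right)
    have Fsum: "F x = (\<Sum>p\<in>P. G p x)" if "x \<in> V" for x
      by (rule C1on_grad_unique[OF f gs P(6) that]) (use fsum in auto)
    have \<Omega>V: "\<Omega> \<subseteq> V" and \<Gamma>V: "\<Gamma> \<subseteq> V" using P(7) closure_subset frontier_iff by blast+
    have "(LINT x|lborel. indicator \<Omega> x * (F x \<bullet> w)) = (LINT x|lborel. (\<Sum>p\<in>P. indicator \<Omega> x * (G p x \<bullet> w)))"
      using Fsum \<Omega>V by (intro Bochner_Integration.integral_cong refl) (auto simp: indicator_def inner_sum_left)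
    also have "\<dots> = (\<Sum>p\<in>P. LINT x|lborel. indicator \<Omega> x * (G p x \<bullet> w))"
      using C1_integrable(1)[OF g] by (intro Bochner_Integration.integral_sum) auto
    finally have 1: "(LINT x|lborel. indicator \<Omega> x * (F x \<bullet> w)) = \<dots>" .
    have "(LINT x|S. f x * (n x \<bullet> w)) = (LINT x|S. (\<Sum>p\<in>P. g p x * (n x \<bullet> w)))"
      using fsum \<Gamma>V by (intro Bochner_Integration.integral_cong refl) (auto simp: sum_distrib_right)
    also have "\<dots> = (\<Sum>p\<in>P. LINT x|S. g p x * (n x \<bullet> w))"
      using C1_integrable(2)[OF g] by (intro Bochner_Integration.integral_sum) auto
    finally have 2: "(LINT x|S. f x * (n x \<bullet> w)) = \<dots>" .
    have "\<bar>defect f F w\<bar> = \<bar>\<Sum>p\<in>P. defect (g p) (G p) w\<bar>"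
      unfolding defect_def 1 2 by (simp add: sum_subtractf)
    also have "\<dots> \<le> (\<Sum>p\<in>P. \<bar>defect (g p) (G p) w\<bar>)" by (rule sum_abs)
    also have "\<dots> \<le> (\<Sum>p\<in>P. \<zeta> * (LINT x|S. \<bar>g p x\<bar>))"
      using P(2,5) g by (intro sum_mono rad(2)) (auto simp: g_def dist_commute not_le less_imp_le)
    also have "\<dots> = \<zeta> * (LINT x|S. (\<Sum>p\<in>P. \<bar>g p x\<bar>))"
      using C1_integrable(3)[OF g] by (subst Bochner_Integration.integral_sum) (auto simp: sum_distrib_left)
    also have "(LINT x|S. (\<Sum>p\<in>P. \<bar>g p x\<bar>)) = (LINT x|S. \<bar>f x\<bar>)"
    proof (intro Bochner_Integration.integral_cong refl)
      fix x assume "x \<in> space S"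
      then have "x \<in> V" using \<Gamma>V by auto
      then show "(\<Sum>p\<in>P. \<bar>g p x\<bar>) = \<bar>f x\<bar>"
        using P(4) P(8)[of x] by (simp add: g_def abs_mult flip: sum_distrib_right)
    qed
    finally show ?thesis .
  qed
  define M where "M = (LINT x|S. \<bar>f x\<bar>)"
  have M0: "0 \<le> M" unfolding M_def by (intro integral_nonneg_AE) auto
  have "\<bar>defect f F w\<bar> \<le> 0 + e" if "0 < e" for e
  proof -
    have "\<bar>defect f F w\<bar> \<le> e / (M + 1) * M" using bound[of "e / (M + 1)"] that M0 unfolding M_def[symmetric] by simp
    also have "\<dots> \<le> e" using that M0 by (simp add: field_simps)
    finally show ?thesis by simp
  qed
  then have "\<bar>defect f F w\<bar> \<le> 0" by (rule field_le_epsilon)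
  then show ?thesis by simp
qed

theorem divergence_C1:
  assumes f: "C1on UNIV f F"
  shows "(LINT x|lborel. indicator \<Omega> x * (F x \<bullet> w)) = (LINT x|S. f x * (n x \<bullet> w))"
proof -
  have "defect f F w = 0"
  proof (cases "w = 0")
    case False
    have "w = norm w *\<^sub>R sgn w" using False by (simp add: sgn_div_norm)
    then have "defect f F w = norm w * defect f F (sgn w)" using defect_scale[OF f] by metis
    then show ?thesis using divergence_unit[OF f, of "sgn w"] False by (simp add: norm_sgn)
  qed (simp add: defect_def)
  then show ?thesis by (simp add: defect_def)
qed

end

section \<open>A divergence identity without second derivatives\<close>

lemma segment_mvt:
  fixes f :: "'a::euclidean_space \<Rightarrow> real"
  assumes c: "continuous_on (closed_segment x y) f"
    and d: "\<And>z. z \<in> open_segment x y \<Longrightarrow> (f has_derivative (\<lambda>h. F z \<bullet> h)) (at z)" and "x \<noteq> y"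
  obtains z where "z \<in> open_segment x y" "f y - f x = F z \<bullet> (y - x)"
proof -
  let ?\<gamma> = "\<lambda>t. x + t *\<^sub>R (y - x)"
  have inseg: "?\<gamma> t \<in> open_segment x y" if "0 < t" "t < 1" for t
    using that \<open>x \<noteq> y\<close> by (auto simp: in_segment intro!: exI[of _ t] simp: algebra_simps)
  have incl: "?\<gamma> t \<in> closed_segment x y" if "0 \<le> t" "t \<le> 1" for t
    using that by (auto simp: in_segment intro!: exI[of _ t] simp: algebra_simps)
  have "continuous_on {0..1} (\<lambda>t. f (?\<gamma> t))"
    by (rule continuous_on_compose2[OF c]) (auto intro!: continuous_intros incl)
  moreover have "((\<lambda>t. f (?\<gamma> t)) has_derivative (\<lambda>s. F (?\<gamma> t) \<bullet> (s *\<^sub>R (y - x)))) (at t)" if "0 < t" "t < 1" for t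
  proof -
    have "(?\<gamma> has_derivative (\<lambda>s. s *\<^sub>R (y - x))) (at t)" by (auto intro!: derivative_eq_intros)
    from has_derivative_compose[OF this d[OF inseg[OF that]]] show ?thesis .
  qed
  ultimately obtain t where t: "0 < t" "t < 1" "f (?\<gamma> 1) - f (?\<gamma> 0) = F (?\<gamma> t) \<bullet> ((1 - 0) *\<^sub>R (y - x))"
    by (rule mvt[of 0 1 "\<lambda>t. f (?\<gamma> t)" "\<lambda>t s. F (?\<gamma> t) \<bullet> (s *\<^sub>R (y - x))", rotated]) auto
  then show ?thesis using that[OF inseg[OF t(1,2)]] by simp
qed

section \<open>Averaged difference quotients\<close>

lemma C1on_shift: "C1on UNIV f F \<Longrightarrow> C1on UNIV (\<lambda>x. f (x + v)) (\<lambda>x. F (x + v))"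
  using C1on_translate[of UNIV f F "- v"] by simp

lemma C1on_average:
  fixes f :: "'a::euclidean_space \<Rightarrow> real"
  assumes f: "C1on UNIV f F"
  shows "C1on UNIV (\<lambda>x. integral {0..1} (\<lambda>t::real. f (x + t *\<^sub>R v))) (\<lambda>x. integral {0..1} (\<lambda>t. F (x + t *\<^sub>R v)))"
  unfolding C1on_def
proof (intro conjI ballI)
  have cF: "continuous_on UNIV F" by (rule C1on_continuous_grad[OF f])
  have cf: "continuous_on UNIV f" by (rule C1on_continuous[OF f])
  have c2: "continuous_on (UNIV \<times> cbox 0 (1::real)) (\<lambda>(x, t). F (x + t *\<^sub>R v))"
    by (rule continuous_on_compose2[OF cF, where f = "\<lambda>(x,t). x + t *\<^sub>R v", unfolded case_prod_unfold] | simp add: case_prod_unfold)+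
       (auto intro!: continuous_intros)
  show "continuous_on UNIV (\<lambda>x. integral {0..1::real} (\<lambda>t. F (x + t *\<^sub>R v)))"
    using integral_continuous_on_param[OF c2] by simp
  fix x0 :: 'a
  let ?fx = "\<lambda>x t. blinfun_inner_right (F (x + t *\<^sub>R v))"
  have c3: "continuous_on (UNIV \<times> cbox 0 (1::real)) (\<lambda>(x, t). ?fx x t)"
    using bounded_linear.continuous_on[OF bounded_linear_blinfun_inner_right c2] by (simp add: case_prod_unfold)
  have "((\<lambda>x. integral (cbox 0 1) (\<lambda>t. f (x + t *\<^sub>R v))) has_derivative integral (cbox 0 (1::real)) (?fx x0)) (at x0 within UNIV)"
  proof (rule leibniz_rule[OF _ _ c3])
    fix x :: 'a and t :: real
    have "((\<lambda>x. x + t *\<^sub>R v) has_derivative (\<lambda>h. h)) (at x)" by (auto intro!: derivative_eq_intros)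
    from has_derivative_compose[OF this C1onD[OF f UNIV_I]]
    show "((\<lambda>x. f (x + t *\<^sub>R v)) has_derivative blinfun_apply (?fx x t)) (at x within UNIV)" by simp
  next
    fix x :: 'a
    show "(\<lambda>t. f (x + t *\<^sub>R v)) integrable_on cbox 0 1"
      by (intro integrable_continuous continuous_on_compose2[OF cf] continuous_intros) auto
  qed auto
  moreover have "blinfun_apply (integral (cbox 0 (1::real)) (?fx x0)) h = integral {0..1} (\<lambda>t. F (x0 + t *\<^sub>R v)) \<bullet> h" for h
  proof -
    have cFt: "continuous_on {0..1::real} (\<lambda>t. F (x0 + t *\<^sub>R v))"
      by (intro continuous_on_compose2[OF cF] continuous_intros) auto
    have i1: "?fx x0 integrable_on {0..1}"
      by (rule integrable_continuous_interval) (rule bounded_linear.continuous_on[OF bounded_linear_blinfun_inner_right cFt])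
    have "integral {0..1} ((\<lambda>b. blinfun_apply b h) \<circ> ?fx x0) = blinfun_apply (integral {0..1} (?fx x0)) h"
      by (rule integral_linear[OF i1]) (rule blinfun.bounded_linear_left)
    moreover have "integral {0..1} ((\<lambda>y. y \<bullet> h) \<circ> (\<lambda>t. F (x0 + t *\<^sub>R v))) = integral {0..1} (\<lambda>t. F (x0 + t *\<^sub>R v)) \<bullet> h"
      by (rule integral_linear[OF integrable_continuous_interval[OF cFt]]) (rule bounded_linear_inner_left)
    ultimately show ?thesis by (simp add: o_def)
  qed
  ultimately show "((\<lambda>x. integral {0..1} (\<lambda>t. f (x + t *\<^sub>R v))) has_derivative (\<bullet>) (integral {0..1} (\<lambda>t. F (x0 + t *\<^sub>R v)))) (at x0)"
  proof -
    assume d: "((\<lambda>x. integral (cbox 0 1) (\<lambda>t. f (x + t *\<^sub>R v))) has_derivative integral (cbox 0 (1::real)) (?fx x0)) (at x0 within UNIV)"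
      and e: "\<And>h. blinfun_apply (integral (cbox 0 (1::real)) (?fx x0)) h = integral {0..1} (\<lambda>t. F (x0 + t *\<^sub>R v)) \<bullet> h"
    have "blinfun_apply (integral (cbox 0 (1::real)) (?fx x0)) = (\<bullet>) (integral {0..1} (\<lambda>t. F (x0 + t *\<^sub>R v)))"
      by (rule ext) (rule e)
    with d show ?thesis by simp
  qed
qed

text \<open>Averaging the difference quotient \<open>g (x + w) - g x\<close> along \<open>v\<close> makes the derivative along \<open>v\<close> a
  double difference, which is symmetric in \<open>v\<close> and \<open>w\<close>; this replaces the symmetry of the second derivatives of
  \<open>g\<close>.\<close>

definition steklov :: "('a::euclidean_space \<Rightarrow> 'b::euclidean_space) \<Rightarrow> 'a \<Rightarrow> 'a \<Rightarrow> 'a \<Rightarrow> 'b" where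
  "steklov g v w x = integral {0..1} (\<lambda>t::real. g (x + t *\<^sub>R v + w) - g (x + t *\<^sub>R v))"

lemma C1on_steklov:
  assumes g: "C1on UNIV g G"
  shows "C1on UNIV (steklov g v w) (steklov G v w)"
proof -
  have "C1on UNIV (\<lambda>x. g (x + w) - g x) (\<lambda>x. G (x + w) - G x)"
    by (intro C1on_diff C1on_shift g)
  from C1on_average[OF this, of v] show ?thesis by (simp add: steklov_def[abs_def] algebra_simps)
qed

text \<open>Along v the derivative of the integrand is its total derivative in t, so the integral
  collapses to a second difference.\<close>

lemma steklov_grad:
  assumes g: "C1on UNIV g G"
  shows "steklov G v w x \<bullet> v = g (x + v + w) - g (x + v) - g (x + w) + g x"
proof -
  have cG: "continuous_on UNIV G" by (rule C1on_continuous_grad[OF g])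
  let ?\<phi> = "\<lambda>t. g (x + t *\<^sub>R v + w) - g (x + t *\<^sub>R v)"
  let ?\<Phi> = "\<lambda>t. G (x + t *\<^sub>R v + w) - G (x + t *\<^sub>R v)"
  have der: "(?\<phi> has_vector_derivative ?\<Phi> t \<bullet> v) (at t within {0..1})" for t
  proof -
    have d: "((\<lambda>t. g (x + t *\<^sub>R v + c)) has_derivative (\<lambda>s. G (x + t *\<^sub>R v + c) \<bullet> (s *\<^sub>R v))) (at t within {0..1})" for c
    proof -
      have "((\<lambda>t. x + t *\<^sub>R v + c) has_derivative (\<lambda>s. s *\<^sub>R v)) (at t within {0..1})" by (auto intro!: derivative_eq_intros)
      from has_derivative_compose[OF this C1onD[OF g UNIV_I]] show ?thesis .
    qed
    from has_derivative_diff[OF d[of w] d[of 0]] show ?thesis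
      by (simp add: has_vector_derivative_def inner_diff_left algebra_simps)
  qed
  have "((\<lambda>t. ?\<Phi> t \<bullet> v) has_integral ?\<phi> 1 - ?\<phi> 0) {0..1}"
    by (rule fundamental_theorem_of_calculus) (use der in auto)
  moreover have "integral {0..1} ((\<lambda>y. y \<bullet> v) \<circ> ?\<Phi>) = integral {0..1} ?\<Phi> \<bullet> v"
    by (rule integral_linear[OF integrable_continuous_interval bounded_linear_inner_left])
       (intro continuous_on_compose2[OF cG] continuous_intros, auto)
  ultimately show ?thesis by (simp add: steklov_def o_def integral_unique)
qed

text \<open>For each t the mean value theorem turns the difference in direction b into a value of G
  . b at distance at most s (|a| + |b|) from x. With c = G x . b this yields convergence, with c = 0
  a uniform bound.\<close>

lemma steklov_estimate:
  assumes g: "C1on UNIV g G" and s: "0 < s"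
    and close: "\<And>y. dist x y \<le> s * (norm a + norm b) \<Longrightarrow> \<bar>G y \<bullet> b - c\<bar> \<le> \<epsilon>"
  shows "\<bar>steklov g (s *\<^sub>R a) (s *\<^sub>R b) x / s - c\<bar> \<le> \<epsilon>"
proof -
  have cg: "continuous_on UNIV g" by (rule C1on_continuous[OF g])
  let ?\<phi> = "\<lambda>t. g (x + t *\<^sub>R (s *\<^sub>R a) + s *\<^sub>R b) - g (x + t *\<^sub>R (s *\<^sub>R a))"
  have \<epsilon>0: "0 \<le> \<epsilon>" using close[of x] s by (auto intro: order_trans[OF abs_ge_zero])
  have pt: "\<bar>?\<phi> t - s * c\<bar> \<le> s * \<epsilon>" if t: "t \<in> {0..1}" for t
  proof -
    let ?z = "x + t *\<^sub>R (s *\<^sub>R a)"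
    have "\<exists>y. dist x y \<le> s * (norm a + norm b) \<and> ?\<phi> t = s * (G y \<bullet> b)"
    proof (cases "b = 0")
      case True then show ?thesis using s by (intro exI[of _ x]) simp
    next
      case False
      then have "?z \<noteq> ?z + s *\<^sub>R b" using s by simp
      then obtain y where y: "y \<in> open_segment ?z (?z + s *\<^sub>R b)" "g (?z + s *\<^sub>R b) - g ?z = G y \<bullet> (?z + s *\<^sub>R b - ?z)"
        using segment_mvt[of ?z "?z + s *\<^sub>R b" g G] continuous_on_subset[OF cg] C1onD[OF g] by blast
      then obtain \<tau> where \<tau>: "0 < \<tau>" "\<tau> < 1" "y = ?z + \<tau> *\<^sub>R (s *\<^sub>R b)"
        by (auto simp: in_segment algebra_simps)
      have "dist x y = norm (t *\<^sub>R (s *\<^sub>R a) + \<tau> *\<^sub>R (s *\<^sub>R b))" using \<tau>(3) by (simp add: dist_norm norm_minus_commute algebra_simps)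
      also have "\<dots> \<le> norm (t *\<^sub>R (s *\<^sub>R a)) + norm (\<tau> *\<^sub>R (s *\<^sub>R b))" by (rule norm_triangle_ineq)
      also have "\<dots> = t * (s * norm a) + \<tau> * (s * norm b)" using t \<tau> s by simp
      also have "\<dots> \<le> 1 * (s * norm a) + 1 * (s * norm b)" using t \<tau> s by (intro add_mono mult_right_mono) auto
      finally show ?thesis using y(2) by (intro exI[of _ y]) (simp add: algebra_simps)
    qed
    then obtain y where y: "dist x y \<le> s * (norm a + norm b)" "?\<phi> t = s * (G y \<bullet> b)" by blast
    have "\<bar>?\<phi> t - s * c\<bar> = s * \<bar>G y \<bullet> b - c\<bar>" unfolding y(2) using s by (simp add: abs_mult flip: right_diff_distrib)
    also have "\<dots> \<le> s * \<epsilon>" using close[OF y(1)] s by (intro mult_left_mono) auto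
    finally show ?thesis .
  qed
  have i: "?\<phi> integrable_on {0..1}"
    by (intro integrable_continuous_interval continuous_intros continuous_on_compose2[OF cg]) auto
  have "integral {0..1} (\<lambda>t. ?\<phi> t - s * c) = integral {0..1} ?\<phi> - s * c"
    by (subst integral_diff[OF i]) auto
  moreover have "norm (integral {0..1} (\<lambda>t. ?\<phi> t - s * c)) \<le> integral {0..1} (\<lambda>t::real. s * \<epsilon>)"
    using i pt by (intro integral_norm_bound_integral) (auto intro!: integrable_diff)
  ultimately have "\<bar>steklov g (s *\<^sub>R a) (s *\<^sub>R b) x - s * c\<bar> \<le> s * \<epsilon>" by (simp add: steklov_def)
  moreover have "\<bar>steklov g (s *\<^sub>R a) (s *\<^sub>R b) x - s * c\<bar> = s * \<bar>steklov g (s *\<^sub>R a) (s *\<^sub>R b) x / s - c\<bar>"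
  proof -
    have "steklov g (s *\<^sub>R a) (s *\<^sub>R b) x - s * c = s * (steklov g (s *\<^sub>R a) (s *\<^sub>R b) x / s - c)"
      using s by (simp add: right_diff_distrib)
    then show ?thesis using s by (simp only: abs_mult abs_of_pos)
  qed
  ultimately show ?thesis using s by simp
qed

lemma steklov_tendsto:
  assumes g: "C1on UNIV g G"
  shows "(\<lambda>k. steklov g ((1 / real (Suc k)) *\<^sub>R a) ((1 / real (Suc k)) *\<^sub>R b) x / (1 / real (Suc k))) \<longlonglongrightarrow> G x \<bullet> b"
proof (rule LIMSEQ_I)
  fix r :: real assume r: "0 < r"
  have "continuous_on UNIV (\<lambda>y. G y \<bullet> b)" by (intro continuous_intros C1on_continuous_grad[OF g])
  then obtain \<delta> where \<delta>: "0 < \<delta>" "\<And>y. dist y x < \<delta> \<Longrightarrow> dist (G y \<bullet> b) (G x \<bullet> b) < r / 2"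
    using r unfolding continuous_on_iff by (meson UNIV_I half_gt_zero)
  obtain N where N: "(norm a + norm b) / \<delta> < real (Suc N)" by (metis reals_Archimedean2 less_trans of_nat_less_iff lessI)
  show "\<exists>N. \<forall>k\<ge>N. norm (steklov g ((1 / real (Suc k)) *\<^sub>R a) ((1 / real (Suc k)) *\<^sub>R b) x / (1 / real (Suc k)) - G x \<bullet> b) < r"
  proof (intro exI[of _ N] allI impI)
    fix k assume k: "N \<le> k"
    have "\<bar>steklov g ((1 / real (Suc k)) *\<^sub>R a) ((1 / real (Suc k)) *\<^sub>R b) x / (1 / real (Suc k)) - G x \<bullet> b\<bar> \<le> r / 2"
    proof (rule steklov_estimate[OF g])
      fix y assume y: "dist x y \<le> 1 / real (Suc k) * (norm a + norm b)"
      have "(norm a + norm b) / \<delta> < real (Suc k)" using N k by (meson less_le_trans of_nat_le_iff Suc_le_mono)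
      then have "1 / real (Suc k) * (norm a + norm b) < \<delta>" using \<delta>(1) by (simp add: field_simps)
      then have "dist (G y \<bullet> b) (G x \<bullet> b) < r / 2" using y by (intro \<delta>(2)) (simp add: dist_commute)
      then show "\<bar>G y \<bullet> b - G x \<bullet> b\<bar> \<le> r / 2" by (simp add: dist_real_def)
    qed simp
    then show "norm (steklov g ((1 / real (Suc k)) *\<^sub>R a) ((1 / real (Suc k)) *\<^sub>R b) x / (1 / real (Suc k)) - G x \<bullet> b) < r"
      using r by simp
  qed
qed

lemma steklov_bounded:
  assumes g: "C1on UNIV g G" and K: "bounded K"
  obtains M where "\<And>x k. x \<in> K \<Longrightarrow> \<bar>steklov g ((1 / real (Suc k)) *\<^sub>R a) ((1 / real (Suc k)) *\<^sub>R b) x / (1 / real (Suc k))\<bar> \<le> M"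
proof -
  obtain R where R: "\<And>x. x \<in> K \<Longrightarrow> norm x \<le> R" using K by (auto simp: bounded_iff)
  let ?B = "cball 0 (R + (norm a + norm b))"
  have "continuous_on ?B (\<lambda>y. G y \<bullet> b)" by (intro continuous_intros continuous_on_subset[OF C1on_continuous_grad[OF g]]) auto
  then have "bounded ((\<lambda>y. G y \<bullet> b) ` ?B)" by (intro compact_imp_bounded compact_continuous_image) auto
  then obtain M where M: "\<And>y. y \<in> ?B \<Longrightarrow> \<bar>G y \<bullet> b\<bar> \<le> M" unfolding bounded_iff by (metis imageI real_norm_def)
  show ?thesis
  proof (rule that[of M])
    fix x k assume x: "x \<in> K"
    have "\<bar>steklov g ((1 / real (Suc k)) *\<^sub>R a) ((1 / real (Suc k)) *\<^sub>R b) x / (1 / real (Suc k)) - 0\<bar> \<le> M"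
    proof (rule steklov_estimate[OF g])
      fix y assume y: "dist x y \<le> 1 / real (Suc k) * (norm a + norm b)"
      also have "\<dots> \<le> 1 * (norm a + norm b)" by (intro mult_right_mono) auto
      finally have "norm y \<le> R + (norm a + norm b)"
        using R[OF x] norm_triangle_ineq2[of y x] by (simp add: dist_norm norm_minus_commute)
      then show "\<bar>G y \<bullet> b - 0\<bar> \<le> M" using M by simp
    qed simp
    then show "\<bar>steklov g ((1 / real (Suc k)) *\<^sub>R a) ((1 / real (Suc k)) *\<^sub>R b) x / (1 / real (Suc k))\<bar> \<le> M" by simp
  qed
qed

context C1_domain
begin

text \<open>Let \<open>Pb\<close> and \<open>Pa\<close> be the averaged difference quotients of g in
  directions b and a. In the divergence of f (Pb a - Pa b) the derivative of \<open>Pb\<close> along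
  a cancels that of \<open>Pa\<close> along b, both being the same second difference. Dominated
  convergence then replaces the quotients by derivatives of g.\<close>

theorem curl_identity_C1:
  assumes f: "C1on UNIV f F" and g: "C1on UNIV g G"
  shows "(LINT x|lborel. indicator \<Omega> x * ((F x \<bullet> a) * (G x \<bullet> b) - (F x \<bullet> b) * (G x \<bullet> a)))
    = (LINT x|S. f x * ((G x \<bullet> b) * (n x \<bullet> a) - (G x \<bullet> a) * (n x \<bullet> b)))"
proof -
  define \<sigma> where "\<sigma> k = 1 / real (Suc k)" for k
  have \<sigma>: "0 < \<sigma> k" for k by (simp add: \<sigma>_def)
  define Pb where "Pb k x = steklov g (\<sigma> k *\<^sub>R a) (\<sigma> k *\<^sub>R b) x / \<sigma> k" for k x
  define Pa where "Pa k x = steklov g (\<sigma> k *\<^sub>R b) (\<sigma> k *\<^sub>R a) x / \<sigma> k" for k x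
  define Pb' where "Pb' k x = (1 / \<sigma> k) *\<^sub>R steklov G (\<sigma> k *\<^sub>R a) (\<sigma> k *\<^sub>R b) x" for k x
  define Pa' where "Pa' k x = (1 / \<sigma> k) *\<^sub>R steklov G (\<sigma> k *\<^sub>R b) (\<sigma> k *\<^sub>R a) x" for k x
  have CPb: "C1on UNIV (Pb k) (Pb' k)" for k
    using C1on_cmult[OF C1on_steklov[OF g], of "1 / \<sigma> k"] by (simp add: Pb_def[abs_def] Pb'_def[abs_def])
  have CPa: "C1on UNIV (Pa k) (Pa' k)" for k
    using C1on_cmult[OF C1on_steklov[OF g], of "1 / \<sigma> k"] by (simp add: Pa_def[abs_def] Pa'_def[abs_def])
  have sym: "Pb' k x \<bullet> a = Pa' k x \<bullet> b" for k x
  proof -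
    have "\<sigma> k * (steklov G (\<sigma> k *\<^sub>R a) (\<sigma> k *\<^sub>R b) x \<bullet> a) = \<sigma> k * (steklov G (\<sigma> k *\<^sub>R b) (\<sigma> k *\<^sub>R a) x \<bullet> b)"
      using steklov_grad[OF g, of "\<sigma> k *\<^sub>R a" "\<sigma> k *\<^sub>R b" x] steklov_grad[OF g, of "\<sigma> k *\<^sub>R b" "\<sigma> k *\<^sub>R a" x]
      by (simp add: add_ac)
    then show ?thesis using \<sigma>[of k] by (simp add: Pb'_def Pa'_def)
  qed
  let ?L = "\<lambda>k x. indicator \<Omega> x * ((F x \<bullet> a) * Pb k x - (F x \<bullet> b) * Pa k x)"
  let ?R = "\<lambda>k x. f x * (Pb k x * (n x \<bullet> a) - Pa k x * (n x \<bullet> b))"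
  note fPb = C1on_mult[OF f CPb] and fPa = C1on_mult[OF f CPa]
  have eq: "(LINT x|lborel. ?L k x) = (LINT x|S. ?R k x)" for k
  proof -
    have "(LINT x|lborel. ?L k x) = (LINT x|lborel. indicator \<Omega> x * ((f x *\<^sub>R Pb' k x + Pb k x *\<^sub>R F x) \<bullet> a)
        - indicator \<Omega> x * ((f x *\<^sub>R Pa' k x + Pa k x *\<^sub>R F x) \<bullet> b))"
      by (intro Bochner_Integration.integral_cong refl) (simp add: inner_add_left sym algebra_simps)
    also have "\<dots> = (LINT x|S. (f x * Pb k x) * (n x \<bullet> a)) - (LINT x|S. (f x * Pa k x) * (n x \<bullet> b))"
      using C1_integrable(1)[OF fPb] C1_integrable(1)[OF fPa]
      by (subst Bochner_Integration.integral_diff) (simp_all add: divergence_C1[OF fPb] divergence_C1[OF fPa])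
    also have "\<dots> = (LINT x|S. ?R k x)"
      using C1_integrable(2)[OF fPb] C1_integrable(2)[OF fPa]
      by (subst Bochner_Integration.integral_diff[symmetric]) (simp_all add: algebra_simps)
    finally show ?thesis .
  qed
  have limb: "(\<lambda>k. Pb k x) \<longlonglongrightarrow> G x \<bullet> b" for x
    unfolding Pb_def \<sigma>_def by (rule steklov_tendsto[OF g])
  have lima: "(\<lambda>k. Pa k x) \<longlonglongrightarrow> G x \<bullet> a" for x
    unfolding Pa_def \<sigma>_def by (rule steklov_tendsto[OF g])
  have bc: "bounded (closure \<Omega>)" using bounded_\<Omega> by (rule bounded_closure)
  obtain Mb where Mb: "\<And>x k. x \<in> closure \<Omega> \<Longrightarrow> \<bar>Pb k x\<bar> \<le> Mb"
    unfolding Pb_def \<sigma>_def using steklov_bounded[OF g bc] by metis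
  obtain Ma where Ma: "\<And>x k. x \<in> closure \<Omega> \<Longrightarrow> \<bar>Pa k x\<bar> \<le> Ma"
    unfolding Pa_def \<sigma>_def using steklov_bounded[OF g bc] by metis
  have cF: "continuous_on A F" and cf: "continuous_on A f" and cG: "continuous_on A G"
    and cPb: "continuous_on A (Pb k)" and cPa: "continuous_on A (Pa k)" for A k
    using C1on_continuous_grad[OF f] C1on_continuous[OF f] C1on_continuous_grad[OF g] C1on_continuous[OF CPb] C1on_continuous[OF CPa]
    by (auto intro: continuous_on_subset)
  have "(\<lambda>k. LINT x|lborel. ?L k x) \<longlonglongrightarrow> (LINT x|lborel. indicator \<Omega> x * ((F x \<bullet> a) * (G x \<bullet> b) - (F x \<bullet> b) * (G x \<bullet> a)))"
  proof (rule integral_dominated_convergence[where w = "\<lambda>x. indicator \<Omega> x * (\<bar>F x \<bullet> a\<bar> * Mb + \<bar>F x \<bullet> b\<bar> * Ma)"])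
    show "(\<lambda>x. indicator \<Omega> x * ((F x \<bullet> a) * (G x \<bullet> b) - (F x \<bullet> b) * (G x \<bullet> a))) \<in> borel_measurable lborel"
      by (rule borel_measurable_integrable, rule integrable_volume) (intro continuous_intros cF cG)
    show "?L k \<in> borel_measurable lborel" for k
      by (rule borel_measurable_integrable, rule integrable_volume) (intro continuous_intros cF cPa cPb)
    show "integrable lborel (\<lambda>x. indicator \<Omega> x * (\<bar>F x \<bullet> a\<bar> * Mb + \<bar>F x \<bullet> b\<bar> * Ma))"
      by (rule integrable_volume) (intro continuous_intros cF)
    show "AE x in lborel. (\<lambda>k. ?L k x) \<longlonglongrightarrow> indicator \<Omega> x * ((F x \<bullet> a) * (G x \<bullet> b) - (F x \<bullet> b) * (G x \<bullet> a))"
      by (intro always_eventually allI tendsto_intros limb lima)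
    show "AE x in lborel. norm (?L k x) \<le> indicator \<Omega> x * (\<bar>F x \<bullet> a\<bar> * Mb + \<bar>F x \<bullet> b\<bar> * Ma)" for k
    proof (intro always_eventually allI)
      fix x
      show "norm (?L k x) \<le> indicator \<Omega> x * (\<bar>F x \<bullet> a\<bar> * Mb + \<bar>F x \<bullet> b\<bar> * Ma)"
      proof (cases "x \<in> \<Omega>")
        case True
        then have x: "x \<in> closure \<Omega>" using closure_subset by blast
        have "\<bar>(F x \<bullet> a) * Pb k x - (F x \<bullet> b) * Pa k x\<bar> \<le> \<bar>F x \<bullet> a\<bar> * \<bar>Pb k x\<bar> + \<bar>F x \<bullet> b\<bar> * \<bar>Pa k x\<bar>"
          by (metis abs_mult abs_triangle_ineq4)
        also have "\<dots> \<le> \<bar>F x \<bullet> a\<bar> * Mb + \<bar>F x \<bullet> b\<bar> * Ma"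
          using Mb[OF x] Ma[OF x] by (intro add_mono mult_left_mono) auto
        finally show ?thesis using True by simp
      qed simp
    qed
  qed
  moreover have "(\<lambda>k. LINT x|S. ?R k x) \<longlonglongrightarrow> (LINT x|S. f x * ((G x \<bullet> b) * (n x \<bullet> a) - (G x \<bullet> a) * (n x \<bullet> b)))"
  proof (rule integral_dominated_convergence[where w = "\<lambda>x. \<bar>f x\<bar> * (Mb * \<bar>n x \<bullet> a\<bar> + Ma * \<bar>n x \<bullet> b\<bar>)"])
    show "(\<lambda>x. f x * ((G x \<bullet> b) * (n x \<bullet> a) - (G x \<bullet> a) * (n x \<bullet> b))) \<in> borel_measurable S"
      by (rule borel_measurable_integrable, rule integrable_surface) (intro continuous_intros cf cG cont_n)
    show "?R k \<in> borel_measurable S" for k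
      by (rule borel_measurable_integrable, rule integrable_surface) (intro continuous_intros cf cPa cPb cont_n)
    show "integrable S (\<lambda>x. \<bar>f x\<bar> * (Mb * \<bar>n x \<bullet> a\<bar> + Ma * \<bar>n x \<bullet> b\<bar>))"
      by (rule integrable_surface) (intro continuous_intros cf cont_n)
    show "AE x in S. (\<lambda>k. ?R k x) \<longlonglongrightarrow> f x * ((G x \<bullet> b) * (n x \<bullet> a) - (G x \<bullet> a) * (n x \<bullet> b))"
      by (intro always_eventually allI tendsto_intros limb lima)
    show "AE x in S. norm (?R k x) \<le> \<bar>f x\<bar> * (Mb * \<bar>n x \<bullet> a\<bar> + Ma * \<bar>n x \<bullet> b\<bar>)" for k
    proof (rule AE_I2)
      fix x assume "x \<in> space S"
      then have x: "x \<in> closure \<Omega>" by (simp add: frontier_iff)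
      have "\<bar>Pb k x * (n x \<bullet> a) - Pa k x * (n x \<bullet> b)\<bar> \<le> \<bar>Pb k x\<bar> * \<bar>n x \<bullet> a\<bar> + \<bar>Pa k x\<bar> * \<bar>n x \<bullet> b\<bar>"
        by (metis abs_mult abs_triangle_ineq4)
      also have "\<dots> \<le> Mb * \<bar>n x \<bullet> a\<bar> + Ma * \<bar>n x \<bullet> b\<bar>"
        using Mb[OF x] Ma[OF x] by (intro add_mono mult_right_mono) auto
      finally show "norm (?R k x) \<le> \<bar>f x\<bar> * (Mb * \<bar>n x \<bullet> a\<bar> + Ma * \<bar>n x \<bullet> b\<bar>)"
        by (simp add: abs_mult mult_left_mono)
    qed
  qed
  ultimately show ?thesis unfolding eq by (rule LIMSEQ_unique)
qed

end

section \<open>Functions differentiable up to the boundary\<close>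

context C1_domain
begin

text \<open>On the boundary F is a mere limit of interior gradients; that it is a derivative there
  is the content of \<open>C1bar_has_derivative\<close>.\<close>

definition C1bar :: "(real^'n \<Rightarrow> real) \<Rightarrow> (real^'n \<Rightarrow> real^'n) \<Rightarrow> bool" where
  "C1bar f F \<longleftrightarrow> C1on \<Omega> f F \<and> continuous_on (closure \<Omega>) f \<and> continuous_on (closure \<Omega>) F"

text \<open>At a boundary point d is the normal: a step along -d has slope -1 and falls into the
  cone of slope 1/2. At an interior point d = 0 serves.\<close>

lemma inward_shift:
  assumes p: "p \<in> closure \<Omega>"
  shows "\<exists>r d e. 0 < r \<and> 0 < e \<and> (\<forall>x\<in>closure \<Omega> \<inter> cball p r. \<forall>s. 0 < s \<and> s \<le> e \<longrightarrow> x - s *\<^sub>R d \<in> \<Omega>)"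
proof (cases "p \<in> \<Omega>")
  case True
  then obtain r where r: "0 < r" "cball p r \<subseteq> \<Omega>" using open_\<Omega> open_contains_cball by blast
  then show ?thesis by (intro exI[of _ r] exI[of _ 0] exI[of _ 1]) auto
next
  case False
  then have p: "p \<in> \<Gamma>" using p by (simp add: frontier_iff)
  obtain \<rho> where \<rho>: "0 < \<rho>" "\<And>x y. x \<in> ball p \<rho> \<Longrightarrow> y \<in> ball p \<rho> \<Longrightarrow> x \<in> closure \<Omega> \<Longrightarrow> n p \<bullet> (y - x) < - (1/2) * norm (y - x) \<Longrightarrow> y \<in> \<Omega>"
    using cone[OF p, of "1/2"] by auto
  have np: "n p \<bullet> n p = 1" using norm_n[OF p] by (simp add: norm_eq_1)
  have "x - s *\<^sub>R n p \<in> \<Omega>" if x: "x \<in> closure \<Omega> \<inter> cball p (\<rho>/2)" and s: "0 < s" "s \<le> \<rho>/4" for x s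
  proof (rule \<rho>(2))
    show "x \<in> ball p \<rho>" "x \<in> closure \<Omega>" using x \<rho>(1) by auto
    have "norm (p - (x - s *\<^sub>R n p)) \<le> norm (p - x) + norm (s *\<^sub>R n p)"
      using norm_triangle_ineq[of "p - x" "s *\<^sub>R n p"] by (simp add: algebra_simps)
    then show "x - s *\<^sub>R n p \<in> ball p \<rho>" using x s \<rho>(1) norm_n[OF p] by (simp add: dist_norm)
    show "n p \<bullet> (x - s *\<^sub>R n p - x) < - (1/2) * norm (x - s *\<^sub>R n p - x)"
      using s norm_n[OF p] np by simp
  qed
  then show ?thesis using \<rho>(1) by (intro exI[of _ "\<rho>/2"] exI[of _ "n p"] exI[of _ "\<rho>/4"]) auto
qed

text \<open>The shifted functions f (x - \<sigma> d) and g (x - \<sigma> d) are C^1 on an open set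
  containing the part of the closed domain near p. Cut off, they enter
  \<open>curl_identity_C1\<close>; as \<sigma> tends to 0, continuity up to the closure gives
  convergence and compactness gives the majorants. The partition function \<eta> is C^1 on the whole
  space and is not shifted.\<close>

lemma curl_identity_local:
  assumes f: "C1bar f F" and g: "C1bar g G" and \<eta>: "C1on UNIV \<eta> E" "\<And>x. r \<le> dist x p \<Longrightarrow> \<eta> x = 0"
    and shift: "\<And>x s. x \<in> closure \<Omega> \<Longrightarrow> x \<in> cball p r \<Longrightarrow> 0 < s \<Longrightarrow> s \<le> e \<Longrightarrow> x - s *\<^sub>R d \<in> \<Omega>" and e: "0 < e"
  shows "(LINT x|lborel. indicator \<Omega> x * (((\<eta> x *\<^sub>R F x + f x *\<^sub>R E x) \<bullet> a) * (G x \<bullet> b) - ((\<eta> x *\<^sub>R F x + f x *\<^sub>R E x) \<bullet> b) * (G x \<bullet> a)))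
    = (LINT x|S. (\<eta> x * f x) * ((G x \<bullet> b) * (n x \<bullet> a) - (G x \<bullet> a) * (n x \<bullet> b)))"
proof -
  let ?K = "closure \<Omega> \<inter> cball p r"
  define \<sigma> where "\<sigma> k = e / real (Suc k)" for k
  have \<sigma>: "0 < \<sigma> k" "\<sigma> k \<le> e" for k using e by (auto simp: \<sigma>_def field_simps)
  have cK: "compact ?K" using compact_closure_\<Omega> by (intro compact_Int_closed) auto
  have fc: "C1on \<Omega> f F" "continuous_on (closure \<Omega>) f" "continuous_on (closure \<Omega>) F"
    and gc: "C1on \<Omega> g G" "continuous_on (closure \<Omega>) g" "continuous_on (closure \<Omega>) G"
    using f g by (auto simp: C1bar_def)
  have sh: "x - \<sigma> k *\<^sub>R d \<in> \<Omega>" if "x \<in> ?K" for x k using that shift \<sigma> by auto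
  have \<eta>out: "\<eta> x = 0" "E x = 0" if "x \<notin> cball p r" for x
  proof -
    show "\<eta> x = 0" using \<eta>(2)[of x] that by (auto simp: dist_commute)
    show "E x = 0" by (rule C1on_grad_zero[OF \<eta>(1) closed_cball _ that]) (auto intro: \<eta>(2) simp: dist_commute)
  qed
  \<comment> \<open>Collects what the limit needs from the extensions at shift \<sigma> k, so that
    all four can be chosen at once: their values on the closed piece near p, and the vanishing of
    the first pair off the ball.\<close>
  define A where "A k fe Fe ge Ge \<longleftrightarrow> C1on UNIV fe Fe \<and> C1on UNIV ge Ge \<and>
     (\<forall>x\<in>?K. fe x = \<eta> x * f (x - \<sigma> k *\<^sub>R d) \<and> Fe x = \<eta> x *\<^sub>R F (x - \<sigma> k *\<^sub>R d) + f (x - \<sigma> k *\<^sub>R d) *\<^sub>R E x \<and> Ge x = G (x - \<sigma> k *\<^sub>R d)) \<and>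
     (\<forall>x. x \<notin> cball p r \<longrightarrow> fe x = 0 \<and> Fe x = 0)" for k fe Fe ge Ge
  have "\<exists>fe Fe ge Ge. A k fe Fe ge Ge" for k
  proof -
    let ?v = "\<sigma> k *\<^sub>R d" and ?U = "(\<lambda>x. x - \<sigma> k *\<^sub>R d) -` \<Omega>"
    have U: "open ?U" using open_\<Omega> by (intro continuous_open_vimage) (auto intro!: continuous_intros)
    have KU: "?K \<subseteq> ?U" using sh by auto
    obtain \<theta> T L V where \<theta>: "C1on UNIV \<theta> T" "compact L" "L \<subseteq> ?U" "\<And>x. x \<notin> L \<Longrightarrow> \<theta> x = 0"
      "open V" "?K \<subseteq> V" "\<And>x. x \<in> V \<Longrightarrow> \<theta> x = 1"
      by (rule C1_cutoff[OF cK U KU]) (rule that, assumption+)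
    have T0: "T x = 0" if "x \<in> V" for x
      by (rule C1on_grad_unique[OF \<theta>(1) C1on_const[of UNIV 1] \<theta>(5) that]) (auto simp: \<theta>(7))
    have fU: "C1on ?U (\<lambda>x. f (x - ?v)) (\<lambda>x. F (x - ?v))" and gU: "C1on ?U (\<lambda>x. g (x - ?v)) (\<lambda>x. G (x - ?v))"
      by (rule C1on_translate[OF fc(1)], rule C1on_translate[OF gc(1)])
    have \<theta>\<eta>: "C1on UNIV (\<lambda>x. \<theta> x * \<eta> x) (\<lambda>x. \<theta> x *\<^sub>R E x + \<eta> x *\<^sub>R T x)" by (rule C1on_mult[OF \<theta>(1) \<eta>(1)])
    define fe where "fe x = (if x \<in> ?U then (\<theta> x * \<eta> x) * f (x - ?v) else 0)" for x
    define Fe where "Fe x = (if x \<in> ?U then (\<theta> x * \<eta> x) *\<^sub>R F (x - ?v) + f (x - ?v) *\<^sub>R (\<theta> x *\<^sub>R E x + \<eta> x *\<^sub>R T x) else 0)" for x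
    define ge where "ge x = (if x \<in> ?U then \<theta> x * g (x - ?v) else 0)" for x
    define Ge where "Ge x = (if x \<in> ?U then \<theta> x *\<^sub>R G (x - ?v) + g (x - ?v) *\<^sub>R T x else 0)" for x
    have 1: "C1on UNIV fe Fe" unfolding fe_def Fe_def
      by (rule C1on_extend_zero[OF fU U \<theta>\<eta> compact_imp_closed[OF \<theta>(2)] \<theta>(3)]) (simp add: \<theta>(4))
    have 2: "C1on UNIV ge Ge" unfolding ge_def Ge_def
      by (rule C1on_extend_zero[OF gU U \<theta>(1) compact_imp_closed[OF \<theta>(2)] \<theta>(3)]) (simp add: \<theta>(4))
    have 3: "fe x = \<eta> x * f (x - ?v) \<and> Fe x = \<eta> x *\<^sub>R F (x - ?v) + f (x - ?v) *\<^sub>R E x \<and> Ge x = G (x - ?v)" if "x \<in> ?K" for x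
    proof -
      have "x \<in> ?U" "x \<in> V" using that KU \<theta>(6) by auto
      then show ?thesis using \<theta>(7)[of x] T0[of x] by (simp add: fe_def Fe_def Ge_def)
    qed
    have "fe x = 0" if "x \<notin> cball p r" for x using \<eta>out[OF that] by (simp add: fe_def)
    moreover have "Fe x = 0" if "x \<notin> cball p r" for x using \<eta>out[OF that] by (simp add: Fe_def)
    ultimately have "A k fe Fe ge Ge" unfolding A_def using 1 2 3 by blast
    then show ?thesis by blast
  qed
  then obtain fe Fe ge Ge where "\<And>k. A k (fe k) (Fe k) (ge k) (Ge k)" by metis
  then have C: "\<And>k. C1on UNIV (fe k) (Fe k)" "\<And>k. C1on UNIV (ge k) (Ge k)"
    and on: "\<And>k x. x \<in> ?K \<Longrightarrow> fe k x = \<eta> x * f (x - \<sigma> k *\<^sub>R d)"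
      "\<And>k x. x \<in> ?K \<Longrightarrow> Fe k x = \<eta> x *\<^sub>R F (x - \<sigma> k *\<^sub>R d) + f (x - \<sigma> k *\<^sub>R d) *\<^sub>R E x"
      "\<And>k x. x \<in> ?K \<Longrightarrow> Ge k x = G (x - \<sigma> k *\<^sub>R d)"
    and off: "\<And>k x. x \<notin> cball p r \<Longrightarrow> fe k x = 0" "\<And>k x. x \<notin> cball p r \<Longrightarrow> Fe k x = 0"
    unfolding A_def by blast+
  let ?F = "\<lambda>x. \<eta> x *\<^sub>R F x + f x *\<^sub>R E x"
  let ?L = "\<lambda>k x. indicator \<Omega> x * ((Fe k x \<bullet> a) * (Ge k x \<bullet> b) - (Fe k x \<bullet> b) * (Ge k x \<bullet> a))"
  let ?R = "\<lambda>k x. fe k x * ((Ge k x \<bullet> b) * (n x \<bullet> a) - (Ge k x \<bullet> a) * (n x \<bullet> b))"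
  note eq = curl_identity_C1[OF C]
  have \<sigma>0: "\<sigma> \<longlonglongrightarrow> 0" unfolding \<sigma>_def by (rule LIMSEQ_Suc[OF lim_const_over_n])
  have lim0: "(\<lambda>k. x - \<sigma> k *\<^sub>R d) \<longlonglongrightarrow> x" for x
    using tendsto_diff[OF tendsto_const tendsto_scaleR[OF \<sigma>0 tendsto_const], of x d] by simp
  have limf: "(\<lambda>k. f (x - \<sigma> k *\<^sub>R d)) \<longlonglongrightarrow> f x" and limF: "(\<lambda>k. F (x - \<sigma> k *\<^sub>R d)) \<longlonglongrightarrow> F x"
    and limG: "(\<lambda>k. G (x - \<sigma> k *\<^sub>R d)) \<longlonglongrightarrow> G x" if x: "x \<in> ?K" for x
  proof -
    have "\<forall>\<^sub>F k in sequentially. x - \<sigma> k *\<^sub>R d \<in> closure \<Omega>"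
      using sh[OF x] closure_subset by (intro always_eventually) blast
    then show "(\<lambda>k. f (x - \<sigma> k *\<^sub>R d)) \<longlonglongrightarrow> f x" "(\<lambda>k. F (x - \<sigma> k *\<^sub>R d)) \<longlonglongrightarrow> F x" "(\<lambda>k. G (x - \<sigma> k *\<^sub>R d)) \<longlonglongrightarrow> G x"
      using x by (auto intro!: continuous_on_tendsto_compose[OF _ lim0] fc gc)
  qed
  have bdd: "\<exists>M>0. \<forall>x\<in>closure \<Omega>. norm (h x) \<le> M" if "continuous_on (closure \<Omega>) h" for h :: "real^'n \<Rightarrow> 'c::real_normed_vector"
    using compact_imp_bounded[OF compact_continuous_image[OF that compact_closure_\<Omega>]] unfolding bounded_pos by auto
  obtain Mf where Mf: "0 < Mf" "\<And>x. x \<in> closure \<Omega> \<Longrightarrow> \<bar>f x\<bar> \<le> Mf" using bdd[OF fc(2)] by auto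
  obtain MF where MF: "0 < MF" "\<And>x. x \<in> closure \<Omega> \<Longrightarrow> norm (F x) \<le> MF" using bdd[OF fc(3)] by blast
  obtain MG where MG: "0 < MG" "\<And>x. x \<in> closure \<Omega> \<Longrightarrow> norm (G x) \<le> MG" using bdd[OF gc(3)] by blast
  obtain M\<eta> where M\<eta>: "0 < M\<eta>" "\<And>x. x \<in> closure \<Omega> \<Longrightarrow> \<bar>\<eta> x\<bar> \<le> M\<eta>"
    using bdd[OF continuous_on_subset[OF C1on_continuous[OF \<eta>(1)] subset_UNIV]] by auto
  obtain ME where ME: "0 < ME" "\<And>x. x \<in> closure \<Omega> \<Longrightarrow> norm (E x) \<le> ME"
    using bdd[OF continuous_on_subset[OF C1on_continuous_grad[OF \<eta>(1)] subset_UNIV]] by blast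
  note M = Mf(1) MF(1) MG(1) M\<eta>(1) ME(1) Mf(2) MF(2) MG(2) M\<eta>(2) ME(2)
  define B where "B = M\<eta> * MF + Mf * ME"
  have Bpos: "0 < B" using M by (simp add: B_def add_pos_pos)
  have FeB: "norm (Fe k x) \<le> B" and feB: "\<bar>fe k x\<bar> \<le> M\<eta> * Mf" and GeB: "norm (Ge k x) \<le> MG" if x: "x \<in> ?K" for k x
  proof -
    have y: "x - \<sigma> k *\<^sub>R d \<in> closure \<Omega>" using sh[OF x] closure_subset by blast
    have xc: "x \<in> closure \<Omega>" using x by simp
    show "norm (Ge k x) \<le> MG" using on(3)[OF x] M(8)[OF y] by simp
    show "\<bar>fe k x\<bar> \<le> M\<eta> * Mf" unfolding on(1)[OF x] abs_mult using M y xc by (intro mult_mono) auto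
    have "norm (Fe k x) \<le> norm (\<eta> x *\<^sub>R F (x - \<sigma> k *\<^sub>R d)) + norm (f (x - \<sigma> k *\<^sub>R d) *\<^sub>R E x)"
      unfolding on(2)[OF x] by (rule norm_triangle_ineq)
    also have "\<dots> \<le> B" unfolding B_def norm_scaleR using M y xc by (intro add_mono mult_mono) auto
    finally show "norm (Fe k x) \<le> B" .
  qed
  have ip: "\<bar>u \<bullet> a\<bar> \<le> m * norm a" "\<bar>u \<bullet> b\<bar> \<le> m * norm b" if "norm u \<le> m" for u m
    using that by (auto intro: order_trans[OF Cauchy_Schwarz_ineq2 mult_right_mono])
  have cross: "\<bar>s1 * t1 - s2 * t2\<bar> \<le> A1 * B1 + A2 * B2"
    if "\<bar>s1\<bar> \<le> A1" "\<bar>t1\<bar> \<le> B1" "\<bar>s2\<bar> \<le> A2" "\<bar>t2\<bar> \<le> B2" for s1 t1 s2 t2 A1 B1 A2 B2 :: real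
  proof -
    have "\<bar>s1 * t1 - s2 * t2\<bar> \<le> \<bar>s1\<bar> * \<bar>t1\<bar> + \<bar>s2\<bar> * \<bar>t2\<bar>" by (metis abs_mult abs_triangle_ineq4)
    also have "\<dots> \<le> A1 * B1 + A2 * B2" using that by (intro add_mono mult_mono) (auto intro: order_trans[OF abs_ge_zero])
    finally show ?thesis .
  qed
  have c\<eta>: "continuous_on A \<eta>" and cE: "continuous_on A E" for A
    using C1on_continuous[OF \<eta>(1)] C1on_continuous_grad[OF \<eta>(1)] by (auto intro: continuous_on_subset)
  have cC: "continuous_on A (fe k)" "continuous_on A (Fe k)" "continuous_on A (Ge k)" for A k
    using C1on_continuous[OF C(1)] C1on_continuous_grad[OF C(1)] C1on_continuous_grad[OF C(2)] by (auto intro: continuous_on_subset)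
  have "(\<lambda>k. LINT x|lborel. ?L k x) \<longlonglongrightarrow> (LINT x|lborel. indicator \<Omega> x * ((?F x \<bullet> a) * (G x \<bullet> b) - (?F x \<bullet> b) * (G x \<bullet> a)))"
  proof (rule integral_dominated_convergence[where w = "\<lambda>x. indicator \<Omega> x * ((B * norm a) * (MG * norm b) + (B * norm b) * (MG * norm a))"])
    show "(\<lambda>x. indicator \<Omega> x * ((?F x \<bullet> a) * (G x \<bullet> b) - (?F x \<bullet> b) * (G x \<bullet> a))) \<in> borel_measurable lborel"
      by (rule borel_measurable_integrable, rule integrable_volume) (intro continuous_intros c\<eta> cE fc gc)
    show "?L k \<in> borel_measurable lborel" for k
      by (rule borel_measurable_integrable, rule integrable_volume) (intro continuous_intros cC)
    show "integrable lborel (\<lambda>x. indicator \<Omega> x * ((B * norm a) * (MG * norm b) + (B * norm b) * (MG * norm a)))"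
      by (rule integrable_volume) (intro continuous_intros)
    show "AE x in lborel. (\<lambda>k. ?L k x) \<longlonglongrightarrow> indicator \<Omega> x * ((?F x \<bullet> a) * (G x \<bullet> b) - (?F x \<bullet> b) * (G x \<bullet> a))"
    proof (intro always_eventually allI)
      fix x
      show "(\<lambda>k. ?L k x) \<longlonglongrightarrow> indicator \<Omega> x * ((?F x \<bullet> a) * (G x \<bullet> b) - (?F x \<bullet> b) * (G x \<bullet> a))"
      proof (cases "x \<in> \<Omega> \<inter> cball p r")
        case True
        then have x: "x \<in> ?K" using closure_subset by blast
        show ?thesis unfolding on(2)[OF x] on(3)[OF x] by (intro tendsto_intros limf[OF x] limF[OF x] limG[OF x])
      next
        case False
        then consider "x \<notin> \<Omega>" | "x \<notin> cball p r" by blast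
        then show ?thesis by cases (simp_all add: off \<eta>out)
      qed
    qed
    show "AE x in lborel. norm (?L k x) \<le> indicator \<Omega> x * ((B * norm a) * (MG * norm b) + (B * norm b) * (MG * norm a))" for k
    proof (intro always_eventually allI)
      fix x
      have nn: "0 \<le> (B * norm a) * (MG * norm b) + (B * norm b) * (MG * norm a)" using M Bpos by simp
      show "norm (?L k x) \<le> indicator \<Omega> x * ((B * norm a) * (MG * norm b) + (B * norm b) * (MG * norm a))"
      proof (cases "x \<in> \<Omega> \<inter> cball p r")
        case True
        then have x: "x \<in> ?K" using closure_subset by blast
        have "\<bar>(Fe k x \<bullet> a) * (Ge k x \<bullet> b) - (Fe k x \<bullet> b) * (Ge k x \<bullet> a)\<bar> \<le> (B * norm a) * (MG * norm b) + (B * norm b) * (MG * norm a)"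
          by (intro cross ip FeB[OF x] GeB[OF x])
        then show ?thesis using True by simp
      next
        case False
        then consider "x \<notin> \<Omega>" | "x \<notin> cball p r" by blast
        then show ?thesis using nn by cases (simp_all add: off \<eta>out)
      qed
    qed
  qed
  moreover have "(\<lambda>k. LINT x|S. ?R k x) \<longlonglongrightarrow> (LINT x|S. (\<eta> x * f x) * ((G x \<bullet> b) * (n x \<bullet> a) - (G x \<bullet> a) * (n x \<bullet> b)))"
  proof (rule integral_dominated_convergence[where w = "\<lambda>x. (M\<eta> * Mf) * ((MG * norm b) * (1 * norm a) + (MG * norm a) * (1 * norm b))"])
    have sub: "\<Gamma> \<subseteq> closure \<Omega>" by (auto simp: frontier_iff)
    note fcs = continuous_on_subset[OF fc(2) sub] continuous_on_subset[OF gc(3) sub]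
    show "(\<lambda>x. (\<eta> x * f x) * ((G x \<bullet> b) * (n x \<bullet> a) - (G x \<bullet> a) * (n x \<bullet> b))) \<in> borel_measurable S"
      by (rule borel_measurable_integrable, rule integrable_surface) (intro continuous_intros c\<eta> fcs cont_n)
    show "?R k \<in> borel_measurable S" for k
      by (rule borel_measurable_integrable, rule integrable_surface) (intro continuous_intros cC cont_n)
    show "integrable S (\<lambda>x. (M\<eta> * Mf) * ((MG * norm b) * (1 * norm a) + (MG * norm a) * (1 * norm b)))"
      by (rule integrable_surface) (intro continuous_intros)
    show "AE x in S. (\<lambda>k. ?R k x) \<longlonglongrightarrow> (\<eta> x * f x) * ((G x \<bullet> b) * (n x \<bullet> a) - (G x \<bullet> a) * (n x \<bullet> b))"
    proof (rule AE_I2)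
      fix x assume xs: "x \<in> space S"
      show "(\<lambda>k. ?R k x) \<longlonglongrightarrow> (\<eta> x * f x) * ((G x \<bullet> b) * (n x \<bullet> a) - (G x \<bullet> a) * (n x \<bullet> b))"
      proof (cases "x \<in> cball p r")
        case True
        then have x: "x \<in> ?K" using xs by (simp add: frontier_iff)
        show ?thesis unfolding on(1)[OF x] on(3)[OF x] by (intro tendsto_intros limf[OF x] limG[OF x])
      qed (simp add: off \<eta>out)
    qed
    show "AE x in S. norm (?R k x) \<le> (M\<eta> * Mf) * ((MG * norm b) * (1 * norm a) + (MG * norm a) * (1 * norm b))" for k
    proof (rule AE_I2)
      fix x assume xs: "x \<in> space S"
      show "norm (?R k x) \<le> (M\<eta> * Mf) * ((MG * norm b) * (1 * norm a) + (MG * norm a) * (1 * norm b))"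
      proof (cases "x \<in> cball p r")
        case True
        then have x: "x \<in> ?K" using xs by (simp add: frontier_iff)
        have nx: "norm (n x) \<le> 1" using norm_n xs by simp
        have "\<bar>(Ge k x \<bullet> b) * (n x \<bullet> a) - (Ge k x \<bullet> a) * (n x \<bullet> b)\<bar> \<le> (MG * norm b) * (1 * norm a) + (MG * norm a) * (1 * norm b)"
          by (intro cross ip GeB[OF x] nx)
        then show ?thesis unfolding real_norm_def abs_mult using feB[OF x, of k] M by (intro mult_mono) auto
      next
        case False
        then show ?thesis using M by (simp add: off)
      qed
    qed
  qed
  ultimately show ?thesis unfolding eq by (rule LIMSEQ_unique)
qed

text \<open>The identity is linear in f, so only f is partitioned. The gradients of the partition
  functions sum to 0, so the gradients of the pieces sum to F.\<close>

theorem curl_identity_bar: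
  assumes f: "C1bar f F" and g: "C1bar g G"
  shows "(LINT x|lborel. indicator \<Omega> x * ((F x \<bullet> a) * (G x \<bullet> b) - (F x \<bullet> b) * (G x \<bullet> a)))
    = (LINT x|S. f x * ((G x \<bullet> b) * (n x \<bullet> a) - (G x \<bullet> a) * (n x \<bullet> b)))"
proof -
  obtain r d e where rde: "\<And>p. p \<in> closure \<Omega> \<Longrightarrow> 0 < r p" "\<And>p. p \<in> closure \<Omega> \<Longrightarrow> 0 < (e p :: real)"
    "\<And>p x s. p \<in> closure \<Omega> \<Longrightarrow> x \<in> closure \<Omega> \<Longrightarrow> x \<in> cball p (r p) \<Longrightarrow> 0 < s \<Longrightarrow> s \<le> e p \<Longrightarrow> x - s *\<^sub>R d p \<in> \<Omega>"
    using inward_shift by (metis IntI)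
  obtain P \<eta> E V where P: "finite P" "P \<subseteq> closure \<Omega>" "\<And>p. p \<in> P \<Longrightarrow> C1on UNIV (\<eta> p) (E p)"
    "\<And>p x. p \<in> P \<Longrightarrow> 0 \<le> \<eta> p x" "\<And>p x. p \<in> P \<Longrightarrow> r p \<le> dist x p \<Longrightarrow> \<eta> p x = 0"
    "open V" "closure \<Omega> \<subseteq> V" "\<And>x. x \<in> V \<Longrightarrow> (\<Sum>p\<in>P. \<eta> p x) = 1"
    by (rule C1_partition_of_unity[OF compact_closure_\<Omega> rde(1)]) auto
  have E0: "(\<Sum>p\<in>P. E p x) = 0" if "x \<in> V" for x
    by (rule C1on_grad_unique[OF C1on_sum[OF P(1,3)] C1on_const[of UNIV 1] P(6) that]) (auto simp: P(8))
  have fc: "continuous_on (closure \<Omega>) f" "continuous_on (closure \<Omega>) F" "continuous_on (closure \<Omega>) G"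
    using f g by (auto simp: C1bar_def)
  let ?F = "\<lambda>p x. \<eta> p x *\<^sub>R F x + f x *\<^sub>R E p x"
  have loc: "(LINT x|lborel. indicator \<Omega> x * ((?F p x \<bullet> a) * (G x \<bullet> b) - (?F p x \<bullet> b) * (G x \<bullet> a)))
    = (LINT x|S. (\<eta> p x * f x) * ((G x \<bullet> b) * (n x \<bullet> a) - (G x \<bullet> a) * (n x \<bullet> b)))" if "p \<in> P" for p
    using that P(2) rde by (intro curl_identity_local[OF f g P(3) P(5), where e = "e p" and d = "d p"]) blast+
  have c: "continuous_on A (\<eta> p)" "continuous_on A (E p)" if "p \<in> P" for A p
    using C1on_continuous[OF P(3)[OF that]] C1on_continuous_grad[OF P(3)[OF that]] by (auto intro: continuous_on_subset)
  have Fs: "F x = (\<Sum>p\<in>P. ?F p x)" and fs: "f x = (\<Sum>p\<in>P. \<eta> p x * f x)" if "x \<in> closure \<Omega>" for x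
    using P(7,8) E0 that by (auto simp: sum.distrib simp flip: scaleR_left.sum scaleR_right.sum sum_distrib_right)
  have "(LINT x|lborel. indicator \<Omega> x * ((F x \<bullet> a) * (G x \<bullet> b) - (F x \<bullet> b) * (G x \<bullet> a)))
     = (LINT x|lborel. (\<Sum>p\<in>P. indicator \<Omega> x * ((?F p x \<bullet> a) * (G x \<bullet> b) - (?F p x \<bullet> b) * (G x \<bullet> a))))"
  proof (intro Bochner_Integration.integral_cong refl)
    fix x
    show "indicator \<Omega> x * ((F x \<bullet> a) * (G x \<bullet> b) - (F x \<bullet> b) * (G x \<bullet> a))
      = (\<Sum>p\<in>P. indicator \<Omega> x * ((?F p x \<bullet> a) * (G x \<bullet> b) - (?F p x \<bullet> b) * (G x \<bullet> a)))"
    proof (cases "x \<in> \<Omega>")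
      case True
      then have Fx: "F x = (\<Sum>p\<in>P. ?F p x)" using Fs closure_subset by blast
      have e: "F x \<bullet> v = (\<Sum>p\<in>P. ?F p x \<bullet> v)" for v
        using arg_cong[OF Fx, of "\<lambda>z. z \<bullet> v"] unfolding inner_sum_left .
      show ?thesis unfolding e[of a] e[of b] sum_distrib_left[symmetric] sum_subtractf sum_distrib_right ..
    qed simp
  qed
  also have "\<dots> = (\<Sum>p\<in>P. LINT x|lborel. indicator \<Omega> x * ((?F p x \<bullet> a) * (G x \<bullet> b) - (?F p x \<bullet> b) * (G x \<bullet> a)))"
    by (intro Bochner_Integration.integral_sum integrable_volume continuous_intros fc c)
  also have "\<dots> = (\<Sum>p\<in>P. LINT x|S. (\<eta> p x * f x) * ((G x \<bullet> b) * (n x \<bullet> a) - (G x \<bullet> a) * (n x \<bullet> b)))"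
    by (intro sum.cong refl loc)
  also have "\<dots> = (LINT x|S. (\<Sum>p\<in>P. (\<eta> p x * f x) * ((G x \<bullet> b) * (n x \<bullet> a) - (G x \<bullet> a) * (n x \<bullet> b))))"
  proof (rule Bochner_Integration.integral_sum[symmetric])
    have sub: "\<Gamma> \<subseteq> closure \<Omega>" by (auto simp: frontier_iff)
    show "integrable S (\<lambda>x. (\<eta> p x * f x) * ((G x \<bullet> b) * (n x \<bullet> a) - (G x \<bullet> a) * (n x \<bullet> b)))" if "p \<in> P" for p
      by (intro integrable_surface continuous_intros c that continuous_on_subset[OF fc(1) sub] continuous_on_subset[OF fc(3) sub] cont_n)
  qed
  also have "\<dots> = (LINT x|S. f x * ((G x \<bullet> b) * (n x \<bullet> a) - (G x \<bullet> a) * (n x \<bullet> b)))"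
  proof (intro Bochner_Integration.integral_cong refl)
    fix x assume "x \<in> space S"
    then have "f x = (\<Sum>p\<in>P. \<eta> p x * f x)" by (intro fs) (simp add: frontier_iff)
    then show "(\<Sum>p\<in>P. (\<eta> p x * f x) * ((G x \<bullet> b) * (n x \<bullet> a) - (G x \<bullet> a) * (n x \<bullet> b))) = f x * ((G x \<bullet> b) * (n x \<bullet> a) - (G x \<bullet> a) * (n x \<bullet> b))"
      by (metis sum_distrib_right)
  qed
  finally show ?thesis .
qed

text \<open>Otherwise p would lie in the cone below x and hence in \<Omega>.\<close>

lemma closure_normal_le:
  assumes p: "p \<in> \<Gamma>" and \<rho>: "\<And>x y. x \<in> ball p \<rho> \<Longrightarrow> y \<in> ball p \<rho> \<Longrightarrow> x \<in> closure \<Omega> \<Longrightarrow> n p \<bullet> (y - x) < - \<eta> * norm (y - x) \<Longrightarrow> y \<in> \<Omega>"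
    and x: "x \<in> closure \<Omega>" "x \<in> ball p \<rho>"
  shows "n p \<bullet> (x - p) \<le> \<eta> * norm (x - p)"
proof (rule ccontr)
  assume "\<not> ?thesis"
  then have "n p \<bullet> (p - x) < - \<eta> * norm (p - x)" by (simp add: inner_diff_right norm_minus_commute)
  moreover have "p \<in> ball p \<rho>" using x(2) by (metis dist_self mem_ball zero_le_dist le_less_trans)
  ultimately have "p \<in> \<Omega>" using \<rho> x by blast
  then show False using p by (simp add: frontier_iff)
qed

text \<open>The segment from p to x may leave the domain. The path goes instead from p down by h =
  |x - p| along the normal, across, and up to x; it is interior apart from its two ends, so the mean
  value theorem applies to each piece. The two vertical contributions cancel up to the oscillation
  of F near p.\<close>

lemma C1bar_has_derivative:
  assumes f: "C1bar f F" and p: "p \<in> \<Gamma>"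
  shows "(f has_derivative (\<lambda>h. F p \<bullet> h)) (at p within closure \<Omega>)"
  unfolding has_derivative_within_alt
proof (intro conjI allI impI)
  show "bounded_linear ((\<bullet>) (F p))" by (rule bounded_linear_inner_right)
  fix e :: real assume e: "0 < e"
  have fc: "C1on \<Omega> f F" "continuous_on (closure \<Omega>) f" "continuous_on (closure \<Omega>) F" using f by (auto simp: C1bar_def)
  have pc: "p \<in> closure \<Omega>" using p by (simp add: frontier_iff)
  have np: "n p \<bullet> n p = 1" using norm_n[OF p] by (simp add: norm_eq_1)
  \<comment> \<open>With slope 1/4 the point x is at most h/4 above the tangent plane, so the
    crossing segment is at least 3h/4 below it at distance at most 2h from p, well inside the
    cone.\<close>
  obtain \<rho> where \<rho>: "0 < \<rho>" "\<And>x y. x \<in> ball p \<rho> \<Longrightarrow> y \<in> ball p \<rho> \<Longrightarrow> x \<in> closure \<Omega> \<Longrightarrow> n p \<bullet> (y - x) < - (1/4) * norm (y - x) \<Longrightarrow> y \<in> \<Omega>"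
    using cone[OF p, of "1/4"] by auto
  obtain \<delta> where \<delta>: "0 < \<delta>" "\<And>z. z \<in> closure \<Omega> \<Longrightarrow> dist z p < \<delta> \<Longrightarrow> dist (F z) (F p) < e / 3"
    using fc(3) pc e unfolding continuous_on_iff by (metis zero_less_divide_iff zero_less_numeral)
  show "\<exists>d>0. \<forall>y\<in>closure \<Omega>. norm (y - p) < d \<longrightarrow> norm (f y - f p - F p \<bullet> (y - p)) \<le> e * norm (y - p)"
  proof (intro exI[of _ "min \<rho> \<delta> / 2"] conjI ballI impI)
    show "0 < min \<rho> \<delta> / 2" using \<rho> \<delta> by simp
    fix x assume x: "x \<in> closure \<Omega>" and xs: "norm (x - p) < min \<rho> \<delta> / 2"
    define h where "h = norm (x - p)"
    show "norm (f x - f p - F p \<bullet> (x - p)) \<le> e * norm (x - p)"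
    proof (cases "x = p")
      case False
      then have h0: "0 < h" by (simp add: h_def)
      have h2: "2 * h < \<rho>" "2 * h < \<delta>" using xs by (auto simp: h_def)
      have near: "dist z p < \<delta>" "z \<in> ball p \<rho>" if "norm (z - p) \<le> 2 * h" for z
        using that h2 by (auto simp: dist_norm norm_minus_commute)
      have vert: "y - \<tau> *\<^sub>R n p \<in> \<Omega>" "norm (y - \<tau> *\<^sub>R n p - p) \<le> 2 * h"
        if "y \<in> closure \<Omega>" "norm (y - p) \<le> h" "0 < \<tau>" "\<tau> \<le> h" for y \<tau>
      proof -
        have "norm (y - \<tau> *\<^sub>R n p - p) \<le> norm (y - p) + norm (\<tau> *\<^sub>R n p)"
          using norm_triangle_ineq4[of "y - p" "\<tau> *\<^sub>R n p"] by (simp add: algebra_simps)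
        then show b: "norm (y - \<tau> *\<^sub>R n p - p) \<le> 2 * h" using that norm_n[OF p] by simp
        show "y - \<tau> *\<^sub>R n p \<in> \<Omega>"
          by (rule \<rho>(2)[OF near(2) near(2)[OF b] that(1)]) (use that norm_n[OF p] np h0 in auto)
      qed
      let ?a = "x - h *\<^sub>R n p" and ?b = "p - h *\<^sub>R n p"
      have mid: "z \<in> \<Omega> \<and> norm (z - p) \<le> 2 * h" if zs: "z \<in> closed_segment ?b ?a" for z
      proof -
        obtain s where s: "0 \<le> s" "s \<le> 1" "z = (1 - s) *\<^sub>R ?b + s *\<^sub>R ?a"
          using zs unfolding in_segment by blast
        then have zp: "z - p = s *\<^sub>R (x - p) - h *\<^sub>R n p" by (simp add: algebra_simps)
        have "norm (z - p) \<le> norm (s *\<^sub>R (x - p)) + norm (h *\<^sub>R n p)" unfolding zp by (rule norm_triangle_ineq4)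
        also have "\<dots> = s * h + h" using s h0 norm_n[OF p] by (simp add: h_def)
        also have "\<dots> \<le> 2 * h" using s h0 by (simp add: mult_left_le_one_le)
        finally have b: "norm (z - p) \<le> 2 * h" .
        have "n p \<bullet> (x - p) \<le> 1/4 * h"
          unfolding h_def by (rule closure_normal_le[OF p \<rho>(2) x]) (use near[of x] h0 in \<open>auto simp: h_def\<close>)
        then have "s * (n p \<bullet> (x - p)) \<le> s * (1/4 * h)" using s by (intro mult_left_mono)
        also have "\<dots> \<le> 1 * (1/4 * h)" using s h0 by (intro mult_right_mono) auto
        finally have "n p \<bullet> (z - p) \<le> - (3/4 * h)" unfolding zp using np by (simp add: inner_diff_right)
        then have "n p \<bullet> (z - p) < - (1/4) * norm (z - p)" using b h0 by simp
        then have "z \<in> \<Omega>" by (rule \<rho>(2)[OF _ near(2)[OF b] pc, rotated]) (use \<rho>(1) in simp)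
        then show ?thesis using b by blast
      qed
      have step: "\<exists>z\<in>closure \<Omega>. dist z p < \<delta> \<and> f v - f u = F z \<bullet> (v - u)"
        if o: "\<And>z. z \<in> open_segment u v \<Longrightarrow> z \<in> \<Omega> \<and> norm (z - p) \<le> 2 * h" and u: "u \<in> closure \<Omega>" "v \<in> closure \<Omega>" and "u \<noteq> v" for u v
      proof -
        have "closed_segment u v \<subseteq> closure \<Omega>"
          using o u closure_subset unfolding closed_segment_eq_open by blast
        then have "continuous_on (closed_segment u v) f" by (rule continuous_on_subset[OF fc(2)])
        then obtain z where z: "z \<in> open_segment u v" "f v - f u = F z \<bullet> (v - u)"
          using segment_mvt[of u v f F] o C1onD[OF fc(1)] \<open>u \<noteq> v\<close> by blast
        then show ?thesis using o[OF z(1)] near closure_subset by blast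
      qed
      have nn0: "h *\<^sub>R n p \<noteq> 0" using h0 norm_n[OF p] by auto
      have vs: "z \<in> \<Omega> \<and> norm (z - p) \<le> 2 * h" if zy: "z \<in> open_segment y (y - h *\<^sub>R n p)" "y \<in> closure \<Omega>" "norm (y - p) \<le> h" for z y
      proof -
        obtain s where "0 < s" "s < 1" "z = (1 - s) *\<^sub>R y + s *\<^sub>R (y - h *\<^sub>R n p)"
          using zy(1) unfolding in_segment by blast
        then have "z = y - (s * h) *\<^sub>R n p" "0 < s * h" "s * h \<le> h" using h0 by (auto simp: algebra_simps)
        then show ?thesis using vert[OF zy(2,3)] by blast
      qed
      have ain: "?a \<in> closure \<Omega>" "?b \<in> closure \<Omega>" using mid[of ?a] mid[of ?b] closure_subset by auto
      obtain z1 where z1: "z1 \<in> closure \<Omega>" "dist z1 p < \<delta>" "f ?a - f x = F z1 \<bullet> (?a - x)"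
        using step[of x ?a] vs[of _ x] x ain nn0 by (auto simp: h_def)
      obtain z2 where z2: "z2 \<in> closure \<Omega>" "dist z2 p < \<delta>" "f ?a - f ?b = F z2 \<bullet> (?a - ?b)"
      proof -
        have "?b \<noteq> ?a" using False by simp
        moreover have "z \<in> \<Omega> \<and> norm (z - p) \<le> 2 * h" if "z \<in> open_segment ?b ?a" for z
          using mid[OF open_closed_segment[OF that]] .
        ultimately show thesis using step[of ?b ?a] ain that by blast
      qed
      obtain z3 where z3: "z3 \<in> closure \<Omega>" "dist z3 p < \<delta>" "f ?b - f p = F z3 \<bullet> (?b - p)"
        using step[of p ?b] vs[of _ p] pc ain nn0 h0 by auto
      have "f x - f p - F p \<bullet> (x - p) = (F z1 - F p) \<bullet> (h *\<^sub>R n p) + (F z2 - F p) \<bullet> (x - p) - (F z3 - F p) \<bullet> (h *\<^sub>R n p)"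
      proof -
        have "f ?a - f x = - (F z1 \<bullet> (h *\<^sub>R n p))" using z1(3) by simp
        moreover have "f ?a - f ?b = F z2 \<bullet> (x - p)" using z2(3) by (simp add: inner_diff_right)
        moreover have "f ?b - f p = - (F z3 \<bullet> (h *\<^sub>R n p))" using z3(3) by simp
        ultimately show ?thesis unfolding inner_diff_left by linarith
      qed
      also have "norm \<dots> \<le> e / 3 * h + e / 3 * h + e / 3 * h"
      proof -
        have i: "\<bar>(F z - F p) \<bullet> v\<bar> \<le> e / 3 * h" if "z \<in> closure \<Omega>" "dist z p < \<delta>" "norm v = h" for z v
        proof -
          have "\<bar>(F z - F p) \<bullet> v\<bar> \<le> norm (F z - F p) * norm v" by (rule Cauchy_Schwarz_ineq2)
          also have "\<dots> \<le> e / 3 * h" using \<delta>(2)[OF that(1,2)] that(3) h0 e by (intro mult_mono) (auto simp: dist_norm)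
          finally show ?thesis .
        qed
        have "norm (h *\<^sub>R n p) = h" using h0 norm_n[OF p] by simp
        then show ?thesis using i[OF z1(1,2), of "h *\<^sub>R n p"] i[OF z2(1,2) h_def[symmetric]] i[OF z3(1,2), of "h *\<^sub>R n p"]
          unfolding real_norm_def by linarith
      qed
      finally show ?thesis by (simp add: h_def)
    qed simp
  qed
qed

text \<open>Over p + t \<tau> the normal segment of half-length 2 \<eta> t |\<tau>| starts in
  \<Omega> and ends off its closure, so it contains a boundary point, where f = 0. That point is p +
  t \<tau> up to an error of order \<eta> t. Hence f' \<tau> is arbitrarily small.\<close>

lemma tangent_derivative_zero:
  fixes f :: "real^'n \<Rightarrow> 'b::real_normed_vector"
  assumes p: "p \<in> \<Gamma>" and V: "open V" "p \<in> V" and f: "(f has_derivative f') (at p within \<Gamma>)"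
    and zero: "\<And>x. x \<in> \<Gamma> \<Longrightarrow> x \<in> V \<Longrightarrow> f x = 0" and \<tau>: "n p \<bullet> \<tau> = 0"
  shows "f' \<tau> = 0"
proof (rule ccontr)
  assume ne: "f' \<tau> \<noteq> 0"
  interpret f': bounded_linear f' using f by (rule has_derivative_bounded_linear)
  have \<tau>0: "\<tau> \<noteq> 0" using ne f'.zero by auto
  define N where "N = norm \<tau>"
  have N: "0 < N" using \<tau>0 by (simp add: N_def)
  have np: "n p \<bullet> n p = 1" using norm_n[OF p] by (simp add: norm_eq_1)
  define c where "c = norm (f' \<tau>)"
  have c: "0 < c" using ne by (simp add: c_def)
  \<comment> \<open>\<epsilon> and \<eta> make the linearisation error and the contribution of f' (n
    p) at most t c / 4 each, against t c on the left.\<close>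
  define \<epsilon> where "\<epsilon> = c / (8 * N)"
  define \<eta> where "\<eta> = min (1/4) (c / (8 * N * (norm (f' (n p)) + 1)))"
  have den: "0 < 8 * N * (norm (f' (n p)) + 1)" using N by (simp add: add_nonneg_pos)
  have \<eta>: "0 < \<eta>" "\<eta> \<le> 1/4" using c den by (auto simp: \<eta>_def)
  have "\<eta> \<le> c / (8 * N * (norm (f' (n p)) + 1))" by (simp add: \<eta>_def)
  then have "\<eta> * (8 * N * (norm (f' (n p)) + 1)) \<le> c" using den by (simp add: pos_le_divide_eq)
  moreover have "\<eta> * (8 * N * norm (f' (n p))) \<le> \<eta> * (8 * N * (norm (f' (n p)) + 1))" using \<eta> N by (intro mult_left_mono) auto
  ultimately have "\<eta> * (8 * N * norm (f' (n p))) \<le> c" by linarith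
  then have \<eta>c: "2 * \<eta> * N * norm (f' (n p)) \<le> c / 4" by simp
  have \<epsilon>0: "0 < \<epsilon>" using c N by (simp add: \<epsilon>_def)
  obtain \<delta> where \<delta>: "0 < \<delta>" "\<And>y. y \<in> \<Gamma> \<Longrightarrow> norm (y - p) < \<delta> \<Longrightarrow> norm (f y - f p - f' (y - p)) \<le> \<epsilon> * norm (y - p)"
    using f \<epsilon>0 unfolding has_derivative_within_alt by blast
  obtain \<rho> where \<rho>: "0 < \<rho>" "\<And>x y. x \<in> ball p \<rho> \<Longrightarrow> y \<in> ball p \<rho> \<Longrightarrow> x \<in> closure \<Omega> \<Longrightarrow> n p \<bullet> (y - x) < - \<eta> * norm (y - x) \<Longrightarrow> y \<in> \<Omega>"
    using cone[OF p \<eta>(1)] by blast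
  obtain r where r: "0 < r" "ball p r \<subseteq> V" using V open_contains_ball by blast
  define t where "t = min (min \<delta> \<rho>) r / (4 * N)"
  have t: "0 < t" using \<delta> \<rho> r N by (simp add: t_def)
  have "t * N = min (min \<delta> \<rho>) r / 4" using N by (simp add: t_def)
  then have t2: "2 * (t * N) < \<delta>" "2 * (t * N) < \<rho>" "2 * (t * N) < r" using \<delta> \<rho> r by auto
  have tN: "0 < t * N" using t N by simp
  let ?x = "\<lambda>s. p + t *\<^sub>R \<tau> + s *\<^sub>R n p"
  have nx: "norm (?x s - p) < 2 * (t * N)" if "\<bar>s\<bar> \<le> 2 * \<eta> * (t * N)" for s
  proof -
    have "norm (?x s - p) \<le> norm (t *\<^sub>R \<tau>) + norm (s *\<^sub>R n p)" using norm_triangle_ineq[of "t *\<^sub>R \<tau>" "s *\<^sub>R n p"] by (simp add: algebra_simps)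
    also have "\<dots> = t * N + \<bar>s\<bar>" using t norm_n[OF p] by (simp add: N_def)
    also have "\<dots> \<le> t * N + 1/2 * (t * N)"
    proof -
      have "2 * \<eta> * (t * N) \<le> 1/2 * (t * N)" using \<eta>(2) tN by (intro mult_right_mono) auto
      then show ?thesis using that by linarith
    qed
    also have "\<dots> < 2 * (t * N)" using tN by linarith
    finally show ?thesis .
  qed
  let ?s = "2 * \<eta> * (t * N)"
  have s0: "0 < ?s" using \<eta> tN by simp
  have pin: "p \<in> ball p \<rho>" "p \<in> closure \<Omega>" "p \<notin> \<Omega>" using \<rho>(1) p by (auto simp: frontier_iff)
  have bin: "?x s \<in> ball p \<rho>" if "\<bar>s\<bar> \<le> ?s" for s  proof -
    have "dist (?x s) p < \<rho>" using nx[OF that] t2(2) unfolding dist_norm by linarith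
    then show ?thesis by (simp add: dist_commute)
  qed
  have ns: "\<eta> * norm (?x s - p) < ?s" if "\<bar>s\<bar> \<le> ?s" for s
    using mult_strict_left_mono[OF nx[OF that] \<eta>(1)] by (simp add: mult_ac)
  have e1: "n p \<bullet> (?x s - p) = s" for s using \<tau> np by (simp add: inner_add_right)
  have A: "?x (- ?s) \<in> \<Omega>"
    by (rule \<rho>(2)[OF pin(1) bin pin(2)]) (use s0 ns[of "- ?s"] in \<open>simp_all only: e1, simp_all\<close>)
  have B: "?x ?s \<notin> closure \<Omega>"
  proof
    assume cl: "?x ?s \<in> closure \<Omega>"
    have "n p \<bullet> (?x ?s - p) \<le> \<eta> * norm (?x ?s - p)"
      by (rule closure_normal_le[OF p _ cl bin]) (blast intro: \<rho>(2), use s0 in linarith)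
    then show False using ns[of ?s] s0 unfolding e1 by simp
  qed
  have "closed_segment (?x (- ?s)) (?x ?s) \<inter> \<Gamma> \<noteq> {}"
    by (rule connected_Int_frontier) (use A B closure_subset in auto)
  then obtain y where y: "y \<in> closed_segment (?x (- ?s)) (?x ?s)" "y \<in> \<Gamma>" by blast
  then obtain u where u: "0 \<le> u" "u \<le> 1" "y = (1 - u) *\<^sub>R ?x (- ?s) + u *\<^sub>R ?x ?s" by (auto simp: in_segment)
  define s where "s = (2 * u - 1) * ?s"
  have "(1 - u) *\<^sub>R (q + (- c) *\<^sub>R v) + u *\<^sub>R (q + c *\<^sub>R v) = q + ((2 * u - 1) * c) *\<^sub>R v" for c and q v :: "real^'n"
  proof -
    have "(1 - u) *\<^sub>R (q + (- c) *\<^sub>R v) + u *\<^sub>R (q + c *\<^sub>R v) = ((1 - u) + u) *\<^sub>R q + ((1 - u) * (- c) + u * c) *\<^sub>R v"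
      by (simp only: scaleR_add_right scaleR_add_left scaleR_scaleR) simp
    also have "(1 - u) * (- c) + u * c = (2 * u - 1) * c" by (simp add: algebra_simps)
    finally show ?thesis by simp
  qed
  then have ys: "y = ?x s" unfolding u(3) s_def by blast
  have "\<bar>2 * u - 1\<bar> * ?s \<le> 1 * ?s" using u s0 by (intro mult_right_mono) auto
  then have s: "\<bar>s\<bar> \<le> ?s" unfolding s_def abs_mult[of "2 * u - 1"] using s0 by linarith
  have yp: "norm (y - p) < 2 * (t * N)" unfolding ys by (rule nx[OF s])
  have "f y = 0" using yp t2 r y by (intro zero) (auto simp: dist_norm norm_minus_commute)
  moreover have "f p = 0" using zero p V by simp
  ultimately have "norm (f' (y - p)) \<le> \<epsilon> * norm (y - p)" using \<delta>(2)[OF y(2)] yp t2 by simp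
  also have "\<dots> \<le> \<epsilon> * (2 * (t * N))" using yp \<epsilon>0 by (intro mult_left_mono) auto
  also have "\<dots> = t * (c / 4)" using N by (simp add: \<epsilon>_def)
  finally have 1: "norm (f' (y - p)) \<le> t * (c / 4)" .
  have "f' (y - p) = t *\<^sub>R f' \<tau> + s *\<^sub>R f' (n p)" unfolding ys by (simp add: f'.add f'.scaleR)
  then have "t *\<^sub>R f' \<tau> = f' (y - p) - s *\<^sub>R f' (n p)" by simp
  then have "t * c \<le> norm (f' (y - p)) + \<bar>s\<bar> * norm (f' (n p))"
    using norm_triangle_ineq4[of "f' (y - p)" "s *\<^sub>R f' (n p)"] t by (metis abs_of_pos c_def norm_scaleR)
  also have "\<dots> \<le> t * (c / 4) + ?s * norm (f' (n p))" using 1 s by (intro add_mono mult_right_mono) auto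
  also have "\<dots> = t * (c / 4) + t * (2 * \<eta> * N * norm (f' (n p)))" by simp
  also have "\<dots> \<le> t * (c / 4) + t * (c / 4)" using \<eta>c t by (intro add_left_mono mult_left_mono) auto
  finally show False using t c by simp
qed

end

section \<open>Minkowski's formula and Reilly's identity\<close>

lemma sum_axis_scaleR: "(\<Sum>i\<in>UNIV. (v $ i) *\<^sub>R axis i (1::real)) = (v :: real^'n)"
  by (simp add: vec_eq_iff axis_def if_distrib cong: if_cong)

text \<open>On tangent vectors the matrix with rows \<open>M j\<close> takes values in the multiples
  of n, so its tangential trace is 0 and the normal entry is all that is left of the trace.\<close>

lemma trace_tangential:
  fixes M :: "'n \<Rightarrow> real^'n" and n :: "real^'n"
  assumes n: "norm n = 1" and tang: "\<And>\<tau> j. n \<bullet> \<tau> = 0 \<Longrightarrow> M j \<bullet> \<tau> = c \<tau> * n $ j"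
  shows "(\<Sum>j\<in>UNIV. M j $ j) = (\<Sum>j\<in>UNIV. n $ j * (M j \<bullet> n))"
proof -
  have nn: "n \<bullet> n = 1" using n by (simp add: norm_eq_1)
  define \<tau> where "\<tau> i = axis i 1 - (n $ i) *\<^sub>R n" for i
  have t0: "n \<bullet> \<tau> i = 0" for i by (simp add: \<tau>_def inner_diff_right nn inner_axis)
  have Mi: "M j $ i = c (\<tau> i) * n $ j + n $ i * (M j \<bullet> n)" for i j
  proof -
    have "M j $ i = M j \<bullet> axis i 1" by (simp add: inner_axis)
    also have "\<dots> = M j \<bullet> \<tau> i + n $ i * (M j \<bullet> n)" by (simp add: \<tau>_def inner_diff_right)
    finally show ?thesis by (simp add: tang[OF t0])
  qed
  have s0: "(\<Sum>i\<in>UNIV. (n $ i) *\<^sub>R \<tau> i) = 0"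
  proof -
    have "(\<Sum>i\<in>UNIV. (n $ i) *\<^sub>R \<tau> i) = (\<Sum>i\<in>UNIV. (n $ i) *\<^sub>R axis i 1) - (\<Sum>i\<in>UNIV. (n $ i * n $ i) *\<^sub>R n)"
      by (simp add: \<tau>_def scaleR_diff_right sum_subtractf)
    also have "(\<Sum>i\<in>UNIV. (n $ i * n $ i) *\<^sub>R n) = n"
      using nn by (simp add: inner_vec_def flip: scaleR_left.sum)
    finally show ?thesis by (simp add: sum_axis_scaleR)
  qed
  \<comment> \<open>c is an arbitrary function of the tangent vector. Multiplication by
    \<open>n $ j\<close> turns its values into the linear expression M j . \<tau>, and some
    component of n is nonzero.\<close>
  have c0: "(\<Sum>i\<in>UNIV. n $ i * c (\<tau> i)) = 0"
  proof -
    have "n $ j * (\<Sum>i\<in>UNIV. n $ i * c (\<tau> i)) = 0" for j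
    proof -
      have "n $ j * (\<Sum>i\<in>UNIV. n $ i * c (\<tau> i)) = (\<Sum>i\<in>UNIV. n $ i * (M j \<bullet> \<tau> i))"
        by (simp add: tang[OF t0] sum_distrib_left mult_ac)
      also have "\<dots> = M j \<bullet> (\<Sum>i\<in>UNIV. (n $ i) *\<^sub>R \<tau> i)" by (simp add: inner_sum_right)
      finally show ?thesis by (simp add: s0)
    qed
    moreover have "n \<noteq> 0" using n by auto
    then obtain j where "n $ j \<noteq> 0" by (auto simp: vec_eq_iff)
    ultimately show ?thesis by (metis mult_eq_0_iff)
  qed
  have "(\<Sum>j\<in>UNIV. M j $ j) = (\<Sum>j\<in>UNIV. n $ j * c (\<tau> j)) + (\<Sum>j\<in>UNIV. n $ j * (M j \<bullet> n))"
    by (subst Mi) (simp add: sum.distrib mult.commute)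
  then show ?thesis by (simp add: c0)
qed

lemma integral_sum2:
  fixes f :: "'i::finite \<Rightarrow> 'j::finite \<Rightarrow> 'x \<Rightarrow> real"
  assumes "\<And>i j. integrable M (f i j)"
  shows "(LINT x|M. (\<Sum>i\<in>UNIV. \<Sum>j\<in>UNIV. f i j x)) = (\<Sum>i\<in>UNIV. \<Sum>j\<in>UNIV. LINT x|M. f i j x)"
proof -
  have "(LINT x|M. (\<Sum>i\<in>UNIV. \<Sum>j\<in>UNIV. f i j x)) = (\<Sum>i\<in>UNIV. LINT x|M. (\<Sum>j\<in>UNIV. f i j x))"
    by (intro Bochner_Integration.integral_sum Bochner_Integration.integrable_sum assms)
  also have "\<dots> = (\<Sum>i\<in>UNIV. \<Sum>j\<in>UNIV. LINT x|M. f i j x)"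
    by (intro sum.cong refl Bochner_Integration.integral_sum assms)
  finally show ?thesis .
qed

text \<open>The derivative of |N|^2 = 1.\<close>

lemma unit_field_grad:
  fixes N :: "real^'n \<Rightarrow> real^'n"
  assumes "open U" "\<And>j. C1on U (\<lambda>x. N x $ j) (Q j)" "\<And>x. x \<in> U \<Longrightarrow> norm (N x) = 1" "x \<in> U"
  shows "(\<Sum>j\<in>UNIV. N x $ j * (Q j x \<bullet> h)) = 0"
proof -
  have C: "C1on U (\<lambda>x. \<Sum>j\<in>UNIV. N x $ j * N x $ j) (\<lambda>x. \<Sum>j\<in>UNIV. N x $ j *\<^sub>R Q j x + N x $ j *\<^sub>R Q j x)"
    by (intro C1on_sum C1on_mult assms(2)) simp
  have one: "(\<Sum>j\<in>UNIV. N x $ j * N x $ j) = 1" if "x \<in> U" for x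
    using assms(3)[OF that] by (simp add: norm_eq_1 inner_vec_def)
  have "(\<Sum>j\<in>UNIV. N x $ j *\<^sub>R Q j x + N x $ j *\<^sub>R Q j x) = 0"
    by (rule C1on_grad_unique[OF C C1on_const[of U 1] assms(1,4)]) (auto simp: one)
  then have "2 *\<^sub>R (\<Sum>j\<in>UNIV. N x $ j *\<^sub>R Q j x) = 0" by (simp only: sum.distrib scaleR_2)
  then have "(\<Sum>j\<in>UNIV. N x $ j *\<^sub>R Q j x) = 0" by simp
  then have "(\<Sum>j\<in>UNIV. N x $ j *\<^sub>R Q j x) \<bullet> h = 0" by simp
  then show ?thesis by (simp add: inner_sum_left)
qed

text \<open>\<open>H\<close> is the sum of the principal curvatures, that is \<open>N - 1\<close> times the mean curvature.\<close>

locale C2_domain = C1_domain +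
  fixes H :: "real^'a \<Rightarrow> real"
  assumes chart: "\<And>p. p \<in> frontier \<Omega> \<Longrightarrow> \<exists>U N Q. open U \<and> p \<in> U \<and> (\<forall>j. C1on U (\<lambda>x. N x $ j) (Q j)) \<and>
    (\<forall>x\<in>U. norm (N x) = 1) \<and> (\<forall>x\<in>frontier \<Omega> \<inter> U. n x = N x \<and> H x = (\<Sum>i\<in>UNIV. Q i x $ i))"
begin

lemma continuous_H: "continuous_on \<Gamma> H"
  unfolding continuous_on_eq_continuous_within
proof
  fix p assume p: "p \<in> \<Gamma>"
  obtain U N Q where U: "open U" "p \<in> U" "\<And>j. C1on U (\<lambda>x. N x $ j) (Q j)"
    and H: "\<And>x. x \<in> \<Gamma> \<inter> U \<Longrightarrow> n x = N x \<and> H x = (\<Sum>i\<in>UNIV. Q i x $ i)"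
    using chart[OF p] by blast
  have "continuous_on U (\<lambda>x. \<Sum>i\<in>UNIV. Q i x $ i)"
    by (intro continuous_intros C1on_continuous_grad[OF U(3)])
  then have "continuous (at p within \<Gamma> \<inter> U) (\<lambda>x. \<Sum>i\<in>UNIV. Q i x $ i)"
    using U p by (meson IntI continuous_on_eq_continuous_within continuous_within_subset inf_le2)
  then have "continuous (at p within \<Gamma> \<inter> U) H"
    by (rule continuous_transform_within[OF _ zero_less_one]) (use H p U in auto)
  then show "continuous (at p within \<Gamma>) H"
    using at_within_nhd[OF U(2,1), of \<Gamma> "\<Gamma> \<inter> U"] by (simp add: Int_assoc)
qed

text \<open>The curl identity with f = 1: the tangential derivative of g in the plane of a and b has
  integral 0 over the closed surface.\<close>

lemma surface_Stokes:
  assumes g: "C1on UNIV g G"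
  shows "(LINT x|S. (G x \<bullet> b) * (n x \<bullet> a) - (G x \<bullet> a) * (n x \<bullet> b)) = 0"
  using curl_identity_C1[OF C1on_const[of UNIV 1] g, of a b] by simp

text \<open>The tangential operators n_j D_i - n_i D_j, applied to x_j n_i and summed over i and j,
  give H (x . n) - (N - 1), because D_i n_i sums to H and n is a unit field. The extension of n off
  the boundary is only local, so each chart carries a partition function; the terms with their
  gradients cancel in the sum.\<close>

theorem Minkowski: "(LINT x|S. H x * (x \<bullet> n x) - (real CARD('a) - 1)) = 0"
proof -
  define A where "A p U N Q \<longleftrightarrow> open U \<and> p \<in> U \<and> (\<forall>j. C1on U (\<lambda>x. N x $ j) (Q j)) \<and>
    (\<forall>x\<in>U. norm (N x) = 1) \<and> (\<forall>x\<in>\<Gamma> \<inter> U. n x = N x \<and> H x = (\<Sum>i\<in>UNIV. Q i x $ i))" for p U and N :: "real^'a \<Rightarrow> real^'a" and Q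
  have "\<exists>U N Q. A p U N Q" if "p \<in> \<Gamma>" for p using chart[OF that] unfolding A_def by blast
  then obtain U N Q where UNQ: "\<And>p. p \<in> \<Gamma> \<Longrightarrow> A p (U p) (N p) (Q p)" by metis
  have U: "open (U p)" "p \<in> U p" and NQ: "C1on (U p) (\<lambda>x. N p x $ j) (Q p j)"
    and N1: "x \<in> U p \<Longrightarrow> norm (N p x) = 1" and nN: "x \<in> \<Gamma> \<Longrightarrow> x \<in> U p \<Longrightarrow> n x = N p x"
    and HQ: "x \<in> \<Gamma> \<Longrightarrow> x \<in> U p \<Longrightarrow> H x = (\<Sum>i\<in>UNIV. Q p i x $ i)" if "p \<in> \<Gamma>" for p x j
    using UNQ[OF that] unfolding A_def by auto
  have "\<exists>r>0. cball p r \<subseteq> U p" if "p \<in> \<Gamma>" for p using U[OF that] open_contains_cball by blast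
  then obtain rad where rad: "\<And>p. p \<in> \<Gamma> \<Longrightarrow> 0 < rad p" "\<And>p. p \<in> \<Gamma> \<Longrightarrow> cball p (rad p) \<subseteq> U p" by metis
  obtain P \<eta> E V where P: "finite P" "P \<subseteq> \<Gamma>" "\<And>p. p \<in> P \<Longrightarrow> C1on UNIV (\<eta> p) (E p)"
    "\<And>p x. p \<in> P \<Longrightarrow> 0 \<le> \<eta> p x" "\<And>p x. p \<in> P \<Longrightarrow> rad p \<le> dist x p \<Longrightarrow> \<eta> p x = 0"
    "open V" "\<Gamma> \<subseteq> V" "\<And>x. x \<in> V \<Longrightarrow> (\<Sum>p\<in>P. \<eta> p x) = 1"
    by (rule C1_partition_of_unity[OF compact_\<Gamma> rad(1)]) auto
  have E0: "(\<Sum>p\<in>P. E p x) = 0" if "x \<in> V" for x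
    by (rule C1on_grad_unique[OF C1on_sum[OF P(1,3)] C1on_const[of UNIV 1] P(6) that]) (auto simp: P(8))
  let ?c = "real CARD('a) - 1"
  let ?h = "\<lambda>p x. \<eta> p x * (H x * (x \<bullet> n x) - ?c) + ((x \<bullet> n x) * (E p x \<bullet> n x) - x \<bullet> E p x)"
  have local: "(LINT x|S. ?h p x) = 0" if pP: "p \<in> P" for p
  proof -
    have p: "p \<in> \<Gamma>" using pP P by blast
    define \<gamma> where "\<gamma> i j x = (if x \<in> U p then \<eta> p x * (x $ j * N p x $ i) else 0)" for i j x
    define \<gamma>' where "\<gamma>' i j x = (if x \<in> U p then \<eta> p x *\<^sub>R (x $ j *\<^sub>R Q p i x + N p x $ i *\<^sub>R axis j 1) + (x $ j * N p x $ i) *\<^sub>R E p x else 0)" for i j x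
    have C: "C1on UNIV (\<gamma> i j) (\<gamma>' i j)" for i j
    proof -
      have "C1on (U p) (\<lambda>x. x $ j) (\<lambda>x. axis j 1)"
        using C1on_inner_left[of "U p" "axis j 1"] by (simp add: inner_axis')
      from C1on_mult[OF this NQ[OF p, of i]]
      have "C1on (U p) (\<lambda>x. x $ j * N p x $ i) (\<lambda>x. x $ j *\<^sub>R Q p i x + N p x $ i *\<^sub>R axis j 1)" .
      then show ?thesis unfolding \<gamma>_def[abs_def] \<gamma>'_def[abs_def]
        by (rule C1on_extend_zero[OF _ U(1)[OF p] P(3)[OF pP] closed_cball rad(2)[OF p]])
           (use P(5)[OF pP] in \<open>auto simp: dist_commute\<close>)
    qed
    have off: "\<eta> p x = 0" "E p x = 0" if "x \<notin> cball p (rad p)" for x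
    proof -
      show "\<eta> p x = 0" using P(5)[OF pP, of x] that by (auto simp: dist_commute)
      show "E p x = 0" by (rule C1on_grad_zero[OF P(3)[OF pP] closed_cball _ that]) (use P(5)[OF pP] in \<open>auto simp: dist_commute\<close>)
    qed
    let ?g = "\<lambda>i j x. (\<gamma>' i j x \<bullet> axis i 1) * (n x \<bullet> axis j 1) - (\<gamma>' i j x \<bullet> axis j 1) * (n x \<bullet> axis i 1)"
    have int: "integrable S (?g i j)" for i j
      by (intro integrable_surface continuous_intros cont_n continuous_on_subset[OF C1on_continuous_grad[OF C]]) auto
    have "0 = (\<Sum>i\<in>UNIV. \<Sum>j\<in>UNIV. LINT x|S. ?g i j x)"
      using surface_Stokes[OF C] by simp
    also have "\<dots> = (LINT x|S. (\<Sum>i\<in>UNIV. \<Sum>j\<in>UNIV. ?g i j x))"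
      by (rule integral_sum2[OF int, symmetric])
    also have "\<dots> = (LINT x|S. ?h p x)"
    proof (intro Bochner_Integration.integral_cong refl)
      fix x assume "x \<in> space S"
      then have x: "x \<in> \<Gamma>" by simp
      show "(\<Sum>i\<in>UNIV. \<Sum>j\<in>UNIV. ?g i j x) = ?h p x"
      proof (cases "x \<in> cball p (rad p)")
        case False
        then have "\<gamma>' i j x = 0" for i j using off[OF False] by (simp add: \<gamma>'_def)
        then show ?thesis using off[OF False] by simp
      next
        case True
        then have xU: "x \<in> U p" using rad(2)[OF p] by blast
        have Nn: "N p x = n x" using nN[OF p x xU] by simp
        have H: "(\<Sum>i\<in>UNIV. Q p i x $ i) = H x" using HQ[OF p x xU] by simp
        have nn: "(\<Sum>i\<in>UNIV. n x $ i * n x $ i) = 1" using norm_n[OF x] by (simp add: norm_eq_1 inner_vec_def)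
        have nQ: "(\<Sum>i\<in>UNIV. n x $ i * Q p i x $ j) = 0" for j
          using unit_field_grad[OF U(1)[OF p] NQ[OF p] N1[OF p] xU, of "axis j 1"] Nn by (simp add: inner_axis)
        have t1: "(\<Sum>i\<in>UNIV. \<Sum>j\<in>UNIV. (\<gamma>' i j x $ i) * n x $ j)
          = \<eta> p x * (H x * (x \<bullet> n x) + 1) + (x \<bullet> n x) * (E p x \<bullet> n x)"
        proof -
          have "(\<gamma>' i j x $ i) * n x $ j = \<eta> p x * (Q p i x $ i * (x $ j * n x $ j)) + (if i = j then \<eta> p x * (n x $ i * n x $ i) else 0)
             + (E p x $ i * n x $ i) * (x $ j * n x $ j)" for i j
            using xU by (auto simp: \<gamma>'_def Nn axis_def algebra_simps)
          then have "(\<Sum>i\<in>UNIV. \<Sum>j\<in>UNIV. (\<gamma>' i j x $ i) * n x $ j) = \<eta> p x * (\<Sum>i\<in>UNIV. \<Sum>j\<in>UNIV. Q p i x $ i * (x $ j * n x $ j))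
             + \<eta> p x * (\<Sum>i\<in>UNIV. n x $ i * n x $ i) + (\<Sum>i\<in>UNIV. \<Sum>j\<in>UNIV. (E p x $ i * n x $ i) * (x $ j * n x $ j))"
            by (simp add: sum.distrib sum_distrib_left)
          also have "(\<Sum>i\<in>UNIV. \<Sum>j\<in>UNIV. Q p i x $ i * (x $ j * n x $ j)) = H x * (x \<bullet> n x)"
            unfolding inner_vec_def H[symmetric] by (simp add: sum_product)
          also have "(\<Sum>i\<in>UNIV. \<Sum>j\<in>UNIV. (E p x $ i * n x $ i) * (x $ j * n x $ j)) = (E p x \<bullet> n x) * (x \<bullet> n x)"
            unfolding inner_vec_def by (simp add: sum_product)
          finally show ?thesis unfolding nn by (simp add: algebra_simps)
        qed
        have t2: "(\<Sum>i\<in>UNIV. \<Sum>j\<in>UNIV. (\<gamma>' i j x $ j) * n x $ i) = \<eta> p x * real CARD('a) + x \<bullet> E p x"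
        proof -
          have "(\<gamma>' i j x $ j) * n x $ i = \<eta> p x * (x $ j * (n x $ i * Q p i x $ j)) + \<eta> p x * (n x $ i * n x $ i)
             + (n x $ i * n x $ i) * (x $ j * E p x $ j)" for i j
            using xU by (simp add: \<gamma>'_def Nn axis_def algebra_simps)
          then have "(\<Sum>i\<in>UNIV. \<Sum>j\<in>UNIV. (\<gamma>' i j x $ j) * n x $ i) = (\<Sum>i\<in>UNIV. \<Sum>j\<in>UNIV. \<eta> p x * (x $ j * (n x $ i * Q p i x $ j)))
             + (\<Sum>i\<in>UNIV. \<Sum>j\<in>(UNIV::'a set). \<eta> p x * (n x $ i * n x $ i)) + (\<Sum>i\<in>UNIV. \<Sum>j\<in>UNIV. (n x $ i * n x $ i) * (x $ j * E p x $ j))"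
            by (simp add: sum.distrib)
          also have "(\<Sum>i\<in>UNIV. \<Sum>j\<in>UNIV. \<eta> p x * (x $ j * (n x $ i * Q p i x $ j))) = (\<Sum>j\<in>UNIV. \<eta> p x * (x $ j * (\<Sum>i\<in>UNIV. n x $ i * Q p i x $ j)))"
            by (subst sum.swap) (simp add: sum_distrib_left)
          also have "\<dots> = 0" by (simp add: nQ)
          also have "(\<Sum>i\<in>UNIV. \<Sum>j\<in>(UNIV::'a set). \<eta> p x * (n x $ i * n x $ i)) = \<eta> p x * real CARD('a) * (\<Sum>i\<in>UNIV. n x $ i * n x $ i)"
            by (simp add: sum_distrib_left mult_ac)
          also have "(\<Sum>i\<in>UNIV. \<Sum>j\<in>UNIV. (n x $ i * n x $ i) * (x $ j * E p x $ j)) = (\<Sum>i\<in>UNIV. n x $ i * n x $ i) * (x \<bullet> E p x)"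
            unfolding inner_vec_def by (simp add: sum_product)
          finally show ?thesis unfolding nn by simp
        qed
        show ?thesis using t1 t2 by (simp add: inner_axis sum_subtractf algebra_simps)
      qed
    qed
    finally show ?thesis by simp
  qed
  have "integrable S (?h p)" if "p \<in> P" for p
    by (intro integrable_surface continuous_intros cont_n continuous_H
        continuous_on_subset[OF C1on_continuous[OF P(3)[OF that]]] continuous_on_subset[OF C1on_continuous_grad[OF P(3)[OF that]]]) auto
  then have "(LINT x|S. (\<Sum>p\<in>P. ?h p x)) = (\<Sum>p\<in>P. LINT x|S. ?h p x)"
    by (intro Bochner_Integration.integral_sum)
  also have "\<dots> = 0" using local by simp
  also have "(LINT x|S. (\<Sum>p\<in>P. ?h p x)) = (LINT x|S. H x * (x \<bullet> n x) - ?c)"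
  proof (intro Bochner_Integration.integral_cong refl)
    fix x assume "x \<in> space S"
    then have x: "x \<in> V" using P(7) by auto
    have "(\<Sum>p\<in>P. ?h p x) = (\<Sum>p\<in>P. \<eta> p x) * (H x * (x \<bullet> n x) - ?c) + ((x \<bullet> n x) * ((\<Sum>p\<in>P. E p x) \<bullet> n x) - x \<bullet> (\<Sum>p\<in>P. E p x))"
      by (simp add: sum.distrib sum_subtractf sum_distrib_right sum_distrib_left inner_sum_left inner_sum_right)
    then show "(\<Sum>p\<in>P. ?h p x) = H x * (x \<bullet> n x) - ?c" by (simp add: P(8)[OF x] E0[OF x])
  qed
  finally show ?thesis .
qed

text \<open>F p annihilates tangent vectors; applied to its own tangential part this shows that part
  to be 0.\<close>

lemma boundary_gradient:
  assumes f: "C1bar f F" and f0: "\<And>x. x \<in> \<Gamma> \<Longrightarrow> f x = 0" and p: "p \<in> \<Gamma>"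
  shows "F p = (F p \<bullet> n p) *\<^sub>R n p"
proof -
  have sub: "\<Gamma> \<subseteq> closure \<Omega>" by (auto simp: frontier_iff)
  have np: "n p \<bullet> n p = 1" using norm_n[OF p] by (simp add: norm_eq_1)
  let ?\<tau> = "F p - (F p \<bullet> n p) *\<^sub>R n p"
  have t0: "n p \<bullet> ?\<tau> = 0" using np by (simp add: inner_diff_right inner_commute)
  have "F p \<bullet> ?\<tau> = 0"
    by (rule tangent_derivative_zero[OF p open_UNIV UNIV_I has_derivative_subset[OF C1bar_has_derivative[OF f p] sub] _ t0])
      (use f0 in auto)
  then have "?\<tau> \<bullet> ?\<tau> = 0" using t0 by (simp add: inner_diff_left inner_commute)
  then show ?thesis by simp
qed

text \<open>By \<open>boundary_gradient\<close> the minors G_j N_k - G_k N_j vanish on the boundary.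
  Their tangential derivatives, contracted with n_k, show that DG - w DN with w = G . n maps tangent
  vectors to multiples of n. \<open>trace_tangential\<close> then yields the formula, DN having
  trace H and no normal component. Using minors avoids differentiating w.\<close>

lemma boundary_hessian:
  fixes G :: "real^'a \<Rightarrow> real^'a"
  assumes f: "C1bar f G" and f0: "\<And>x. x \<in> \<Gamma> \<Longrightarrow> f x = 0"
    and G: "\<And>j. C1bar (\<lambda>x. G x $ j) (B j)" and p: "p \<in> \<Gamma>"
  shows "(\<Sum>j\<in>UNIV. B j p $ j) - (\<Sum>j\<in>UNIV. n p $ j * (B j p \<bullet> n p)) = (G p \<bullet> n p) * H p"
proof -
  obtain U N Q where U: "open U" "p \<in> U" and NQ: "\<And>j. C1on U (\<lambda>x. N x $ j) (Q j)"
    and N1: "\<And>x. x \<in> U \<Longrightarrow> norm (N x) = 1" and H: "\<And>x. x \<in> \<Gamma> \<Longrightarrow> x \<in> U \<Longrightarrow> n x = N x \<and> H x = (\<Sum>i\<in>UNIV. Q i x $ i)"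
    using chart[OF p] by blast
  have sub: "\<Gamma> \<subseteq> closure \<Omega>" by (auto simp: frontier_iff)
  define w where "w = G p \<bullet> n p"
  have Gp: "G p = w *\<^sub>R n p" unfolding w_def by (rule boundary_gradient[OF f f0 p])
  have Np: "N p = n p" using H[OF p U(2)] by simp
  have nn: "(\<Sum>k\<in>UNIV. n p $ k * n p $ k) = 1" using norm_n[OF p] by (simp add: norm_eq_1 inner_vec_def)
  have nQ: "(\<Sum>k\<in>UNIV. n p $ k * (Q k p \<bullet> h)) = 0" for h
    using unit_field_grad[OF U(1) NQ N1 U(2), of h] Np by simp
  let ?M = "\<lambda>j. B j p - w *\<^sub>R Q j p"
  have "?M j \<bullet> \<tau> = (\<Sum>k\<in>UNIV. n p $ k * (B k p \<bullet> \<tau>)) * n p $ j" if \<tau>: "n p \<bullet> \<tau> = 0" for \<tau> j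
  proof -
    have wedge: "G p $ j * (Q k p \<bullet> \<tau>) + (B j p \<bullet> \<tau>) * N p $ k - (G p $ k * (Q j p \<bullet> \<tau>) + (B k p \<bullet> \<tau>) * N p $ j) = 0" for k
    proof (rule tangent_derivative_zero[OF p U _ _ \<tau>, where f = "\<lambda>x. G x $ j * N x $ k - G x $ k * N x $ j"])
      have dG: "((\<lambda>x. G x $ i) has_derivative (\<lambda>h. B i p \<bullet> h)) (at p within \<Gamma>)" for i
        by (rule has_derivative_subset[OF C1bar_has_derivative[OF G p] sub])
      have dN: "((\<lambda>x. N x $ i) has_derivative (\<lambda>h. Q i p \<bullet> h)) (at p within \<Gamma>)" for i
        by (rule has_derivative_at_withinI[OF C1onD[OF NQ U(2)]])
      show "((\<lambda>x. G x $ j * N x $ k - G x $ k * N x $ j) has_derivative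
        (\<lambda>\<tau>. G p $ j * (Q k p \<bullet> \<tau>) + (B j p \<bullet> \<tau>) * N p $ k - (G p $ k * (Q j p \<bullet> \<tau>) + (B k p \<bullet> \<tau>) * N p $ j))) (at p within \<Gamma>)"
        by (intro has_derivative_diff has_derivative_mult dG dN)
      fix x assume x: "x \<in> \<Gamma>" "x \<in> U"
      have "G x = (G x \<bullet> n x) *\<^sub>R N x" using boundary_gradient[OF f f0 x(1)] H[OF x] by simp
      then have e: "G x $ i = (G x \<bullet> n x) * N x $ i" for i by (metis vector_scaleR_component real_scaleR_def)
      show "G x $ j * N x $ k - G x $ k * N x $ j = 0" unfolding e[of j] e[of k] by simp
    qed
    have "0 = (\<Sum>k\<in>UNIV. n p $ k * (G p $ j * (Q k p \<bullet> \<tau>) + (B j p \<bullet> \<tau>) * N p $ k - (G p $ k * (Q j p \<bullet> \<tau>) + (B k p \<bullet> \<tau>) * N p $ j)))"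
      by (simp only: wedge) simp
    also have "\<dots> = (\<Sum>k\<in>UNIV. G p $ j * (n p $ k * (Q k p \<bullet> \<tau>)) + (B j p \<bullet> \<tau>) * (n p $ k * n p $ k) - (w * (Q j p \<bullet> \<tau>)) * (n p $ k * n p $ k) - (n p $ k * (B k p \<bullet> \<tau>)) * n p $ j)"
      unfolding Np by (intro sum.cong refl) (simp add: Gp algebra_simps)
    also have "\<dots> = G p $ j * (\<Sum>k\<in>UNIV. n p $ k * (Q k p \<bullet> \<tau>)) + (B j p \<bullet> \<tau>) * (\<Sum>k\<in>UNIV. n p $ k * n p $ k) - (w * (Q j p \<bullet> \<tau>)) * (\<Sum>k\<in>UNIV. n p $ k * n p $ k) - (\<Sum>k\<in>UNIV. n p $ k * (B k p \<bullet> \<tau>)) * n p $ j"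
      by (simp only: sum.distrib sum_subtractf sum_distrib_left sum_distrib_right)
    finally show ?thesis unfolding nn nQ by (simp add: inner_diff_left)
  qed
  from trace_tangential[OF norm_n[OF p] this]
  have "(\<Sum>j\<in>UNIV. ?M j $ j) = (\<Sum>j\<in>UNIV. n p $ j * (?M j \<bullet> n p))" .
  then have "(\<Sum>j\<in>UNIV. B j p $ j) - w * (\<Sum>j\<in>UNIV. Q j p $ j) = (\<Sum>j\<in>UNIV. n p $ j * (B j p \<bullet> n p)) - w * (\<Sum>j\<in>UNIV. n p $ j * (Q j p \<bullet> n p))"
    by (simp add: sum_subtractf sum_distrib_left inner_diff_left algebra_simps)
  then show ?thesis using H[OF p U(2)] unfolding nQ w_def by simp
qed

text \<open>The curl identity for the components G_i and G_j in the directions of axes i and j,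
  summed over i and j. In the interior this gives (tr B)^2 - tr (B^2); on the boundary G = w n
  reduces the sum to w times the expression in \<open>boundary_hessian\<close>.\<close>

theorem Reilly_identity:
  fixes G :: "real^'a \<Rightarrow> real^'a"
  assumes f: "C1bar f G" and f0: "\<And>x. x \<in> \<Gamma> \<Longrightarrow> f x = 0" and G: "\<And>j. C1bar (\<lambda>x. G x $ j) (B j)"
  shows "(LINT x|lborel. indicator \<Omega> x * ((\<Sum>i\<in>UNIV. B i x $ i)\<^sup>2 - (\<Sum>i\<in>UNIV. \<Sum>j\<in>UNIV. B i x $ j * B j x $ i)))
    = (LINT x|S. H x * (G x \<bullet> n x)\<^sup>2)"
proof -
  have sub: "\<Gamma> \<subseteq> closure \<Omega>" by (auto simp: frontier_iff)
  have cG: "continuous_on (closure \<Omega>) (\<lambda>x. G x $ j)" and cB: "continuous_on (closure \<Omega>) (B j)" for j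
    using G by (auto simp: C1bar_def)
  note cs = continuous_on_subset[OF cG sub] continuous_on_subset[OF cB sub]
  let ?l = "\<lambda>i j x. indicator \<Omega> x * ((B i x \<bullet> axis i 1) * (B j x \<bullet> axis j 1) - (B i x \<bullet> axis j 1) * (B j x \<bullet> axis i 1))"
  let ?r = "\<lambda>i j x. G x $ i * ((B j x \<bullet> axis j 1) * (n x \<bullet> axis i 1) - (B j x \<bullet> axis i 1) * (n x \<bullet> axis j 1))"
  have il: "integrable lborel (?l i j)" for i j by (intro integrable_volume continuous_intros cB)
  have ir: "integrable S (?r i j)" for i j by (intro integrable_surface continuous_intros cs cont_n)
  have "(LINT x|lborel. indicator \<Omega> x * ((\<Sum>i\<in>UNIV. B i x $ i)\<^sup>2 - (\<Sum>i\<in>UNIV. \<Sum>j\<in>UNIV. B i x $ j * B j x $ i)))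
     = (LINT x|lborel. (\<Sum>i\<in>UNIV. \<Sum>j\<in>UNIV. ?l i j x))"
    by (intro Bochner_Integration.integral_cong refl)
       (simp add: inner_axis power2_eq_square sum_product sum_subtractf flip: sum_distrib_left)
  also have "\<dots> = (\<Sum>i\<in>UNIV. \<Sum>j\<in>UNIV. LINT x|lborel. ?l i j x)"
    by (rule integral_sum2[OF il])
  also have "\<dots> = (\<Sum>i\<in>UNIV. \<Sum>j\<in>UNIV. LINT x|S. ?r i j x)"
    by (intro sum.cong refl curl_identity_bar[OF G G])
  also have "\<dots> = (LINT x|S. (\<Sum>i\<in>UNIV. \<Sum>j\<in>UNIV. ?r i j x))"
    by (rule integral_sum2[OF ir, symmetric])
  also have "\<dots> = (LINT x|S. H x * (G x \<bullet> n x)\<^sup>2)"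
  proof (intro Bochner_Integration.integral_cong refl)
    fix x assume "x \<in> space S"
    then have x: "x \<in> \<Gamma>" by simp
    define w where "w = G x \<bullet> n x"
    have Gx: "G x = w *\<^sub>R n x" unfolding w_def by (rule boundary_gradient[OF f f0 x])
    have nn: "(\<Sum>i\<in>UNIV. n x $ i * n x $ i) = 1" using norm_n[OF x] by (simp add: norm_eq_1 inner_vec_def)
    have "(\<Sum>i\<in>UNIV. \<Sum>j\<in>UNIV. ?r i j x) = (\<Sum>i\<in>UNIV. \<Sum>j\<in>UNIV. w * ((n x $ i * n x $ i) * B j x $ j) - w * (n x $ j * (B j x $ i * n x $ i)))"
      by (intro sum.cong refl) (simp add: Gx inner_axis algebra_simps)
    also have "\<dots> = w * ((\<Sum>i\<in>UNIV. n x $ i * n x $ i) * (\<Sum>j\<in>UNIV. B j x $ j)) - w * (\<Sum>j\<in>UNIV. n x $ j * (B j x \<bullet> n x))"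
    proof -
      have "(\<Sum>i\<in>UNIV. \<Sum>j\<in>UNIV. n x $ j * (B j x $ i * n x $ i)) = (\<Sum>j\<in>UNIV. n x $ j * (B j x \<bullet> n x))"
        by (subst sum.swap) (simp add: inner_vec_def sum_distrib_left)
      then show ?thesis by (simp add: sum_subtractf sum_product flip: sum_distrib_left)
    qed
    also have "\<dots> = w * ((\<Sum>j\<in>UNIV. B j x $ j) - (\<Sum>j\<in>UNIV. n x $ j * (B j x \<bullet> n x)))"
      unfolding nn by (simp add: right_diff_distrib)
    also have "(\<Sum>j\<in>UNIV. B j x $ j) - (\<Sum>j\<in>UNIV. n x $ j * (B j x \<bullet> n x)) = w * H x"
      unfolding w_def by (rule boundary_hessian[OF f f0 G x])
    also have "w * (w * H x) = H x * w\<^sup>2" by (simp add: power2_eq_square)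
    finally show "(\<Sum>i\<in>UNIV. \<Sum>j\<in>UNIV. ?r i j x) = H x * (G x \<bullet> n x)\<^sup>2" by (simp add: w_def)
  qed
  finally show ?thesis .
qed

text \<open>The curl identity with g a coordinate function x_k for some k other than i: its gradient
  is constant and orthogonal to axis i, so one term survives on each side.\<close>

theorem divergence_bar:
  fixes G :: "real^'a \<Rightarrow> real^'a"
  assumes G: "\<And>j. C1bar (\<lambda>x. G x $ j) (B j)"
  shows "(LINT x|lborel. indicator \<Omega> x * (\<Sum>i\<in>UNIV. B i x $ i)) = (LINT x|S. G x \<bullet> n x)"
proof -
  have sub: "\<Gamma> \<subseteq> closure \<Omega>" by (auto simp: frontier_iff)
  have cG: "continuous_on (closure \<Omega>) (\<lambda>x. G x $ j)" and cB: "continuous_on (closure \<Omega>) (B j)" for j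
    using G by (auto simp: C1bar_def)
  have one: "(LINT x|lborel. indicator \<Omega> x * B i x $ i) = (LINT x|S. G x $ i * n x $ i)" for i
  proof -
    obtain k where k: "k \<noteq> i"
    proof -
      have "\<not> (\<forall>k. k = i)"
      proof
        assume "\<forall>k. k = i"
        then have "(UNIV :: 'a set) = {i}" by auto
        then have "CARD('a) = 1" by (metis card_1_singleton_iff One_nat_def)
        then show False using CARD2 by simp
      qed
      then show thesis using that by blast
    qed
    have g: "C1bar (\<lambda>x. axis k 1 \<bullet> x) (\<lambda>_. axis k 1)"
      unfolding C1bar_def by (intro conjI C1on_inner_left continuous_intros)
    have "axis k (1::real) $ i = 0" "axis k (1::real) $ k = 1" using k by (auto simp: axis_def)
    then show ?thesis using curl_identity_bar[OF G g, of i "axis i 1" "axis k 1"]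
      by (simp add: inner_axis)
  qed
  have "(LINT x|lborel. indicator \<Omega> x * (\<Sum>i\<in>UNIV. B i x $ i)) = (LINT x|lborel. (\<Sum>i\<in>UNIV. indicator \<Omega> x * B i x $ i))"
    by (simp add: sum_distrib_left)
  also have "\<dots> = (\<Sum>i\<in>UNIV. LINT x|lborel. indicator \<Omega> x * B i x $ i)"
    by (intro Bochner_Integration.integral_sum integrable_volume continuous_intros cB)
  also have "\<dots> = (\<Sum>i\<in>UNIV. LINT x|S. G x $ i * n x $ i)" by (simp add: one)
  also have "\<dots> = (LINT x|S. (\<Sum>i\<in>UNIV. G x $ i * n x $ i))"
    by (intro Bochner_Integration.integral_sum[symmetric] integrable_surface continuous_intros continuous_on_subset[OF cG sub] cont_n)
  finally show ?thesis by (simp add: inner_vec_def)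
qed

end

section \<open>Outer normal and mean curvature of a level set\<close>

lemma differentiable_grad:
  fixes f :: "real^'n \<Rightarrow> real"
  assumes "f differentiable (at x)"
  shows "(f has_derivative (\<lambda>h. grad f x \<bullet> h)) (at x)"
proof -
  let ?f' = "frechet_derivative f (at x)"
  have d: "(f has_derivative ?f') (at x)" using assms by (simp add: frechet_derivative_works)
  then interpret f': bounded_linear ?f' by (rule has_derivative_bounded_linear)
  have "?f' h = grad f x \<bullet> h" for h
  proof -
    have "?f' h = ?f' (\<Sum>i\<in>UNIV. (h $ i) *\<^sub>R axis i 1)" by (simp only: sum_axis_scaleR)
    also have "\<dots> = grad f x \<bullet> h" by (simp add: f'.sum f'.scaleR inner_vec_def grad_def pd_def mult.commute)
    finally show ?thesis .
  qed
  then have "?f' = (\<lambda>h. grad f x \<bullet> h)" by (rule ext)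
  with d show ?thesis by simp
qed

text \<open>In \<open>hess f x $ i $ j\<close> the outer derivative is the i-th, so the gradient of
  the j-th partial derivative is the j-th column.\<close>

lemma C2_on_C1on:
  fixes f :: "real^'n \<Rightarrow> real"
  assumes f: "C2_on U f"
  shows "C1on U f (grad f)" "C1on U (\<lambda>x. grad f x $ j) (\<lambda>x. \<chi> i. hess f x $ i $ j)"
proof -
  have d: "f differentiable (at x)" "(\<lambda>y. pd f j y) differentiable (at x)" if "x \<in> U" for x j
    using f that by (auto simp: C2_on_def)
  have ch: "continuous_on U (hess f)" using f by (simp add: C2_on_def)
  have cp: "continuous_on U (\<lambda>x. pd f j x)" for j
    using d(2) by (meson continuous_at_imp_continuous_on differentiable_imp_continuous_within)
  show "C1on U f (grad f)"
    unfolding C1on_def using differentiable_grad[OF d(1)] cp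
    by (auto simp: grad_def[abs_def] intro!: continuous_on_vec_lambda)
  have "grad (\<lambda>y. pd f j y) x = (\<chi> i. hess f x $ i $ j)" for x
    by (simp add: grad_def hess_def vec_eq_iff)
  then show "C1on U (\<lambda>x. grad f x $ j) (\<lambda>x. \<chi> i. hess f x $ i $ j)"
    unfolding C1on_def using differentiable_grad[OF d(2), of _ j] ch
    by (auto simp: grad_def[of f] intro!: continuous_on_vec_lambda continuous_intros)
qed

text \<open>The second difference is symmetric in i and j. Two applications of the mean value
  theorem express it by one Hessian entry at a nearby point, in the order in which they are
  made.\<close>

lemma double_difference:
  fixes f :: "real^'n \<Rightarrow> real"
  assumes f: "C2_on U f" and s: "0 < s" and U: "cball x (2 * s) \<subseteq> U"
  obtains y where "dist y x \<le> 2 * s"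
    "f (x + s *\<^sub>R axis i 1 + s *\<^sub>R axis j 1) - f (x + s *\<^sub>R axis i 1) - f (x + s *\<^sub>R axis j 1) + f x = s\<^sup>2 * hess f y $ j $ i"
proof -
  let ?a = "s *\<^sub>R axis i (1::real) :: real^'n" and ?b = "s *\<^sub>R axis j (1::real) :: real^'n"
  have na: "norm ?a = s" "norm ?b = s" using s by auto
  have ne: "?a \<noteq> 0" "?b \<noteq> 0" using na s by auto
  note C = C2_on_C1on[OF f]
  have inU: "x + t *\<^sub>R ?a + t' *\<^sub>R ?b \<in> cball x (2 * s)" if "0 \<le> t" "t \<le> 1" "0 \<le> t'" "t' \<le> 1" for t t'
  proof -
    have "norm (t *\<^sub>R ?a + t' *\<^sub>R ?b) \<le> norm (t *\<^sub>R ?a) + norm (t' *\<^sub>R ?b)" by (rule norm_triangle_ineq)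
    also have "\<dots> = t * s + t' * s" using that s by simp
    also have "\<dots> \<le> 1 * s + 1 * s" using that s by (intro add_mono mult_right_mono) auto
    finally have "dist (x + (t *\<^sub>R ?a + t' *\<^sub>R ?b)) x \<le> 2 * s" by (simp add: dist_norm)
    then show ?thesis by (simp add: dist_commute add.assoc)
  qed
  let ?g = "\<lambda>y. f (y + ?b) - f y" and ?G = "\<lambda>y. grad f (y + ?b) - grad f y"
  have dg: "(?g has_derivative (\<lambda>h. ?G y \<bullet> h)) (at y)" if "y \<in> U" "y + ?b \<in> U" for y
  proof -
    have "((\<lambda>y. y + ?b) has_derivative (\<lambda>h. h)) (at y)" by (auto intro!: derivative_eq_intros)
    from has_derivative_diff[OF has_derivative_compose[OF this C1onD[OF C(1) that(2)]] C1onD[OF C(1) that(1)]]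
    show ?thesis by (simp add: inner_diff_left)
  qed
  have segin: "z \<in> U \<and> z + ?b \<in> U" if zz: "z \<in> closed_segment x (x + ?a)" for z
  proof -
    obtain t where t: "0 \<le> t" "t \<le> 1" "z = (1 - t) *\<^sub>R x + t *\<^sub>R (x + ?a)" using zz unfolding in_segment by blast
    then have "z = x + t *\<^sub>R ?a" by (simp add: algebra_simps)
    then show ?thesis using inU[of t 0] inU[of t 1] t U by auto
  qed
  have "continuous_on (closed_segment x (x + ?a)) ?g"
    using segin dg by (meson continuous_at_imp_continuous_on has_derivative_continuous)
  then obtain z where z: "z \<in> open_segment x (x + ?a)" "?g (x + ?a) - ?g x = ?G z \<bullet> (x + ?a - x)"
    using segment_mvt[of x "x + ?a" ?g ?G] dg segin ne open_closed_segment by (metis (no_types, lifting) add_cancel_left_right)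
  obtain t where t: "0 < t" "t < 1" "z = (1 - t) *\<^sub>R x + t *\<^sub>R (x + ?a)" using z(1) unfolding in_segment by blast
  then have zt: "z = x + t *\<^sub>R ?a" by (simp add: algebra_simps)
  have segin2: "y \<in> U \<and> dist y x \<le> 2 * s" if yy: "y \<in> closed_segment z (z + ?b)" for y
  proof -
    obtain t' where t': "0 \<le> t'" "t' \<le> 1" "y = (1 - t') *\<^sub>R z + t' *\<^sub>R (z + ?b)" using yy unfolding in_segment by blast
    then have "y = x + t *\<^sub>R ?a + t' *\<^sub>R ?b" unfolding zt by (simp add: algebra_simps)
    then show ?thesis using inU[of t t'] t t' U by (auto simp: dist_commute)
  qed
  let ?h = "\<lambda>y. grad f y $ i"
  have dh: "(?h has_derivative (\<lambda>k. (\<chi> l. hess f y $ l $ i) \<bullet> k)) (at y)" if "y \<in> U" for y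
    by (rule C1onD[OF C(2) that])
  have "continuous_on (closed_segment z (z + ?b)) ?h"
    using segin2 C1on_continuous[OF C(2)] continuous_on_subset by blast
  then obtain y where y: "y \<in> open_segment z (z + ?b)" "?h (z + ?b) - ?h z = (\<chi> l. hess f y $ l $ i) \<bullet> (z + ?b - z)"
  proof (rule segment_mvt[of z "z + ?b" ?h "\<lambda>y. \<chi> l. hess f y $ l $ i"])
    show "z \<noteq> z + ?b" using ne by simp
    show "(?h has_derivative (\<lambda>k. (\<chi> l. hess f y $ l $ i) \<bullet> k)) (at y)" if "y \<in> open_segment z (z + ?b)" for y
      using dh segin2[OF open_closed_segment[OF that]] by blast
  qed (rule that)
  have "f (x + ?a + ?b) - f (x + ?a) - f (x + ?b) + f x = ?g (x + ?a) - ?g x" by simp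
  also have "\<dots> = s * (?h (z + ?b) - ?h z)" unfolding z(2) by (simp add: inner_axis)
  also have "\<dots> = s\<^sup>2 * hess f y $ j $ i" unfolding y(2) by (simp add: inner_axis power2_eq_square)
  finally show ?thesis using that[of y] segin2[OF open_closed_segment[OF y(1)]] by blast
qed

text \<open>Reilly's identity involves the sum of B_ij B_ji, the theorem the sum of squares of the
  entries; symmetry identifies the two.\<close>

lemma hess_symmetric:
  fixes f :: "real^'n \<Rightarrow> real"
  assumes f: "C2_on U f" and U: "open U" "x \<in> U"
  shows "hess f x $ i $ j = hess f x $ j $ i"
proof -
  have ch: "continuous_on U (hess f)" using f by (simp add: C2_on_def)
  have "\<bar>hess f x $ i $ j - hess f x $ j $ i\<bar> \<le> 0 + e" if e: "0 < e" for e
  proof -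
    have c: "continuous_on U (\<lambda>y. hess f y $ k $ l)" for k l using ch by (intro continuous_intros)
    have "\<exists>d>0. \<forall>y\<in>U. dist y x < d \<longrightarrow> dist (hess f y $ k $ l) (hess f x $ k $ l) < e / 2" for k l
      using c[of k l] U(2) e unfolding continuous_on_iff by (meson half_gt_zero)
    then obtain d where d: "\<And>k l. 0 < d k l" "\<And>k l y. y \<in> U \<Longrightarrow> dist y x < d k l \<Longrightarrow> dist (hess f y $ k $ l) (hess f x $ k $ l) < e / 2" by metis
    obtain r where r: "0 < r" "cball x r \<subseteq> U" using U open_contains_cball by blast
    define s where "s = min r (min (d i j) (d j i)) / 4"
    have s: "0 < s" "2 * s < r" "2 * s < d i j" "2 * s < d j i" using r(1) d(1)[of i j] d(1)[of j i] by (auto simp: s_def)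
    have cb: "cball x (2 * s) \<subseteq> U" using r s by (auto simp: subset_iff)
    obtain y where y: "dist y x \<le> 2 * s" "f (x + s *\<^sub>R axis i 1 + s *\<^sub>R axis j 1) - f (x + s *\<^sub>R axis i 1) - f (x + s *\<^sub>R axis j 1) + f x = s\<^sup>2 * hess f y $ j $ i"
      by (rule double_difference[OF f s(1) cb])
    obtain z where z: "dist z x \<le> 2 * s" "f (x + s *\<^sub>R axis j 1 + s *\<^sub>R axis i 1) - f (x + s *\<^sub>R axis j 1) - f (x + s *\<^sub>R axis i 1) + f x = s\<^sup>2 * hess f z $ i $ j"
      by (rule double_difference[OF f s(1) cb])
    have "x + s *\<^sub>R axis j 1 + s *\<^sub>R axis i 1 = x + s *\<^sub>R axis i 1 + s *\<^sub>R axis j (1::real)" by (simp only: add_ac)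
    then have "s\<^sup>2 * hess f y $ j $ i = s\<^sup>2 * hess f z $ i $ j" using y(2) z(2) by (simp only:)
    then have yz: "hess f y $ j $ i = hess f z $ i $ j" using s by simp
    have yU: "y \<in> U" "z \<in> U" using cb y(1) z(1) by (auto simp: dist_commute subset_iff)
    have "dist y x < d j i" "dist z x < d i j" using y(1) z(1) s by linarith+
    then have "\<bar>hess f y $ j $ i - hess f x $ j $ i\<bar> < e / 2" "\<bar>hess f z $ i $ j - hess f x $ i $ j\<bar> < e / 2"
      using d(2)[OF yU(1)] d(2)[OF yU(2)] unfolding dist_real_def by blast+
    then show ?thesis unfolding yz by linarith
  qed
  then have "\<bar>hess f x $ i $ j - hess f x $ j $ i\<bar> \<le> 0" by (rule field_le_epsilon)
  then show ?thesis by simp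
qed

abbreviation unit_grad :: "(real^'n \<Rightarrow> real) \<Rightarrow> real^'n \<Rightarrow> real^'n" where
  "unit_grad f x \<equiv> inverse (norm (grad f x)) *\<^sub>R grad f x"

lemma divergence_eq:
  fixes N :: "real^'n \<Rightarrow> real^'n"
  assumes "\<And>j. ((\<lambda>x. N x $ j) has_derivative (\<lambda>h. Q j \<bullet> h)) (at x)"
  shows "divergence N x = (\<Sum>i\<in>UNIV. Q i $ i)"
proof -
  have "(N has_derivative (\<lambda>h. \<chi> j. Q j \<bullet> h)) (at x)"
    unfolding has_derivative_componentwise_within[of N]
    using assms by (auto simp: Basis_vec_def inner_axis)
  then have "frechet_derivative N (at x) = (\<lambda>h. \<chi> j. Q j \<bullet> h)" using frechet_derivative_at by metis
  then show ?thesis by (simp add: divergence_def inner_axis)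
qed

text \<open>The inverse norm is t^(-1/2) at the squared norm, which is C^1 and positive on
  U.\<close>

lemma unit_grad_C1on:
  fixes f :: "real^'n \<Rightarrow> real"
  assumes f: "C2_on U f" and ne: "\<And>x. x \<in> U \<Longrightarrow> grad f x \<noteq> 0"
  obtains Q where "\<And>j. C1on U (\<lambda>x. unit_grad f x $ j) (Q j)" "\<And>x. x \<in> U \<Longrightarrow> divergence (unit_grad f) x = (\<Sum>i\<in>UNIV. Q i x $ i)"
proof -
  note C = C2_on_C1on[OF f]
  let ?s = "\<lambda>x. \<Sum>j\<in>UNIV. grad f x $ j * grad f x $ j"
  have sn: "?s x = (norm (grad f x))\<^sup>2" for x by (simp add: power2_norm_eq_inner inner_vec_def)
  have pos: "0 < ?s x" if "x \<in> U" for x unfolding sn using ne[OF that] by simp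
  define S' where "S' x = (\<Sum>j\<in>UNIV. grad f x $ j *\<^sub>R (\<chi> i. hess f x $ i $ j) + grad f x $ j *\<^sub>R (\<chi> i. hess f x $ i $ j))" for x
  have S': "C1on U ?s S'" unfolding S'_def by (intro C1on_sum C1on_mult C finite)
  let ?\<phi> = "\<lambda>t::real. inverse (sqrt t)"
  let ?\<phi>' = "\<lambda>t::real. - (inverse (sqrt t) * (inverse (sqrt t) / 2) * inverse (sqrt t))"
  have "C1on U (\<lambda>x. ?\<phi> (?s x)) (\<lambda>x. ?\<phi>' (?s x) *\<^sub>R S' x)"
  proof (rule C1on_compose[OF S', where \<phi> = ?\<phi> and \<phi>' = ?\<phi>'])
    fix x assume x: "x \<in> U"
    have "DERIV ?\<phi> t :> ?\<phi>' t" if "0 < t" for t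
      by (rule DERIV_inverse'[OF DERIV_real_sqrt[OF that]]) (use that in simp)
    then show "DERIV ?\<phi> (?s x) :> ?\<phi>' (?s x)" using pos[OF x] by blast
  next
    have "continuous_on {0<..} ?\<phi>'" by (intro continuous_intros) auto
    then show "continuous_on U (\<lambda>x. ?\<phi>' (?s x))"
      by (rule continuous_on_compose2[OF _ C1on_continuous[OF S']]) (use pos in auto)
  qed
  moreover have "?\<phi> (?s x) = inverse (norm (grad f x))" for x
    by (simp only: sn real_sqrt_abs abs_norm_cancel)
  ultimately have I: "C1on U (\<lambda>x. inverse (norm (grad f x))) (\<lambda>x. ?\<phi>' (?s x) *\<^sub>R S' x)"
    by (simp only:)
  define Q where "Q j x = inverse (norm (grad f x)) *\<^sub>R (\<chi> i. hess f x $ i $ j) + grad f x $ j *\<^sub>R (?\<phi>' (?s x) *\<^sub>R S' x)" for j x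
  have Q: "C1on U (\<lambda>x. unit_grad f x $ j) (Q j)" for j
    using C1on_mult[OF I C(2), of j] by (simp add: Q_def[abs_def])
  show ?thesis
  proof (rule that[OF Q])
    fix x assume "x \<in> U"
    then show "divergence (unit_grad f) x = (\<Sum>i\<in>UNIV. Q i x $ i)"
      by (intro divergence_eq C1onD[OF Q])
  qed
qed

section \<open>Independence of normal and mean curvature from the defining function\<close>

lemma norm_unit_grad: "grad f x \<noteq> 0 \<Longrightarrow> norm (unit_grad f x) = 1"
  by simp

lemma local_defn_closure_le:
  assumes \<phi>: "local_defn \<Omega> p U \<phi>" and x: "x \<in> closure \<Omega>" "x \<in> U"
  shows "\<phi> x \<le> 0"
proof (rule ccontr)
  assume "\<not> \<phi> x \<le> 0"
  have U: "open U" and C: "C2_on U \<phi>" and \<Omega>: "\<Omega> \<inter> U = {x\<in>U. \<phi> x < 0}" using \<phi> by (auto simp: local_defn_def)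
  have "continuous_on U \<phi>" by (rule C1on_continuous[OF C2_on_C1on(1)[OF C]])
  then have "open (U \<inter> \<phi> -` {0<..})" using U by (intro continuous_open_preimage) auto
  moreover have "x \<in> U \<inter> \<phi> -` {0<..}" using x \<open>\<not> \<phi> x \<le> 0\<close> by simp
  ultimately have "U \<inter> \<phi> -` {0<..} \<inter> \<Omega> \<noteq> {}" using x(1) by (meson disjoint_iff open_Int_closure_eq_empty)
  then obtain y where "y \<in> \<Omega> \<inter> U" "0 < \<phi> y" by auto
  then show False unfolding \<Omega> by auto
qed

text \<open>Near p the unit gradient stays within \<eta> of its value at p, so \<phi> has negative
  derivative along the whole segment from x to y; it starts at a value at most 0 and ends
  negative.\<close>

lemma local_defn_cone:
  assumes \<phi>: "local_defn \<Omega> p U \<phi>" and \<eta>: "0 < \<eta>"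
  shows "\<exists>\<rho>>0. \<forall>x\<in>ball p \<rho>. \<forall>y\<in>ball p \<rho>. x \<in> closure \<Omega> \<longrightarrow> unit_grad \<phi> p \<bullet> (y - x) < - \<eta> * norm (y - x) \<longrightarrow> y \<in> \<Omega>"
proof -
  have U: "open U" "p \<in> U" and C: "C2_on U \<phi>" and ne: "\<And>x. x \<in> U \<Longrightarrow> grad \<phi> x \<noteq> 0" and \<Omega>: "\<Omega> \<inter> U = {x\<in>U. \<phi> x < 0}"
    using \<phi> by (auto simp: local_defn_def)
  note C1 = C2_on_C1on(1)[OF C]
  have "continuous_on U (unit_grad \<phi>)"
    using C1on_continuous_grad[OF C1] ne by (intro continuous_intros) auto
  then obtain r1 where r1: "0 < r1" "\<And>z. z \<in> U \<Longrightarrow> dist z p < r1 \<Longrightarrow> dist (unit_grad \<phi> z) (unit_grad \<phi> p) < \<eta>"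
    using U(2) \<eta> unfolding continuous_on_iff by metis
  obtain r2 where r2: "0 < r2" "ball p r2 \<subseteq> U" using U open_contains_ball by blast
  define \<rho> where "\<rho> = min r1 r2"
  have b: "ball p \<rho> \<subseteq> U" using r2 by (auto simp: \<rho>_def)
  have "y \<in> \<Omega>" if x: "x \<in> ball p \<rho>" and y: "y \<in> ball p \<rho>" and xc: "x \<in> closure \<Omega>"
    and lt: "unit_grad \<phi> p \<bullet> (y - x) < - \<eta> * norm (y - x)" for x y
  proof -
    have "x \<noteq> y" using lt by auto
    have seg: "closed_segment x y \<subseteq> ball p \<rho>" using x y by (intro closed_segment_subset) auto
    then have segU: "closed_segment x y \<subseteq> U" using b by blast
    obtain z where z: "z \<in> open_segment x y" "\<phi> y - \<phi> x = grad \<phi> z \<bullet> (y - x)"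
    proof (rule segment_mvt[of x y \<phi> "grad \<phi>"])
      show "continuous_on (closed_segment x y) \<phi>" by (rule continuous_on_subset[OF C1on_continuous[OF C1] segU])
      show "(\<phi> has_derivative (\<bullet>) (grad \<phi> z)) (at z)" if "z \<in> open_segment x y" for z
        using that segU by (intro C1onD[OF C1]) (auto simp: open_segment_def)
    qed (use \<open>x \<noteq> y\<close> in auto)
    have zb: "z \<in> ball p \<rho>" "z \<in> U" using z(1) seg segU by (auto simp: open_segment_def)
    then have "norm (unit_grad \<phi> z - unit_grad \<phi> p) < \<eta>" using r1(2)[OF zb(2)] by (simp add: \<rho>_def dist_norm[symmetric] dist_commute[of p])
    then have "\<bar>(unit_grad \<phi> z - unit_grad \<phi> p) \<bullet> (y - x)\<bar> \<le> \<eta> * norm (y - x)"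
      by (intro order_trans[OF Cauchy_Schwarz_ineq2] mult_right_mono) auto
    then have "unit_grad \<phi> z \<bullet> (y - x) < 0" using lt unfolding inner_diff_left[of "unit_grad \<phi> z"] by linarith
    then have "norm (grad \<phi> z) * (unit_grad \<phi> z \<bullet> (y - x)) < 0" using ne[OF zb(2)] by (simp add: mult_pos_neg)
    moreover have "norm (grad \<phi> z) * (unit_grad \<phi> z \<bullet> (y - x)) = grad \<phi> z \<bullet> (y - x)"
      using ne[OF zb(2)] by (simp only: inner_scaleR_left mult.assoc[symmetric]) (simp add: right_inverse)
    ultimately have "grad \<phi> z \<bullet> (y - x) < 0" by linarith
    then have "\<phi> y < 0" using z(2) local_defn_closure_le[OF \<phi> xc] x b by force
    then show ?thesis using \<Omega> y b by blast
  qed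
  then show ?thesis using r1(1) r2(1) by (intro exI[of _ \<rho>]) (auto simp: \<rho>_def)
qed

text \<open>If a and b differ, v = b - a satisfies a . v < 0 < b . v. A short step from p along v
  enters \<Omega> by the first cone condition, and the step back to p stays in \<Omega> by the
  second, although p is not in \<Omega>.\<close>

lemma cone_normal_unique:
  fixes a b :: "real^'n"
  assumes p: "p \<in> closure \<Omega>" "p \<notin> \<Omega>" and unit: "norm a = 1" "norm b = 1"
    and a: "\<And>\<eta>. 0 < \<eta> \<Longrightarrow> \<exists>\<rho>>0. \<forall>x\<in>ball p \<rho>. \<forall>y\<in>ball p \<rho>. x \<in> closure \<Omega> \<longrightarrow> a \<bullet> (y - x) < - \<eta> * norm (y - x) \<longrightarrow> y \<in> \<Omega>"
    and b: "\<And>\<eta>. 0 < \<eta> \<Longrightarrow> \<exists>\<rho>>0. \<forall>x\<in>ball p \<rho>. \<forall>y\<in>ball p \<rho>. x \<in> closure \<Omega> \<longrightarrow> b \<bullet> (y - x) < - \<eta> * norm (y - x) \<longrightarrow> y \<in> \<Omega>"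
  shows "a = b"
proof (rule ccontr)
  assume ne: "a \<noteq> b"
  define v where "v = b - a"
  define \<kappa> where "\<kappa> = 1 - a \<bullet> b"
  have ab1: "a \<bullet> a = 1" "b \<bullet> b = 1" using unit by (auto simp: norm_eq_1)
  have "v \<bullet> v = 2 * \<kappa>" using ab1 by (simp add: v_def \<kappa>_def inner_diff_left inner_diff_right inner_commute)
  moreover have "0 < v \<bullet> v" using ne by (simp add: v_def)
  ultimately have \<kappa>: "0 < \<kappa>" by simp
  have v0: "0 < norm v" using ne by (simp add: v_def)
  have av: "a \<bullet> v = - \<kappa>" and bv: "b \<bullet> v = \<kappa>" using ab1 by (auto simp: v_def \<kappa>_def inner_diff_right inner_commute)
  define \<eta> where "\<eta> = \<kappa> / (2 * norm v)"
  have \<eta>: "0 < \<eta>" "\<eta> * norm v = \<kappa> / 2" using \<kappa> v0 by (auto simp: \<eta>_def)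
  obtain r1 where r1: "0 < r1" "\<forall>x\<in>ball p r1. \<forall>y\<in>ball p r1. x \<in> closure \<Omega> \<longrightarrow> a \<bullet> (y - x) < - \<eta> * norm (y - x) \<longrightarrow> y \<in> \<Omega>"
    using a[OF \<eta>(1)] by blast
  obtain r2 where r2: "0 < r2" "\<forall>x\<in>ball p r2. \<forall>y\<in>ball p r2. x \<in> closure \<Omega> \<longrightarrow> b \<bullet> (y - x) < - \<eta> * norm (y - x) \<longrightarrow> y \<in> \<Omega>"
    using b[OF \<eta>(1)] by blast
  define t where "t = min r1 r2 / (2 * norm v)"
  have t: "0 < t" "t * norm v < r1" "t * norm v < r2" using r1(1) r2(1) v0 by (auto simp: t_def)
  let ?q = "p + t *\<^sub>R v"
  have q: "?q \<in> ball p r1" "?q \<in> ball p r2" using t by (auto simp: dist_norm)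
  have pb: "p \<in> ball p r1" "p \<in> ball p r2" using r1 r2 by auto
  have e: "\<eta> * (t * norm v) = t * (\<kappa> / 2)" using \<eta>(2) by (metis mult.left_commute)
  have "t * (\<kappa> / 2) < t * \<kappa>" using t(1) \<kappa> by simp
  then have lt: "a \<bullet> (?q - p) < - \<eta> * norm (?q - p)" "b \<bullet> (p - ?q) < - \<eta> * norm (p - ?q)"
    using t(1) by (simp_all add: av bv e)
  have "?q \<in> \<Omega>" using r1(2) pb q p(1) lt(1) by blast
  then have "?q \<in> closure \<Omega>" using closure_subset by blast
  then have "p \<in> \<Omega>" using r2(2) pb q lt(2) by blast
  then show False using p by simp
qed

lemma outer_normal_eq:
  assumes \<Omega>: "open \<Omega>" and p: "p \<in> frontier \<Omega>" and \<phi>: "local_defn \<Omega> p U \<phi>"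
  shows "outer_normal \<Omega> p = unit_grad \<phi> p"
proof -
  have pc: "p \<in> closure \<Omega>" "p \<notin> \<Omega>" using p \<Omega> by (auto simp: frontier_def interior_open)
  have "\<exists>U \<phi>. local_defn \<Omega> p U \<phi> \<and> outer_normal \<Omega> p = unit_grad \<phi> p"
    unfolding outer_normal_def by (rule someI[where P = "\<lambda>\<nu>. \<exists>U \<phi>. local_defn \<Omega> p U \<phi> \<and> \<nu> = unit_grad \<phi> p"]) (use \<phi> in blast)
  then obtain U' \<psi> where \<psi>: "local_defn \<Omega> p U' \<psi>" "outer_normal \<Omega> p = unit_grad \<psi> p" by blast
  have "unit_grad \<psi> p = unit_grad \<phi> p"
    by (rule cone_normal_unique[OF pc _ _ local_defn_cone[OF \<psi>(1)] local_defn_cone[OF \<phi>]])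
      (use \<phi> \<psi>(1) in \<open>auto simp: local_defn_def\<close>)
  with \<psi>(2) show ?thesis by simp
qed

lemma local_defn_move: "local_defn \<Omega> p U \<phi> \<Longrightarrow> x \<in> U \<Longrightarrow> local_defn \<Omega> x U \<phi>"
  by (simp add: local_defn_def)

lemma C1_domain_outer_normal:
  fixes \<Omega> :: "(real^'n) set"
  assumes N2: "CARD('n) \<ge> 2" and dom: "open \<Omega>" "bounded \<Omega>" and bdry: "C2alpha_boundary \<alpha> \<Omega>"
  shows "C1_domain \<Omega> (outer_normal \<Omega>)"
proof
  show "CARD('n) \<ge> 2" "open \<Omega>" "bounded \<Omega>" by fact+
  have ex: "\<exists>U \<phi>. local_defn \<Omega> p U \<phi>" if "p \<in> frontier \<Omega>" for p
    using bdry that unfolding C2alpha_boundary_def by blast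
  show "norm (outer_normal \<Omega> x) = 1" if x: "x \<in> frontier \<Omega>" for x
  proof -
    obtain U \<phi> where \<phi>: "local_defn \<Omega> x U \<phi>" using ex[OF x] by blast
    then have "grad \<phi> x \<noteq> 0" by (auto simp: local_defn_def)
    then show ?thesis unfolding outer_normal_eq[OF dom(1) x \<phi>] by (rule norm_unit_grad)
  qed
  show "continuous_on (frontier \<Omega>) (outer_normal \<Omega>)"
    unfolding continuous_on_eq_continuous_within
  proof
    fix p assume p: "p \<in> frontier \<Omega>"
    obtain U \<phi> where \<phi>: "local_defn \<Omega> p U \<phi>" using ex[OF p] by blast
    then have U: "open U" "p \<in> U" and C: "C2_on U \<phi>" and ne: "\<And>x. x \<in> U \<Longrightarrow> grad \<phi> x \<noteq> 0" by (auto simp: local_defn_def)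
    have "continuous_on U (unit_grad \<phi>)"
      using C1on_continuous_grad[OF C2_on_C1on(1)[OF C]] ne by (intro continuous_intros) auto
    then have "continuous (at p within frontier \<Omega> \<inter> U) (unit_grad \<phi>)"
      using U by (meson continuous_on_eq_continuous_within continuous_within_subset inf_le2)
    then have "continuous (at p within frontier \<Omega> \<inter> U) (outer_normal \<Omega>)"
      by (rule continuous_transform_within[OF _ zero_less_one])
        (use p U outer_normal_eq[OF dom(1) _ local_defn_move[OF \<phi>]] in auto)
    then show "continuous (at p within frontier \<Omega>) (outer_normal \<Omega>)"
      using at_within_nhd[OF U(2,1), of "frontier \<Omega>" "frontier \<Omega> \<inter> U"] by (simp add: Int_assoc)
  qed
  show "\<exists>\<rho>>0. \<forall>x\<in>ball p \<rho>. \<forall>y\<in>ball p \<rho>. x \<in> closure \<Omega> \<longrightarrow> outer_normal \<Omega> p \<bullet> (y - x) < - \<eta> * norm (y - x) \<longrightarrow> y \<in> \<Omega>"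
    if p: "p \<in> frontier \<Omega>" and \<eta>: "0 < \<eta>" for p \<eta>
  proof -
    obtain U \<phi> where \<phi>: "local_defn \<Omega> p U \<phi>" using ex[OF p] by blast
    show ?thesis unfolding outer_normal_eq[OF dom(1) p \<phi>] by (rule local_defn_cone[OF \<phi> \<eta>])
  qed
qed

text \<open>The two unit fields agree on the boundary, so the derivatives of their difference vanish
  on tangent vectors. The normal entry of the derivative of a unit field is 0, so the traces agree
  as well.\<close>

lemma mean_curv_eq:
  fixes \<Omega> :: "(real^'n) set"
  assumes D: "C1_domain \<Omega> (outer_normal \<Omega>)" and p: "p \<in> frontier \<Omega>" and \<phi>: "local_defn \<Omega> p U \<phi>"
  shows "mean_curv \<Omega> p = divergence (unit_grad \<phi>) p / (real CARD('n) - 1)"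
proof -
  interpret C1_domain \<Omega> "outer_normal \<Omega>" by (rule D)
  have "\<exists>U \<phi>. local_defn \<Omega> p U \<phi> \<and> mean_curv \<Omega> p = divergence (unit_grad \<phi>) p / (real CARD('n) - 1)"
    unfolding mean_curv_def
    by (rule someI[where P = "\<lambda>h. \<exists>U \<phi>. local_defn \<Omega> p U \<phi> \<and> h = divergence (unit_grad \<phi>) p / (real CARD('n) - 1)"]) (use \<phi> in blast)
  then obtain U' \<psi> where \<psi>: "local_defn \<Omega> p U' \<psi>" "mean_curv \<Omega> p = divergence (unit_grad \<psi>) p / (real CARD('n) - 1)" by blast
  have U: "open U" "p \<in> U" "C2_on U \<phi>" "\<And>x. x \<in> U \<Longrightarrow> grad \<phi> x \<noteq> 0" using \<phi> by (auto simp: local_defn_def)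
  have U': "open U'" "p \<in> U'" "C2_on U' \<psi>" "\<And>x. x \<in> U' \<Longrightarrow> grad \<psi> x \<noteq> 0" using \<psi>(1) by (auto simp: local_defn_def)
  obtain Q where Q: "\<And>j. C1on U (\<lambda>x. unit_grad \<phi> x $ j) (Q j)" "\<And>x. x \<in> U \<Longrightarrow> divergence (unit_grad \<phi>) x = (\<Sum>i\<in>UNIV. Q i x $ i)"
    by (rule unit_grad_C1on[OF U(3,4)]) (assumption, rule that, assumption+)
  obtain Q' where Q': "\<And>j. C1on U' (\<lambda>x. unit_grad \<psi> x $ j) (Q' j)" "\<And>x. x \<in> U' \<Longrightarrow> divergence (unit_grad \<psi>) x = (\<Sum>i\<in>UNIV. Q' i x $ i)"
    by (rule unit_grad_C1on[OF U'(3,4)]) (assumption, rule that, assumption+)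
  let ?n = "outer_normal \<Omega>"
  have np: "unit_grad \<phi> p = ?n p" "unit_grad \<psi> p = ?n p"
    using outer_normal_eq[OF open_\<Omega> p \<phi>] outer_normal_eq[OF open_\<Omega> p \<psi>(1)] by auto
  have z: "(\<Sum>j\<in>UNIV. ?n p $ j * (Q j p \<bullet> h)) = 0" "(\<Sum>j\<in>UNIV. ?n p $ j * (Q' j p \<bullet> h)) = 0" for h
    using unit_field_grad[OF U(1) Q(1) norm_unit_grad[OF U(4)] U(2), of h]
      unit_field_grad[OF U'(1) Q'(1) norm_unit_grad[OF U'(4)] U'(2), of h] unfolding np by auto
  have "(Q j p - Q' j p) \<bullet> \<tau> = 0 * ?n p $ j" if \<tau>: "?n p \<bullet> \<tau> = 0" for \<tau> j
  proof -
    have "Q j p \<bullet> \<tau> - Q' j p \<bullet> \<tau> = 0"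
    proof (rule tangent_derivative_zero[OF p open_Int[OF U(1) U'(1)] _ _ _ \<tau>, where f = "\<lambda>x. unit_grad \<phi> x $ j - unit_grad \<psi> x $ j"])
      show "((\<lambda>x. unit_grad \<phi> x $ j - unit_grad \<psi> x $ j) has_derivative (\<lambda>h. Q j p \<bullet> h - Q' j p \<bullet> h)) (at p within \<Gamma>)"
        by (intro has_derivative_diff has_derivative_at_withinI[OF C1onD[OF Q(1) U(2)]] has_derivative_at_withinI[OF C1onD[OF Q'(1) U'(2)]])
      show "unit_grad \<phi> x $ j - unit_grad \<psi> x $ j = 0" if "x \<in> \<Gamma>" "x \<in> U \<inter> U'" for x
        using outer_normal_eq[OF open_\<Omega> that(1) local_defn_move[OF \<phi>]] outer_normal_eq[OF open_\<Omega> that(1) local_defn_move[OF \<psi>(1)]] that by simp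
    qed (use U U' in auto)
    then show ?thesis by (simp add: inner_diff_left)
  qed
  from trace_tangential[of "?n p" "\<lambda>j. Q j p - Q' j p" "\<lambda>_. 0", OF norm_n[OF p] this]
  have "(\<Sum>j\<in>UNIV. (Q j p - Q' j p) $ j) = (\<Sum>j\<in>UNIV. ?n p $ j * ((Q j p - Q' j p) \<bullet> ?n p))" .
  also have "\<dots> = 0" using z by (simp add: inner_diff_left right_diff_distrib sum_subtractf)
  finally have "(\<Sum>j\<in>UNIV. Q j p $ j) = (\<Sum>j\<in>UNIV. Q' j p $ j)" by (simp add: sum_subtractf)
  then show ?thesis using \<psi>(2) Q(2)[OF U(2)] Q'(2)[OF U'(2)] by simp
qed

lemma C2_domain_outer_normal:
  fixes \<Omega> :: "(real^'n) set"
  assumes N2: "CARD('n) \<ge> 2" and dom: "open \<Omega>" "bounded \<Omega>" and bdry: "C2alpha_boundary \<alpha> \<Omega>"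
  shows "C2_domain \<Omega> (outer_normal \<Omega>) (\<lambda>x. (real CARD('n) - 1) * mean_curv \<Omega> x)"
proof -
  have D: "C1_domain \<Omega> (outer_normal \<Omega>)" by (rule C1_domain_outer_normal[OF assms])
  interpret C1_domain \<Omega> "outer_normal \<Omega>" by (rule D)
  show ?thesis
  proof
    fix p assume p: "p \<in> frontier \<Omega>"
    obtain U \<phi> where \<phi>: "local_defn \<Omega> p U \<phi>" using bdry p unfolding C2alpha_boundary_def by blast
    have U: "open U" "p \<in> U" "C2_on U \<phi>" "\<And>x. x \<in> U \<Longrightarrow> grad \<phi> x \<noteq> 0" using \<phi> by (auto simp: local_defn_def)
    obtain Q where Q: "\<And>j. C1on U (\<lambda>x. unit_grad \<phi> x $ j) (Q j)" "\<And>x. x \<in> U \<Longrightarrow> divergence (unit_grad \<phi>) x = (\<Sum>i\<in>UNIV. Q i x $ i)"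
      by (rule unit_grad_C1on[OF U(3,4)]) (assumption, rule that, assumption+)
    have "outer_normal \<Omega> x = unit_grad \<phi> x \<and> (real CARD('n) - 1) * mean_curv \<Omega> x = (\<Sum>i\<in>UNIV. Q i x $ i)"
      if x: "x \<in> frontier \<Omega> \<inter> U" for x
    proof -
      have \<phi>x: "local_defn \<Omega> x U \<phi>" and xf: "x \<in> frontier \<Omega>" using x local_defn_move[OF \<phi>] by auto
      show ?thesis using outer_normal_eq[OF dom(1) xf \<phi>x] mean_curv_eq[OF D xf \<phi>x] Q(2)[of x] x N2 by simp
    qed
    then show "\<exists>U N Q. open U \<and> p \<in> U \<and> (\<forall>j. C1on U (\<lambda>x. N x $ j) (Q j)) \<and> (\<forall>x\<in>U. norm (N x) = 1) \<and>
        (\<forall>x\<in>frontier \<Omega> \<inter> U. outer_normal \<Omega> x = N x \<and> (real CARD('n) - 1) * mean_curv \<Omega> x = (\<Sum>i\<in>UNIV. Q i x $ i))"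
      using U Q(1) norm_unit_grad[OF U(4)] by (intro exI[of _ U] exI[of _ "unit_grad \<phi>"] exI[of _ Q]) blast
  qed
qed

section \<open>The Heintze--Karcher inequality\<close>

text \<open>The complement of the closed ball and the open ball are connected and miss the frontier,
  so each lies in \<Omega> or is disjoint from it. Boundedness decides the first case, nonemptiness
  the second.\<close>

lemma open_eq_ball:
  fixes \<Omega> :: "'a::euclidean_space set"
  assumes D: "2 \<le> DIM('a)" and \<Omega>: "open \<Omega>" "bounded \<Omega>" "\<Omega> \<noteq> {}" and fr: "frontier \<Omega> \<subseteq> sphere c r"
  shows "\<Omega> = ball c r"
proof -
  have "\<Omega> \<inter> - cball c r = {}"
  proof (rule ccontr)
    assume ne: "\<Omega> \<inter> - cball c r \<noteq> {}"
    have "connected (- cball c r)" by (rule connected_complement_bounded_convex[OF bounded_cball convex_cball D])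
    moreover have "- cball c r \<inter> frontier \<Omega> = {}" using fr by auto
    ultimately have "- cball c r \<subseteq> \<Omega>" using connected_Int_frontier[of "- cball c r" \<Omega>] ne by blast
    then have "bounded (- cball c r)" using \<Omega>(2) bounded_subset by blast
    then show False using cobounded_imp_unbounded[of "- cball c r"] by simp
  qed
  then have "\<Omega> \<subseteq> cball c r" by blast
  then have sub: "\<Omega> \<subseteq> ball c r" using interior_maximal[OF _ \<Omega>(1)] by (metis interior_cball)
  have "ball c r \<inter> frontier \<Omega> = {}" using fr by auto
  then have "ball c r \<subseteq> \<Omega>"
    using connected_Int_frontier[OF connected_ball, of c r \<Omega>] sub \<Omega>(3) by blast
  with sub show ?thesis by blast
qed

context C1_domain
begin

text \<open>The set where h is positive is open and null, hence empty.\<close>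

lemma integral_eq_0_imp:
  fixes h :: "real^'n \<Rightarrow> real"
  assumes h: "continuous_on (closure \<Omega>) h" "\<And>x. x \<in> \<Omega> \<Longrightarrow> 0 \<le> h x"
    and i0: "(LINT x|lborel. indicator \<Omega> x * h x) = 0" and x: "x \<in> \<Omega>"
  shows "h x = 0"
proof (rule ccontr)
  assume "h x \<noteq> 0"
  let ?P = "\<Omega> \<inter> h -` {0<..}"
  have "x \<in> ?P" using x h(2)[OF x] \<open>h x \<noteq> 0\<close> by simp
  have op: "open ?P"
    using continuous_on_subset[OF h(1) closure_subset] open_\<Omega> by (intro continuous_open_preimage) auto
  have "AE x in lborel. indicator \<Omega> x * h x = 0"
    using i0 by (subst (asm) integral_nonneg_eq_0_iff_AE[OF integrable_volume[OF h(1)]]) (auto simp: h(2) indicator_def)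
  then have "AE x in lborel. x \<notin> ?P" by eventually_elim auto
  then have "?P \<in> null_sets lborel" using op by (simp add: AE_iff_null_sets)
  then have "negligible ?P" by (simp add: negligible_iff_null_sets null_sets_completionI)
  then show False using open_not_negligible[OF op] \<open>x \<in> ?P\<close> by blast
qed

lemma C1bar_affine: "C1bar (\<lambda>x. (x - c) $ j) (\<lambda>_. axis j 1)"
proof -
  have "((\<lambda>x. (x - c) $ j) has_derivative (\<lambda>h. axis j 1 \<bullet> h)) (at x)" for x :: "real^'n"
    using has_derivative_diff[OF bounded_linear_imp_has_derivative[OF bounded_linear_vec_nth, of j "at x"] has_derivative_const[of "c $ j"]]
    by (simp add: inner_axis')
  then show ?thesis unfolding C1bar_def C1on_def by (intro conjI ballI continuous_intros) auto
qed

lemma ball_of_unit_hessian: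
  fixes G :: "real^'n \<Rightarrow> real^'n"
  assumes c\<Omega>: "connected \<Omega>" "\<Omega> \<noteq> {}" and f: "C1bar f G" and f0: "\<And>x. x \<in> \<Gamma> \<Longrightarrow> f x = 0"
    and G: "\<And>j. C1bar (\<lambda>x. G x $ j) (B j)" and B: "\<And>j x. x \<in> \<Omega> \<Longrightarrow> B j x = axis j 1"
  shows "\<exists>c r. \<Omega> = ball c r"
proof -
  obtain a where a: "a \<in> \<Omega>" using c\<Omega> by blast
  define c where "c = a - G a"
  have Gc: "G x = x - c" if x: "x \<in> \<Omega>" for x
  proof -
    have "G x $ j - x $ j = G a $ j - a $ j" for j
    proof (rule has_derivative_zero_unique_connected[OF open_\<Omega> c\<Omega>(1) _ x a, where f = "\<lambda>x. G x $ j - x $ j"])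
      fix y assume y: "y \<in> \<Omega>"
      have "((\<lambda>x. G x $ j) has_derivative (\<lambda>h. B j y \<bullet> h)) (at y)"
        using G[of j] C1onD[OF _ y] by (simp add: C1bar_def)
      moreover have "((\<lambda>x. x $ j) has_derivative (\<lambda>h. h $ j)) (at y)" by (rule bounded_linear_imp_has_derivative[OF bounded_linear_vec_nth])
      ultimately show "((\<lambda>x. G x $ j - x $ j) has_derivative (\<lambda>x. 0)) (at y)"
        using has_derivative_diff[of _ "\<lambda>h. B j y \<bullet> h" "at y" "\<lambda>x. x $ j" "\<lambda>h. h $ j"] by (simp add: B[OF y] inner_axis')
    qed
    then show ?thesis by (simp add: vec_eq_iff c_def algebra_simps)
  qed
  let ?q = "\<lambda>x. f x - (x - c) \<bullet> (x - c) / 2"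
  have fc: "continuous_on (closure \<Omega>) f" "C1on \<Omega> f G" using f by (auto simp: C1bar_def)
  have q: "?q x = ?q a" if x: "x \<in> \<Omega>" for x
  proof (rule has_derivative_zero_unique_connected[OF open_\<Omega> c\<Omega>(1) _ x a, where f = ?q])
    fix y assume y: "y \<in> \<Omega>"
    have "((\<lambda>x. (x - c) \<bullet> (x - c) / 2) has_derivative (\<lambda>h. (y - c) \<bullet> h)) (at y)"
      by (auto intro!: derivative_eq_intros simp: inner_commute)
    from has_derivative_diff[OF C1onD[OF fc(2) y] this]
    show "(?q has_derivative (\<lambda>x. 0)) (at y)" by (simp add: Gc[OF y])
  qed
  have "continuous_on (closure \<Omega>) ?q" using fc by (intro continuous_intros) auto
  then have qc: "?q x = ?q a" if "x \<in> closure \<Omega>" for x by (rule continuous_constant_on_closure[OF _ q that])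
  \<comment> \<open>The constant \<open>?q a\<close> equals -|x - c|^2 / 2 on the boundary, where f
    = 0, so s is the squared radius.\<close>
  define s where "s = - 2 * ?q a"
  have "frontier \<Omega> \<subseteq> sphere c (sqrt s)"
  proof
    fix x assume x: "x \<in> \<Gamma>"
    then have "x \<in> closure \<Omega>" by (simp add: frontier_iff)
    from qc[OF this] have "(x - c) \<bullet> (x - c) = s" unfolding s_def f0[OF x] by (simp only: diff_0 minus_mult_left[symmetric]) simp
    then have "norm (x - c) = sqrt s" unfolding norm_eq_sqrt_inner by (rule arg_cong)
    then show "x \<in> sphere c (sqrt s)" by (simp only: mem_sphere dist_norm norm_minus_commute)
  qed
  then have "\<Omega> = ball c (sqrt s)"
    using CARD2 open_\<Omega> bounded_\<Omega> c\<Omega>(2) by (intro open_eq_ball) auto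
  then show ?thesis by blast
qed

end

section \<open>The integral identity and its equality cases\<close>

context C2_domain
begin

context
  fixes m :: "real^'a \<Rightarrow> real"
  assumes H: "\<And>x. x \<in> \<Gamma> \<Longrightarrow> H x = (real CARD('a) - 1) * m x"
    and m: "\<And>x. x \<in> \<Gamma> \<Longrightarrow> 0 < m x"
begin

lemma continuous_m: "continuous_on \<Gamma> m"
proof -
  have "continuous_on \<Gamma> (\<lambda>x. H x / (real CARD('a) - 1))"
    using CARD2 continuous_H by (intro continuous_intros) auto
  then show ?thesis using H CARD2 by (subst continuous_on_cong[OF refl, of _ _ "\<lambda>x. H x / (real CARD('a) - 1)"]) auto
qed

lemma volume_eq:
  fixes G :: "real^'a \<Rightarrow> real^'a"
  assumes G: "\<And>j. C1bar (\<lambda>x. G x $ j) (B j)" and tr: "\<And>x. x \<in> \<Omega> \<Longrightarrow> (\<Sum>i\<in>UNIV. B i x $ i) = real CARD('a)"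
  shows "(LINT x|S. G x \<bullet> n x) = real CARD('a) * measure lebesgue \<Omega>"
proof -
  have "(LINT x|S. G x \<bullet> n x) = (LINT x|lborel. indicator \<Omega> x * (\<Sum>i\<in>UNIV. B i x $ i))"
    by (rule divergence_bar[OF G, symmetric])
  also have "\<dots> = (LINT x|lborel. real CARD('a) * indicator \<Omega> x)"
    by (intro Bochner_Integration.integral_cong) (auto simp: tr indicator_def)
  also have "\<dots> = real CARD('a) * measure lborel \<Omega>" by simp
  also have "measure lborel \<Omega> = measure lebesgue \<Omega>"
    using open_\<Omega> by (simp add: measure_completion)
  finally show ?thesis .
qed

lemma torsion_identity:
  fixes G :: "real^'a \<Rightarrow> real^'a"
  assumes f: "C1bar f G" and f0: "\<And>x. x \<in> \<Gamma> \<Longrightarrow> f x = 0" and G: "\<And>j. C1bar (\<lambda>x. G x $ j) (B j)"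
    and tr: "\<And>x. x \<in> \<Omega> \<Longrightarrow> (\<Sum>i\<in>UNIV. B i x $ i) = real CARD('a)"
    and sym: "\<And>x i j. x \<in> \<Omega> \<Longrightarrow> B i x $ j = B j x $ i"
  shows "1 / (real CARD('a) - 1) * (LINT x|lborel. indicator \<Omega> x * ((\<Sum>i\<in>UNIV. \<Sum>j\<in>UNIV. (B i x $ j)\<^sup>2) - real CARD('a)))
      + (LINT x|S. (1 - m x * (G x \<bullet> n x))\<^sup>2 / m x)
    = (LINT x|S. 1 / m x) - real CARD('a) * measure lebesgue \<Omega>"
proof -
  let ?K = "real CARD('a)" and ?V = "measure lebesgue \<Omega>"
  have sub: "\<Gamma> \<subseteq> closure \<Omega>" by (auto simp: frontier_iff)
  have cG: "continuous_on (closure \<Omega>) (\<lambda>x. G x)" and cB: "continuous_on (closure \<Omega>) (B j)" for j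
    using f G by (auto simp: C1bar_def)
  have cw: "continuous_on \<Gamma> (\<lambda>x. G x \<bullet> n x)" by (intro continuous_intros cont_n continuous_on_subset[OF cG sub])
  have K: "?K - 1 \<noteq> 0" using CARD2 by simp
  let ?s = "\<lambda>x. \<Sum>i\<in>UNIV. \<Sum>j\<in>UNIV. (B i x $ j)\<^sup>2"
  have cs: "continuous_on (closure \<Omega>) ?s" by (intro continuous_intros cB)
  \<comment> \<open>W enters both integrals: the Hessian term is N |\<Omega>| - W, the expanded
    square is the integral of 1 / m minus 2 N |\<Omega>| plus W, and W cancels in the sum.\<close>
  define W where "W = (LINT x|S. m x * (G x \<bullet> n x)\<^sup>2)"
  have V: "(LINT x|lborel. indicator \<Omega> x * c) = c * ?V" for c
  proof -
    have "measure lborel \<Omega> = ?V" using open_\<Omega> by (simp add: measure_completion)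
    then show ?thesis by (simp add: mult.commute)
  qed
  have "(?K - 1) * W = (LINT x|S. H x * (G x \<bullet> n x)\<^sup>2)"
    unfolding W_def integral_mult_right_zero[symmetric]
    by (intro Bochner_Integration.integral_cong refl) (simp add: H mult.assoc)
  also have "\<dots> = (LINT x|lborel. indicator \<Omega> x * ((\<Sum>i\<in>UNIV. B i x $ i)\<^sup>2 - (\<Sum>i\<in>UNIV. \<Sum>j\<in>UNIV. B i x $ j * B j x $ i)))"
    by (rule Reilly_identity[OF f f0 G, symmetric])
  also have "\<dots> = (LINT x|lborel. indicator \<Omega> x * (?K\<^sup>2 - ?K) - indicator \<Omega> x * (?s x - ?K))"
  proof (intro Bochner_Integration.integral_cong refl)
    fix x
    have "(\<Sum>i\<in>UNIV. \<Sum>j\<in>UNIV. B i x $ j * B j x $ i) = ?s x" if "x \<in> \<Omega>"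
      by (intro sum.cong refl) (simp add: power2_eq_square sym[OF that])
    then show "indicator \<Omega> x * ((\<Sum>i\<in>UNIV. B i x $ i)\<^sup>2 - (\<Sum>i\<in>UNIV. \<Sum>j\<in>UNIV. B i x $ j * B j x $ i)) = indicator \<Omega> x * (?K\<^sup>2 - ?K) - indicator \<Omega> x * (?s x - ?K)"
      by (cases "x \<in> \<Omega>") (simp_all add: tr)
  qed
  also have "\<dots> = (LINT x|lborel. indicator \<Omega> x * (?K\<^sup>2 - ?K)) - (LINT x|lborel. indicator \<Omega> x * (?s x - ?K))"
    by (intro Bochner_Integration.integral_diff integrable_volume continuous_intros cs)
  finally have "(LINT x|lborel. indicator \<Omega> x * (?s x - ?K)) = (?K - 1) * (?K * ?V - W)"
    unfolding V by (simp add: algebra_simps power2_eq_square)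
  then have D: "1 / (?K - 1) * (LINT x|lborel. indicator \<Omega> x * (?s x - ?K)) = ?K * ?V - W" using K by simp
  have "(LINT x|S. (1 - m x * (G x \<bullet> n x))\<^sup>2 / m x) = (LINT x|S. 1 / m x - 2 * (G x \<bullet> n x) + m x * (G x \<bullet> n x)\<^sup>2)"
  proof (intro Bochner_Integration.integral_cong refl)
    fix x assume "x \<in> space S"
    then have "m x \<noteq> 0" using m[of x] by simp
    then show "(1 - m x * (G x \<bullet> n x))\<^sup>2 / m x = 1 / m x - 2 * (G x \<bullet> n x) + m x * (G x \<bullet> n x)\<^sup>2"
      by (simp add: field_simps power2_eq_square)
  qed
  also have "\<dots> = (LINT x|S. 1 / m x - 2 * (G x \<bullet> n x)) + W"
    unfolding W_def
    by (intro Bochner_Integration.integral_add integrable_surface continuous_intros cw continuous_m) (use m in force)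
  also have "(LINT x|S. 1 / m x - 2 * (G x \<bullet> n x)) = (LINT x|S. 1 / m x) - (LINT x|S. 2 * (G x \<bullet> n x))"
    by (intro Bochner_Integration.integral_diff integrable_surface continuous_intros cw continuous_m) (use m in force)
  also have "(LINT x|S. 2 * (G x \<bullet> n x)) = 2 * (?K * ?V)" using volume_eq[OF G tr] by simp
  finally show ?thesis unfolding D by simp
qed

text \<open>The explicit solution (|x - c|^2 - r^2)/2 has the identity as Hessian, so
  \<open>boundary_hessian\<close> reads N - 1 = u_nu H, that is 1 / m = u_nu. The curvature of the
  sphere is thus obtained without a defining function.\<close>

lemma HeintzeKarcher_ball:
  assumes ball: "\<Omega> = ball c r" and r: "0 < r"
  shows "(LINT x|S. 1 / m x) = real CARD('a) * measure lebesgue \<Omega>"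
proof -
  let ?K = "real CARD('a)"
  let ?f = "\<lambda>x. ((x - c) \<bullet> (x - c) - r\<^sup>2) / 2"
  have "(?f has_derivative (\<lambda>h. (x - c) \<bullet> h)) (at x)" for x
    by (auto intro!: derivative_eq_intros simp: inner_commute)
  then have f: "C1bar ?f (\<lambda>x. x - c)" unfolding C1bar_def C1on_def by (intro conjI ballI continuous_intros) auto
  have f0: "?f x = 0" if "x \<in> \<Gamma>" for x
    using that r unfolding ball by (simp add: dist_norm norm_minus_commute[of c] dot_square_norm)
  have tr: "(\<Sum>i\<in>UNIV. (axis i 1 :: real^'a) $ i) = ?K" by simp
  have "1 / m x = (x - c) \<bullet> n x" if x: "x \<in> \<Gamma>" for x
  proof -
    have "(\<Sum>j\<in>UNIV. n x $ j * (axis j 1 \<bullet> n x)) = 1"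
      using norm_n[OF x] unfolding norm_eq_1 inner_vec_def[of "n x"] by (simp add: inner_axis')
    then have "?K - 1 = (x - c) \<bullet> n x * H x"
      using boundary_hessian[OF f f0 C1bar_affine x] by (simp only: tr)
    then have "(?K - 1) * ((x - c) \<bullet> n x * m x) = (?K - 1) * 1" using H[OF x] by (simp add: mult_ac)
    then have "(x - c) \<bullet> n x * m x = 1" using CARD2 by simp
    then show ?thesis using m[OF x] by (simp add: field_simps)
  qed
  then have "(LINT x|S. 1 / m x) = (LINT x|S. (x - c) \<bullet> n x)" by (intro Bochner_Integration.integral_cong) auto
  also have "\<dots> = ?K * measure lebesgue \<Omega>" by (rule volume_eq[OF C1bar_affine tr])
  finally show ?thesis .
qed

lemma HeintzeKarcher_constant:
  assumes h: "\<And>x. x \<in> \<Gamma> \<Longrightarrow> m x = h" and "\<Gamma> \<noteq> {}"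
  shows "(LINT x|S. 1 / m x) = real CARD('a) * measure lebesgue \<Omega>"
proof -
  let ?K = "real CARD('a)"
  have h0: "h \<noteq> 0" using m h \<open>\<Gamma> \<noteq> {}\<close> by force
  have V: "(LINT x|S. x \<bullet> n x) = ?K * measure lebesgue \<Omega>"
    using volume_eq[OF C1bar_affine, of 0] by simp
  \<comment> \<open>The number N - 1 is written as (N - 1) h (1 / m), so that Minkowski's formula
    compares the integrals of x . n and 1 / m directly.\<close>
  have "(LINT x|S. H x * (x \<bullet> n x) - (?K - 1)) = (LINT x|S. ((?K - 1) * h) * (x \<bullet> n x) - ((?K - 1) * h) * (1 / m x))"
    by (intro Bochner_Integration.integral_cong refl) (simp add: H h h0)
  also have "\<dots> = (LINT x|S. ((?K - 1) * h) * (x \<bullet> n x)) - (LINT x|S. ((?K - 1) * h) * (1 / m x))"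
    by (intro Bochner_Integration.integral_diff integrable_surface continuous_intros cont_n continuous_m) (use m in force)
  also have "\<dots> = ((?K - 1) * h) * ((LINT x|S. x \<bullet> n x) - (LINT x|S. 1 / m x))"
    unfolding integral_mult_right_zero by (rule right_diff_distrib[symmetric])
  finally have "((?K - 1) * h) * ((LINT x|S. x \<bullet> n x) - (LINT x|S. 1 / m x)) = 0" using Minkowski by simp
  then show ?thesis using V h0 CARD2 by simp
qed

lemma
  fixes G :: "real^'a \<Rightarrow> real^'a"
  assumes f: "C1bar f G" and f0: "\<And>x. x \<in> \<Gamma> \<Longrightarrow> f x = 0" and G: "\<And>j. C1bar (\<lambda>x. G x $ j) (B j)"
    and tr: "\<And>x. x \<in> \<Omega> \<Longrightarrow> (\<Sum>i\<in>UNIV. B i x $ i) = real CARD('a)"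
    and sym: "\<And>x i j. x \<in> \<Omega> \<Longrightarrow> B i x $ j = B j x $ i"
  shows HeintzeKarcher_le: "real CARD('a) * measure lebesgue \<Omega> \<le> (LINT x|S. 1 / m x)"
    and HeintzeKarcher_eq: "(LINT x|S. 1 / m x) = real CARD('a) * measure lebesgue \<Omega> \<Longrightarrow> connected \<Omega> \<Longrightarrow> \<Omega> \<noteq> {} \<Longrightarrow> \<exists>c r. \<Omega> = ball c r"
proof -
  let ?K = "real CARD('a)"
  let ?e = "\<lambda>x. \<Sum>i\<in>UNIV. \<Sum>j\<in>UNIV. (B i x $ j - axis i 1 $ j)\<^sup>2"
  \<comment> \<open>Expanding about the identity matrix adds N - 2 tr B, which is -N because the
    trace is N.\<close>
  have e: "(\<Sum>i\<in>UNIV. \<Sum>j\<in>UNIV. (B i x $ j)\<^sup>2) - ?K = ?e x" if x: "x \<in> \<Omega>" for x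
  proof -
    have "(B i x $ j - axis i 1 $ j)\<^sup>2 = (B i x $ j)\<^sup>2 + (if j = i then 1 - 2 * B i x $ j else 0)" for i j
      by (auto simp: axis_def power2_eq_square algebra_simps)
    then have "?e x = (\<Sum>i\<in>UNIV. (\<Sum>j\<in>UNIV. (B i x $ j)\<^sup>2) + (1 - 2 * B i x $ i))"
      by (simp add: sum.distrib)
    also have "\<dots> = (\<Sum>i\<in>UNIV. \<Sum>j\<in>UNIV. (B i x $ j)\<^sup>2) + (?K - 2 * (\<Sum>i\<in>UNIV. B i x $ i))"
      by (simp add: sum.distrib sum_subtractf sum_distrib_left)
    finally show ?thesis by (simp add: tr[OF x])
  qed
  have ce: "continuous_on (closure \<Omega>) ?e"
    using G by (intro continuous_intros) (auto simp: C1bar_def)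
  let ?D = "LINT x|lborel. indicator \<Omega> x * ((\<Sum>i\<in>UNIV. \<Sum>j\<in>UNIV. (B i x $ j)\<^sup>2) - ?K)"
  have D: "?D = (LINT x|lborel. indicator \<Omega> x * ?e x)"
    by (intro Bochner_Integration.integral_cong refl) (simp add: e indicator_def)
  have e0: "0 \<le> ?e x" for x by (intro sum_nonneg) auto
  have D0: "0 \<le> ?D" unfolding D by (intro Bochner_Integration.integral_nonneg mult_nonneg_nonneg e0) auto
  have W0: "0 \<le> (LINT x|S. (1 - m x * (G x \<bullet> n x))\<^sup>2 / m x)"
    by (intro Bochner_Integration.integral_nonneg_AE AE_I2 divide_nonneg_nonneg) (auto intro: less_imp_le m)
  note identity = torsion_identity[OF f f0 G tr sym]
  have K: "0 < ?K - 1" using CARD2 by simp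
  have D1: "0 \<le> 1 / (?K - 1) * ?D" using D0 K by simp
  show "?K * measure lebesgue \<Omega> \<le> (LINT x|S. 1 / m x)" using identity D1 W0 by linarith
  assume eq: "(LINT x|S. 1 / m x) = ?K * measure lebesgue \<Omega>" and c\<Omega>: "connected \<Omega>" "\<Omega> \<noteq> {}"
  have "1 / (?K - 1) * ?D = 0" using identity D1 W0 eq by linarith
  then have i0: "(LINT x|lborel. indicator \<Omega> x * ?e x) = 0" using K D by simp
  have "B i x = axis i 1" if x: "x \<in> \<Omega>" for i x
  proof -
    have "?e x = 0" by (rule integral_eq_0_imp[OF ce e0 i0 x])
    then have "\<forall>i j. (B i x $ j - axis i 1 $ j)\<^sup>2 = 0"
      by (simp add: sum_nonneg_eq_0_iff sum_nonneg)
    then show ?thesis by (simp add: vec_eq_iff)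
  qed
  then show "\<exists>c r. \<Omega> = ball c r" using f0 by (intro ball_of_unit_hessian[OF c\<Omega> f _ G]) blast+
qed

end

end

section \<open>Regularity of u up to the boundary, and the theorem\<close>

lemma Hoelder_uniformly_continuous_on:
  fixes f :: "'a::metric_space \<Rightarrow> 'b::real_normed_vector"
  assumes f: "\<And>x y. x \<in> A \<Longrightarrow> y \<in> A \<Longrightarrow> norm (f x - f y) \<le> C * dist x y powr \<alpha>" and \<alpha>: "0 < \<alpha>"
  shows "uniformly_continuous_on A f"
  unfolding uniformly_continuous_on_def
proof (intro allI impI)
  fix e :: real assume e: "0 < e"
  define K where "K = \<bar>C\<bar> + 1"
  have K: "0 < K" "C \<le> K" by (auto simp: K_def)
  define d where "d = (e / K) powr (1 / \<alpha>)"
  have d: "0 < d" "d powr \<alpha> = e / K" using e K \<alpha> by (auto simp: d_def powr_powr)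
  have "dist (f y) (f x) < e" if xy: "x \<in> A" "y \<in> A" "dist y x < d" for x y
  proof -
    have "norm (f y - f x) \<le> C * dist y x powr \<alpha>" by (rule f[OF xy(2,1)])
    also have "\<dots> \<le> K * dist y x powr \<alpha>" using K by (intro mult_right_mono) auto
    also have "\<dots> < K * d powr \<alpha>" using K xy(3) \<alpha> by (intro mult_strict_left_mono powr_less_mono2) auto
    also have "\<dots> = e" using K d by simp
    finally show ?thesis by (simp add: dist_norm)
  qed
  then show "\<exists>d>0. \<forall>x\<in>A. \<forall>y\<in>A. dist y x < d \<longrightarrow> dist (f y) (f x) < e" using d(1) by blast
qed

lemma norm_matrix_square: "(norm (M :: real^'n^'m))\<^sup>2 = (\<Sum>i\<in>UNIV. \<Sum>j\<in>UNIV. (M $ i $ j)\<^sup>2)"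
  unfolding power2_norm_eq_inner inner_vec_def by (simp add: power2_eq_square)

theorem theorem2p6:
  fixes \<Omega> :: "(real^'n) set" and u :: "real^'n \<Rightarrow> real" and \<alpha> :: real
  assumes N2: "CARD('n) \<ge> 2"
    and alpha: "0 < \<alpha>" "\<alpha> < 1"
    and dom: "open \<Omega>" "connected \<Omega>" "bounded \<Omega>" "\<Omega> \<noteq> {}"
    and bdry: "C2alpha_boundary \<alpha> \<Omega>"
    and reg: "C2alpha_closure \<alpha> \<Omega> u"
    and pde: "\<forall>x\<in>\<Omega>. laplacian u x = real CARD('n)"
    and bc: "\<forall>x\<in>frontier \<Omega>. u x = 0"
    and meanconvex: "\<forall>x\<in>frontier \<Omega>. mean_curv \<Omega> x > 0"
  shows "(1 / (real CARD('n) - 1) *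
           integral \<Omega> (\<lambda>x. (norm (hess u x))\<^sup>2 - (laplacian u x)\<^sup>2 / real CARD('n))
         + (\<integral>x. (1 - mean_curv \<Omega> x * (bgrad \<Omega> u x \<bullet> outer_normal \<Omega> x))\<^sup>2 / mean_curv \<Omega> x
              \<partial>surface_measure (frontier \<Omega>))
         = (\<integral>x. 1 / mean_curv \<Omega> x \<partial>surface_measure (frontier \<Omega>)) - real CARD('n) * measure lebesgue \<Omega>)
    \<and> ((\<integral>x. 1 / mean_curv \<Omega> x \<partial>surface_measure (frontier \<Omega>)) \<ge> real CARD('n) * measure lebesgue \<Omega>)
    \<and> (((\<integral>x. 1 / mean_curv \<Omega> x \<partial>surface_measure (frontier \<Omega>)) = real CARD('n) * measure lebesgue \<Omega>)
         \<longleftrightarrow> (\<exists>c r. \<Omega> = ball c r))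
    \<and> ((\<exists>h. \<forall>x\<in>frontier \<Omega>. mean_curv \<Omega> x = h)
         \<longrightarrow> (\<exists>c r. 0 < r \<and> frontier \<Omega> = sphere c r))"
proof -
  interpret C2_domain \<Omega> "outer_normal \<Omega>" "\<lambda>x. (real CARD('n) - 1) * mean_curv \<Omega> x"
    by (rule C2_domain_outer_normal[OF N2 dom(1,3) bdry])
  let ?K = "real CARD('n)" and ?m = "mean_curv \<Omega>"
  have C2: "C2_on \<Omega> u" and cu: "continuous_on (closure \<Omega>) u" and ug: "uniformly_continuous_on \<Omega> (grad u)"
    using reg by (auto simp: C2alpha_closure_def)
  obtain C where "\<forall>x\<in>\<Omega>. \<forall>y\<in>\<Omega>. norm (hess u x - hess u y) \<le> C * dist x y powr \<alpha>"
    using reg unfolding C2alpha_closure_def by blast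
  then have uh: "uniformly_continuous_on \<Omega> (hess u)" by (intro Hoelder_uniformly_continuous_on[OF _ alpha(1), of _ _ C]) blast
  obtain G where G: "uniformly_continuous_on (closure \<Omega>) G" "\<And>x. x \<in> \<Omega> \<Longrightarrow> grad u x = G x"
    by (rule uniformly_continuous_on_extension_on_closure[OF ug]) blast
  obtain M where M: "uniformly_continuous_on (closure \<Omega>) M" "\<And>x. x \<in> \<Omega> \<Longrightarrow> hess u x = M x"
    by (rule uniformly_continuous_on_extension_on_closure[OF uh]) blast
  \<comment> \<open>B j is the j-th column of the extended Hessian, the gradient of the j-th partial
    derivative.\<close>
  define B where "B j x = (\<chi> i. M x $ i $ j)" for j x
  have cG: "continuous_on (closure \<Omega>) G" and cM: "continuous_on (closure \<Omega>) M"
    using G(1) M(1) by (auto intro: uniformly_continuous_imp_continuous)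
  have f: "C1bar u G"
    unfolding C1bar_def using C1on_transform[OF C2_on_C1on(1)[OF C2] dom(1) refl G(2)] cu cG by blast
  have Gj: "C1bar (\<lambda>x. G x $ j) (B j)" for j
    unfolding C1bar_def
  proof (intro conjI)
    show "C1on \<Omega> (\<lambda>x. G x $ j) (B j)"
      by (rule C1on_transform[OF C2_on_C1on(2)[OF C2, of j] dom(1)]) (simp_all add: G(2) M(2) B_def)
    show "continuous_on (closure \<Omega>) (\<lambda>x. G x $ j)" "continuous_on (closure \<Omega>) (B j)"
      unfolding B_def by (intro continuous_intros continuous_on_vec_lambda cG cM)+
  qed
  have tr: "(\<Sum>i\<in>UNIV. B i x $ i) = ?K" if "x \<in> \<Omega>" for x
    using pde that by (simp add: B_def M(2)[symmetric] laplacian_def)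
  have sym: "B i x $ j = B j x $ i" if "x \<in> \<Omega>" for x i j
    using hess_symmetric[OF C2 dom(1) that] by (simp add: B_def M(2)[OF that, symmetric])
  \<comment> \<open>\<open>bgrad\<close> is a limit taken through \<Omega>. A boundary point is in
    the closure but not in \<Omega>, hence a limit point of \<Omega>, and the limit is the value of
    the continuous extension.\<close>
  have bg: "bgrad \<Omega> u x = G x" if x: "x \<in> \<Gamma>" for x
  proof -
    have xc: "x \<in> closure \<Omega>" "x \<notin> \<Omega>" using x by (auto simp: frontier_iff)
    have "(G \<longlongrightarrow> G x) (at x within closure \<Omega>)" using cG xc(1) by (simp add: continuous_on_def)
    then have "(G \<longlongrightarrow> G x) (at x within \<Omega>)" using closure_subset by (rule tendsto_within_subset)
    then have "(grad u \<longlongrightarrow> G x) (at x within \<Omega>)"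
      by (rule Lim_transform_eventually) (simp add: eventually_at_filter G(2))
    moreover have "at x within \<Omega> \<noteq> bot" using xc by (simp add: trivial_limit_within closure_def)
    ultimately show ?thesis unfolding bgrad_def by (intro tendsto_Lim) auto
  qed
  have mc: "0 < ?m x" if "x \<in> \<Gamma>" for x using meanconvex that by blast
  have f0: "u x = 0" if "x \<in> \<Gamma>" for x using bc that by blast
  have Feq: "indicator \<Omega> x *\<^sub>R ((norm (hess u x))\<^sup>2 - (laplacian u x)\<^sup>2 / ?K) = indicator \<Omega> x * ((\<Sum>i\<in>UNIV. \<Sum>j\<in>UNIV. (B i x $ j)\<^sup>2) - ?K)" for x
  proof (cases "x \<in> \<Omega>")
    case True
    have "(norm (hess u x))\<^sup>2 = (\<Sum>i\<in>UNIV. \<Sum>j\<in>UNIV. (B j x $ i)\<^sup>2)"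
      by (simp add: norm_matrix_square B_def M(2)[OF True])
    also have "\<dots> = (\<Sum>i\<in>UNIV. \<Sum>j\<in>UNIV. (B i x $ j)\<^sup>2)" by (rule sum.swap)
    finally show ?thesis using pde True by (simp add: power2_eq_square)
  qed simp
  have cB: "continuous_on (closure \<Omega>) (B j)" for j using Gj by (simp add: C1bar_def)
  have "integrable lborel (\<lambda>x. indicator \<Omega> x * ((\<Sum>i\<in>UNIV. \<Sum>j\<in>UNIV. (B i x $ j)\<^sup>2) - ?K))"
    by (intro integrable_volume continuous_intros cB)
  then have "set_integrable lborel \<Omega> (\<lambda>x. (norm (hess u x))\<^sup>2 - (laplacian u x)\<^sup>2 / ?K)"
    unfolding set_integrable_def Feq .
  from set_borel_integral_eq_integral(2)[OF this]
  have I: "integral \<Omega> (\<lambda>x. (norm (hess u x))\<^sup>2 - (laplacian u x)\<^sup>2 / ?K)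
    = (LINT x|lborel. indicator \<Omega> x * ((\<Sum>i\<in>UNIV. \<Sum>j\<in>UNIV. (B i x $ j)\<^sup>2) - ?K))"
    unfolding set_lebesgue_integral_def Feq by simp
  have J: "(\<integral>x. (1 - ?m x * (bgrad \<Omega> u x \<bullet> outer_normal \<Omega> x))\<^sup>2 / ?m x \<partial>S) = (\<integral>x. (1 - ?m x * (G x \<bullet> outer_normal \<Omega> x))\<^sup>2 / ?m x \<partial>S)"
    by (intro Bochner_Integration.integral_cong refl) (simp add: bg)
  note HK = HeintzeKarcher_eq[OF refl mc f f0 Gj tr sym _ dom(2,4)]
  have eq: "(\<integral>x. 1 / ?m x \<partial>S) = ?K * measure lebesgue \<Omega> \<longleftrightarrow> (\<exists>c r. \<Omega> = ball c r)"
  proof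
    assume "\<exists>c r. \<Omega> = ball c r"
    then obtain c r where b: "\<Omega> = ball c r" by blast
    then have "0 < r" using dom(4) by auto
    then show "(\<integral>x. 1 / ?m x \<partial>S) = ?K * measure lebesgue \<Omega>" by (intro HeintzeKarcher_ball[OF refl mc b])
  qed (rule HK)
  have const: "\<exists>c r. 0 < r \<and> frontier \<Omega> = sphere c r" if h: "\<forall>x\<in>\<Gamma>. ?m x = h" for h
  proof -
    \<comment> \<open>A boundary point is what makes the constant h positive.\<close>
    have "\<Gamma> \<noteq> {}" using dom(3,4) by (metis frontier_eq_empty not_bounded_UNIV)
    then have "(\<integral>x. 1 / ?m x \<partial>S) = ?K * measure lebesgue \<Omega>" using h by (intro HeintzeKarcher_constant[OF refl mc]) auto
    then obtain c r where b: "\<Omega> = ball c r" using HK by blast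
    then have "0 < r" using dom(4) by auto
    then show ?thesis using b by (intro exI[of _ c] exI[of _ r]) simp
  qed
  show ?thesis
    using torsion_identity[OF refl mc f f0 Gj tr sym] HeintzeKarcher_le[OF refl mc f f0 Gj tr sym] eq const
    unfolding I J by blast
qed

end
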